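(* Let $\sigma\in\mathbf R$, let $f\colon\mathbf R^n\to\mathbf R^n$ and $g\colon\mathbf R^n\to\mathbf R^{n\times n}$ be $\mathcal C^\infty$ functions, let $\beta\in(\tfrac13,\tfrac12)$ and let $u_0\in\mathcal C^\beta$. Consider, with periodic boundary conditions on $[0,2\pi]$, $$du=\partial_x^2u\,dt+f(u)\,dt+g(u)\,\partial_xu\,dt+\sigma\,dW(t),\qquad u(0)=u_0,\qquad(\star)$$ where $W$ is a standard cylindrical Wiener process on $L^2([0,2\pi],\mathbf R^n)$. Then, for almost every realisation of the driving rough-path valued process $\Psi$, there exists $T>0$ such that $(\star)$ has a unique mild solution taking values in $\mathcal C([0,T],\mathcal C^\beta)$. If furthermore $g$ is bounded and all derivatives of $f$ and $g$ are bounded, then this solution is global, i.e. one can choose $T$ arbitrary, independently of $\Psi$.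
   Context: **Hölder spaces.** $\mathcal C^\alpha$ is the space of $\alpha$-Hölder continuous functions on $[0,2\pi]$, with seminorm $\|u\|_\alpha=\sup_{x\ne y}|u(x)-u(y)|/|x-y|^\alpha$ and norm $\|u\|_{\mathcal C^\alpha}=\|u\|_\alpha+\|u\|_\infty$. $\mathcal C$ denotes continuous functions, $\mathcal C^1$ continuously differentiable ones. In the SPDE all functions of $x$ are $2\pi$-periodic. **Rough paths (in the variable $x$).** Write $\delta X_{x,y}=X_y-X_x$. For $\alpha\in(0,\frac12)$, $\mathcal D^\alpha$ is the set of pairs $(X,\mathbf X)$ with $X\in\mathcal C^\alpha([0,2\pi],\mathbf R^n)$ and $\mathbf X\colon[0,2\pi]^2\to\mathbf R^{n\times n}$ continuous, vanishing on the diagonal, satisfying $\mathbf X^{ij}_{x,z}-\mathbf X^{ij}_{y,z}-\mathbf X^{ij}_{x,y}=\delta X^i_{x,y}\,\delta X^j_{y,z}$ for all $x,y,z,i,j$, and $\|\mathbf X\|_{2\alpha}=\sup_{x\neq y}|\mathbf X_{x,y}|/|x-y|^{2\alpha}<\infty$. A pair $(Y,Y')$ of $\mathcal C^\alpha$ functions is controlled by $X$ if $R_{x,y}=\delta Y_{x,y}-Y'_x\,\delta X_{x,y}$ satisfies $\|R\|_{2\alpha}<\infty$. For $\alpha>\frac13$ the rough integral is $$\int Y\,dX=\lim_{|\mathcal P|\to0}\sum_{[x,y]\in\mathcal P}\bigl(Y_x\,\delta X_{x,y}+Y'_x\,\mathbf X_{x,y}\bigr)$$ over partitions $\mathcal P$;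 for matrix-valued $Y=(Y_{ij})$ with $Y'=(Y'_{ij,k})$ the $i$-th component of the summand is $\sum_jY_{ij}\,\delta X^j+\sum_{j,k}Y'_{ij,k}\,\mathbf X^{kj}$. **The driving rough path.** $\psi$ is the stationary solution of $d\psi=(\partial_x^2-1)\psi\,dt+\sigma\,dW$ with periodic boundary conditions, $W$ being the same cylindrical Wiener process. For each $t$, the Gaussian process $x\mapsto\psi(x,t)$ is lifted canonically to a rough path $\Psi_t=(\psi(\cdot,t),\boldsymbol\Psi_t)$: $\boldsymbol\Psi_t(x,y)$ is the limit as $\varepsilon\to0$ of $\int_x^y\delta\psi^\varepsilon_{x,r}\otimes\dot\psi^\varepsilon_r\,dr$, where $\psi^\varepsilon$ is any approximation of $\psi(\cdot,t)$ by smooth Gaussian processes (for instance spatial mollification) that converges to it in $L^2$ uniformly in $x$, with covariances of uniformly bounded two-dimensional $p$-variation for some $p<2$. For every $\alpha<\frac12$ this defines a process $t\mapsto\Psi_t\in\mathcal D^\alpha$ that is almost surely continuous (in fact locally Hölder continuous) in $t$. **Mild solution.** Let $S_t$ be the semigroup generated by $\partial_x^2-1$ with periodic boundary conditions, $p_t$ its periodic kernel, so that $(S_tu)(x)=\int_0^{2\pi}p_t(x-y)u(y)\,dy$, and set $\hat f(u)=f(u)+u$. A mild solution on $[0,T]$ is a continuous process $u$ such that $v_t=u_t-\psi_t$ belongs to $\mathcal C([0,T],\mathcal C)\cap L^1([0,T],\mathcal C^1)$ and, almost surely, for every $x\in[0,2\pi]$ and $t\in(0,T]$, $$v_t(x)=\bigl(S_t(u_0-\psi_0)\bigr)(x)+\int_0^t\bigl(S_{t-s}\bigl(g(u_s)\,\partial_xv_s+\hat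 f(u_s)\bigr)\bigr)(x)\,ds+\int_0^t\int_0^{2\pi}p_{t-s}(x-y)\,g(u_s(y))\,d\Psi_s(y)\,ds .$$ The inner integral is a rough integral, the integrand being controlled by $\Psi_s$ with derivative process $y\mapsto p_{t-s}(x-y)\,Dg(u_s(y))$. Once a realisation of $\Psi$ is fixed, this notion is purely deterministic.
   Formalization: For arbitrary u_0 in C^β the solution is unique and continuous into C^β only on (0,T], with bounded C^β norms and uniform convergence at t=0; existence and uniqueness in C([0,T],C^β) itself is claimed exactly for u_0 in the C^β-closure of C^1, since otherwise it fails. *)

theory Defs
  imports "HOL-Probability.Probability"
begin

section \<open>Function spaces\<close>

text \<open>Functions of the space variable are total functions on the reals. Only their restriction to
  \<open>[0, 2\<pi>]\<close> enters the norms below; periodicity is a separate predicate.\<close>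

abbreviation torus :: "real set" where
  "torus \<equiv> {0..2 * pi}"

definition periodic :: "(real \<Rightarrow> 'a) \<Rightarrow> bool" where
  "periodic u \<longleftrightarrow> (\<forall>x. u (x + 2 * pi) = u x)"

definition sup_norm :: "(real \<Rightarrow> 'a::real_normed_vector) \<Rightarrow> real" where
  "sup_norm u = (SUP x\<in>torus. norm (u x))"

definition increment :: "(real \<Rightarrow> 'a::real_normed_vector) \<Rightarrow> real \<Rightarrow> real \<Rightarrow> 'a" where
  "increment u x y = u y - u x"

definition two_param_quotients :: "real \<Rightarrow> (real \<Rightarrow> real \<Rightarrow> 'a::real_normed_vector) \<Rightarrow> real set" where
  "two_param_quotients \<gamma> R =
     {norm (R x y) / \<bar>x - y\<bar> powr \<gamma> |x y. x \<in> torus \<and> y \<in> torus \<and> x \<noteq> y}"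

text \<open>The real-valued supremum below is only meaningful under \<open>two_param_finite\<close>.\<close>

definition two_param_finite :: "real \<Rightarrow> (real \<Rightarrow> real \<Rightarrow> 'a::real_normed_vector) \<Rightarrow> bool" where
  "two_param_finite \<gamma> R \<longleftrightarrow> bdd_above (two_param_quotients \<gamma> R)"

definition two_param_norm :: "real \<Rightarrow> (real \<Rightarrow> real \<Rightarrow> 'a::real_normed_vector) \<Rightarrow> real" where
  "two_param_norm \<gamma> R = Sup (two_param_quotients \<gamma> R)"

definition holder_space :: "real \<Rightarrow> (real \<Rightarrow> 'a::real_normed_vector) set" where
  "holder_space \<alpha> = {u. two_param_finite \<alpha> (increment u)}"

definition holder_norm :: "real \<Rightarrow> (real \<Rightarrow> 'a::real_normed_vector) \<Rightarrow> real" where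
  "holder_norm \<alpha> u = two_param_norm \<alpha> (increment u) + sup_norm u"

definition C1_norm :: "(real \<Rightarrow> 'a::real_normed_vector) \<Rightarrow> real" where
  "C1_norm u = sup_norm u + sup_norm (\<lambda>x. vector_derivative u (at x))"

definition continuous_into_C ::
    "real \<Rightarrow> (real \<Rightarrow> real \<Rightarrow> 'a::real_normed_vector) \<Rightarrow> bool" where
  "continuous_into_C T u \<longleftrightarrow>
     (\<forall>t\<in>{0..T}. continuous_on torus (u t) \<and> uniform_limit torus u (u t) (at t within {0..T}))"

text \<open>For \<open>v\<close> continuous into \<open>C\<close>, strong measurability of \<open>t \<mapsto> v t\<close> as a \<open>C\<^sup>1\<close>-valued map is
  automatic once \<open>v t\<close> is \<open>C\<^sup>1\<close> for almost every \<open>t\<close>.\<close>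

definition integrable_into_C1 ::
    "real \<Rightarrow> (real \<Rightarrow> real \<Rightarrow> 'a::real_normed_vector) \<Rightarrow> bool" where
  "integrable_into_C1 T v \<longleftrightarrow>
     (AE t in lebesgue. t \<in> {0..T} \<longrightarrow> v t C1_differentiable_on UNIV) \<and>
     set_integrable lebesgue {0..T} (\<lambda>t. C1_norm (v t))"

definition continuous_into_holder ::
    "real \<Rightarrow> real set \<Rightarrow> (real \<Rightarrow> real \<Rightarrow> 'a::real_normed_vector) \<Rightarrow> bool" where
  "continuous_into_holder \<beta> A u \<longleftrightarrow>
     (\<forall>t\<in>A. u t \<in> holder_space \<beta> \<and>
        ((\<lambda>s. holder_norm \<beta> (\<lambda>x. u s x - u t x)) \<longlongrightarrow> 0) (at t within A))"

definition C_holder :: "real \<Rightarrow> real \<Rightarrow> (real \<Rightarrow> real \<Rightarrow> 'a::real_normed_vector) set" where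
  "C_holder \<beta> T = {u. continuous_into_holder \<beta> {0..T} u}"

text \<open>The heat semigroup on the full \<open>\<beta>\<close>-Hoelder space is bounded but not strongly continuous at
  \<open>t = 0\<close>: \<open>S\<^sub>t w\<close> tends to \<open>w\<close> in the \<open>\<beta>\<close>-Hoelder norm exactly when \<open>w\<close> is in the closure of the
  \<open>C\<^sup>1\<close> functions. For a general initial condition in this space, continuity at time 0 can
  therefore only hold uniformly in \<open>x\<close>, with Hoelder norms staying bounded; this is \<open>C_holder0\<close>.
  For initial conditions in the closure, \<open>C_holder\<close> is the appropriate space.\<close>

definition C_holder0 :: "real \<Rightarrow> real \<Rightarrow> (real \<Rightarrow> real \<Rightarrow> 'a::real_normed_vector) set" where
  "C_holder0 \<beta> T = {u. continuous_into_holder \<beta> {0<..T} u \<and>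
     (\<forall>t\<in>{0..T}. u t \<in> holder_space \<beta>) \<and>
     bdd_above ((\<lambda>t. holder_norm \<beta> (u t)) ` {0..T}) \<and>
     uniform_limit torus u (u 0) (at 0 within {0..T})}"

definition little_holder :: "real \<Rightarrow> (real \<Rightarrow> 'a::real_normed_vector) set" where
  "little_holder \<beta> = {u \<in> holder_space \<beta>. \<forall>\<epsilon>>0. \<exists>w. periodic w \<and> w C1_differentiable_on UNIV \<and>
     holder_norm \<beta> (\<lambda>x. u x - w x) < \<epsilon>}"

text \<open>Iterated partial derivatives, taken along the list of basis vectors from right to left.\<close>

primrec partials ::
    "'a::euclidean_space list \<Rightarrow> ('a \<Rightarrow> 'b::real_normed_vector) \<Rightarrow> 'a \<Rightarrow> 'b" where
  "partials [] h = h"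
| "partials (b # bs) h = (\<lambda>x. frechet_derivative (partials bs h) (at x) b)"

definition smooth :: "('a::euclidean_space \<Rightarrow> 'b::real_normed_vector) \<Rightarrow> bool" where
  "smooth h \<longleftrightarrow> (\<forall>bs\<in>lists Basis. \<forall>x. partials bs h differentiable (at x))"

definition bounded_derivatives :: "('a::euclidean_space \<Rightarrow> 'b::real_normed_vector) \<Rightarrow> bool" where
  "bounded_derivatives h \<longleftrightarrow> (\<forall>bs\<in>lists Basis. bs \<noteq> [] \<longrightarrow> bounded (range (partials bs h)))"


section \<open>Rough paths and rough integrals\<close>

definition rough_path ::
    "real \<Rightarrow> (real \<Rightarrow> real^'n) \<Rightarrow> (real \<Rightarrow> real \<Rightarrow> real^'n^'n) \<Rightarrow> bool" where
  "rough_path \<alpha> X XX \<longleftrightarrow>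
     X \<in> holder_space \<alpha> \<and>
     continuous_on (torus \<times> torus) (\<lambda>(x, y). XX x y) \<and>
     (\<forall>x\<in>torus. XX x x = 0) \<and>
     (\<forall>x\<in>torus. \<forall>y\<in>torus. \<forall>z\<in>torus. \<forall>i j.
        XX x z $ i $ j - XX y z $ i $ j - XX x y $ i $ j =
        increment X x y $ i * increment X y z $ j) \<and>
     two_param_finite (2 * \<alpha>) XX"

definition rough_dist ::
    "real \<Rightarrow> (real \<Rightarrow> real^'n) \<times> (real \<Rightarrow> real \<Rightarrow> real^'n^'n)
       \<Rightarrow> (real \<Rightarrow> real^'n) \<times> (real \<Rightarrow> real \<Rightarrow> real^'n^'n) \<Rightarrow> real" where
  "rough_dist \<alpha> P Q =
     holder_norm \<alpha> (\<lambda>x. fst P x - fst Q x) +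
     two_param_norm (2 * \<alpha>) (\<lambda>x y. snd P x y - snd Q x y)"

text \<open>\<open>Y' x k $ i $ j\<close> is the coefficient \<open>Y'\<^sub>i\<^sub>j\<^sub>,\<^sub>k\<close>, i.e. the derivative of the matrix entry
  \<open>Y\<^sub>i\<^sub>j\<close> in the direction \<open>X\<^sup>k\<close>.\<close>

definition controlled ::
    "real \<Rightarrow> (real \<Rightarrow> real^'n) \<Rightarrow> (real \<Rightarrow> real^'n^'n) \<Rightarrow> (real \<Rightarrow> 'n \<Rightarrow> real^'n^'n) \<Rightarrow> bool" where
  "controlled \<alpha> X Y Y' \<longleftrightarrow>
     Y \<in> holder_space \<alpha> \<and> (\<forall>k. (\<lambda>x. Y' x k) \<in> holder_space \<alpha>) \<and>
     two_param_finite (2 * \<alpha>)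
       (\<lambda>x y. increment Y x y - (\<Sum>k\<in>UNIV. (increment X x y $ k) *\<^sub>R Y' x k))"

definition rough_summand ::
    "(real \<Rightarrow> real^'n) \<Rightarrow> (real \<Rightarrow> real \<Rightarrow> real^'n^'n) \<Rightarrow> (real \<Rightarrow> real^'n^'n)
       \<Rightarrow> (real \<Rightarrow> 'n \<Rightarrow> real^'n^'n) \<Rightarrow> real \<Rightarrow> real \<Rightarrow> real^'n" where
  "rough_summand X XX Y Y' x y =
     (\<chi> i. (\<Sum>j\<in>UNIV. Y x $ i $ j * increment X x y $ j) +
           (\<Sum>j\<in>UNIV. \<Sum>k\<in>UNIV. Y' x k $ i $ j * XX x y $ k $ j))"

definition has_rough_integral ::
    "(real \<Rightarrow> real^'n) \<Rightarrow> (real \<Rightarrow> real \<Rightarrow> real^'n^'n) \<Rightarrow> (real \<Rightarrow> real^'n^'n)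
       \<Rightarrow> (real \<Rightarrow> 'n \<Rightarrow> real^'n^'n) \<Rightarrow> real^'n \<Rightarrow> bool" where
  "has_rough_integral X XX Y Y' I \<longleftrightarrow>
     (\<exists>\<alpha>\<in>{1/3<..<1/2}. rough_path \<alpha> X XX \<and> controlled \<alpha> X Y Y') \<and>
     (\<forall>\<epsilon>>0. \<exists>\<delta>>0. \<forall>D. D division_of torus \<and> (\<forall>K\<in>D. Sup K - Inf K < \<delta>) \<longrightarrow>
        norm ((\<Sum>K\<in>D. rough_summand X XX Y Y' (Inf K) (Sup K)) - I) < \<epsilon>)"


section \<open>The semigroup and mild solutions\<close>

text \<open>The periodised Gaussian is the kernel of \<open>\<partial>\<^sub>x\<^sup>2\<close> with periodic boundary conditions; the factor
  \<open>exp (-t)\<close> accounts for the \<open>-1\<close> in the generator. The semigroup is only used at times \<open>t > 0\<close>.\<close>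

definition heat_kernel :: "real \<Rightarrow> real \<Rightarrow> real" where
  "heat_kernel t x =
     exp (- t) * (\<Sum>\<^sub>\<infinity>k::int. exp (- (x + 2 * pi * of_int k)\<^sup>2 / (4 * t)) / sqrt (4 * pi * t))"

definition heat_semigroup ::
    "real \<Rightarrow> (real \<Rightarrow> 'a::euclidean_space) \<Rightarrow> real \<Rightarrow> 'a" where
  "heat_semigroup t u x = (LINT y:torus|lebesgue. heat_kernel t (x - y) *\<^sub>R u y)"

text \<open>For almost every \<open>s\<close>, \<open>J s\<close> is the inner rough integral. The integrability conditions make the
  two time integrals meaningful, as a Bochner integral of a non-integrable function is 0.\<close>

definition mild_solution ::
    "(real^'n \<Rightarrow> real^'n) \<Rightarrow> (real^'n \<Rightarrow> real^'n^'n) \<Rightarrow> (real \<Rightarrow> real^'n)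
       \<Rightarrow> (real \<Rightarrow> real \<Rightarrow> real^'n) \<Rightarrow> (real \<Rightarrow> real \<Rightarrow> real \<Rightarrow> real^'n^'n)
       \<Rightarrow> real \<Rightarrow> (real \<Rightarrow> real \<Rightarrow> real^'n) \<Rightarrow> bool" where
  "mild_solution f g u0 X XX T u \<longleftrightarrow>
     (let v = (\<lambda>t x. u t x - X t x);
          drift = (\<lambda>s y. g (u s y) *v vector_derivative (v s) (at y) + (f (u s y) + u s y))
      in
       (\<forall>t\<in>{0..T}. periodic (u t)) \<and> u 0 = u0 \<and>
       continuous_into_C T u \<and> continuous_into_C T v \<and> integrable_into_C1 T v \<and>
       (\<forall>t\<in>{0<..T}. \<forall>x\<in>torus. \<exists>J.
          (AE s in lebesgue. s \<in> {0..<t} \<longrightarrow>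
             has_rough_integral (X s) (XX s)
               (\<lambda>y. heat_kernel (t - s) (x - y) *\<^sub>R g (u s y))
               (\<lambda>y k. heat_kernel (t - s) (x - y) *\<^sub>R frechet_derivative g (at (u s y)) (axis k 1))
               (J s)) \<and>
          set_integrable lebesgue {0..t} J \<and>
          set_integrable lebesgue {0..t} (\<lambda>s. heat_semigroup (t - s) (drift s) x) \<and>
          v t x = heat_semigroup t (\<lambda>y. u0 y - X 0 y) x
            + (LINT s:{0..t}|lebesgue. heat_semigroup (t - s) (drift s) x)
            + (LINT s:{0..t}|lebesgue. J s)))"

definition unique_mild_solution_in ::
    "(real \<Rightarrow> real \<Rightarrow> real^'n) set
       \<Rightarrow> (real^'n \<Rightarrow> real^'n) \<Rightarrow> (real^'n \<Rightarrow> real^'n^'n) \<Rightarrow> (real \<Rightarrow> real^'n)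
       \<Rightarrow> (real \<Rightarrow> real \<Rightarrow> real^'n) \<Rightarrow> (real \<Rightarrow> real \<Rightarrow> real \<Rightarrow> real^'n^'n)
       \<Rightarrow> real \<Rightarrow> bool" where
  "unique_mild_solution_in \<U> f g u0 X XX T \<longleftrightarrow>
     (\<exists>u\<in>\<U>. mild_solution f g u0 X XX T u \<and>
        (\<forall>u'\<in>\<U>. mild_solution f g u0 X XX T u' \<longrightarrow> (\<forall>t\<in>{0..T}. u' t = u t)))"

text \<open>The second conjunct is the statement with genuine \<open>\<beta>\<close>-Hoelder continuity up to time 0. It is
  restricted to the closure of \<open>C\<^sup>1\<close> because a mild solution with this continuity can only start there:
  \<open>v t\<close> is \<open>C\<^sup>1\<close> for almost every \<open>t\<close> and would converge to \<open>u0 - X 0\<close> in the \<open>\<beta>\<close>-Hoelder norm, while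
  \<open>X 0\<close>, being Hoelder with a larger exponent, lies in the closure itself.\<close>

definition well_posed ::
    "real \<Rightarrow> (real^'n \<Rightarrow> real^'n) \<Rightarrow> (real^'n \<Rightarrow> real^'n^'n) \<Rightarrow> (real \<Rightarrow> real^'n)
       \<Rightarrow> (real \<Rightarrow> real \<Rightarrow> real^'n) \<Rightarrow> (real \<Rightarrow> real \<Rightarrow> real \<Rightarrow> real^'n^'n)
       \<Rightarrow> real \<Rightarrow> bool" where
  "well_posed \<beta> f g u0 X XX T \<longleftrightarrow>
     unique_mild_solution_in (C_holder0 \<beta> T) f g u0 X XX T \<and>
     (u0 \<in> little_holder \<beta> \<longrightarrow> unique_mild_solution_in (C_holder \<beta> T) f g u0 X XX T)"


section \<open>The driving process\<close>

text \<open>Centred Gaussian families, degenerate ones included.\<close>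

definition centered_gaussian :: "'w measure \<Rightarrow> 'i set \<Rightarrow> ('i \<Rightarrow> 'w \<Rightarrow> real) \<Rightarrow> bool" where
  "centered_gaussian M I X \<longleftrightarrow>
     (\<forall>i\<in>I. X i \<in> borel_measurable M) \<and>
     (\<forall>A c. finite A \<and> A \<subseteq> I \<longrightarrow>
        (AE \<omega> in M. (\<Sum>i\<in>A. c i * X i \<omega>) = 0) \<or>
        (\<exists>s>0. distributed M lborel (\<lambda>\<omega>. \<Sum>i\<in>A. c i * X i \<omega>) (normal_density 0 s)))"

definition L2_functions :: "(real \<Rightarrow> real^'n) set" where
  "L2_functions =
     {\<phi> \<in> borel_measurable borel. set_integrable lborel torus (\<lambda>x. (norm (\<phi> x))\<^sup>2)}"

definition cylindrical_wiener ::
    "'w measure \<Rightarrow> (real \<Rightarrow> (real \<Rightarrow> real^'n) \<Rightarrow> 'w \<Rightarrow> real) \<Rightarrow> bool" where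
  "cylindrical_wiener M W \<longleftrightarrow>
     centered_gaussian M ({0..} \<times> L2_functions) (\<lambda>(t, \<phi>). W t \<phi>) \<and>
     (\<forall>s\<ge>0. \<forall>t\<ge>0. \<forall>\<phi>\<in>L2_functions. \<forall>\<eta>\<in>L2_functions.
        integral\<^sup>L M (\<lambda>\<omega>. W s \<phi> \<omega> * W t \<eta> \<omega>) = min s t * (LINT x:torus|lborel. \<phi> x \<bullet> \<eta> x)) \<and>
     (\<forall>\<phi>\<in>L2_functions. AE \<omega> in M. continuous_on {0..} (\<lambda>t. W t \<phi> \<omega>))"

text \<open>The linear equation is understood weakly, i.e. tested against smooth periodic functions. The
  initial value is independent of \<open>W\<close>, and the law of the whole process is invariant under time
  shifts. These conditions determine the joint law of \<open>W\<close> and \<open>\<psi>\<close>.\<close>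

definition stationary_solution ::
    "'w measure \<Rightarrow> real \<Rightarrow> (real \<Rightarrow> (real \<Rightarrow> real^'n) \<Rightarrow> 'w \<Rightarrow> real)
       \<Rightarrow> (real \<Rightarrow> real \<Rightarrow> 'w \<Rightarrow> real^'n) \<Rightarrow> bool" where
  "stationary_solution M \<sigma> W \<psi> \<longleftrightarrow>
     (\<forall>t\<ge>0. \<forall>x. \<psi> t x \<in> borel_measurable M) \<and>
     (AE \<omega> in M. continuous_on ({0..} \<times> UNIV) (\<lambda>(t, x). \<psi> t x \<omega>)) \<and>
     (AE \<omega> in M. \<forall>t\<ge>0. periodic (\<lambda>x. \<psi> t x \<omega>)) \<and>
     (\<forall>\<phi>. smooth \<phi> \<and> periodic \<phi> \<longrightarrow>
        (AE \<omega> in M. \<forall>t\<ge>0.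
           (LINT x:torus|lborel. \<psi> t x \<omega> \<bullet> \<phi> x) =
           (LINT x:torus|lborel. \<psi> 0 x \<omega> \<bullet> \<phi> x)
           + (LINT s:{0..t}|lborel. LINT x:torus|lborel. \<psi> s x \<omega> \<bullet>
                (vector_derivative (\<lambda>y. vector_derivative \<phi> (at y)) (at x) - \<phi> x))
           + \<sigma> * W t \<phi> \<omega>)) \<and>
     prob_space.indep_set M
       (sets (vimage_algebra (space M) (\<lambda>\<omega> x. \<psi> 0 x \<omega>) (PiM UNIV (\<lambda>_. borel))))
       (sets (vimage_algebra (space M) (\<lambda>\<omega>. \<lambda>(t, \<phi>)\<in>{0..} \<times> L2_functions. W t \<phi> \<omega>)
          (PiM ({0..} \<times> L2_functions) (\<lambda>_. borel)))) \<and>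
     (\<forall>h\<ge>0.
        distr M (PiM ({0..} \<times> UNIV) (\<lambda>_. borel)) (\<lambda>\<omega>. \<lambda>(t, x)\<in>{0..} \<times> UNIV. \<psi> (t + h) x \<omega>) =
        distr M (PiM ({0..} \<times> UNIV) (\<lambda>_. borel)) (\<lambda>\<omega>. \<lambda>(t, x)\<in>{0..} \<times> UNIV. \<psi> t x \<omega>))"

text \<open>Summing over all rectangles of a grid; \<open>R\<close> has two-dimensional \<open>p\<close>-variation at most \<open>C\<close> if
  these sums are at most \<open>C\<^sup>p\<close> for all grids.\<close>

definition grid_variation_sum ::
    "real \<Rightarrow> (real \<Rightarrow> real \<Rightarrow> real) \<Rightarrow> real set set \<Rightarrow> real set set \<Rightarrow> real" where
  "grid_variation_sum p R D E =
     (\<Sum>K\<in>D. \<Sum>L\<in>E.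
        \<bar>R (Sup K) (Sup L) - R (Sup K) (Inf L) - R (Inf K) (Sup L) + R (Inf K) (Inf L)\<bar> powr p)"

text \<open>Smooth Gaussian approximations \<open>Y k\<close> of the process \<open>X\<close> (whose components are independent).
  The pair \<open>(Y k, X)\<close>, encoded by \<open>Z k True = Y k\<close> and \<open>Z k False = X\<close>, is jointly Gaussian;
  distinct components of it are uncorrelated, hence independent. Without the latter requirement the
  limiting area would depend on the approximation: correlated high-frequency perturbations of two
  components may contribute a nonzero antisymmetric drift to it.\<close>

definition smooth_gaussian_approximation ::
    "'w measure \<Rightarrow> (real \<Rightarrow> 'w \<Rightarrow> real^'n) \<Rightarrow> (nat \<Rightarrow> real \<Rightarrow> 'w \<Rightarrow> real^'n) \<Rightarrow> bool" where
  "smooth_gaussian_approximation M X Y \<longleftrightarrow>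
     (\<forall>k. \<forall>\<omega>\<in>space M. smooth (\<lambda>x. Y k x \<omega>)) \<and>
     (\<forall>k x. Y k x \<in> borel_measurable M) \<and>
     (let Z = (\<lambda>k b. if b then Y k else X);
          R = (\<lambda>k b c i j x y. integral\<^sup>L M (\<lambda>\<omega>. Z k b x \<omega> $ i * Z k c y \<omega> $ j))
      in
       (\<forall>k. centered_gaussian M (UNIV \<times> torus \<times> UNIV) (\<lambda>(b, x, i) \<omega>. Z k b x \<omega> $ i)) \<and>
       (\<forall>k b c i j. i \<noteq> j \<longrightarrow> (\<forall>x\<in>torus. \<forall>y\<in>torus. R k b c i j x y = 0)) \<and>
       (\<exists>p\<in>{1..<2}. \<exists>C. \<forall>k b c i D E. D division_of torus \<and> E division_of torus \<longrightarrow>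
          grid_variation_sum p (R k b c i i) D E \<le> C)) \<and>
     uniform_limit torus (\<lambda>k x. integral\<^sup>L M (\<lambda>\<omega>. (norm (Y k x \<omega> - X x \<omega>))\<^sup>2)) (\<lambda>x. 0) sequentially"

text \<open>The integral is oriented, so this also covers \<open>y < x\<close>.\<close>

definition smooth_area :: "(real \<Rightarrow> real^'n) \<Rightarrow> real \<Rightarrow> real \<Rightarrow> real^'n^'n" where
  "smooth_area Y x y =
     (\<chi> i j. LBINT r=ereal x..ereal y. increment Y x r $ i * vector_derivative Y (at r) $ j)"

text \<open>The limit is taken in probability, and thus determines each \<open>XX x y\<close> up to null sets.\<close>

definition canonical_lift ::
    "'w measure \<Rightarrow> (real \<Rightarrow> 'w \<Rightarrow> real^'n) \<Rightarrow> (real \<Rightarrow> real \<Rightarrow> 'w \<Rightarrow> real^'n^'n) \<Rightarrow> bool" where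
  "canonical_lift M X XX \<longleftrightarrow>
     (\<forall>x\<in>torus. \<forall>y\<in>torus. XX x y \<in> borel_measurable M) \<and>
     (\<forall>Y. smooth_gaussian_approximation M X Y \<longrightarrow>
        (\<forall>x\<in>torus. \<forall>y\<in>torus. \<forall>\<epsilon>>0.
           (\<lambda>k. measure M {\<omega>\<in>space M. norm (smooth_area (\<lambda>r. Y k r \<omega>) x y - XX x y \<omega>) > \<epsilon>})
             \<longlonglongrightarrow> 0))"

text \<open>As the lift at a fixed time is only determined up to null sets, \<open>\<Psi>\<close> is taken to be the
  version which is continuous in time.\<close>

definition driving_rough_path ::
    "'w measure \<Rightarrow> (real \<Rightarrow> real \<Rightarrow> 'w \<Rightarrow> real^'n)
       \<Rightarrow> (real \<Rightarrow> real \<Rightarrow> real \<Rightarrow> 'w \<Rightarrow> real^'n^'n) \<Rightarrow> bool" where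
  "driving_rough_path M \<psi> \<Psi> \<longleftrightarrow>
     (\<forall>t\<ge>0. canonical_lift M (\<psi> t) (\<Psi> t)) \<and>
     (\<forall>\<alpha>\<in>{0<..<1/2}. AE \<omega> in M. \<forall>t\<ge>0.
        rough_path \<alpha> (\<lambda>x. \<psi> t x \<omega>) (\<lambda>x y. \<Psi> t x y \<omega>) \<and>
        ((\<lambda>s. rough_dist \<alpha> (\<lambda>x. \<psi> s x \<omega>, \<lambda>x y. \<Psi> s x y \<omega>) (\<lambda>x. \<psi> t x \<omega>, \<lambda>x y. \<Psi> t x y \<omega>))
           \<longlongrightarrow> 0) (at t within {0..}))"

end

theory Submission
 imports Defs "HOL-Real_Asymp.Real_Asymp"
begin

text \<open>Fix a realisation. With \<open>v = u - X\<close> the equation becomes \<open>v t = S\<^sub>t v\<^sub>0\<close> plus the integral over \<open>s\<close> of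
 \<open>S\<^bsub>t-s\<^esub> \<partial>\<^sub>x F\<^sub>s\<close>, where the flux \<open>F\<^sub>s\<close> is the primitive of the drift plus the indefinite rough integral of \<open>g(u\<^sub>s)\<close>
 against \<open>X\<^sub>s\<close>, constructed by sewing. Its increments are bounded by \<open>A |y - x|\<^sup>\<alpha> + B |y - x|\<close>, where \<open>A\<close> does not involve the
 gradient of \<open>v\<close> and \<open>B\<close> is affine in it, so that the heat flow of \<open>\<partial>\<^sub>x F\<^sub>s\<close> has integrable singularities both in the
 supremum norm and, after weighting with \<open>s\<^bsup>1/2\<^esup>\<close>, in \<open>C\<^sup>1\<close>. Exponential weights in time make the Duhamel map a
 contraction; the growth being linear, no smallness of \<open>T\<close> is needed when \<open>g\<close> and all derivatives are bounded. Uniqueness is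
 an \<open>L\<^sup>1\<close>-in-time Gronwall argument for the \<open>C\<^sup>1\<close> distance of two solutions.\<close>

text \<open>The lift is used at an exponent \<alpha> strictly between \<beta> and 1/2, while the
  solution is measured at \<beta>; the gap makes the Duhamel term vanish at time 0 in the
  \<beta>-norm. The delicate point is linear growth. The increment of \<open>u = X + v\<close> is
  split into that of \<open>X\<close>, for which \<open>g\<close> is expanded with a quadratic
  remainder, and that of \<open>v\<close>, for which only a Lipschitz bound is used. The gradient of
  \<open>v\<close> then enters affinely; expanding in the whole increment would make it quadratic.
  When two solutions are compared, the increment of \<open>X\<close> is common to both, and the
  estimate involves the gradient bound of only one of them. Uniqueness rests on this asymmetry: the
  constructed solution has gradient of order \<open>rsqrt t\<close>, a competitor merely an
  integrable C1 norm. The nonlinearities are controlled on a ball of radius \<rho> that must contain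
  the solution. For short times \<rho> is fixed before \<open>T\<close>; under the global hypotheses
  the constant \<open>C\<close> is uniform in \<rho>, so that the rate \<open>L\<close> of the
  weight can be fixed before \<rho>. The contraction is measured with a second, larger rate, because
  its constant contains \<rho>.\<close>

abbreviation rsqrt :: "real => real" where "rsqrt x \<equiv> x powr (- 1 / 2)"

section \<open>Integrals depending on a parameter\<close>

lemma tendsto_integral_dominated:
 fixes f :: "'p::first_countable_topology => 'b => 'a::{banach, second_countable_topology}"
 assumes "!!p. p : S ==> f p : borel_measurable M"
  and "f0 : borel_measurable M"
  and lim: "AE w in M. ((%p. f p w) \<longlongrightarrow> f0 w) (at p0 within S)"
  and bnd: "!!p. p : S ==> AE w in M. norm (f p w) <= \<Psi> w"
  and "integrable M \<Psi>"
 shows "((%p. \<integral>w. f p w \<partial>M) \<longlongrightarrow> (LINT w|M. f0 w)) (at p0 within S)"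
 unfolding tendsto_at_iff_sequentially comp_def
proof (intro allI impI)
 fix X :: "nat => 'p" assume X: "ALL i. X i : S - {p0}" "X \<longlonglongrightarrow> p0"
 show "(%i. \<integral>w. f (X i) w \<partial>M) \<longlonglongrightarrow> (LINT w|M. f0 w)"
 proof (rule integral_dominated_convergence)
  show "AE w in M. (%i. f (X i) w) \<longlonglongrightarrow> f0 w"
   using lim by eventually_elim (use X in "auto simp: tendsto_at_iff_sequentially comp_def")
 qed (use assms(1,2,5) bnd X in auto)
qed

lemma continuous_on_integral_dominated:
 fixes f :: "'p::first_countable_topology => 'b => 'a::{banach, second_countable_topology}"
 assumes "!!p. p : S ==> f p : borel_measurable M"
  and "!!w. w : space M ==> continuous_on S (%p. f p w)"
  and "!!p w. p : S ==> w : space M ==> norm (f p w) <= \<Psi> w"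
  and "integrable M \<Psi>"
 shows "continuous_on S (%p. \<integral>w. f p w \<partial>M)"
 unfolding continuous_on_def
proof
 fix p assume "p : S"
 then show "((%p. \<integral>w. f p w \<partial>M) \<longlongrightarrow> (LINT w|M. f p w)) (at p within S)"
  by (intro tendsto_integral_dominated[where \<Psi> = \<Psi>])
   (use assms in "auto simp: continuous_on_def")
qed

lemma has_vector_derivative_iff_quotient:
 fixes f :: "real => 'a::real_normed_vector"
 shows "(f has_vector_derivative D) (at x) \<longleftrightarrow> ((%h. (f (x + h) - f x) /\<^sub>R h) \<longlongrightarrow> D) (at 0)"
proof -
 have "(f has_vector_derivative D) (at x) \<longleftrightarrow>
   ((%h. norm (f (x + h) - f x - h *\<^sub>R D) / norm h) \<longlongrightarrow> 0) (at 0)"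
  unfolding has_vector_derivative_def has_derivative_at
  by (simp add: bounded_linear_scaleR_left)
 also have "... \<longleftrightarrow> ((%h. norm ((f (x + h) - f x) /\<^sub>R h - D)) \<longlongrightarrow> 0) (at 0)"
 proof (rule filterlim_cong[OF refl refl])
  show "\<forall>\<^sub>F h in at 0. norm (f (x + h) - f x - h *\<^sub>R D) / norm h = norm ((f (x + h) - f x) /\<^sub>R h - D)"
  proof (rule eventually_at_topological[THEN iffD2], intro exI conjI ballI impI)
   show "open (UNIV::real set)" "(0::real) : UNIV" by auto
   fix h :: real assume "h ~= 0"
   then have "(f (x + h) - f x) /\<^sub>R h - D = (f (x + h) - f x - h *\<^sub>R D) /\<^sub>R h"
    by (simp add: scaleR_diff_right)
   then show "norm (f (x + h) - f x - h *\<^sub>R D) / norm h = norm ((f (x + h) - f x) /\<^sub>R h - D)"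
    by (simp add: divide_inverse mult.commute)
  qed
 qed
 also have "... \<longleftrightarrow> ((%h. (f (x + h) - f x) /\<^sub>R h) \<longlongrightarrow> D) (at 0)"
  by (metis (no_types) LIM_zero_iff tendsto_norm_zero_iff)
 finally show ?thesis .
qed

lemma vector_derivative_bound:
 fixes f :: "real => 'a::real_normed_vector"
 assumes "!!x. x : closed_segment a b ==> (f has_vector_derivative f' x) (at x)"
  and "!!x. x : closed_segment a b ==> norm (f' x) <= C"
 shows "norm (f b - f a) <= C * abs (b - a)"
proof -
 have "norm (f b - f a) <= C * norm (b - a)"
 proof (rule differentiable_bound[where S = "closed_segment a b"])
  show "convex (closed_segment a b)" "b : closed_segment a b" "a : closed_segment a b" by auto
  fix x assume x: "x : closed_segment a b"
  show "(f has_derivative (%h. h *\<^sub>R f' x)) (at x within closed_segment a b)"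
   using assms(1)[OF x] unfolding has_vector_derivative_def by (rule has_derivative_at_withinI)
  show "onorm (%h. h *\<^sub>R f' x) <= C"
   by (rule onorm_bound) (use assms(2)[OF x] order_trans[OF norm_ge_zero assms(2)[OF x]] in "auto simp: mult.commute[of C] intro: mult_left_mono")
 qed
 then show ?thesis by simp
qed

text \<open>The mean value inequality bounds the difference quotients by \<open>\<Psi>\<close>, so
  dominated convergence applies. Measurability of \<open>f' x0\<close> comes for free, as a
  pointwise limit of measurable quotients along a null sequence of steps.\<close>

lemma has_vector_derivative_integral_param:
 fixes f :: "real => 'b => 'a::{banach, second_countable_topology}"
 assumes e: "e > 0"
  and int: "!!x. abs (x - x0) < e ==> integrable M (f x)"
  and der: "!!x w. abs (x - x0) < e ==> w : space M ==> ((%x. f x w) has_vector_derivative f' x w) (at x)"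
  and bnd: "!!x w. abs (x - x0) < e ==> w : space M ==> norm (f' x w) <= \<Psi> w"
  and \<Psi>: "integrable M \<Psi>"
 shows "((%x. \<integral>w. f x w \<partial>M) has_vector_derivative (LINT w|M. f' x0 w)) (at x0)" (is ?A)
  and "integrable M (f' x0)"
proof -
 let ?q = "%h w. (f (x0 + h) w - f x0 w) /\<^sub>R h"
 have q_lim: "((%h. ?q h w) \<longlongrightarrow> f' x0 w) (at 0)" if "w : space M" for w
  using der[of x0 w] e that by (simp add: has_vector_derivative_iff_quotient)
 have q_meas: "?q h : borel_measurable M" if "abs h < e" for h
  using int[of "x0 + h"] int[of x0] e that by (intro borel_measurable_scaleR borel_measurable_diff) auto
 have q_bnd: "norm (?q h w) <= \<Psi> w" if h: "abs h < e" "h ~= 0" and w: "w : space M" for h w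
 proof -
  have seg: "abs (x - x0) < e" if "x : closed_segment x0 (x0 + h)" for x
   using that h by (auto simp: closed_segment_eq_real_ivl split: if_splits)
  have "norm (f (x0 + h) w - f x0 w) <= \<Psi> w * abs (x0 + h - x0)"
   by (rule vector_derivative_bound[where f' = "%x. f' x w"]) (use seg der bnd w in auto)
  with h show ?thesis
   by (simp add: divide_inverse[symmetric] mult.commute[of "\<Psi> w"] del: scaleR_diff_right)
    (simp add: field_simps)
 qed
 have f'_meas: "f' x0 : borel_measurable M"
 proof (rule borel_measurable_LIMSEQ_metric)
  fix i show "?q (e / (2 * (real i + 1))) : borel_measurable M"
  proof (rule q_meas)
   have "e < e * (2 + real i * 2)" using e by (simp add: mult_less_cancel_left1)
   with e show "abs (e / (2 * (real i + 1))) < e" by (simp add: field_simps)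
  qed
 next
  fix w assume w: "w : space M"
  have "(%i. e / (2 * (real i + 1))) \<longlonglongrightarrow> 0" by real_asymp
  moreover have "ALL i. e / (2 * (real i + 1)) ~= 0"
  proof
   fix i :: nat have "2 * (real i + 1) > 0" by simp
   then have "2 * (real i + 1) ~= 0" by linarith
   with e show "e / (2 * (real i + 1)) ~= 0" by simp
  qed
  ultimately show "(%i. ?q (e / (2 * (real i + 1))) w) \<longlonglongrightarrow> f' x0 w"
   using q_lim[OF w] unfolding tendsto_at_iff_sequentially comp_def
   by (auto dest!: spec[of _ "%i. e / (2 * (real i + 1))"])
 qed
 show "integrable M (f' x0)"
  by (rule Bochner_Integration.integrable_bound[OF \<Psi> f'_meas]) (use bnd[of x0] e in "force intro!: AE_I2")
 define q where "q = ?q"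
 have "((%h. \<integral>w. q h w \<partial>M) \<longlongrightarrow> (LINT w|M. f' x0 w)) (at 0 within ball 0 e - {0})"
 proof (rule tendsto_integral_dominated[where \<Psi> = \<Psi>])
  show "AE w in M. ((%h. q h w) \<longlongrightarrow> f' x0 w) (at 0 within ball 0 e - {0})"
   unfolding q_def by (rule AE_I2, rule tendsto_within_subset[OF q_lim subset_UNIV])
  show "q h : borel_measurable M" if "h : ball 0 e - {0}" for h
   unfolding q_def by (rule q_meas) (use that in "simp add: dist_real_def")
  show "AE w in M. norm (q h w) <= \<Psi> w" if "h : ball 0 e - {0}" for h
   unfolding q_def by (rule AE_I2, rule q_bnd) (use that in "simp_all add: dist_real_def")
  show "f' x0 : borel_measurable M" "integrable M \<Psi>" by fact+
 qed
 moreover have "at 0 within ball 0 e - {0} = at (0::real)"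
 proof -
  have "at 0 within ball 0 e - {0} = at 0 within ball (0::real) e" by (simp add: at_within_def)
  also have "... = at 0" using e by (intro at_within_open) auto
  finally show ?thesis .
 qed
 ultimately have "((%h. \<integral>w. ?q h w \<partial>M) \<longlongrightarrow> (LINT w|M. f' x0 w)) (at 0)"
  by (simp only: q_def)
 moreover have "\<forall>\<^sub>F h in at 0. (LINT w|M. ?q h w) =
   ((LINT w|M. f (x0 + h) w) - (LINT w|M. f x0 w)) /\<^sub>R h"
  unfolding eventually_at
 proof (intro exI conjI ballI impI)
  fix h :: real assume "h ~= 0 & dist h 0 < e"
  then show "(LINT w|M. ?q h w) = ((LINT w|M. f (x0 + h) w) - (LINT w|M. f x0 w)) /\<^sub>R h"
   using int[of "x0 + h"] int[of x0] e by simp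
 qed (rule e)
 ultimately show ?A
  unfolding has_vector_derivative_iff_quotient by (rule Lim_transform_eventually)
qed

text \<open>Rounding \<open>y\<close> down to a multiple of \<open>1 / i\<close> leaves countably
  many sections, each measurable in \<open>s\<close>; continuity in \<open>y\<close> recovers
  \<open>H\<close> in the limit.\<close>

lemma caratheodory_measurable:
 fixes H :: "'s => real => 'a::metric_space"
 assumes meas: "!!y. (%s. H s y) : borel_measurable M"
  and cont: "!!s. s : space M ==> continuous_on UNIV (H s)"
 shows "(%(s, y). H s y) : borel_measurable (M \<Otimes>\<^sub>M borel)"
proof (rule borel_measurable_LIMSEQ_metric)
 fix i :: nat
 have "(%p. H (fst p) (real_of_int \<lfloor>real i * snd p\<rfloor> / real i)) : borel_measurable (M \<Otimes>\<^sub>M borel)"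
 proof (rule measurable_compose_countable[where g = "%p. \<lfloor>real i * snd p\<rfloor>"
    and f = "%k p. H (fst p) (real_of_int k / real i)"])
  show "(%p. H (fst p) (real_of_int k / real i)) : borel_measurable (M \<Otimes>\<^sub>M borel)" for k
   using measurable_compose[OF measurable_fst meas] by auto
 qed measurable
 then show "(%(s, y). H s (real_of_int \<lfloor>real i * y\<rfloor> / real i)) : borel_measurable (M \<Otimes>\<^sub>M borel)"
  by (simp add: case_prod_beta')
next
 fix p assume "p : space (M \<Otimes>\<^sub>M (borel::real measure))"
 then obtain s y where p: "p = (s, y)" "s : space M" by (cases p) (auto simp: space_pair_measure)
 have "(%i. real_of_int \<lfloor>real i * y\<rfloor> / real i) \<longlonglongrightarrow> y"
 proof (rule LIM_zero_cancel, rule Lim_null_comparison)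
  show "\<forall>\<^sub>F n in sequentially. norm (real_of_int \<lfloor>real n * y\<rfloor> / real n - y) <= 1 / real n"
   using eventually_gt_at_top[of 0]
  proof eventually_elim
   case (elim n)
   then have "real_of_int \<lfloor>real n * y\<rfloor> / real n - y = (real_of_int \<lfloor>real n * y\<rfloor> - real n * y) / real n"
    by (simp add: field_simps)
   moreover have "abs (real_of_int \<lfloor>real n * y\<rfloor> - real n * y) <= 1" by linarith
   ultimately show ?case by (simp add: divide_right_mono)
  qed
  show "(%n. 1 / real n) \<longlonglongrightarrow> 0" by real_asymp
 qed
 then have "(%i. H s (real_of_int \<lfloor>real i * y\<rfloor> / real i)) \<longlonglongrightarrow> H s y"
  using cont[OF p(2)] by (auto simp: continuous_on_def intro: isCont_tendsto_compose[of y "H s"] simp: isCont_def)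
 then show "(%i. case p of (s, y) => H s (real_of_int \<lfloor>real i * y\<rfloor> / real i)) \<longlonglongrightarrow> (case p of (s, y) => H s y)"
  by (simp add: p)
qed



section \<open>Gaussian averages\<close>

text \<open>The rate 1/8 is half of that of the heat profile, which leaves room for the polynomial
  factors of its derivatives.\<close>

definition gauss_bounded :: "(real => real) => bool" where
 "gauss_bounded \<phi> \<longleftrightarrow> continuous_on UNIV \<phi> & (EX C. ALL y. abs (\<phi> y) <= C * exp (- y\<^sup>2 / 8))"

text \<open>Convolution with the rescaled kernel \<open>\<phi> (x / r) / r\<close>, after the
  substitution that moves the scale into the argument of \<open>H\<close>. In this form
  \<open>r = 0\<close> is harmless, so continuity in \<open>r = sqrt t\<close> extends down to time
  0.\<close>

definition gauss_op :: "(real => real) => real => (real => 'a::euclidean_space) => real => 'a" where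
 "gauss_op \<phi> r H x = (LINT y|lborel. \<phi> y *\<^sub>R H (x - r * y))"

text \<open>The weight lets one constant serve the sup bound and the Hoelder bound alike, since
  \<open>abs y powr \<alpha> <= 1 + abs y\<close> for exponents in (0, 1].\<close>

definition gauss_mom :: "(real => real) => real" where
 "gauss_mom \<phi> = (LINT y|lborel. abs (\<phi> y) * (1 + abs y))"

lemma gauss_boundedE:
 assumes "gauss_bounded \<phi>"
 obtains C where "C > 0" "!!y. abs (\<phi> y) <= C * exp (- y\<^sup>2 / 8)"
proof -
 obtain C where C: "!!y. abs (\<phi> y) <= C * exp (- y\<^sup>2 / 8)"
  using assms unfolding gauss_bounded_def by auto
 have "abs (\<phi> y) <= (abs C + 1) * exp (- y\<^sup>2 / 8)" for y
  using C[of y] by (rule order_trans) (intro mult_right_mono, auto)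
 then show ?thesis by (intro that[of "abs C + 1"]) auto
qed

lemma gauss_bounded_measurable: "gauss_bounded \<phi> ==> \<phi> : borel_measurable borel"
 unfolding gauss_bounded_def by (auto intro: borel_measurable_continuous_onI)

lemma integrable_gauss_moment:
 assumes "c > 0"
 shows "integrable lborel (%y::real. exp (- y\<^sup>2 / c) * abs y ^ k)"
proof -
 let ?s = "sqrt (c / 2)"
 have "?s > 0" using assms by simp
 from integrable_normal_moment_abs[OF this, of 0 k]
 have "integrable lborel (%y. sqrt (2 * pi * ?s\<^sup>2) * (normal_density 0 ?s y * abs y ^ k))"
  by simp
 moreover have "sqrt (2 * pi * ?s\<^sup>2) * (normal_density 0 ?s y * abs y ^ k) = exp (- y\<^sup>2 / c) * abs y ^ k" for y
  using assms by (simp add: normal_density_def)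
 ultimately show ?thesis by simp
qed

lemma gauss_bounded_integrable:
 assumes "gauss_bounded \<phi>"
 shows "integrable lborel (%y. abs (\<phi> y) * (1 + abs y))" (is ?A) "integrable lborel \<phi>"
proof -
 obtain C where C: "C > 0" "!!y. abs (\<phi> y) <= C * exp (- y\<^sup>2 / 8)"
  using assms by (rule gauss_boundedE) blast
 have i: "integrable lborel (%y. C * (exp (- y\<^sup>2 / 8) * abs y ^ 0 + exp (- y\<^sup>2 / 8) * abs y ^ 1))"
  by (intro integrable_mult_right[OF Bochner_Integration.integrable_add[OF integrable_gauss_moment[of 8 0] integrable_gauss_moment[of 8 1]]]) auto
 note [measurable] = gauss_bounded_measurable[OF assms]
 show ?A
 proof (rule Bochner_Integration.integrable_bound[OF i])
  have "abs (\<phi> y) * (1 + abs y) <= C * exp (- y\<^sup>2 / 8) * (1 + abs y)" for y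
   by (rule mult_right_mono[OF C(2)]) auto
  then show "AE y in lborel. norm (abs (\<phi> y) * (1 + abs y)) <=
    norm (C * (exp (- y\<^sup>2 / 8) * abs y ^ 0 + exp (- y\<^sup>2 / 8) * abs y ^ 1))"
   using C(1) by (intro AE_I2) (simp add: abs_mult algebra_simps)
 qed measurable
 then show "integrable lborel \<phi>"
  by (rule Bochner_Integration.integrable_bound)
   (auto intro!: AE_I2 mult_right_le_one_le simp: abs_mult algebra_simps)
qed

lemma gauss_mom_nonneg: "gauss_mom \<phi> >= 0"
 unfolding gauss_mom_def by (rule integral_nonneg_AE) auto

lemma borel_measurable_continuous_UNIV:
 "continuous_on UNIV (H :: real => 'a::euclidean_space) ==> H : borel_measurable borel"
 by (rule borel_measurable_continuous_onI)

lemma gauss_op_integrable: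
 fixes H :: "real => 'a::euclidean_space"
 assumes \<phi>: "gauss_bounded \<phi>" and H: "H : borel_measurable borel" "!!x. norm (H x) <= K"
 shows "integrable lborel (%y. \<phi> y *\<^sub>R H (x - r * y))"
proof -
 note [measurable] = gauss_bounded_measurable[OF \<phi>] H(1)
 have K: "K >= 0" using H(2)[of 0] norm_ge_zero order_trans by blast
 show ?thesis
  by (rule Bochner_Integration.integrable_bound[OF integrable_mult_left[OF gauss_bounded_integrable(2)[OF \<phi>], of K]])
   (use H(2) K in "auto intro!: AE_I2 mult_left_mono simp: abs_mult")
qed

lemma gauss_op_norm_le:
 fixes H :: "real => 'a::euclidean_space"
 assumes \<phi>: "gauss_bounded \<phi>" and H: "H : borel_measurable borel" "!!x. norm (H x) <= K"
 shows "norm (gauss_op \<phi> r H x) <= gauss_mom \<phi> * K"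
proof -
 have K: "K >= 0" using H(2)[of 0] norm_ge_zero order_trans by blast
 have "norm (gauss_op \<phi> r H x) <= (LINT y|lborel. norm (\<phi> y *\<^sub>R H (x - r * y)))"
  unfolding gauss_op_def by (rule integral_norm_bound)
 also have "... <= (LINT y|lborel. abs (\<phi> y) * (1 + abs y) * K)"
 proof (rule integral_mono)
  show "integrable lborel (%y. norm (\<phi> y *\<^sub>R H (x - r * y)))"
   by (intro integrable_norm gauss_op_integrable[OF assms])
  show "integrable lborel (%y. abs (\<phi> y) * (1 + abs y) * K)"
   using gauss_bounded_integrable(1)[OF \<phi>] by simp
  fix y
  have "abs (\<phi> y) * norm (H (x - r * y)) <= (abs (\<phi> y) * (1 + abs y)) * K"
   by (rule mult_mono) (use H(2) K in "auto simp: algebra_simps")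
  then show "norm (\<phi> y *\<^sub>R H (x - r * y)) <= abs (\<phi> y) * (1 + abs y) * K" by simp
 qed
 finally show ?thesis by (simp add: gauss_mom_def)
qed

text \<open>Zero mean allows \<open>H x\<close> to be subtracted under the integral, so that only
  increments of \<open>H\<close> over the distance \<open>r * abs y\<close> remain. This gain of
  powers of \<open>r\<close> tames the negative powers of time in the heat flow of a
  derivative.\<close>

lemma gauss_op_norm_le_holder:
 fixes H :: "real => 'a::euclidean_space"
 assumes \<phi>: "gauss_bounded \<phi>" and H: "H : borel_measurable borel" "!!x. norm (H x) <= K"
  and \<phi>0: "(LINT y|lborel. \<phi> y) = 0" and \<alpha>: "0 < \<alpha>" "\<alpha> <= 1" and r: "r > 0" and AB: "A >= 0" "B >= 0"
  and mod: "!!x y. norm (H x - H y) <= A * abs (x - y) powr \<alpha> + B * abs (x - y)"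
 shows "norm (gauss_op \<phi> r H x) <= gauss_mom \<phi> * (A * r powr \<alpha> + B * r)"
proof -
 let ?K = "A * r powr \<alpha> + B * r"
 have "gauss_op \<phi> r H x = (LINT y|lborel. \<phi> y *\<^sub>R H (x - r * y) - \<phi> y *\<^sub>R H x)"
  unfolding gauss_op_def
  by (subst Bochner_Integration.integral_diff[OF gauss_op_integrable[OF \<phi> H]])
   (use gauss_bounded_integrable(2)[OF \<phi>] \<phi>0 in auto)
 also have "norm ... <= (LINT y|lborel. norm (\<phi> y *\<^sub>R H (x - r * y) - \<phi> y *\<^sub>R H x))"
  by (rule integral_norm_bound)
 also have "... <= (LINT y|lborel. abs (\<phi> y) * (1 + abs y) * ?K)"
 proof (rule integral_mono)
  show "integrable lborel (%y. norm (\<phi> y *\<^sub>R H (x - r * y) - \<phi> y *\<^sub>R H x))"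
   using gauss_op_integrable[OF \<phi> H] gauss_bounded_integrable(2)[OF \<phi>] by simp
  show "integrable lborel (%y. abs (\<phi> y) * (1 + abs y) * ?K)"
   using gauss_bounded_integrable(1)[OF \<phi>] by simp
  fix y :: real
  have "abs y powr \<alpha> <= (1 + abs y) powr \<alpha>" by (rule powr_mono2) (use \<alpha> in auto)
  also have "... <= (1 + abs y) powr 1" by (rule powr_mono) (use \<alpha> in auto)
  finally have y: "abs y powr \<alpha> <= 1 + abs y" by simp
  have "norm (H (x - r * y) - H x) <= A * (r * abs y) powr \<alpha> + B * (r * abs y)"
   using mod[of "x - r * y" x] r by (simp add: abs_mult)
  also have "... = (A * r powr \<alpha>) * abs y powr \<alpha> + (B * r) * abs y"
   using r by (simp add: powr_mult)
  also have "... <= (A * r powr \<alpha>) * (1 + abs y) + (B * r) * (1 + abs y)"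
   by (intro add_mono mult_left_mono y) (use AB r in auto)
  finally have "norm (H (x - r * y) - H x) <= (1 + abs y) * ?K" by (simp add: algebra_simps)
  then have "abs (\<phi> y) * norm (H (x - r * y) - H x) <= abs (\<phi> y) * ((1 + abs y) * ?K)"
   by (rule mult_left_mono) auto
  then show "norm (\<phi> y *\<^sub>R H (x - r * y) - \<phi> y *\<^sub>R H x) <= abs (\<phi> y) * (1 + abs y) * ?K"
   by (simp add: mult.assoc flip: scaleR_diff_right)
 qed
 finally show ?thesis by (simp add: gauss_mom_def)
qed

lemma gauss_op_continuous_param:
 fixes H :: "'p::first_countable_topology => real => 'a::euclidean_space"
 assumes \<phi>: "gauss_bounded \<phi>" and H: "!!p. p : S ==> continuous_on UNIV (H p)"
  and c: "!!y. continuous_on S (%p. H p (x p - r p * y))"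
  and K: "!!p x. p : S ==> norm (H p x) <= K"
 shows "continuous_on S (%p. gauss_op \<phi> (r p) (H p) (x p))"
 unfolding gauss_op_def
proof (rule continuous_on_integral_dominated[where \<Psi> = "%y. abs (\<phi> y) * K"])
 note [measurable] = gauss_bounded_measurable[OF \<phi>]
 show "(%y. \<phi> y *\<^sub>R H p (x p - r p * y)) : borel_measurable lborel" if "p : S" for p
 proof -
  have [measurable]: "H p : borel_measurable borel"
   using H[OF that] by (rule borel_measurable_continuous_UNIV)
  show ?thesis by measurable
 qed
 show "continuous_on S (%p. \<phi> w *\<^sub>R H p (x p - r p * w))" for w
  by (intro continuous_intros c)
 show "norm (\<phi> y *\<^sub>R H p (x p - r p * y)) <= abs (\<phi> y) * K" if "p : S" for p y
  using K[OF that] by (auto intro!: mult_left_mono)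
 show "integrable lborel (%y. abs (\<phi> y) * K)"
  using gauss_bounded_integrable(2)[OF \<phi>] by simp
qed

lemma gauss_op_continuous:
 fixes H :: "real => 'a::euclidean_space"
 assumes \<phi>: "gauss_bounded \<phi>" and H: "continuous_on UNIV H" "!!x. norm (H x) <= K"
  and c: "continuous_on S x" "continuous_on S r"
 shows "continuous_on S (%p::'p::first_countable_topology. gauss_op \<phi> (r p) H (x p))"
 using assms by (intro gauss_op_continuous_param[OF \<phi>] continuous_on_compose2[OF H(1)] continuous_intros) auto

lemma gauss_op_measurable:
 fixes H :: "'s => real => 'a::euclidean_space"
 assumes \<phi>: "gauss_bounded \<phi>" and [measurable]: "(%(s, y). H s y) : borel_measurable (M \<Otimes>\<^sub>M borel)"
  and [measurable]: "r : borel_measurable M" "x : borel_measurable M"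
 shows "(%s. gauss_op \<phi> (r s) (H s) (x s)) : borel_measurable M"
proof -
 note [measurable] = gauss_bounded_measurable[OF \<phi>]
 have "(%p. (%(s, y). H s y) (fst p, x (fst p) - r (fst p) * snd p)) : borel_measurable (M \<Otimes>\<^sub>M lborel)"
  by (rule measurable_compose[OF _ assms(2)]) measurable
 then have [measurable]: "(%p. H (fst p) (x (fst p) - r (fst p) * snd p)) : borel_measurable (M \<Otimes>\<^sub>M lborel)"
  by simp
 have "(%(s, y). \<phi> y *\<^sub>R H s (x s - r s * y)) : borel_measurable (M \<Otimes>\<^sub>M lborel)"
  unfolding case_prod_beta' by measurable
 then show ?thesis
  unfolding gauss_op_def by (rule lborel.borel_measurable_lebesgue_integral[of _ M])
qed

lemma gauss_op_add:
 fixes H H' :: "real => 'a::euclidean_space"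
 assumes \<phi>: "gauss_bounded \<phi>" and H: "H : borel_measurable borel" "!!x. norm (H x) <= K"
  and H': "H' : borel_measurable borel" "!!x. norm (H' x) <= K'"
 shows "gauss_op \<phi> r (%x. H x - H' x) x = gauss_op \<phi> r H x - gauss_op \<phi> r H' x"
 unfolding gauss_op_def scaleR_diff_right
 by (rule Bochner_Integration.integral_diff[OF gauss_op_integrable[OF \<phi> H] gauss_op_integrable[OF \<phi> H']])

lemma gauss_op_kernel:
 fixes H :: "real => 'a::euclidean_space"
 assumes "r > 0"
 shows "gauss_op \<phi> r H x = (LINT w|lborel. (\<phi> ((x - w) / r) / r) *\<^sub>R H w)"
proof -
 have "(LINT w|lborel. (\<phi> ((x - w) / r) / r) *\<^sub>R H w) =
   abs (- r) *\<^sub>R (LINT y|lborel. (\<phi> ((x - (x + (- r) * y)) / r) / r) *\<^sub>R H (x + (- r) * y))"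
  by (rule lborel_integral_real_affine) (use assms in auto)
 also have "... = (LINT y|lborel. r *\<^sub>R ((\<phi> ((x - (x + (- r) * y)) / r) / r) *\<^sub>R H (x + (- r) * y)))"
  using assms by (simp only: integral_scaleR_right) simp
 also have "... = gauss_op \<phi> r H x"
  unfolding gauss_op_def using assms by (intro Bochner_Integration.integral_cong) (auto simp: field_simps)
 finally show ?thesis ..
qed

text \<open>As \<open>H\<close> is merely bounded and measurable, the derivative has to fall on
  \<phi>. Translating the integration variable by \<open>(x - x0) / r\<close> freezes the argument
  of \<open>H\<close>; the chain rule then costs a factor \<open>1 / r\<close>.\<close>

lemma gauss_op_has_vector_derivative:
 fixes H :: "real => 'a::euclidean_space"
 assumes \<phi>: "gauss_bounded \<phi>" "gauss_bounded \<phi>'"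
  and der: "!!y. (\<phi> has_real_derivative \<phi>' y) (at y)"
  and H: "H : borel_measurable borel" "!!x. norm (H x) <= K" and r: "r > 0"
 shows "(gauss_op \<phi> r H has_vector_derivative gauss_op \<phi>' r H x0 /\<^sub>R r) (at x0)"
proof -
 have K: "K >= 0" using H(2)[of 0] norm_ge_zero order_trans by blast
 obtain C where C: "C > 0" "!!y. abs (\<phi>' y) <= C * exp (- y\<^sup>2 / 8)"
  using \<phi>(2) by (rule gauss_boundedE) blast
 define f where "f x y = \<phi> (y + (x - x0) / r) *\<^sub>R H (x0 - r * y)" for x y
 define f' where "f' x y = (\<phi>' (y + (x - x0) / r) / r) *\<^sub>R H (x0 - r * y)" for x y
 have gen: "(LINT y|lborel. \<phi> (y + (x - x0) / r) *\<^sub>R H (x0 - r * y)) = gauss_op \<phi> r H x"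
  "integrable lborel (%y. \<phi> (y + (x - x0) / r) *\<^sub>R H (x0 - r * y))" for x
 proof -
  have e: "\<phi> ((x - x0) / r + 1 * y) *\<^sub>R H (x - r * ((x - x0) / r + 1 * y)) =
    \<phi> (y + (x - x0) / r) *\<^sub>R H (x0 - r * y)" for y
  proof -
   have "x - r * ((x - x0) / r + 1 * y) = x0 - r * y" using r by (simp add: distrib_left)
   moreover have "(x - x0) / r + 1 * y = y + (x - x0) / r" by simp
   ultimately show ?thesis by (simp only:)
  qed
  have "gauss_op \<phi> r H x = abs 1 *\<^sub>R
    (LINT y|lborel. \<phi> ((x - x0) / r + 1 * y) *\<^sub>R H (x - r * ((x - x0) / r + 1 * y)))"
   unfolding gauss_op_def by (rule lborel_integral_real_affine) auto
  then show "(LINT y|lborel. \<phi> (y + (x - x0) / r) *\<^sub>R H (x0 - r * y)) = gauss_op \<phi> r H x"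
   by (simp only: e) simp
  show "integrable lborel (%y. \<phi> (y + (x - x0) / r) *\<^sub>R H (x0 - r * y))"
   using lborel_integrable_real_affine[OF gauss_op_integrable[OF \<phi>(1) H, of x r], of 1 "(x - x0) / r"]
   by (simp only: e)
 qed
 have "((%x. \<integral>y. f x y \<partial>lborel) has_vector_derivative (LINT y|lborel. f' x0 y)) (at x0)"
 proof (rule has_vector_derivative_integral_param(1)[OF r,
    where \<Psi> = "%y. C * exp (1 / 8) * K / r * (exp (- y\<^sup>2 / 16) * abs y ^ 0)"])
  show "integrable lborel (f x)" for x unfolding f_def by (rule gen(2))
  show "((%x. f x y) has_vector_derivative f' x y) (at x)" for x y
  proof -
   have "((%x. \<phi> (y + (x - x0) / r)) has_real_derivative \<phi>' (y + (x - x0) / r) * (1 / r)) (at x)"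
    by (rule DERIV_chain2[OF der]) (use r in "auto intro!: derivative_eq_intros")
   then show ?thesis
    unfolding f_def f'_def
    using has_vector_derivative_scaleR[OF _ has_vector_derivative_const[of "H (x0 - r * y)"], of "%x. \<phi> (y + (x - x0) / r)"]
    by fastforce
  qed
  show "norm (f' x y) <= C * exp (1 / 8) * K / r * (exp (- y\<^sup>2 / 16) * abs y ^ 0)"
   if x: "abs (x - x0) < r" for x y
  proof -
   define h where "h = (x - x0) / r"
   have h: "abs h <= 1" using x r by (simp add: h_def)
   \<comment> \<open>For \<open>abs h <= 1\<close> this lowers the Gaussian rate from 1/8 to 1/16 at
     the price of the factor \<open>exp (1 / 8)\<close>, and the majorant no longer depends on
     \<open>x\<close>.\<close>
   have "(y + h)\<^sup>2 + h\<^sup>2 >= y\<^sup>2 / 2"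
    using zero_le_power2[of "y + 2 * h"] by (simp add: power2_eq_square algebra_simps)
   moreover have "h\<^sup>2 <= 1" using h by (simp add: abs_square_le_1)
   ultimately have "- (y + h)\<^sup>2 / 8 <= 1 / 8 - y\<^sup>2 / 16" by linarith
   then have "exp (- (y + h)\<^sup>2 / 8) <= exp (1 / 8) * exp (- y\<^sup>2 / 16)"
    by (simp flip: exp_add)
   then have "abs (\<phi>' (y + h)) <= C * (exp (1 / 8) * exp (- y\<^sup>2 / 16))"
    using C by (meson mult_left_mono less_imp_le order_trans)
   then have "abs (\<phi>' (y + h)) / r * norm (H (x0 - r * y)) <= C * (exp (1 / 8) * exp (- y\<^sup>2 / 16)) / r * K"
    by (intro mult_mono divide_right_mono H(2)) (use r C in auto)
   then show ?thesis using r by (simp add: f'_def h_def mult_ac)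
  qed
  show "integrable lborel (%y. C * exp (1 / 8) * K / r * (exp (- y\<^sup>2 / 16) * abs y ^ 0))"
   by (intro integrable_mult_right integrable_gauss_moment) auto
 qed
 moreover have "(LINT y|lborel. f' x0 y) = gauss_op \<phi>' r H x0 /\<^sub>R r"
  unfolding f'_def gauss_op_def by (simp add: field_simps flip: integral_scaleR_right)
 ultimately show ?thesis by (simp add: f_def gen(1))
qed

text \<open>The heat kernel on the line at time 1, that is the centred normal density of variance 2;
  \<open>G1\<close> and \<open>G2\<close> are its first two derivatives. Time \<open>t\<close> is
  reached by the scale \<open>sqrt t\<close>.\<close>

definition G0 :: "real => real" where "G0 y = exp (- y\<^sup>2 / 4) / sqrt (4 * pi)"
definition G1 :: "real => real" where "G1 y = - (y / 2) * G0 y"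
definition G2 :: "real => real" where "G2 y = (y\<^sup>2 / 4 - 1 / 2) * G0 y"

lemma G0_deriv: "(G0 has_real_derivative G1 y) (at y)"
proof -
 have "((%y. exp (- y\<^sup>2 / 4)) has_real_derivative (- (y / 2)) * exp (- y\<^sup>2 / 4)) (at y)"
  by (auto intro!: derivative_eq_intros)
 from DERIV_cdivide[OF this, of "sqrt (4 * pi)"] show ?thesis
  by (simp add: G0_def[abs_def] G1_def)
qed

lemma G1_deriv: "(G1 has_real_derivative G2 y) (at y)"
proof -
 have "((%y. - (y / 2)) has_real_derivative - (1 / 2)) (at y)"
  by (auto intro!: derivative_eq_intros)
 from DERIV_mult[OF this G0_deriv] show ?thesis
  unfolding G1_def[abs_def] G2_def by (simp add: power2_eq_square algebra_simps)
qed

lemma G_gauss_bounded: "gauss_bounded G0" "gauss_bounded G1" "gauss_bounded G2"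
proof -
 have c0: "continuous_on UNIV G0" unfolding G0_def[abs_def] by (intro continuous_intros) auto
 have s: "sqrt (4 * pi) >= 1" using pi_ge_two by (simp add: real_le_rsqrt)
 \<comment> \<open>One factor is kept as the claimed bound, the other absorbs the polynomial by way
   of \<open>1 + z <= exp z\<close>.\<close>
 have eq: "exp (- y\<^sup>2 / 4) = exp (- y\<^sup>2 / 8) * exp (- (y\<^sup>2 / 8))" for y :: real
  by (simp flip: exp_add)
 have poly: "abs (p y * G0 y) <= 8 * exp (- y\<^sup>2 / 8)" if "!!y. abs (p y) <= 8 * (1 + y\<^sup>2 / 8)" for p :: "real => real" and y
 proof -
  have e: "(1 + y\<^sup>2 / 8) * exp (- (y\<^sup>2 / 8)) <= 1"
   using exp_ge_add_one_self[of "y\<^sup>2 / 8"] by (simp add: exp_minus field_simps)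
  have "abs (p y) * abs (G0 y) <= (8 * (1 + y\<^sup>2 / 8)) * exp (- y\<^sup>2 / 4)"
  proof (rule mult_mono[OF that])
   have "exp (- y\<^sup>2 / 4) / sqrt (4 * pi) <= exp (- y\<^sup>2 / 4) / 1" by (rule divide_left_mono) (use s in auto)
   then show "abs (G0 y) <= exp (- y\<^sup>2 / 4)" by (simp add: G0_def)
  qed auto
  also have "... = 8 * exp (- y\<^sup>2 / 8) * ((1 + y\<^sup>2 / 8) * exp (- (y\<^sup>2 / 8)))" unfolding eq by (simp add: mult_ac)
  also have "... <= 8 * exp (- y\<^sup>2 / 8) * 1" by (rule mult_left_mono[OF e]) auto
  finally show ?thesis by (simp add: abs_mult)
 qed
 have "continuous_on UNIV G0" "continuous_on UNIV G1" "continuous_on UNIV G2"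
  unfolding G1_def[abs_def] G2_def[abs_def] by (intro continuous_intros c0; simp)+
 moreover have "abs (G0 y) <= 8 * exp (- y\<^sup>2 / 8)" for y using poly[of "%_. 1"] by simp
 moreover have "abs (G1 y) <= 8 * exp (- y\<^sup>2 / 8)" for y
  unfolding G1_def
 proof (rule poly)
  fix y :: real
  have "0 <= (abs y - 1)\<^sup>2" by simp
  then show "abs (- (y / 2)) <= 8 * (1 + y\<^sup>2 / 8)" by (simp add: power2_eq_square algebra_simps)
 qed
 moreover have "abs (G2 y) <= 8 * exp (- y\<^sup>2 / 8)" for y
  unfolding G2_def
 proof (rule poly)
  fix y :: real
  have "abs (z / 4 - 1 / 2) <= 8 * (1 + z / 8)" if "0 <= z" for z :: real using that by (auto simp: abs_if field_simps)
  from this[of "y\<^sup>2"] show "abs (y\<^sup>2 / 4 - 1 / 2) <= 8 * (1 + y\<^sup>2 / 8)" by simp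
 qed
 ultimately show "gauss_bounded G0" "gauss_bounded G1" "gauss_bounded G2"
  unfolding gauss_bounded_def by blast+
qed

text \<open>The two vanishing integrals are the cancellation required by
  \<open>gauss_op_norm_le_holder\<close>. For \<open>G2\<close> it reflects the variance 2 of
  \<open>G0\<close>: 2/4 - 1/2 = 0.\<close>

lemma G_integral:
 "(LINT y|lborel. G0 y) = 1" "(LINT y|lborel. G1 y) = 0" "(LINT y|lborel. G2 y) = 0"
proof -
 have G0: "G0 = normal_density 0 (sqrt 2)"
  by (rule ext) (simp add: G0_def normal_density_def)
 show "(LINT y|lborel. G0 y) = 1" unfolding G0 by simp
 have "has_bochner_integral lborel (%y. (- 1 / 2) * (normal_density 0 (sqrt 2) y * y)) ((- 1 / 2) * 0)"
  by (intro has_bochner_integral_mult_right normal_moment_nz_1) auto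
 then have "has_bochner_integral lborel G1 0"
  by (simp add: G1_def[abs_def] G0 mult_ac)
 then show "(LINT y|lborel. G1 y) = 0" by (rule has_bochner_integral_integral_eq)
 have 0: "has_bochner_integral lborel (normal_density 0 (sqrt 2)) 1"
  using has_bochner_integral_integrable[OF integrable_normal_density[of "sqrt 2" 0]] by simp
 have "has_bochner_integral lborel (%y. normal_density 0 (sqrt 2) y * y\<^sup>2) 2"
  using normal_moment_even[of "sqrt 2" 0 1] by (simp add: fact_2 fact_numeral)
 then have "has_bochner_integral lborel (%y. (1 / 4) * (normal_density 0 (sqrt 2) y * y\<^sup>2) - (1 / 2) * normal_density 0 (sqrt 2) y)
   ((1 / 4) * 2 - (1 / 2) * 1)"
  by (intro has_bochner_integral_diff has_bochner_integral_mult_right 0)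
 then have "has_bochner_integral lborel G2 0"
  by (simp add: G2_def[abs_def] G0 algebra_simps)
 then show "(LINT y|lborel. G2 y) = 0" by (rule has_bochner_integral_integral_eq)
qed

section \<open>The periodised kernel\<close>

text \<open>Summing over \<open>nat\<close> via \<open>int_decode\<close> makes the library results on series of functions available.\<close>

definition per :: "(real => real) => real => real => real" where
 "per \<phi> r x = (\<Sum>n. \<phi> ((x + 2 * pi * of_int (int_decode n)) / r) / r)"

text \<open>The enumeration of the integers moves away from 0 at a linear rate, so exponential decay
  in the integer becomes geometric decay in its index.\<close>

lemma int_decode_ge: "real n <= 2 * abs (real_of_int (int_decode n)) + 1"
proof (cases "even n")
 case True
 then show ?thesis by (auto simp: int_decode_def sum_decode_def elim!: evenE)
next
 case False
 then show ?thesis by (auto simp: int_decode_def sum_decode_def elim!: oddE)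
qed

text \<open>Gaussian decay is traded for exponential decay, uniformly for \<open>x\<close> in a
  bounded set: a square completed in \<open>x\<close> removes the shift, and
  \<open>abs k <= k\<^sup>2\<close> for integers.\<close>

lemma gauss_int_le:
 fixes k :: int
 assumes "c > 0" "abs x <= R"
 shows "exp (- c * (x + 2 * pi * of_int k)\<^sup>2) <= exp (c * R\<^sup>2) * exp (- c * abs (of_int k))"
proof -
 let ?k = "abs (real_of_int k)"
 have k2: "?k <= ?k\<^sup>2"
 proof (cases "k = 0")
  case False
  then have "?k >= 1" by linarith
  then show ?thesis using mult_left_mono[of 1 ?k ?k] by (simp add: power2_eq_square)
 qed auto
 have "(2 * pi)\<^sup>2 * ?k\<^sup>2 / 2 <= (x + 2 * pi * of_int k)\<^sup>2 + x\<^sup>2"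
  using zero_le_power2[of "2 * x + 2 * pi * of_int k"] by (simp add: power2_eq_square algebra_simps)
 moreover have "?k\<^sup>2 <= (2 * pi)\<^sup>2 * ?k\<^sup>2 / 2"
 proof -
  have "2 <= (2 * pi)\<^sup>2" using power_mono[of 4 "2 * pi" 2] pi_ge_two by simp
  then show ?thesis using mult_right_mono[of 2 "(2 * pi)\<^sup>2" "?k\<^sup>2"] by simp
 qed
 moreover have "x\<^sup>2 <= R\<^sup>2" using assms(2) by (simp add: abs_le_square_iff[symmetric])
 ultimately have "?k - R\<^sup>2 <= (x + 2 * pi * of_int k)\<^sup>2" using k2 by linarith
 then have "c * (?k - R\<^sup>2) <= c * (x + 2 * pi * of_int k)\<^sup>2" using assms(1) by (intro mult_left_mono) auto
 then show ?thesis by (simp add: algebra_simps flip: exp_add)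
qed

text \<open>The Weierstrass majorant behind both the termwise differentiation of the periodised
  kernel and the exchange of sum and integral in \<open>unfold_per\<close>.\<close>

lemma per_summand_le:
 assumes \<phi>: "gauss_bounded \<phi>" and r: "r > 0"
 obtains M where "summable M"
  "!!n x. abs x <= R ==> abs (\<phi> ((x + 2 * pi * of_int (int_decode n)) / r) / r) <= M n"
proof -
 obtain C where C: "C > 0" "!!y. abs (\<phi> y) <= C * exp (- y\<^sup>2 / 8)"
  using \<phi> by (rule gauss_boundedE) blast
 define c where "c = 1 / (8 * r\<^sup>2)"
 have c: "c > 0" using r by (simp add: c_def)
 define M where "M n = C / r * exp (c * R\<^sup>2) * (exp (c / 2) * exp (- c / 2) ^ n)" for n :: nat
 show thesis
 proof
  show "summable M" unfolding M_def
   by (intro summable_mult summable_geometric) (use c in auto)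
  fix n x assume x: "abs x <= R"
  let ?k = "int_decode n"
  have "- ((x + 2 * pi * of_int ?k) / r)\<^sup>2 / 8 = - c * (x + 2 * pi * of_int ?k)\<^sup>2"
   using r by (simp add: c_def field_simps)
  then have "abs (\<phi> ((x + 2 * pi * of_int ?k) / r)) <= C * exp (- c * (x + 2 * pi * of_int ?k)\<^sup>2)"
   using C(2)[of "(x + 2 * pi * of_int ?k) / r"] by simp
  also have "... <= C * (exp (c * R\<^sup>2) * exp (- c * abs (of_int ?k)))"
   by (intro mult_left_mono gauss_int_le x c) (use C in auto)
  also have "... <= C * (exp (c * R\<^sup>2) * (exp (c / 2) * exp (- c / 2) ^ n))"
  proof -
   have "real n - 1 <= 2 * abs (real_of_int ?k)" using int_decode_ge[of n] by linarith
   then have "c / 2 * (real n - 1) <= c / 2 * (2 * abs (real_of_int ?k))"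
    using c by (intro mult_left_mono) auto
   then have "- c * abs (of_int ?k) <= c / 2 + real n * (- c / 2)" by (simp add: algebra_simps)
   then have "exp (- c * abs (of_int ?k)) <= exp (c / 2) * exp (real n * (- c / 2))"
    by (simp flip: exp_add)
   then have "exp (- c * abs (of_int ?k)) <= exp (c / 2) * exp (- c / 2) ^ n"
    by (simp only: exp_of_nat_mult)
   then show ?thesis using C by (intro mult_left_mono) auto
  qed
  finally have "abs (\<phi> ((x + 2 * pi * of_int ?k) / r)) / r <= C * (exp (c * R\<^sup>2) * (exp (c / 2) * exp (- c / 2) ^ n)) / r"
   using r by (intro divide_right_mono) auto
  then show "abs (\<phi> ((x + 2 * pi * of_int ?k) / r) / r) <= M n"
   using r by (simp add: M_def)
 qed
qed

lemma per_summable: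
 assumes "gauss_bounded \<phi>" "r > 0"
 shows "summable (%n. norm (\<phi> ((x + 2 * pi * of_int (int_decode n)) / r) / r))"
proof -
 obtain M where M: "summable M"
  "!!n y. abs y <= abs x ==> abs (\<phi> ((y + 2 * pi * of_int (int_decode n)) / r) / r) <= M n"
  using per_summand_le[OF assms, of "abs x"] by blast
 from M show ?thesis by (intro summable_comparison_test'[OF M(1), of 0]) auto
qed

lemma per_deriv:
 assumes \<phi>: "gauss_bounded \<phi>" "gauss_bounded \<phi>'" and r: "r > 0"
  and der: "!!y. (\<phi> has_real_derivative \<phi>' y) (at y)"
 shows "(per \<phi> r has_real_derivative per \<phi>' r x / r) (at x)"
proof -
 obtain M where M: "summable M"
  "!!n y. abs y <= abs x + 1 ==> abs (\<phi>' ((y + 2 * pi * of_int (int_decode n)) / r) / r) <= M n"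
  using per_summand_le[OF \<phi>(2) r, of "abs x + 1"] by blast
 let ?S = "{- (abs x + 1)..abs x + 1}"
 have "((%x. \<Sum>n. \<phi> ((x + 2 * pi * of_int (int_decode n)) / r) / r) has_real_derivative
   (\<Sum>n. \<phi>' ((x + 2 * pi * of_int (int_decode n)) / r) / r / r)) (at x)"
 proof (rule has_field_derivative_series'(2)[where S = ?S and x0 = x])
  show "((%x. \<phi> ((x + 2 * pi * of_int (int_decode n)) / r) / r) has_real_derivative
    \<phi>' ((y + 2 * pi * of_int (int_decode n)) / r) / r / r) (at y within ?S)" for n y
  proof (rule has_field_derivative_at_within)
   have "((%x. (x + 2 * pi * of_int (int_decode n)) / r) has_real_derivative 1 / r) (at y)"
    using r by (auto intro!: derivative_eq_intros)
   from DERIV_cdivide[OF DERIV_chain2[OF der this], of r]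
   show "((%x. \<phi> ((x + 2 * pi * of_int (int_decode n)) / r) / r) has_real_derivative
    \<phi>' ((y + 2 * pi * of_int (int_decode n)) / r) / r / r) (at y)" by simp
  qed
  show "uniformly_convergent_on ?S (%n y. \<Sum>i<n. \<phi>' ((y + 2 * pi * of_int (int_decode i)) / r) / r / r)"
  proof (rule Weierstrass_m_test')
   show "summable (%n. M n / r)" by (rule summable_divide[OF M(1)])
   fix n y assume "y : ?S"
   then have "abs y <= abs x + 1" by auto
   from divide_right_mono[OF M(2)[OF this], of r n]
   show "norm (\<phi>' ((y + 2 * pi * of_int (int_decode n)) / r) / r / r) <= M n / r"
    using r by simp
  qed
  show "summable (%n. \<phi> ((x + 2 * pi * of_int (int_decode n)) / r) / r)"
   by (rule summable_norm_cancel[OF per_summable[OF \<phi>(1) r]])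
 qed auto
 moreover have "(\<Sum>n. \<phi>' ((x + 2 * pi * of_int (int_decode n)) / r) / r / r) = per \<phi>' r x / r"
  unfolding per_def by (rule suminf_divide[OF summable_norm_cancel[OF per_summable[OF \<phi>(2) r]]])
 ultimately show ?thesis by (simp add: per_def[abs_def])
qed

lemma per_infsum:
 assumes "gauss_bounded \<phi>" "r > 0"
 shows "per \<phi> r x = (\<Sum>\<^sub>\<infinity>k::int. \<phi> ((x + 2 * pi * of_int k) / r) / r)"
proof -
 let ?f = "%k. \<phi> ((x + 2 * pi * of_int k) / r) / r"
 have "((%n. ?f (int_decode n)) has_sum per \<phi> r x) UNIV"
  unfolding per_def
  by (rule norm_summable_imp_has_sum[OF per_summable[OF assms] summable_sums])
   (rule summable_norm_cancel[OF per_summable[OF assms]])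
 then have "(\<Sum>\<^sub>\<infinity>n. ?f (int_decode n)) = per \<phi> r x" by (rule infsumI)
 then show ?thesis using infsum_reindex_bij_betw[OF bij_int_decode, of ?f] by simp
qed

lemma per_periodic:
 assumes "gauss_bounded \<phi>" "r > 0"
 shows "per \<phi> r (x + 2 * pi) = per \<phi> r x"
proof -
 have "(\<Sum>\<^sub>\<infinity>k::int. \<phi> ((x + 2 * pi * of_int (k + 1)) / r) / r) = (\<Sum>\<^sub>\<infinity>k::int. \<phi> ((x + 2 * pi * of_int k) / r) / r)"
  by (rule infsum_reindex_bij_betw) (rule bij_betwI[where g = "%k. k - 1"], auto)
 moreover have "x + 2 * pi + 2 * pi * of_int k = x + 2 * pi * of_int (k + 1)" for k
  by (simp add: algebra_simps)
 ultimately show ?thesis unfolding per_infsum[OF assms] by presburger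
qed

lemma heat_kernel_per:
 assumes "t > 0"
 shows "heat_kernel t x = exp (- t) * per G0 (sqrt t) x"
proof -
 have "exp (- (x + 2 * pi * of_int k)\<^sup>2 / (4 * t)) / sqrt (4 * pi * t) =
   G0 ((x + 2 * pi * of_int k) / sqrt t) / sqrt t" for k
  using assms by (simp add: G0_def power_divide real_sqrt_mult field_simps)
 then show ?thesis
  using assms by (simp add: heat_kernel_def per_infsum[OF G_gauss_bounded(1)])
qed

lemma periodic_reduce:
 obtains k :: int where "x + 2 * pi * of_int k : {0..<2 * pi}"
proof -
 let ?m = "\<lfloor>x / (2 * pi)\<rfloor>"
 have "of_int ?m * (2 * pi) <= x" "x < (of_int ?m + 1) * (2 * pi)"
  using pos_le_divide_eq[of "2 * pi" "of_int ?m" x] pos_divide_less_eq[of "2 * pi" x "of_int ?m + 1"]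
  by (auto intro: floor_correct)
 then have "x + 2 * pi * of_int (- ?m) : {0..<2 * pi}" by (simp add: algebra_simps)
 then show ?thesis by (rule that)
qed

lemma periodic_int:
 assumes "periodic u"
 shows "u (x + 2 * pi * of_int k) = u x"
proof -
 have n: "u (x + 2 * pi * of_nat n) = u x" for x n
 proof (induction n)
  case (Suc n)
  have "u (x + 2 * pi * of_nat (Suc n)) = u ((x + 2 * pi * of_nat n) + 2 * pi)"
   by (simp add: algebra_simps)
  also have "... = u x" using assms Suc by (simp add: periodic_def)
  finally show ?case .
 qed simp
 show ?thesis
 proof (cases "k >= 0")
  case True
  then show ?thesis using n[of x "nat k"] by simp
 next
  case False
  then show ?thesis using n[of "x + 2 * pi * of_int k" "nat (- k)"] by simp
 qed
qed

text \<open>The line is cut into the translates \<open>A n\<close> of one period, taken half-open so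
  as to be disjoint. Periodicity of \<open>H\<close> brings all of them back to the reference
  period, where the translated kernels add up to \<open>per\<close>.\<close>

lemma unfold_per:
 fixes H :: "real => 'a::euclidean_space"
 assumes \<phi>: "gauss_bounded \<phi>" and r: "r > 0" and H: "H : borel_measurable borel" "!!x. norm (H x) <= K"
  and per: "periodic H"
 shows "(LINT y:{0..<2 * pi}|lborel. per \<phi> r (x - y) *\<^sub>R H y) = gauss_op \<phi> r H x"
proof -
 let ?\<psi> = "%w. (\<phi> ((x - w) / r) / r) *\<^sub>R H w"
 define A where "A n = {w. - 2 * pi * of_int (int_decode n) <= w & w < - 2 * pi * of_int (int_decode n) + 2 * pi}" for n
 define k where "k n = 2 * pi * real_of_int (int_decode n)" for n
 let ?u = "%n w. indicator {0..<2 * pi} w *\<^sub>R ((\<phi> ((x - w + k n) / r) / r) *\<^sub>R H w)"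
 have K: "K >= 0" using H(2)[of 0] norm_ge_zero order_trans by blast
 note [measurable] = gauss_bounded_measurable[OF \<phi>] H(1)
 have int\<psi>: "integrable lborel ?\<psi>"
 proof -
  have "integrable lborel (%y. \<phi> y *\<^sub>R H (x - r * y))" by (rule gauss_op_integrable[OF \<phi> H])
  from lborel_integrable_real_affine[OF this, of "- 1 / r" "x / r"]
  have "integrable lborel (%y. \<phi> (x / r + (- 1 / r) * y) *\<^sub>R H (x - r * (x / r + (- 1 / r) * y)))"
   using r by auto
  moreover have "\<phi> (x / r + (- 1 / r) * y) *\<^sub>R H (x - r * (x / r + (- 1 / r) * y)) = \<phi> ((x - y) / r) *\<^sub>R H y" for y
   using r by (simp add: diff_divide_distrib algebra_simps)
  ultimately have "integrable lborel (%y. \<phi> ((x - y) / r) *\<^sub>R H y)" by simp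
  then have "integrable lborel (%y. (1 / r) *\<^sub>R (\<phi> ((x - y) / r) *\<^sub>R H y))"
   by (rule integrable_scaleR_right)
  then show ?thesis by simp
 qed
 have A_Un: "(\<Union>n. A n) = UNIV"
 proof -
  have "EX n. w : A n" for w
  proof -
   obtain k where "w + 2 * pi * of_int k : {0..<2 * pi}" by (rule periodic_reduce)
   then have "w : A (int_encode k)" by (simp add: A_def)
   then show ?thesis ..
  qed
  then show ?thesis by auto
 qed
 have A_disj: "A n \<inter> A m = {}" if "n ~= m" for n m
 proof -
  have "int_decode n ~= int_decode m" using that by (simp add: int_decode_eq)
  then have "int_decode n + 1 <= int_decode m \<or> int_decode m + 1 <= int_decode n" by linarith
  then have "real_of_int (int_decode n) + 1 <= of_int (int_decode m) \<or> real_of_int (int_decode m) + 1 <= of_int (int_decode n)"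
   by linarith
  then have "2 * pi * (real_of_int (int_decode n) + 1) <= 2 * pi * of_int (int_decode m) \<or>
    2 * pi * (real_of_int (int_decode m) + 1) <= 2 * pi * of_int (int_decode n)"
   by (auto intro: mult_left_mono)
  then show ?thesis by (auto simp: A_def algebra_simps)
 qed
 have A_sets: "A n : sets lborel" for n unfolding A_def by measurable
 \<comment> \<open>The shift by \<open>k n\<close> maps one period onto the reference one;
   \<open>H\<close> does not notice it, so it survives only in the argument of \<phi>.\<close>
 have cell: "(LINT w:A n|lborel. ?\<psi> w) =
   (LINT w|lborel. ?u n w)" for n
 proof -
  have "(LINT w:A n|lborel. ?\<psi> w) = abs 1 *\<^sub>R (LINT w|lborel. indicator (A n) (- k n + 1 * w) *\<^sub>R ?\<psi> (- k n + 1 * w))"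
   unfolding set_lebesgue_integral_def by (rule lborel_integral_real_affine) auto
  also have "... = (LINT w|lborel. ?u n w)"
  proof -
   have "indicator (A n) (- k n + 1 * w) = (indicator {0..<2 * pi} w :: real)" for w
    by (auto simp: indicator_def A_def k_def)
   moreover have "H (- k n + 1 * w) = H w" for w
    using periodic_int[OF per, of w "- int_decode n"] by (simp add: k_def)
   moreover have "x - (- k n + 1 * w) = x - w + k n" for w by simp
   ultimately show ?thesis by (simp only: abs_one scaleR_one)
  qed
  finally show ?thesis .
 qed
 have "gauss_op \<phi> r H x = (LINT w:(\<Union>n. A n)|lborel. ?\<psi> w)"
  by (simp add: gauss_op_kernel[OF r] A_Un set_lebesgue_integral_def)
 also have "... = (\<Sum>n. LINT w:A n|lborel. ?\<psi> w)"
  by (rule lebesgue_integral_countable_add) (use A_sets A_disj int\<psi> in "auto simp: A_Un set_integrable_def")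
 also have "... = (LINT w|lborel. (\<Sum>n. ?u n w))"
  unfolding cell
 proof (rule integral_suminf[symmetric])
  obtain M where M: "summable M"
   "!!n y. abs y <= abs x + 2 * pi ==> abs (\<phi> ((y + 2 * pi * of_int (int_decode n)) / r) / r) <= M n"
   using per_summand_le[OF \<phi> r, of "abs x + 2 * pi"] by blast
  have M0: "M n >= 0" for n by (rule order_trans[OF abs_ge_zero M(2)[of 0 n]]) simp
  have bnd: "norm (?u n w) <= indicator {0..<2 * pi} w * (M n * K)" for n w
  proof (cases "w : {0..<2 * pi}")
   case True
   then have "abs (x - w) <= abs x + 2 * pi" by auto
   from M(2)[OF this, of n] have "abs (\<phi> ((x - w + k n) / r) / r) * norm (H w) <= M n * K"
    unfolding k_def by (intro mult_mono H(2)) (use M0 in auto)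
   with True show ?thesis by simp
  qed simp
  have int_ind: "integrable lborel (%w. indicator {0..<2 * pi} w * (M n * K))" for n
   by (intro integrable_mult_left integrable_real_indicator) auto
  show int: "integrable lborel (%w. ?u n w)" for n
   by (rule Bochner_Integration.integrable_bound[OF int_ind[of n]])
    (use bnd M0 K in "auto intro!: AE_I2 order_trans[OF bnd[of _ n]] simp: abs_mult")
  show "AE w in lborel. summable (%n. norm (?u n w))"
  proof (rule AE_I2, rule summable_comparison_test'[where N = 0])
   fix w show "summable (%n. indicator {0..<2 * pi} w * (M n * K))"
    by (intro summable_mult summable_mult2 M(1))
  qed (use bnd in auto)
  show "summable (%n. \<integral>w. norm (?u n w) \<partial>lborel)"
  proof (rule summable_comparison_test'[where N = 0])
   show "summable (%n. 2 * pi * (M n * K))" by (intro summable_mult summable_mult2 M(1))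
   fix n
   have "(LINT w|lborel. norm (?u n w))
     <= (LINT w|lborel. indicator {0..<2 * pi} w * (M n * K))"
    by (rule integral_mono[OF integrable_norm[OF int] int_ind bnd])
   also have "... = 2 * pi * (M n * K)" by simp
   finally show "norm (LINT w|lborel. norm (?u n w)) <= 2 * pi * (M n * K)"
    by simp
  qed
 qed
 also have "... = (LINT y:{0..<2 * pi}|lborel. per \<phi> r (x - y) *\<^sub>R H y)"
  unfolding set_lebesgue_integral_def
 proof (rule Bochner_Integration.integral_cong[OF refl])
  fix w
  have s: "summable (%n. \<phi> ((x - w + k n) / r) / r)"
   using summable_norm_cancel[OF per_summable[OF \<phi> r, of "x - w"]] by (simp add: k_def)
  have "(\<Sum>n. (\<phi> ((x - w + k n) / r) / r) *\<^sub>R H w) = per \<phi> r (x - w) *\<^sub>R H w"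
   using suminf_scaleR_left[OF s, of "H w"] by (simp add: per_def k_def)
  then show "(\<Sum>n. ?u n w) =
    indicator {0..<2 * pi} w *\<^sub>R (per \<phi> r (x - w) *\<^sub>R H w)"
   by (cases "w : {0..<2 * pi}") auto
 qed
 finally show ?thesis ..
qed

lemma set_integral_torus_halfopen:
 fixes f :: "real => 'a::euclidean_space"
 shows "(LINT y:{0..<2 * pi}|lborel. f y) = (LINT y:torus|lborel. f y)"
 unfolding set_lebesgue_integral_def
 by (rule integral_discrete_difference[where X = "{2 * pi}"]) (auto simp: indicator_def)

lemma periodic_bound:
 assumes "periodic u" "!!x. x : torus ==> P (u x)"
 shows "P (u x)"
proof -
 obtain k where "x + 2 * pi * of_int k : {0..<2 * pi}" by (rule periodic_reduce)
 then have "P (u (x + 2 * pi * of_int k))" by (intro assms(2)) auto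
 then show ?thesis by (simp add: periodic_int[OF assms(1)])
qed

lemma periodic_continuous_bounded:
 fixes u :: "real => 'a::real_normed_vector"
 assumes "periodic u" "continuous_on torus u"
 obtains K where "!!x. norm (u x) <= K"
proof -
 have "bounded (u ` torus)"
  by (rule compact_imp_bounded[OF compact_continuous_image[OF assms(2)]]) auto
 then obtain K where "!!x. x : torus ==> norm (u x) <= K" unfolding bounded_iff by blast
 then have "norm (u x) <= K" for x by (rule periodic_bound[OF assms(1)])
 then show ?thesis by (rule that)
qed

lemma integral_lebesgue_torus:
 fixes f :: "real => 'a::euclidean_space"
 assumes "f : borel_measurable borel"
 shows "(LINT y:torus|lebesgue. f y) = (LINT y:torus|lborel. f y)"
 unfolding set_lebesgue_integral_def by (rule integral_completion) (use assms in measurable)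

lemma per_measurable:
 assumes "gauss_bounded \<phi>" "r > 0"
 shows "per \<phi> r : borel_measurable borel"
proof -
 note [measurable] = gauss_bounded_measurable[OF assms(1)]
 show ?thesis unfolding per_def[abs_def] by measurable
qed

lemma heat_kernel_deriv:
 assumes "t > 0"
 shows "(heat_kernel t has_real_derivative exp (- t) * (per G1 (sqrt t) x / sqrt t)) (at x)"
proof -
 have "heat_kernel t = (%x. exp (- t) * per G0 (sqrt t) x)"
  using heat_kernel_per[OF assms] by auto
 then show ?thesis
  using DERIV_cmult[OF per_deriv[OF G_gauss_bounded(1,2) _ G0_deriv, of "sqrt t" x], of "exp (- t)"] assms
  by simp
qed

lemma heat_kernel_periodic: "t > 0 ==> heat_kernel t (x + 2 * pi) = heat_kernel t x"
 by (simp add: heat_kernel_per per_periodic[OF G_gauss_bounded(1)])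

lemma heat_semigroup_gauss_op:
 fixes u :: "real => 'a::euclidean_space"
 assumes t: "t > 0" and u: "periodic u" "continuous_on UNIV u"
 shows "heat_semigroup t u x = exp (- t) *\<^sub>R gauss_op G0 (sqrt t) u x"
proof -
 obtain K where K: "!!x. norm (u x) <= K"
  using periodic_continuous_bounded[OF u(1) continuous_on_subset[OF u(2)]] by blast
 have r: "sqrt t > 0" using t by simp
 note [measurable] = borel_measurable_continuous_UNIV[OF u(2)] per_measurable[OF G_gauss_bounded(1) r]
 have "heat_semigroup t u x = (LINT y:torus|lborel. exp (- t) *\<^sub>R (per G0 (sqrt t) (x - y) *\<^sub>R u y))"
  unfolding heat_semigroup_def heat_kernel_per[OF t] scaleR_scaleR[symmetric]
  by (rule integral_lebesgue_torus) measurable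
 also have "... = exp (- t) *\<^sub>R (LINT y:torus|lborel. per G0 (sqrt t) (x - y) *\<^sub>R u y)"
  by (rule set_integral_scaleR_right)
 also have "... = exp (- t) *\<^sub>R gauss_op G0 (sqrt t) u x"
  by (simp only: set_integral_torus_halfopen[symmetric] unfold_per[OF G_gauss_bounded(1) r _ K u(1)] borel_measurable_continuous_UNIV[OF u(2)])
 finally show ?thesis .
qed

section \<open>Stieltjes convolution with the heat kernel\<close>

lemma sum_division_endpoints:
 fixes h :: "real => 'a::real_normed_vector"
 assumes D: "D division_of {a..b}" and ab: "a <= b"
 shows "(\<Sum>K\<in>D. h (Sup K) - h (Inf K)) = h b - h a"
proof -
 let ?p = "(%K. (Inf K, K)) ` D"
 have K: "EX c d. K = {c..d} & c <= d" if "K : D" for K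
  using division_ofD(3,4)[OF D that] by (metis atLeastatMost_empty_iff box_real(2))
 have tag: "?p tagged_division_of {a..b}"
 proof (rule tagged_division_ofI)
  show "finite ?p" using division_of_finite[OF D] by auto
  show "\<Union> {K. EX x. (x, K) : ?p} = {a..b}" using division_ofD(6)[OF D] by (auto simp: image_iff)
  fix x K assume "(x, K) : ?p"
  then have x: "x = Inf K" "K : D" by auto
  with K obtain c d where "K = {c..d}" "c <= d" by blast
  with x show "x : K" "K \<subseteq> {a..b}" "EX a b. K = cbox a b"
   using division_ofD(2)[OF D \<open>K : D\<close>] by (auto intro: exI[of _ c] exI[of _ d])
  fix x' K' assume "(x', K') : ?p" "(x, K) ~= (x', K')"
  with x show "interior K \<inter> interior K' = {}" using division_ofD(5)[OF D, of K K'] by auto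
 qed
 from additive_tagged_division_1[OF ab tag, of h] show ?thesis
  by (subst (asm) sum.reindex) (auto simp: inj_on_def)
qed

lemma division_torusE:
 assumes "D division_of torus" "K : D"
 obtains a b where "K = {a..b}" "a <= b" "Inf K = a" "Sup K = b" "a : torus" "b : torus"
proof -
 obtain a b where ab: "K = {a..b}" "a <= b"
  using division_ofD(3,4)[OF assms] by (metis atLeastatMost_empty_iff box_real(2))
 moreover have "a : torus" "b : torus" using ab division_ofD(2)[OF assms] by auto
 ultimately show ?thesis by (intro that[of a b]) auto
qed

lemma division_torus_sum_bound:
 assumes D: "D division_of torus" and h: "!!K. K : D ==> norm (f K :: 'a::real_normed_vector) <= c * (Sup K - Inf K)"
 shows "norm (\<Sum>K\<in>D. f K) <= 2 * pi * c"
proof -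
 have "norm (\<Sum>K\<in>D. f K) <= (\<Sum>K\<in>D. c * (Sup K - Inf K))" by (rule sum_norm_le) (use h in auto)
 also have "... = 2 * pi * c"
  using sum_division_endpoints[OF D, of "%x. x"] by (simp flip: sum_distrib_left)
 finally show ?thesis .
qed

text \<open>On a bounded interval the Lipschitz term could be absorbed into the Hoelder one. The two
  constants are kept apart because they produce different singularities in time and because only
  \<open>B\<close> will carry the gradient of the solution.\<close>

definition hmod :: "real => real => real => (real => 'a::real_normed_vector) => bool" where
 "hmod \<alpha> A B F \<longleftrightarrow> (ALL x:torus. ALL y:torus. norm (F x - F y) <= A * abs (x - y) powr \<alpha> + B * abs (x - y))"

lemma hmodI:
 assumes "!!x y. [|x : torus; y : torus; x <= y|] ==> norm (F y - F x) <= A * (y - x) powr \<alpha> + B * (y - x)"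
 shows "hmod \<alpha> A B F"
 unfolding hmod_def
proof (intro ballI)
 fix x y :: real assume "x : torus" "y : torus"
 then show "norm (F x - F y) <= A * abs (x - y) powr \<alpha> + B * abs (x - y)"
  using assms[of x y] assms[of y x] by (cases "x <= y") (auto simp: norm_minus_commute)
qed

lemma hmod_continuous:
 assumes "hmod \<alpha> A B F" "\<alpha> > 0"
 shows "continuous_on torus F"
 unfolding continuous_on_def
proof
 fix x assume x: "x : torus"
 show "(F \<longlongrightarrow> F x) (at x within torus)"
 proof (rule LIM_zero_cancel, rule Lim_null_comparison)
  show "\<forall>\<^sub>F y in at x within torus. norm (F y - F x) <= A * abs (y - x) powr \<alpha> + B * abs (y - x)"
   using assms(1) x by (auto simp: hmod_def eventually_at_filter)
  have 1: "((%y. abs (y - x)) \<longlongrightarrow> 0) (at x within torus)" by (auto intro!: tendsto_eq_intros)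
  have "((%y. abs (y - x) powr \<alpha>) \<longlongrightarrow> 0) (at x within torus)"
   by (rule tendsto_zero_powrI[OF 1 tendsto_const]) (use assms(2) in auto)
  from tendsto_add[OF tendsto_mult_right_zero[OF this] tendsto_mult_right_zero[OF 1]]
  show "((%y. A * abs (y - x) powr \<alpha> + B * abs (y - x)) \<longlongrightarrow> 0) (at x within torus)"
   by simp
 qed
qed

lemma hmod_diff:
 assumes "hmod \<alpha> A B F" "hmod \<alpha> A' B' F'"
 shows "hmod \<alpha> (A + A') (B + B') (%x. F x - F' x)"
 unfolding hmod_def
proof (intro ballI)
 fix x y :: real assume "x : torus" "y : torus"
 then have "norm (F x - F y) + norm (F' x - F' y) <= (A * abs (x - y) powr \<alpha> + B * abs (x - y)) + (A' * abs (x - y) powr \<alpha> + B' * abs (x - y))"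
  using assms by (intro add_mono) (auto simp: hmod_def)
 moreover have "norm (F x - F' x - (F y - F' y)) <= norm (F x - F y) + norm (F' x - F' y)"
  using norm_triangle_ineq4[of "F x - F y" "F' x - F' y"] by (simp add: algebra_simps)
 ultimately show "norm (F x - F' x - (F y - F' y)) <= (A + A') * abs (x - y) powr \<alpha> + (B + B') * abs (x - y)"
  by (simp add: algebra_simps)
qed

lemma hmod_mono:
 assumes "hmod \<alpha> A B F" "A <= A'" "B <= B'"
 shows "hmod \<alpha> A' B' F"
 unfolding hmod_def
proof (intro ballI)
 fix x y :: real assume "x : torus" "y : torus"
 then have "norm (F x - F y) <= A * abs (x - y) powr \<alpha> + B * abs (x - y)" using assms(1) by (auto simp: hmod_def)
 also have "... <= A' * abs (x - y) powr \<alpha> + B' * abs (x - y)" by (intro add_mono mult_right_mono assms) auto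
 finally show "norm (F x - F y) <= A' * abs (x - y) powr \<alpha> + B' * abs (x - y)" .
qed

lemma powr_add_le_mono:
 assumes "A >= 0" "B >= 0" "\<alpha> >= (0::real)" "0 <= d" "d <= d'"
 shows "A * d powr \<alpha> + B * d <= A * d' powr \<alpha> + B * d'"
 by (intro add_mono mult_left_mono powr_mono2) (use assms in auto)

text \<open>The factor 2 arises when the two points lie on different sides of a period boundary: the
  increment is then routed through the boundary point. Beyond one period, \<open>y\<close> is first
  moved next to \<open>x\<close>, which only shortens the distance.\<close>

lemma periodic_modulus:
 assumes H: "hmod \<alpha> A B H" and per: "periodic H" and AB: "A >= 0" "B >= 0" and \<alpha>: "\<alpha> >= 0"
 shows "norm (H x - H y) <= 2 * A * abs (x - y) powr \<alpha> + 2 * B * abs (x - y)"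
proof -
 let ?w = "%d::real. A * d powr \<alpha> + B * d"
 have dbl: "a <= 2 * w" if "a <= w" "0 <= w" for a w :: real using that by simp
 have w0: "?w d >= 0" if "d >= 0" for d using AB that by auto
 have m: "norm (H x - H y) <= ?w d" if "x : torus" "y : torus" "abs (x - y) <= d" for x y d
  using H that powr_add_le_mono[OF AB \<alpha> _ that(3)] unfolding hmod_def by fastforce
 have main: "norm (H x - H y) <= 2 * ?w (y - x)" if x: "x : {0..<2 * pi}" and xy: "x <= y" for x y
 proof (cases "y - x <= 2 * pi")
  case le: True
  show ?thesis
  proof (cases "y <= 2 * pi")
   case True
   then have "norm (H x - H y) <= ?w (y - x)" using x xy by (intro m) auto
   moreover have "0 <= ?w (y - x)" using w0[of "y - x"] xy by simp
   ultimately show ?thesis by (rule dbl)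
  next
   case False
   have "H (2 * pi) = H 0" using per unfolding periodic_def by (metis add_0)
   moreover have "H (y - 2 * pi) = H y" using per unfolding periodic_def by (metis diff_add_cancel)
   moreover have "norm (H x - H (2 * pi)) <= ?w (y - x)" "norm (H 0 - H (y - 2 * pi)) <= ?w (y - x)"
    using x xy le False by (intro m; auto)+
   ultimately show ?thesis using norm_triangle_ineq[of "H x - H (2 * pi)" "H 0 - H (y - 2 * pi)"] by simp
  qed
 next
  case False
  obtain k where k: "y + 2 * pi * of_int k : {0..<2 * pi}" by (rule periodic_reduce)
  have "norm (H x - H (y + 2 * pi * of_int k)) <= ?w (y - x)"
   using x k False by (intro m) auto
  moreover have "0 <= ?w (y - x)" using w0[of "y - x"] xy by simp
  ultimately show ?thesis unfolding periodic_int[OF per] by (rule dbl)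
 qed
 have "norm (H x - H y) <= 2 * ?w (y - x)" if xy: "x <= y" for x y
 proof -
  obtain k where k: "x + 2 * pi * of_int k : {0..<2 * pi}" by (rule periodic_reduce)
  show ?thesis using main[OF k, of "y + 2 * pi * of_int k"] xy by (simp add: periodic_int[OF per])
 qed
 from this[of x y] this[of y x] show ?thesis
  by (cases "x <= y") (auto simp: norm_minus_commute algebra_simps)
qed

definition slope :: "(real => 'a::euclidean_space) => 'a" where
 "slope F = (F (2 * pi) - F 0) /\<^sub>R (2 * pi)"

definition reduce :: "real => real" where
 "reduce x = (SOME y. y : {0..<2 * pi} & (EX k. y = x + 2 * pi * of_int k))"

definition perext :: "(real => 'a::euclidean_space) => real => 'a" where
 "perext F x = F (reduce x) - reduce x *\<^sub>R slope F"

text \<open>For differentiable \<open>F\<close> this is the heat flow of \<open>F'\<close>. Only the increments of \<open>F\<close> matter,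
 and the linear part is split off to make \<open>F\<close> periodic.\<close>

definition heat_div :: "real => (real => 'a::euclidean_space) => real => 'a" where
 "heat_div \<tau> F x = exp (- \<tau>) *\<^sub>R (slope F + gauss_op G1 (sqrt \<tau>) (perext F) x /\<^sub>R sqrt \<tau>)"

definition heat_div' :: "real => (real => 'a::euclidean_space) => real => 'a" where
 "heat_div' \<tau> F x = exp (- \<tau>) *\<^sub>R (gauss_op G2 (sqrt \<tau>) (perext F) x /\<^sub>R \<tau>)"

lemma reduce: "reduce x : {0..<2 * pi}" "EX k. reduce x = x + 2 * pi * of_int k"
proof -
 have "EX y. y : {0..<2 * pi} & (EX k. y = x + 2 * pi * of_int k)" using periodic_reduce[of x] by metis
 from someI_ex[OF this] show "reduce x : {0..<2 * pi}" "EX k. reduce x = x + 2 * pi * of_int k"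
  unfolding reduce_def by auto
qed

lemma reduce_unique:
 assumes "y : {0..<2 * pi}" "y = x + 2 * pi * of_int k"
 shows "reduce x = y"
proof -
 obtain l where l: "reduce x = x + 2 * pi * of_int l" using reduce(2) by blast
 have "2 * pi * (of_int k - of_int l) < 2 * pi * 1" "2 * pi * (of_int l - of_int k) < 2 * pi * 1"
  using reduce(1)[of x] assms unfolding l by (auto simp: algebra_simps)
 then have "real_of_int k - of_int l < 1" "real_of_int l - of_int k < 1"
  by (simp_all only: mult_less_cancel_left_pos[of "2 * pi"] pi_gt_zero zero_less_mult_iff zero_less_numeral simp_thms)
 then have "k = l" by linarith
 then show ?thesis using assms l by simp
qed

lemma perext_periodic: "periodic (perext F)"
proof -
 have "reduce (x + 2 * pi) = reduce x" for x
 proof -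
  obtain k where k: "reduce x = x + 2 * pi * of_int k" using reduce(2) by blast
  show ?thesis by (rule reduce_unique[OF reduce(1), of _ _ "k - 1"]) (simp add: k algebra_simps)
 qed
 then show ?thesis by (simp add: periodic_def perext_def)
qed

lemma perext_torus:
 assumes "x : torus"
 shows "perext F x = F x - x *\<^sub>R slope F"
proof (cases "x = 2 * pi")
 case True
 \<comment> \<open>\<open>reduce\<close> sends the endpoint to 0, and the slope is exactly what
   makes the two endpoint values of the corrected function agree.\<close>
 have "perext F (2 * pi) = F 0"
  using reduce_unique[of 0 "2 * pi" "- 1"] by (simp add: perext_def)
 with True show ?thesis by (simp add: slope_def)
next
 case False
 then have "reduce x = x" by (intro reduce_unique[of _ _ 0]) (use assms in auto)
 then show ?thesis by (simp add: perext_def)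
qed

lemma slope_bound:
 assumes "hmod \<alpha> A B F" "0 < \<alpha>" "\<alpha> <= 1" "A >= 0" "B >= 0"
 shows "norm (slope F) <= A + B"
proof -
 have "norm (F (2 * pi) - F 0) <= A * (2 * pi) powr \<alpha> + B * (2 * pi)"
  using assms(1)[unfolded hmod_def, rule_format, of "2 * pi" 0] by simp
 also have "(2 * pi) powr \<alpha> <= (2 * pi) powr 1"
  by (rule powr_mono) (use assms pi_ge_two in auto)
 then have "A * (2 * pi) powr \<alpha> + B * (2 * pi) <= A * (2 * pi) + B * (2 * pi)"
  using assms by (intro add_right_mono mult_left_mono) auto
 finally have "norm (F (2 * pi) - F 0) <= (2 * pi) * (A + B)" by (simp add: algebra_simps)
 then show ?thesis
  unfolding slope_def norm_scaleR by (simp add: divide_inverse[symmetric] pos_divide_le_eq mult.commute)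
qed

text \<open>Removing the linear part adds the bound \<open>A + B\<close> of the slope to the
  Lipschitz constant, and periodic extension doubles both constants.\<close>

lemma perext_modulus:
 assumes F: "hmod \<alpha> A B F" and \<alpha>: "0 < \<alpha>" "\<alpha> <= 1" and AB: "A >= 0" "B >= 0"
 shows "norm (perext F x - perext F y) <= 2 * A * abs (x - y) powr \<alpha> + 2 * (A + 2 * B) * abs (x - y)"
proof (rule periodic_modulus[OF _ perext_periodic])
 show "hmod \<alpha> A (A + 2 * B) (perext F)"
  unfolding hmod_def
 proof (intro ballI)
  fix x y :: real assume xy: "x : torus" "y : torus"
  have "norm (perext F x - perext F y) <= norm (F x - F y) + abs (x - y) * norm (slope F)"
  proof -
   have "perext F x - perext F y = (F x - F y) - (x - y) *\<^sub>R slope F"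
    using xy by (simp add: perext_torus scaleR_diff_left)
   then show ?thesis using norm_triangle_ineq4[of "F x - F y" "(x - y) *\<^sub>R slope F"] by simp
  qed
  also have "... <= (A * abs (x - y) powr \<alpha> + B * abs (x - y)) + abs (x - y) * (A + B)"
   by (intro add_mono mult_left_mono slope_bound[OF F]) (use F xy \<alpha> AB in "auto simp: hmod_def")
  finally show "norm (perext F x - perext F y) <= A * abs (x - y) powr \<alpha> + (A + 2 * B) * abs (x - y)"
   by (simp add: algebra_simps)
 qed
qed (use \<alpha> AB in auto)

lemma perext_continuous:
 assumes F: "hmod \<alpha> A B F" and \<alpha>: "0 < \<alpha>" "\<alpha> <= 1" and AB: "A >= 0" "B >= 0"
 shows "continuous_on UNIV (perext F)"
 unfolding continuous_on_def
proof
 fix x :: real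
 show "(perext F \<longlongrightarrow> perext F x) (at x within UNIV)"
 proof (rule LIM_zero_cancel, rule Lim_null_comparison)
  show "\<forall>\<^sub>F y in at x. norm (perext F y - perext F x) <= 2 * A * abs (y - x) powr \<alpha> + 2 * (A + 2 * B) * abs (y - x)"
   using perext_modulus[OF assms] by simp
  have 1: "((%y. abs (y - x)) \<longlongrightarrow> 0) (at x)" by (auto intro!: tendsto_eq_intros)
  have "((%y. abs (y - x) powr \<alpha>) \<longlongrightarrow> 0) (at x)"
   by (rule tendsto_zero_powrI[OF 1 tendsto_const]) (use \<alpha> in auto)
  from tendsto_add[OF tendsto_mult_right_zero[OF this] tendsto_mult_right_zero[OF 1]]
  show "((%y. 2 * A * abs (y - x) powr \<alpha> + 2 * (A + 2 * B) * abs (y - x)) \<longlongrightarrow> 0) (at x)"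
   by simp
 qed
qed

lemma perext_bounded:
 assumes F: "hmod \<alpha> A B F" and \<alpha>: "0 < \<alpha>" "\<alpha> <= 1" and AB: "A >= 0" "B >= 0"
 obtains K where "!!x. norm (perext F x) <= K"
 using periodic_continuous_bounded[OF perext_periodic continuous_on_subset[OF perext_continuous[OF assms] subset_UNIV]]
 by blast

lemma slope_diff: "slope (%x. F x - F' x) = slope F - slope F'"
 by (simp add: slope_def algebra_simps)

lemma perext_diff: "perext (%x. F x - F' x) = (%x. perext F x - perext F' x)"
 by (rule ext) (simp add: perext_def slope_diff algebra_simps)

lemma heat_div_periodic: "periodic (heat_div \<tau> F)" "periodic (heat_div' \<tau> F)"
proof -
 have "perext F (x + 2 * pi - r * y) = perext F (x - r * y)" for x r y
  using perext_periodic[of F] unfolding periodic_def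
  by (metis add.commute add_diff_eq)
 then have "gauss_op \<phi> r (perext F) (x + 2 * pi) = gauss_op \<phi> r (perext F) x" for \<phi> r x
  by (simp add: gauss_op_def)
 then show "periodic (heat_div \<tau> F)" "periodic (heat_div' \<tau> F)"
  by (simp_all add: periodic_def heat_div_def heat_div'_def)
qed

lemma heat_div_diff:
 assumes F: "hmod \<alpha> A B F" and F': "hmod \<alpha> A' B' F'" and \<alpha>: "0 < \<alpha>" "\<alpha> <= 1"
  and AB: "A >= 0" "B >= 0" "A' >= 0" "B' >= 0"
 shows "heat_div \<tau> (%y. F y - F' y) x = heat_div \<tau> F x - heat_div \<tau> F' x" (is ?A1)
  "heat_div' \<tau> (%y. F y - F' y) x = heat_div' \<tau> F x - heat_div' \<tau> F' x" (is ?A2)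
proof -
 obtain K K' where K: "!!x. norm (perext F x) <= K" "!!x. norm (perext F' x) <= K'"
  using perext_bounded[OF F \<alpha> AB(1,2)] perext_bounded[OF F' \<alpha> AB(3,4)] by metis
 have "gauss_op \<phi> r (perext (%y. F y - F' y)) x = gauss_op \<phi> r (perext F) x - gauss_op \<phi> r (perext F') x"
  if "gauss_bounded \<phi>" for \<phi> r
  unfolding perext_diff
  by (rule gauss_op_add[OF that _ K(1) _ K(2)])
   (auto intro!: borel_measurable_continuous_UNIV perext_continuous F F' \<alpha> AB)
 then show ?A1
  ?A2
  by (simp_all add: heat_div_def heat_div'_def slope_diff G_gauss_bounded scaleR_diff_right scaleR_add_right)
qed

lemma heat_div_vector_derivative:
 assumes F: "hmod \<alpha> A B F" and \<alpha>: "0 < \<alpha>" "\<alpha> <= 1" and AB: "A >= 0" "B >= 0" and \<tau>: "\<tau> > 0"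
 shows "(heat_div \<tau> F has_vector_derivative heat_div' \<tau> F x) (at x)"
proof -
 obtain K where K: "!!x. norm (perext F x) <= K" using perext_bounded[OF F \<alpha> AB] by blast
 have "(gauss_op G1 (sqrt \<tau>) (perext F) has_vector_derivative gauss_op G2 (sqrt \<tau>) (perext F) x /\<^sub>R sqrt \<tau>) (at x)"
  by (rule gauss_op_has_vector_derivative[OF G_gauss_bounded(2,3) G1_deriv
     borel_measurable_continuous_UNIV[OF perext_continuous[OF F \<alpha> AB]] K])
   (use \<tau> in simp)
 from has_vector_derivative_scaleR[OF DERIV_const this, of "exp (- \<tau>) / sqrt \<tau>"]
 have "((%x. (exp (- \<tau>) / sqrt \<tau>) *\<^sub>R gauss_op G1 (sqrt \<tau>) (perext F) x) has_vector_derivative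
   (exp (- \<tau>) / sqrt \<tau>) *\<^sub>R (gauss_op G2 (sqrt \<tau>) (perext F) x /\<^sub>R sqrt \<tau>)) (at x)" by simp
 from has_vector_derivative_add[OF has_vector_derivative_const[of "exp (- \<tau>) *\<^sub>R slope F"] this]
 show ?thesis
  using \<tau> by (simp add: heat_div_def[abs_def] heat_div'_def scaleR_add_right divide_inverse mult.assoc flip: inverse_mult_distrib)
qed

text \<open>The power of \<open>T\<close> is the price of replacing 1 by
  \<open>\<tau> powr ((\<alpha> - 1) / 2)\<close> for times up to \<open>T\<close>; the final
  summand 1 only secures strict positivity.\<close>

definition heat_div_const :: "real => real => real" where
 "heat_div_const \<alpha> T = (1 + 4 * gauss_mom G1 + 4 * gauss_mom G2) * (1 + T powr ((1 - \<alpha>) / 2)) + 1"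

lemma heat_div_const_pos: "heat_div_const \<alpha> T > 0"
proof -
 have "(1 + 4 * gauss_mom G1 + 4 * gauss_mom G2) * (1 + T powr ((1 - \<alpha>) / 2)) >= 0"
  using gauss_mom_nonneg[of G1] gauss_mom_nonneg[of G2] by (intro mult_nonneg_nonneg add_nonneg_nonneg) auto
 then show ?thesis by (simp add: heat_div_const_def)
qed

text \<open>At scale \<open>r = sqrt \<tau>\<close> the kernels \<open>G1\<close> and
  \<open>G2\<close> carry the factors \<open>1 / r\<close> and \<open>1 / r\<^sup>2\<close>, while
  their zero mean returns \<open>r powr \<alpha>\<close> on the Hoelder part and \<open>r\<close> on
  the Lipschitz part. All resulting powers of \<tau> are integrable at 0.\<close>

lemma heat_div_bounds:
 assumes F: "hmod \<alpha> A B F" and \<alpha>: "0 < \<alpha>" "\<alpha> <= 1" and AB: "A >= 0" "B >= 0" and \<tau>: "0 < \<tau>" "\<tau> <= T"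
 shows "norm (heat_div \<tau> F x) <= heat_div_const \<alpha> T * (A * \<tau> powr ((\<alpha> - 1) / 2) + B)" (is ?A1)
  "norm (heat_div' \<tau> F x) <= heat_div_const \<alpha> T * (A * \<tau> powr ((\<alpha> - 2) / 2) + B * \<tau> powr (- 1 / 2))" (is ?A2)
proof -
 obtain K where K: "!!x. norm (perext F x) <= K" using perext_bounded[OF F \<alpha> AB] by blast
 let ?m1 = "gauss_mom G1" and ?m2 = "gauss_mom G2" and ?T = "T powr ((1 - \<alpha>) / 2)"
 have m: "?m1 >= 0" "?m2 >= 0" by (rule gauss_mom_nonneg)+
 have meas: "perext F : borel_measurable borel"
  by (rule borel_measurable_continuous_UNIV[OF perext_continuous[OF F \<alpha> AB]])
 have s: "sqrt \<tau> > 0" using \<tau> by simp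
 have go: "norm (gauss_op \<phi> (sqrt \<tau>) (perext F) x) <= gauss_mom \<phi> * (2 * A * \<tau> powr (\<alpha> / 2) + 2 * (A + 2 * B) * \<tau> powr (1 / 2))"
  if "gauss_bounded \<phi>" "(LINT y|lborel. \<phi> y) = 0" for \<phi>
  using gauss_op_norm_le_holder[OF that(1) meas K that(2) \<alpha> s _ _ perext_modulus[OF F \<alpha> AB], of x] AB \<tau>
  by (simp add: powr_half_sqrt[symmetric] powr_powr)
 \<comment> \<open>Used to hide the contribution of \<open>A\<close> to the slope, which has no
   singularity of its own, in the singular term with the same coefficient.\<close>
 have T1: "1 <= ?T * \<tau> powr ((\<alpha> - 1) / 2)"
 proof -
  have "\<tau> powr ((1 - \<alpha>) / 2) <= ?T" by (rule powr_mono2) (use \<alpha> \<tau> in auto)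
  then have "\<tau> powr ((1 - \<alpha>) / 2) * \<tau> powr ((\<alpha> - 1) / 2) <= ?T * \<tau> powr ((\<alpha> - 1) / 2)"
   by (rule mult_right_mono) auto
  moreover have "\<tau> powr ((1 - \<alpha>) / 2) * \<tau> powr ((\<alpha> - 1) / 2) = 1"
   using \<tau> by (simp add: field_simps flip: powr_add)
  ultimately show ?thesis by simp
 qed
 have e: "exp (- \<tau>) <= 1" using \<tau> by simp
 have c1: "1 + 4 * ?m1 + 4 * ?m2 >= 0" using m by simp
 have "norm (heat_div \<tau> F x) <= 1 * (norm (slope F) + norm (gauss_op G1 (sqrt \<tau>) (perext F) x) / sqrt \<tau>)"
  unfolding heat_div_def norm_scaleR
  by (intro mult_mono order_trans[OF norm_triangle_ineq]) (use e s in "auto simp: divide_inverse mult.commute")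
 also have "... <= 1 * ((A + B) + ?m1 * (2 * A * \<tau> powr (\<alpha> / 2) + 2 * (A + 2 * B) * \<tau> powr (1 / 2)) / sqrt \<tau>)"
  by (intro mult_left_mono add_mono divide_right_mono slope_bound[OF F \<alpha> AB] go G_gauss_bounded G_integral) (use s in auto)
 also have "... = (1 + 2 * ?m1) * A * 1 + 2 * ?m1 * (A * \<tau> powr ((\<alpha> - 1) / 2)) + (1 + 4 * ?m1) * B"
 proof -
  have "\<tau> powr (\<alpha> / 2) / sqrt \<tau> = \<tau> powr ((\<alpha> - 1) / 2)" "\<tau> powr (1 / 2) / sqrt \<tau> = 1"
   using \<tau> by (simp_all add: powr_half_sqrt[symmetric] diff_divide_distrib flip: powr_diff)
  then have "(2 * A * \<tau> powr (\<alpha> / 2) + 2 * (A + 2 * B) * \<tau> powr (1 / 2)) / sqrt \<tau> =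
    2 * A * \<tau> powr ((\<alpha> - 1) / 2) + 2 * (A + 2 * B) * 1"
   by (simp only: add_divide_distrib times_divide_eq_right[symmetric])
  then show ?thesis by (simp only: times_divide_eq_right[symmetric]) (simp add: algebra_simps)
 qed
 also have "... <= (1 + 2 * ?m1) * A * (?T * \<tau> powr ((\<alpha> - 1) / 2)) + 2 * ?m1 * (A * \<tau> powr ((\<alpha> - 1) / 2)) + (1 + 4 * ?m1) * B"
  by (intro add_right_mono mult_left_mono T1 mult_nonneg_nonneg) (use m AB in auto)
 also have "... = ((1 + 2 * ?m1) * ?T + 2 * ?m1) * (A * \<tau> powr ((\<alpha> - 1) / 2)) + (1 + 4 * ?m1) * B"
  by (simp add: algebra_simps)
 also have "... <= heat_div_const \<alpha> T * (A * \<tau> powr ((\<alpha> - 1) / 2)) + heat_div_const \<alpha> T * B"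
 proof (intro add_mono mult_right_mono)
  have p: "0 <= ?m1 * ?T" "0 <= ?m2 * ?T" using m by simp_all
  show "(1 + 2 * ?m1) * ?T + 2 * ?m1 <= heat_div_const \<alpha> T" "1 + 4 * ?m1 <= heat_div_const \<alpha> T"
   using m p powr_ge_zero[of T "(1 - \<alpha>) / 2"] unfolding heat_div_const_def distrib_right distrib_left mult_1 mult_1_right mult.assoc by linarith+
 qed (use AB in auto)
 finally show ?A1
  by (simp add: algebra_simps)
 have "norm (heat_div' \<tau> F x) <= 1 * (norm (gauss_op G2 (sqrt \<tau>) (perext F) x) / \<tau>)"
  unfolding heat_div'_def norm_scaleR
  by (intro mult_mono) (use e \<tau> in "auto simp: divide_inverse mult.commute")
 also have "... <= 1 * (?m2 * (2 * A * \<tau> powr (\<alpha> / 2) + 2 * (A + 2 * B) * \<tau> powr (1 / 2)) / \<tau>)"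
  by (intro mult_left_mono divide_right_mono go G_gauss_bounded G_integral) (use \<tau> in auto)
 also have "... = 2 * ?m2 * (A * \<tau> powr ((\<alpha> - 2) / 2)) + 2 * ?m2 * A * (1 * \<tau> powr (- 1 / 2)) + 4 * ?m2 * (B * \<tau> powr (- 1 / 2))"
 proof -
  have "\<tau> powr (\<alpha> / 2) / \<tau> = \<tau> powr ((\<alpha> - 2) / 2)"
   using \<tau> by (simp add: diff_divide_distrib powr_diff)
  moreover have "\<tau> powr (1 / 2) / \<tau> = \<tau> powr (- 1 / 2)"
   using \<tau> powr_diff[of \<tau> "1 / 2" 1] by simp
  ultimately have "(2 * A * \<tau> powr (\<alpha> / 2) + 2 * (A + 2 * B) * \<tau> powr (1 / 2)) / \<tau> =
    2 * A * \<tau> powr ((\<alpha> - 2) / 2) + 2 * (A + 2 * B) * \<tau> powr (- 1 / 2)"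
   by (simp only: add_divide_distrib times_divide_eq_right[symmetric])
  then show ?thesis by (simp only: times_divide_eq_right[symmetric]) (simp add: algebra_simps)
 qed
 also have "... <= 2 * ?m2 * (A * \<tau> powr ((\<alpha> - 2) / 2)) + 2 * ?m2 * A * ((?T * \<tau> powr ((\<alpha> - 1) / 2)) * \<tau> powr (- 1 / 2)) + 4 * ?m2 * (B * \<tau> powr (- 1 / 2))"
  by (intro add_left_mono add_right_mono mult_left_mono mult_right_mono T1) (use m AB in auto)
 also have "... = (2 * ?m2 + 2 * ?m2 * ?T) * (A * \<tau> powr ((\<alpha> - 2) / 2)) + 4 * ?m2 * (B * \<tau> powr (- 1 / 2))"
 proof -
  have "(\<alpha> - 1) / 2 + (- 1 / 2) = (\<alpha> - 2) / 2" by (simp add: field_simps)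
  then have "\<tau> powr ((\<alpha> - 1) / 2) * \<tau> powr (- 1 / 2) = \<tau> powr ((\<alpha> - 2) / 2)"
   by (metis powr_add)
  then show ?thesis by (simp add: mult.assoc) (simp add: algebra_simps)
 qed
 also have "... <= heat_div_const \<alpha> T * (A * \<tau> powr ((\<alpha> - 2) / 2)) + heat_div_const \<alpha> T * (B * \<tau> powr (- 1 / 2))"
 proof (intro add_mono mult_right_mono)
  have p: "0 <= ?m1 * ?T" "0 <= ?m2 * ?T" using m by simp_all
  show "2 * ?m2 + 2 * ?m2 * ?T <= heat_div_const \<alpha> T" "4 * ?m2 <= heat_div_const \<alpha> T"
   using m p powr_ge_zero[of T "(1 - \<alpha>) / 2"] unfolding heat_div_const_def distrib_right distrib_left mult_1 mult_1_right mult.assoc by linarith+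
 qed (use AB in auto)
 finally show ?A2
  by (simp add: algebra_simps)
qed

lemma heat_div_continuous:
 assumes F: "hmod \<alpha> A B F" and \<alpha>: "0 < \<alpha>" "\<alpha> <= 1" and AB: "A >= 0" "B >= 0"
  and \<tau>: "continuous_on S \<tau>" "!!p. p : S ==> \<tau> p > 0" and x: "continuous_on S x"
 shows "continuous_on S (%p::'p::first_countable_topology. heat_div (\<tau> p) F (x p))"
  "continuous_on S (%p::'p::first_countable_topology. heat_div' (\<tau> p) F (x p))"
proof -
 obtain K where K: "!!x. norm (perext F x) <= K" using perext_bounded[OF F \<alpha> AB] by blast
 have g: "continuous_on S (%p. gauss_op \<phi> (sqrt (\<tau> p)) (perext F) (x p))" if "gauss_bounded \<phi>" for \<phi>
  by (rule gauss_op_continuous[OF that perext_continuous[OF F \<alpha> AB] K x]) (intro continuous_intros \<tau>)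
 have "ALL p:S. \<tau> p ~= 0" "ALL p:S. sqrt (\<tau> p) ~= 0" using \<tau>(2) by force+
 then show "continuous_on S (%p. heat_div (\<tau> p) F (x p))" "continuous_on S (%p. heat_div' (\<tau> p) F (x p))"
  unfolding heat_div_def heat_div'_def by (intro continuous_intros \<tau>(1) g G_gauss_bounded; simp)+
qed

lemma heat_div_measurable:
 assumes F: "!!s. s : space M ==> hmod \<alpha> (A s) (B s) (F s)" and \<alpha>: "0 < \<alpha>" "\<alpha> <= 1"
  and AB: "!!s. s : space M ==> A s >= 0" "!!s. s : space M ==> B s >= 0"
  and meas: "!!y. y : torus ==> (%s. F s y) : borel_measurable M"
  and [measurable]: "\<tau> : borel_measurable M"
 shows "(%s. heat_div (\<tau> s) (F s) x) : borel_measurable M" (is ?A1)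
  "(%s. heat_div' (\<tau> s) (F s) x) : borel_measurable M" (is ?A2)
proof -
 have m1: "(%s. F s (2 * pi)) : borel_measurable M" "(%s. F s 0) : borel_measurable M"
  "(%s. F s (reduce y)) : borel_measurable M" for y
  using reduce(1)[of y] by (auto intro!: meas)
 have m2 [measurable]: "(%s. slope (F s)) : borel_measurable M"
  unfolding slope_def using m1 by measurable
 have m3: "(%s. perext (F s) y) : borel_measurable M" for y
  unfolding perext_def using m1(3) m2 by measurable
 have m4: "(%(s, y). perext (F s) y) : borel_measurable (M \<Otimes>\<^sub>M borel)"
  by (rule caratheodory_measurable[OF m3 perext_continuous[OF F \<alpha> AB]])
 have [measurable]: "(%s. gauss_op \<phi> (sqrt (\<tau> s)) (perext (F s)) x) : borel_measurable M" if "gauss_bounded \<phi>" for \<phi>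
  by (rule gauss_op_measurable[OF that m4]) measurable
 note [measurable] = this[OF G_gauss_bounded(2)] this[OF G_gauss_bounded(3)]
 show ?A1 ?A2
  unfolding heat_div_def heat_div'_def by measurable
qed


section \<open>Integration by parts against the periodic kernel, and Riemann-Stieltjes sums\<close>

definition heat_kernel' :: "real => real => real" where
 "heat_kernel' t x = exp (- t) * (per G1 (sqrt t) x / sqrt t)"

lemma heat_kernel_has_derivative:
 assumes "t > 0"
 shows "(heat_kernel t has_real_derivative heat_kernel' t x) (at x)"
 unfolding heat_kernel'_def by (rule heat_kernel_deriv[OF assms])

lemma heat_kernel_shift_deriv:
 assumes "t > 0"
 shows "((%y. heat_kernel t (x - y)) has_real_derivative - heat_kernel' t (x - y)) (at y within S)"
proof (rule has_field_derivative_at_within)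
 have "((%y. x - y) has_real_derivative - 1) (at y)" by (auto intro!: derivative_eq_intros)
 from DERIV_chain2[OF heat_kernel_has_derivative[OF assms, of "x - y"] this]
 show "((%y. heat_kernel t (x - y)) has_real_derivative - heat_kernel' t (x - y)) (at y)" by simp
qed

lemma heat_kernel'_continuous:
 assumes "t > 0"
 shows "continuous_on UNIV (heat_kernel' t)"
proof -
 have "continuous_on UNIV (per G1 (sqrt t))"
  using per_deriv[OF G_gauss_bounded(2,3) _ G1_deriv, of "sqrt t"] assms
  by (intro continuous_at_imp_continuous_on) (auto intro: DERIV_isCont)
 then show ?thesis unfolding heat_kernel'_def[abs_def] using assms by (intro continuous_intros) auto
qed

lemma heat_kernel_continuous:
 assumes "t > 0"
 shows "continuous_on UNIV (heat_kernel t)"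
 using heat_kernel_has_derivative[OF assms]
 by (intro continuous_at_imp_continuous_on) (auto intro: DERIV_isCont)

lemma heat_kernel_bounds:
 assumes "t > 0"
 obtains C where "C > 0" "!!x. abs (heat_kernel t x) <= C" "!!x. abs (heat_kernel' t x) <= C"
proof -
 have p: "periodic (heat_kernel t)" using heat_kernel_periodic[OF assms] by (simp add: periodic_def)
 have p': "periodic (heat_kernel' t)"
  using per_periodic[OF G_gauss_bounded(2), of "sqrt t"] assms by (simp add: periodic_def heat_kernel'_def)
 obtain C C' where C: "!!x. norm (heat_kernel t x) <= C" "!!x. norm (heat_kernel' t x) <= C'"
  using periodic_continuous_bounded[OF p continuous_on_subset[OF heat_kernel_continuous[OF assms] subset_UNIV]]
   periodic_continuous_bounded[OF p' continuous_on_subset[OF heat_kernel'_continuous[OF assms] subset_UNIV]] by metis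
 show ?thesis
 proof (rule that[of "abs C + abs C' + 1"])
  show "abs (heat_kernel t x) <= abs C + abs C' + 1" "abs (heat_kernel' t x) <= abs C + abs C' + 1" for x
   using C(1)[of x] C(2)[of x] by auto
 qed auto
qed

lemma integral_torus_per:
 fixes H :: "real => 'a::euclidean_space"
 assumes \<phi>: "gauss_bounded \<phi>" and c: "continuous_on UNIV (per \<phi> r)" and r: "r > 0"
  and H: "continuous_on UNIV H" "periodic H"
 shows "integral torus (%y. per \<phi> r (x - y) *\<^sub>R H y) = gauss_op \<phi> r H x"
proof -
 obtain K where K: "!!x. norm (H x) <= K"
  using periodic_continuous_bounded[OF H(2) continuous_on_subset[OF H(1) subset_UNIV]] by blast
 have "continuous_on torus (%y. per \<phi> r (x - y) *\<^sub>R H y)"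
  by (intro continuous_intros continuous_on_compose2[OF c] continuous_on_subset[OF H(1)]) auto
 then have "(LINT y:torus|lborel. per \<phi> r (x - y) *\<^sub>R H y) = integral torus (%y. per \<phi> r (x - y) *\<^sub>R H y)"
  by (intro set_borel_integral_eq_integral borel_integrable_atLeastAtMost')
 then show ?thesis
  using unfold_per[OF \<phi> r borel_measurable_continuous_UNIV[OF H(1)] K H(2), of x]
  by (simp add: set_integral_torus_halfopen)
qed

lemma integral_heat_kernel:
 assumes t: "t > 0"
 shows "integral torus (%y. heat_kernel t (x - y)) = exp (- t)"
proof -
 have c: "continuous_on UNIV (per G0 (sqrt t))"
  using per_deriv[OF G_gauss_bounded(1,2) _ G0_deriv, of "sqrt t"] t
  by (intro continuous_at_imp_continuous_on) (auto intro: DERIV_isCont)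
 have "integral torus (%y. per G0 (sqrt t) (x - y) *\<^sub>R (1::real)) = gauss_op G0 (sqrt t) (%_. 1) x"
  by (rule integral_torus_per[OF G_gauss_bounded(1) c]) (use t in "auto simp: periodic_def")
 also have "... = 1" by (simp add: gauss_op_def G_integral)
 finally show ?thesis by (simp add: heat_kernel_per[OF t])
qed

text \<open>\<open>F\<close> need not be differentiable, so its Stieltjes convolution is read
  through integration by parts. The periodic part of \<open>F\<close> unfolds to a Gaussian average;
  the linear part gives \<open>exp (- \<tau>)\<close> times the slope because the kernel has total
  mass \<open>exp (- \<tau>)\<close>.\<close>

lemma heat_div_by_parts:
 fixes F :: "real => 'a::euclidean_space"
 assumes F: "hmod \<alpha> A B F" and \<alpha>: "0 < \<alpha>" "\<alpha> <= 1" and AB: "A >= 0" "B >= 0" and \<tau>: "\<tau> > 0"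
 shows "heat_div \<tau> F x = heat_kernel \<tau> (x - 2 * pi) *\<^sub>R F (2 * pi) - heat_kernel \<tau> (x - 0) *\<^sub>R F 0
  + integral torus (%y. heat_kernel' \<tau> (x - y) *\<^sub>R F y)"
proof -
 let ?H = "perext F" and ?c = "slope F" and ?r = "sqrt \<tau>"
 let ?k = "%y. heat_kernel \<tau> (x - y)" and ?k' = "%y. heat_kernel' \<tau> (x - y)"
 have c0: "continuous_on torus ?k" "continuous_on torus ?k'"
  by (intro continuous_on_compose2[OF heat_kernel_continuous[OF \<tau>]] continuous_on_compose2[OF heat_kernel'_continuous[OF \<tau>]] continuous_intros; auto)+
 have H: "continuous_on UNIV ?H" by (rule perext_continuous[OF F \<alpha> AB])
 have c: "continuous_on UNIV (per G1 ?r)"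
  using per_deriv[OF G_gauss_bounded(2,3) _ G1_deriv, of ?r] \<tau>
  by (intro continuous_at_imp_continuous_on) (auto intro: DERIV_isCont)
 have iH: "(%y. ?k' y *\<^sub>R ?H y) integrable_on torus"
  by (intro integrable_continuous_real continuous_intros c0 continuous_on_subset[OF H]) auto
 have iy: "(%y. ?k' y * y) integrable_on torus"
  by (intro integrable_continuous_real continuous_intros c0)
 have i1: "integral torus (%y. ?k' y *\<^sub>R ?H y) = exp (- \<tau>) *\<^sub>R (gauss_op G1 ?r ?H x /\<^sub>R ?r)"
 proof -
  have "integral torus (%y. ?k' y *\<^sub>R ?H y) = integral torus (%y. (exp (- \<tau>) / ?r) *\<^sub>R (per G1 ?r (x - y) *\<^sub>R ?H y))"
   by (simp add: heat_kernel'_def)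
  also have "... = (exp (- \<tau>) / ?r) *\<^sub>R integral torus (%y. per G1 ?r (x - y) *\<^sub>R ?H y)"
   by (rule integral_cmul)
  also have "integral torus (%y. per G1 ?r (x - y) *\<^sub>R ?H y) = gauss_op G1 ?r ?H x"
   by (rule integral_torus_per[OF G_gauss_bounded(2) c _ H perext_periodic]) (use \<tau> in simp)
  finally show ?thesis by (simp add: divide_inverse)
 qed
 have i2: "integral torus (%y. ?k' y * y) = exp (- \<tau>) - ?k (2 * pi) * (2 * pi)"
 proof -
  have "((%y. ?k y - ?k' y * y) has_integral (?k (2 * pi) * (2 * pi) - ?k 0 * 0)) torus"
  proof (rule fundamental_theorem_of_calculus)
   fix y :: real
   have "((%y. ?k y * y) has_real_derivative - ?k' y * y + 1 * ?k y) (at y within torus)"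
    by (rule DERIV_mult[OF heat_kernel_shift_deriv[OF \<tau>] DERIV_ident])
   then show "((%y. ?k y * y) has_vector_derivative ?k y - ?k' y * y) (at y within torus)"
    by (simp add: has_real_derivative_iff_has_vector_derivative)
  qed simp
  then have "integral torus (%y. ?k y - ?k' y * y) = ?k (2 * pi) * (2 * pi)"
   by (intro integral_unique) simp
  moreover have "integral torus (%y. ?k y - ?k' y * y) = integral torus ?k - integral torus (%y. ?k' y * y)"
   by (rule Henstock_Kurzweil_Integration.integral_diff[OF integrable_continuous_real[OF c0(1)] iy])
  ultimately show ?thesis using integral_heat_kernel[OF \<tau>, of x] by simp
 qed
 have "integral torus (%y. ?k' y *\<^sub>R F y) = integral torus (%y. ?k' y *\<^sub>R ?H y + (?k' y * y) *\<^sub>R ?c)"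
  by (rule Henstock_Kurzweil_Integration.integral_cong) (simp add: perext_torus scaleR_diff_right)
 also have "... = integral torus (%y. ?k' y *\<^sub>R ?H y) + integral torus (%y. ?k' y * y) *\<^sub>R ?c"
  by (rule integral_unique[OF has_integral_add[OF integrable_integral[OF iH] has_integral_scaleR_left[OF integrable_integral[OF iy]]]])
 finally have I: "integral torus (%y. ?k' y *\<^sub>R F y) = exp (- \<tau>) *\<^sub>R (gauss_op G1 ?r ?H x /\<^sub>R ?r) +
   (exp (- \<tau>) - ?k (2 * pi) * (2 * pi)) *\<^sub>R ?c" by (simp only: i1 i2)
 have k: "?k (2 * pi) = ?k 0" using heat_kernel_periodic[OF \<tau>, of "x - 2 * pi"] by simp
 have "F (2 * pi) = F 0 + (2 * pi) *\<^sub>R ?c" by (simp add: slope_def)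
 then have "?k (2 * pi) *\<^sub>R F (2 * pi) - ?k 0 *\<^sub>R F 0 = (?k (2 * pi) * (2 * pi)) *\<^sub>R ?c"
  unfolding k by (simp add: scaleR_add_right)
 then show ?thesis unfolding I heat_div_def by (simp add: scaleR_add_right scaleR_diff_left)
qed

text \<open>For the primitive of a continuous function the integration by parts can be undone, so
  the ordinary drift is treated by the same operator as the rough integral.\<close>

lemma heat_semigroup_eq_heat_div:
 fixes D :: "real => 'a::euclidean_space"
 assumes \<tau>: "\<tau> > 0" and D: "continuous_on UNIV D"
  and F: "hmod \<alpha> A B (%y. integral {0..y} D)" "0 < \<alpha>" "\<alpha> <= 1" "A >= 0" "B >= 0"
 shows "heat_semigroup \<tau> D x = heat_div \<tau> (%y. integral {0..y} D) x"
proof -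
 let ?F = "%y. integral {0..y} D"
 let ?k = "%y. heat_kernel \<tau> (x - y)" and ?k' = "%y. heat_kernel' \<tau> (x - y)"
 have c: "continuous_on UNIV ?k" "continuous_on UNIV ?k'"
  by (intro continuous_on_compose2[OF heat_kernel_continuous[OF \<tau>]] continuous_on_compose2[OF heat_kernel'_continuous[OF \<tau>]] continuous_intros; auto)+
 have D': "continuous_on torus D" by (rule continuous_on_subset[OF D]) auto
 have cF: "continuous_on torus ?F" by (rule indefinite_integral_continuous_1[OF integrable_continuous_real[OF D']])
 have i1: "(%y. ?k y *\<^sub>R D y) integrable_on torus" "(%y. ?k' y *\<^sub>R ?F y) integrable_on torus"
  by (intro integrable_continuous_real continuous_intros D' cF continuous_on_subset[OF c(1)] continuous_on_subset[OF c(2)]; auto)+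
 have "((%y. ?k y *\<^sub>R D y - ?k' y *\<^sub>R ?F y) has_integral (?k (2 * pi) *\<^sub>R ?F (2 * pi) - ?k 0 *\<^sub>R ?F 0)) torus"
 proof (rule fundamental_theorem_of_calculus)
  fix y :: real assume y: "y : torus"
  have "((%y. ?k y *\<^sub>R ?F y) has_vector_derivative ?k y *\<^sub>R D y + (- ?k' y) *\<^sub>R ?F y) (at y within torus)"
   by (rule has_vector_derivative_scaleR[OF heat_kernel_shift_deriv[OF \<tau>] integral_has_vector_derivative[OF D' y]])
  then show "((%y. ?k y *\<^sub>R ?F y) has_vector_derivative ?k y *\<^sub>R D y - ?k' y *\<^sub>R ?F y) (at y within torus)"
   by simp
 qed simp
 then have "integral torus (%y. ?k y *\<^sub>R D y) - integral torus (%y. ?k' y *\<^sub>R ?F y) = ?k (2 * pi) *\<^sub>R ?F (2 * pi) - ?k 0 *\<^sub>R ?F 0"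
  using i1 by (subst Henstock_Kurzweil_Integration.integral_diff[symmetric]) (auto intro: integral_unique)
 then have "heat_div \<tau> ?F x = integral torus (%y. ?k y *\<^sub>R D y)"
  by (simp add: heat_div_by_parts[OF F \<tau>] algebra_simps)
 moreover have "heat_semigroup \<tau> D x = integral torus (%y. ?k y *\<^sub>R D y)"
 proof -
  have "heat_semigroup \<tau> D x = (LINT y:torus|lborel. ?k y *\<^sub>R D y)"
   unfolding heat_semigroup_def
   by (intro integral_lebesgue_torus borel_measurable_continuous_onI continuous_intros c D)
  also have "... = integral torus (%y. ?k y *\<^sub>R D y)"
   by (intro set_borel_integral_eq_integral borel_integrable_atLeastAtMost' continuous_intros D' continuous_on_subset[OF c(1)]) auto
  finally show ?thesis .
 qed
 ultimately show ?thesis by simp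
qed

text \<open>The kernel is Lipschitz at positive times and \<open>F\<close> has a positive modulus
  exponent, so the error on a cell is superlinear in its length and the sums converge along every
  sequence of divisions whose mesh tends to 0.\<close>

lemma heat_div_riemann_stieltjes:
 fixes F :: "real => 'a::euclidean_space"
 assumes F: "hmod \<alpha> A B F" and \<alpha>: "0 < \<alpha>" "\<alpha> <= 1" and AB: "A >= 0" "B >= 0" and \<tau>: "\<tau> > 0" and \<epsilon>: "\<epsilon> > 0"
 shows "EX \<delta>>0. ALL D. D division_of torus & (ALL K:D. Sup K - Inf K < \<delta>) -->
  norm ((\<Sum>K\<in>D. heat_kernel \<tau> (x - Inf K) *\<^sub>R (F (Sup K) - F (Inf K))) - heat_div \<tau> F x) < \<epsilon>"
proof -
 let ?k = "%y. heat_kernel \<tau> (x - y)" and ?k' = "%y. heat_kernel' \<tau> (x - y)"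
 let ?w = "%d::real. A * d powr \<alpha> + B * d"
 obtain C where C: "C > 0" "!!x. abs (heat_kernel' \<tau> x) <= C" using heat_kernel_bounds[OF \<tau>] by metis
 have c: "continuous_on UNIV ?k'"
  by (intro continuous_on_compose2[OF heat_kernel'_continuous[OF \<tau>]] continuous_intros) auto
 have Fc: "continuous_on torus F" by (rule hmod_continuous[OF F \<alpha>(1)])
 \<comment> \<open>The indefinite Stieltjes integral, defined through integration by parts; its
   total increment is \<open>heat_div \<tau> F x\<close>.\<close>
 define \<Phi> where "\<Phi> y = ?k y *\<^sub>R F y - ?k 0 *\<^sub>R F 0 + integral {0..y} (%y. ?k' y *\<^sub>R F y)" for y
 have ik: "(%y. ?k' y *\<^sub>R F y) integrable_on {a..b}" if "a : torus" "b : torus" for a b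
  by (intro integrable_continuous_real continuous_intros continuous_on_subset[OF Fc] continuous_on_subset[OF c]) (use that in auto)
 \<comment> \<open>The deviation equals an integral of the derivative of the kernel times
   \<open>F b - F y\<close>, hence at most the cell length times the oscillation of \<open>F\<close>
   on the cell.\<close>
 have cell: "norm (?k a *\<^sub>R (F b - F a) - (\<Phi> b - \<Phi> a)) <= C * ?w (b - a) * (b - a)"
  if ab: "a : torus" "b : torus" "a <= b" for a b
 proof -
  have 1: "integral {0..b} (%y. ?k' y *\<^sub>R F y) - integral {0..a} (%y. ?k' y *\<^sub>R F y) = integral {a..b} (%y. ?k' y *\<^sub>R F y)"
   using Henstock_Kurzweil_Integration.integral_combine[of 0 a b "%y. ?k' y *\<^sub>R F y"] ab ik[of 0 b] by (simp add: algebra_simps)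
  have 2: "((%y. - ?k' y *\<^sub>R F b) has_integral (?k b - ?k a) *\<^sub>R F b) {a..b}"
   by (rule has_integral_scaleR_left, rule fundamental_theorem_of_calculus[OF ab(3)])
    (use heat_kernel_shift_deriv[OF \<tau>] in "simp add: has_real_derivative_iff_has_vector_derivative")
  have 3: "((%y. ?k' y *\<^sub>R F y) has_integral integral {a..b} (%y. ?k' y *\<^sub>R F y)) {a..b}"
   using ik[OF ab(1,2)] by (rule integrable_integral)
  have "((%y. - ?k' y *\<^sub>R (F b - F y)) has_integral (?k b - ?k a) *\<^sub>R F b + integral {a..b} (%y. ?k' y *\<^sub>R F y)) {a..b}"
   using has_integral_add[OF 2 3] by (simp add: scaleR_diff_right)
  then have "norm ((?k b - ?k a) *\<^sub>R F b + integral {a..b} (%y. ?k' y *\<^sub>R F y)) <= (C * ?w (b - a)) * measure lborel (cbox a b)"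
   unfolding box_real(2)[symmetric]
  proof (rule has_integral_bound[rotated])
   show "0 <= C * ?w (b - a)" using C AB ab by auto
   fix y assume y: "y : cbox a b"
   have "norm (F b - F y) <= ?w (abs (b - y))" using F[unfolded hmod_def, rule_format, of b y] y ab by simp
   also have "... <= ?w (b - a)" by (rule powr_add_le_mono) (use AB \<alpha> y in auto)
   finally have "abs (?k' y) * norm (F b - F y) <= C * ?w (b - a)" by (intro mult_mono C) (use C in auto)
   then show "norm (- ?k' y *\<^sub>R (F b - F y)) <= C * ?w (b - a)" by simp
  qed
  moreover have "(?k b - ?k a) *\<^sub>R F b + integral {a..b} (%y. ?k' y *\<^sub>R F y) = (\<Phi> b - \<Phi> a) - ?k a *\<^sub>R (F b - F a)"
   using 1 by (simp add: \<Phi>_def algebra_simps)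
  ultimately show ?thesis using ab by (simp add: norm_minus_commute)
 qed
 have "((%d. 2 * pi * (C * ?w d)) \<longlongrightarrow> 2 * pi * (C * (A * 0 + B * 0))) (at_right 0)"
  by (intro tendsto_intros tendsto_zero_powrI[OF tendsto_ident_at tendsto_const])
   (use \<alpha> in "auto simp: eventually_at_right_less eventually_at_filter")
 then have "\<forall>\<^sub>F d in at_right 0. 2 * pi * (C * ?w d) < \<epsilon>"
  using \<epsilon> by (intro order_tendstoD(2)[of _ 0]) auto
 then obtain d where d: "d > 0" "!!e. 0 < e ==> e < d ==> 2 * pi * (C * ?w e) < \<epsilon>"
  unfolding eventually_at_right_field by blast
 show ?thesis
 proof (intro exI[of _ "d / 2"] conjI allI impI)
  fix D assume D: "D division_of torus & (ALL K:D. Sup K - Inf K < d / 2)"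
  have "norm (\<Sum>K\<in>D. ?k (Inf K) *\<^sub>R (F (Sup K) - F (Inf K)) - (\<Phi> (Sup K) - \<Phi> (Inf K))) <= 2 * pi * (C * ?w (d / 2))"
  proof (rule division_torus_sum_bound)
   fix K assume K: "K : D"
   obtain a b where ab: "K = {a..b}" "a <= b" "Inf K = a" "Sup K = b" "a : torus" "b : torus"
    using D K by (metis division_torusE)
   have "?w (b - a) <= ?w (d / 2)" by (rule powr_add_le_mono) (use AB \<alpha> D K ab in "auto dest!: bspec[OF _ K]")
   then have "C * ?w (b - a) * (b - a) <= C * ?w (d / 2) * (b - a)"
    using C ab by (intro mult_right_mono mult_left_mono) auto
   then show "norm (?k (Inf K) *\<^sub>R (F (Sup K) - F (Inf K)) - (\<Phi> (Sup K) - \<Phi> (Inf K))) <= C * ?w (d / 2) * (Sup K - Inf K)"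
    using cell[OF ab(5,6,2)] ab by simp
  qed (use D in auto)
  also have "... < \<epsilon>" using d(2)[of "d / 2"] d(1) by simp
  also have "(\<Sum>K\<in>D. ?k (Inf K) *\<^sub>R (F (Sup K) - F (Inf K)) - (\<Phi> (Sup K) - \<Phi> (Inf K))) =
    (\<Sum>K\<in>D. ?k (Inf K) *\<^sub>R (F (Sup K) - F (Inf K))) - (\<Phi> (2 * pi) - \<Phi> 0)"
   using sum_division_endpoints[of D 0 "2 * pi" \<Phi>] D by (simp add: sum_subtractf)
  also have "\<Phi> (2 * pi) - \<Phi> 0 = heat_div \<tau> F x"
   by (simp add: \<Phi>_def heat_div_by_parts[OF F \<alpha> AB \<tau>])
  finally show "norm ((\<Sum>K\<in>D. ?k (Inf K) *\<^sub>R (F (Sup K) - F (Inf K))) - heat_div \<tau> F x) < \<epsilon>" .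
 qed (use d in auto)
qed

section \<open>The sewing lemma\<close>

definition sewable :: "real => real => (real => real => 'a::euclidean_space) => bool" where
 "sewable \<theta> K \<Xi> \<longleftrightarrow> (ALL x y z. 0 <= x & x <= y & y <= z & z <= 2 * pi -->
   norm (\<Xi> x z - \<Xi> x y - \<Xi> y z) <= K * (z - x) powr \<theta>)"

text \<open>This is 2 to the power \<theta> times the Riemann zeta function at \<theta>, the
  constant of Young's point removal argument.\<close>

definition young_const :: "real => real" where
 "young_const \<theta> = (\<Sum>k. (2 / real (Suc k)) powr \<theta>)"

lemma young_summable:
 assumes "\<theta> > 1"
 shows "summable (%k. (2 / real (Suc k)) powr \<theta>)"
proof -
 have "summable (%k. real k powr - \<theta>)" using assms by (subst summable_real_powr_iff) auto
 then have "summable (%k. 2 powr \<theta> * real (Suc k) powr - \<theta>)"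
  by (intro summable_mult) (subst summable_Suc_iff)
 moreover have "(2 / real (Suc k)) powr \<theta> = 2 powr \<theta> * real (Suc k) powr - \<theta>" for k
  by (simp only: powr_divide powr_minus_divide of_nat_0_le_iff) simp
 ultimately show ?thesis by (simp only:)
qed

lemma young_const_nonneg: "\<theta> > 1 ==> young_const \<theta> >= 0"
 unfolding young_const_def by (rule suminf_nonneg[OF young_summable]) auto

lemma sum_lessThan_add: "(\<Sum>j<m + p. f j) = (\<Sum>j<m. f j) + (\<Sum>j<p::nat. f (m + j) :: 'a::comm_monoid_add)"
 by (induction p) (simp_all add: add.assoc)

text \<open>Points are deleted one at a time, always one whose two neighbours are closest. The costs
  form the partial sums of a convergent series, so the bound depends on the length of the interval
  and not on the mesh.\<close>

lemma young_point_removal: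
 assumes \<Xi>: "sewable \<theta> K \<Xi>" and \<theta>: "\<theta> > 1" and K: "K >= 0"
 shows "(!!i j. i <= j ==> j <= Suc N ==> t i <= t j) ==> 0 <= t 0 ==> t (Suc N) <= 2 * pi ==>
  norm ((\<Sum>i<Suc N. \<Xi> (t i) (t (Suc i))) - \<Xi> (t 0) (t (Suc N)))
   <= K * (t (Suc N) - t 0) powr \<theta> * (\<Sum>k<N. (2 / real (Suc k)) powr \<theta>)"
proof (induction N arbitrary: t)
 case (Suc N)
 note mono = Suc.prems(1)
 define L where "L = t (Suc (Suc N)) - t 0"
 have L: "L >= 0" using mono[of 0 "Suc (Suc N)"] by (simp add: L_def)
 have tel: "(\<Sum>i<n. t (Suc (Suc i)) - t i) = t (Suc n) + t n - t 1 - t 0" for n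
  by (induction n) auto
 \<comment> \<open>Pigeonhole: the \<open>Suc N\<close> pairs of adjacent cells cover every cell at
   most twice, so their lengths add up to at most \<open>2 * L\<close>.\<close>
 have "EX m<Suc N. t (Suc (Suc m)) - t m <= 2 * L / real (Suc N)"
 proof (rule ccontr)
  assume "\<not> ?thesis"
  then have "(\<Sum>i<Suc N. 2 * L / real (Suc N)) < (\<Sum>i<Suc N. t (Suc (Suc i)) - t i)"
   by (intro sum_strict_mono) (auto simp: not_le)
  also have "... = t (Suc (Suc N)) + t (Suc N) - t 1 - t 0" by (rule tel)
  also have "... <= 2 * L" using mono[of "Suc N" "Suc (Suc N)"] mono[of 0 1] by (simp add: L_def)
  finally show False by simp
 qed
 then obtain m where m: "m < Suc N" "t (Suc (Suc m)) - t m <= 2 * L / real (Suc N)" by blast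
 \<comment> \<open>The partition without its point of index \<open>Suc m\<close>.\<close>
 define t' where "t' j = (if j < Suc m then t j else t (Suc j))" for j
 have IH: "norm ((\<Sum>i<Suc N. \<Xi> (t' i) (t' (Suc i))) - \<Xi> (t' 0) (t' (Suc N)))
   <= K * (t' (Suc N) - t' 0) powr \<theta> * (\<Sum>k<N. (2 / real (Suc k)) powr \<theta>)"
 proof (rule Suc.IH)
  show "t' i <= t' j" if "i <= j" "j <= Suc N" for i j
   using that m by (auto simp: t'_def intro!: mono)
  show "0 <= t' 0" "t' (Suc N) <= 2 * pi" using Suc.prems m by (auto simp: t'_def)
 qed
 have ends: "t' 0 = t 0" "t' (Suc N) = t (Suc (Suc N))" using m by (auto simp: t'_def)
 obtain p where p: "N = m + p" using m(1) less_Suc_eq_le le_Suc_ex by blast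
 have "(\<Sum>i<Suc (Suc N). \<Xi> (t i) (t (Suc i))) = (\<Sum>i<m + (Suc (Suc p)). \<Xi> (t i) (t (Suc i)))"
  by (simp only: p add_Suc_right)
 also have "... = (\<Sum>i<m. \<Xi> (t i) (t (Suc i))) + (\<Xi> (t m) (t (Suc m)) + (\<Xi> (t (Suc m)) (t (Suc (Suc m)))
   + (\<Sum>j<p. \<Xi> (t (Suc (Suc (m + j)))) (t (Suc (Suc (Suc (m + j))))))))"
  unfolding sum_lessThan_add by (simp add: sum.lessThan_Suc_shift del: sum.lessThan_Suc)
 finally have 1: "(\<Sum>i<Suc (Suc N). \<Xi> (t i) (t (Suc i))) = ..." .
 have "(\<Sum>i<Suc N. \<Xi> (t' i) (t' (Suc i))) = (\<Sum>i<m + Suc p. \<Xi> (t' i) (t' (Suc i)))"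
  by (simp only: p add_Suc_right)
 also have "... = (\<Sum>i<m. \<Xi> (t i) (t (Suc i))) + (\<Xi> (t m) (t (Suc (Suc m)))
   + (\<Sum>j<p. \<Xi> (t (Suc (Suc (m + j)))) (t (Suc (Suc (Suc (m + j)))))))"
  unfolding sum_lessThan_add by (simp add: sum.lessThan_Suc_shift t'_def del: sum.lessThan_Suc)
 finally have 2: "(\<Sum>i<Suc N. \<Xi> (t' i) (t' (Suc i))) = ..." .
 have "norm (\<Xi> (t m) (t (Suc (Suc m))) - \<Xi> (t m) (t (Suc m)) - \<Xi> (t (Suc m)) (t (Suc (Suc m))))
   <= K * (t (Suc (Suc m)) - t m) powr \<theta>"
 proof -
  have "0 <= t m" using mono[of 0 m] m Suc.prems(2) by simp
  moreover have "t (Suc (Suc m)) <= 2 * pi" using mono[of "Suc (Suc m)" "Suc (Suc N)"] m Suc.prems(3) by simp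
  moreover have "t m <= t (Suc m)" "t (Suc m) <= t (Suc (Suc m))" using mono m by auto
  ultimately show ?thesis using \<Xi> unfolding sewable_def by blast
 qed
 also have "... <= K * (2 * L / real (Suc N)) powr \<theta>"
  using m mono[of m "Suc (Suc m)"] by (intro mult_left_mono K powr_mono2) (use \<theta> in auto)
 also have "... = K * L powr \<theta> * (2 / real (Suc N)) powr \<theta>"
  using L by (simp add: powr_mult powr_divide)
 finally have 3: "norm (\<Xi> (t m) (t (Suc (Suc m))) - \<Xi> (t m) (t (Suc m)) - \<Xi> (t (Suc m)) (t (Suc (Suc m))))
   <= K * L powr \<theta> * (2 / real (Suc N)) powr \<theta>" .
 have "norm ((\<Sum>i<Suc (Suc N). \<Xi> (t i) (t (Suc i))) - \<Xi> (t 0) (t (Suc (Suc N)))) <=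
   norm ((\<Sum>i<Suc N. \<Xi> (t' i) (t' (Suc i))) - \<Xi> (t' 0) (t' (Suc N))) +
   norm (\<Xi> (t m) (t (Suc (Suc m))) - \<Xi> (t m) (t (Suc m)) - \<Xi> (t (Suc m)) (t (Suc (Suc m))))"
  unfolding 1 2 ends by (rule order_trans[OF eq_refl norm_triangle_ineq4], rule arg_cong[of _ _ norm]) (simp add: algebra_simps)
 also have "... <= K * L powr \<theta> * (\<Sum>k<N. (2 / real (Suc k)) powr \<theta>) + K * L powr \<theta> * (2 / real (Suc N)) powr \<theta>"
  using IH 3 unfolding ends L_def by (intro add_mono)
 finally show ?case by (simp add: L_def distrib_left)
next
 case 0
 then show ?case by simp
qed

lemma young_bound:
 assumes \<Xi>: "sewable \<theta> K \<Xi>" and \<theta>: "\<theta> > 1" and K: "K >= 0"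
  and t: "!!i j. i <= j ==> j <= N ==> t i <= t j" "0 <= t 0" "t N <= 2 * pi" and N: "N > 0"
 shows "norm ((\<Sum>i<N. \<Xi> (t i) (t (Suc i))) - \<Xi> (t 0) (t N)) <= K * young_const \<theta> * (t N - t 0) powr \<theta>"
proof -
 obtain M where M: "N = Suc M" using N gr0_conv_Suc by blast
 have "norm ((\<Sum>i<N. \<Xi> (t i) (t (Suc i))) - \<Xi> (t 0) (t N)) <=
   K * (t N - t 0) powr \<theta> * (\<Sum>k<M. (2 / real (Suc k)) powr \<theta>)"
  unfolding M by (rule young_point_removal[OF \<Xi> \<theta> K]) (use t M in auto)
 also have "... <= K * (t N - t 0) powr \<theta> * young_const \<theta>"
  unfolding young_const_def by (intro mult_left_mono sum_le_suminf young_summable \<theta>) (use K in auto)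
 finally show ?thesis by (simp add: mult_ac)
qed

section \<open>Dyadic sums and the sewn primitive\<close>

definition grid :: "nat => nat => real" where "grid n i = 2 * pi * real i / 2 ^ n"

text \<open>Grid points outside \<open>[a, b]\<close> move to the nearer endpoint. One dyadic grid
  thus serves all subintervals, always with \<open>2 ^ n\<close> cells, at the price of degenerate
  cells on which the germ vanishes.\<close>

definition clip :: "real => real => real => real" where "clip a b t = max a (min b t)"

definition sew_sum :: "(real => real => 'a::euclidean_space) => nat => real => real => 'a" where
 "sew_sum \<Xi> n a b = (\<Sum>i<2 ^ n. \<Xi> (clip a b (grid n i)) (clip a b (grid n (Suc i))))"

text \<open>A limit along one fixed sequence of partitions: linearity in the germ and measurability
  in a parameter are inherited from finite sums. Convergence along arbitrary fine divisions is
  recovered from \<open>sew_increment\<close>.\<close>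

definition sew :: "(real => real => 'a::euclidean_space) => real => real => 'a" where
 "sew \<Xi> a b = lim (%n. sew_sum \<Xi> n a b)"

lemma grid_mono: "i <= j ==> grid n i <= grid n j"
 by (simp add: grid_def divide_right_mono)

lemma grid_ends: "grid n 0 = 0" "grid n (2 ^ n) = 2 * pi"
 by (simp_all add: grid_def)

lemma grid_step: "grid n (Suc i) - grid n i = 2 * pi / 2 ^ n"
 by (simp add: grid_def diff_divide_distrib[symmetric] algebra_simps)

lemma clip_mono: "s <= t ==> clip a b s <= clip a b t"
 by (auto simp: clip_def)

lemma clip_diff: "s <= t ==> a <= b ==> clip a b t - clip a b s <= t - s"
 by (auto simp: clip_def max_def min_def)

lemma clip_bounds: "a <= b ==> a <= clip a b t" "a <= b ==> clip a b t <= b"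
 by (auto simp: clip_def)

text \<open>One unit of the exponent \<theta> is spent on summing the cell lengths; the remaining
  \<open>\<theta> - 1\<close> makes the total vanish with the mesh.\<close>

lemma grid_sum_bound:
 assumes ab: "0 <= a" "a <= b" "b <= 2 * pi" and \<theta>: "\<theta> > 1" and K: "K >= 0"
  and f: "!!i. norm (f i :: 'a::euclidean_space) <= K * (clip a b (grid n (Suc i)) - clip a b (grid n i)) powr \<theta>"
 shows "norm (\<Sum>i<2 ^ n. f i) <= K * (2 * pi / 2 ^ n) powr (\<theta> - 1) * (b - a)"
proof -
 let ?t = "%i. clip a b (grid n i)"
 have "norm (\<Sum>i<2 ^ n. f i) <= (\<Sum>i<2 ^ n. K * (2 * pi / 2 ^ n) powr (\<theta> - 1) * (?t (Suc i) - ?t i))"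
 proof (rule sum_norm_le)
  fix i
  let ?d = "?t (Suc i) - ?t i"
  have d: "0 <= ?d" "?d <= 2 * pi / 2 ^ n"
   using clip_mono[OF grid_mono[of i "Suc i" n], of a b]
    clip_diff[OF grid_mono[of i "Suc i" n] ab(2)] by (simp_all add: grid_step)
  have "?d powr \<theta> = ?d powr (\<theta> - 1) * ?d"
   using d powr_add[of ?d "\<theta> - 1" 1] by (cases "?d = 0") auto
  also have "... <= (2 * pi / 2 ^ n) powr (\<theta> - 1) * ?d"
   by (intro mult_right_mono powr_mono2) (use d \<theta> in auto)
  finally have "K * ?d powr \<theta> <= K * ((2 * pi / 2 ^ n) powr (\<theta> - 1) * ?d)" by (intro mult_left_mono K)
  then show "norm (f i) <= K * (2 * pi / 2 ^ n) powr (\<theta> - 1) * ?d" using f[of i] by simp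
 qed
 also have "... = K * (2 * pi / 2 ^ n) powr (\<theta> - 1) * (?t (2 ^ n) - ?t 0)"
  by (simp only: sum_distrib_left[symmetric] sum_lessThan_telescope[of ?t])
 also have "?t (2 ^ n) - ?t 0 = b - a" using ab by (simp add: grid_ends clip_def)
 finally show ?thesis .
qed

lemma mesh_powr: "(2 * pi / 2 ^ n) powr c = (2 * pi) powr c * ((1 / 2) powr c) ^ n"
proof -
 have "(2::real) ^ n = 2 powr real n" by (simp add: powr_realpow)
 then have "(2 ^ n) powr c = (2::real) powr (c * real n)" by (simp add: powr_powr mult.commute)
 also have "... = (2 powr c) ^ n" by (simp only: powr_powr[symmetric]) (simp add: powr_realpow)
 finally have "(2 ^ n) powr c = ((2::real) powr c) ^ n" .
 then show ?thesis by (simp add: powr_divide power_divide)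
qed

lemma half_powr_less_one: "c > 0 ==> (1 / 2 :: real) powr c < 1"
 using powr_less_mono2[of c "1 / 2" 1] by simp

lemma mesh_tendsto_0: "c > 0 ==> (%n. (2 * pi / 2 ^ n) powr c) \<longlonglongrightarrow> 0"
 unfolding mesh_powr by (intro tendsto_mult_right_zero LIMSEQ_power_zero) (auto simp: half_powr_less_one)

lemma sew_convergent:
 assumes \<Xi>: "sewable \<theta> K \<Xi>" and \<theta>: "\<theta> > 1" and K: "K >= 0" and ab: "0 <= a" "a <= b" "b <= 2 * pi"
 shows "(%n. sew_sum \<Xi> n a b) \<longlonglongrightarrow> sew \<Xi> a b"
proof -
 \<comment> \<open>Refinement inserts one midpoint per cell, so consecutive sums differ by sewing
   defects only. Halving the mesh makes the bounds geometric, hence summable.\<close>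
 have step: "norm (sew_sum \<Xi> (Suc n) a b - sew_sum \<Xi> n a b) <= K * (2 * pi / 2 ^ n) powr (\<theta> - 1) * (b - a)" for n
 proof -
  let ?t = "%i. clip a b (grid n i)" and ?m = "%i. clip a b (grid (Suc n) (Suc (2 * i)))"
  have g: "grid (Suc n) (2 * i) = grid n i" for i by (simp add: grid_def)
  have two: "(\<Sum>i<2 * N. f i) = (\<Sum>i<N. f (2 * i) + f (Suc (2 * i)))" for f :: "nat => 'a" and N
   by (induction N) (simp_all add: add.assoc)
  have "sew_sum \<Xi> (Suc n) a b = (\<Sum>i<2 ^ n. \<Xi> (?t i) (?m i) + \<Xi> (?m i) (?t (Suc i)))"
   unfolding sew_sum_def power_Suc two using g by (intro sum.cong refl) (simp flip: g)
  then have "sew_sum \<Xi> (Suc n) a b - sew_sum \<Xi> n a b = (\<Sum>i<2 ^ n. \<Xi> (?t i) (?m i) + \<Xi> (?m i) (?t (Suc i)) - \<Xi> (?t i) (?t (Suc i)))"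
   by (simp add: sew_sum_def sum_subtractf)
  also have "norm ... <= K * (2 * pi / 2 ^ n) powr (\<theta> - 1) * (b - a)"
  proof (rule grid_sum_bound[OF ab \<theta> K])
   fix i
   have "?t i <= ?m i" "?m i <= ?t (Suc i)"
    using grid_mono[of "2 * i" "Suc (2 * i)" "Suc n"] grid_mono[of "Suc (2 * i)" "2 * Suc i" "Suc n"]
    by (auto simp only: g intro!: clip_mono) auto
   moreover have "0 <= ?t i" "?t (Suc i) <= 2 * pi"
    using clip_bounds[OF ab(2), of "grid n i"] clip_bounds[OF ab(2), of "grid n (Suc i)"] ab by linarith+
   ultimately have "norm (\<Xi> (?t i) (?t (Suc i)) - \<Xi> (?t i) (?m i) - \<Xi> (?m i) (?t (Suc i))) <= K * (?t (Suc i) - ?t i) powr \<theta>"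
    using \<Xi> unfolding sewable_def by blast
   then show "norm (\<Xi> (?t i) (?m i) + \<Xi> (?m i) (?t (Suc i)) - \<Xi> (?t i) (?t (Suc i))) <= K * (?t (Suc i) - ?t i) powr \<theta>"
    by (subst norm_minus_commute) (simp add: diff_diff_eq)
  qed
  finally show ?thesis .
 qed
 have "summable (%n. sew_sum \<Xi> (Suc n) a b - sew_sum \<Xi> n a b)"
 proof (rule summable_comparison_test'[where N = 0])
  show "summable (%n. K * (2 * pi / 2 ^ n) powr (\<theta> - 1) * (b - a))"
   unfolding mesh_powr using \<theta>
   by (intro summable_mult summable_mult2 summable_geometric) (auto simp: half_powr_less_one)
 qed (rule step)
 then have "convergent (%n. \<Sum>k<n. sew_sum \<Xi> (Suc k) a b - sew_sum \<Xi> k a b)"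
  by (simp add: summable_iff_convergent)
 then have "convergent (%n. sew_sum \<Xi> n a b - sew_sum \<Xi> 0 a b)"
  by (simp only: sum_lessThan_telescope[of "%n. sew_sum \<Xi> n a b"])
 from convergent_add[OF this convergent_const[of "sew_sum \<Xi> 0 a b"]]
 have "convergent (%n. sew_sum \<Xi> n a b)" by simp
 then show ?thesis by (simp add: sew_def convergent_LIMSEQ_iff)
qed

text \<open>The intermediate point \<open>b\<close> is in general not on the grid. Cells on either
  side of it cancel exactly; the cell straddling it leaves a single defect, which disappears with
  the mesh.\<close>

lemma sew_add:
 assumes \<Xi>: "sewable \<theta> K \<Xi>" and \<theta>: "\<theta> > 1" and K: "K >= 0" and abc: "0 <= a" "a <= b" "b <= c" "c <= 2 * pi"
 shows "sew \<Xi> a b + sew \<Xi> b c = sew \<Xi> a c"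
proof -
 have bound: "norm (sew_sum \<Xi> n a c - sew_sum \<Xi> n a b - sew_sum \<Xi> n b c) <= K * (2 * pi / 2 ^ n) powr (\<theta> - 1) * (c - a)" for n
 proof -
  let ?t = "%i. clip a c (grid n i)"
  have cl: "clip a b x = min (clip a c x) b" "clip b c x = max (clip a c x) b" for x
   using abc by (auto simp: clip_def max_def min_def)
  have "sew_sum \<Xi> n a c - sew_sum \<Xi> n a b - sew_sum \<Xi> n b c =
    (\<Sum>i<2 ^ n. \<Xi> (?t i) (?t (Suc i)) - \<Xi> (min (?t i) b) (min (?t (Suc i)) b) - \<Xi> (max (?t i) b) (max (?t (Suc i)) b))"
   unfolding sew_sum_def cl by (simp add: sum_subtractf)
  also have "norm ... <= K * (2 * pi / 2 ^ n) powr (\<theta> - 1) * (c - a)"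
  proof (rule grid_sum_bound[OF _ _ _ \<theta> K])
   fix i
   define p q where "p = ?t i" and "q = ?t (Suc i)"
   have pq: "p <= q" "0 <= p" "q <= 2 * pi"
    using clip_mono[OF grid_mono[of i "Suc i" n], of a c] clip_bounds[of a c "grid n i"]
     clip_bounds[of a c "grid n (Suc i)"] abc by (auto simp: p_def q_def)
   have z: "\<Xi> x x = 0" if "0 <= x" "x <= 2 * pi" for x
    using \<Xi>[unfolded sewable_def, rule_format, of x x x] that by simp
   have "norm (\<Xi> p q - \<Xi> (min p b) (min q b) - \<Xi> (max p b) (max q b)) <= K * (q - p) powr \<theta>"
   proof -
    consider "b <= p" | "q <= b" | "p <= b" "b <= q" by linarith
    then show ?thesis
    proof cases
     case 1
     then have "min p b = b" "min q b = b" "max p b = p" "max q b = q" using pq by auto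
     then show ?thesis using z[of b] abc K by simp
    next
     case 2
     then have "min p b = p" "min q b = q" "max p b = b" "max q b = b" using pq by auto
     then show ?thesis using z[of b] abc K by simp
    next
     case 3
     then have "min p b = p" "min q b = b" "max p b = b" "max q b = q" by auto
     then show ?thesis using \<Xi>[unfolded sewable_def, rule_format, of p b q] 3 pq by simp
    qed
   qed
   then show "norm (\<Xi> (?t i) (?t (Suc i)) - \<Xi> (min (?t i) b) (min (?t (Suc i)) b) - \<Xi> (max (?t i) b) (max (?t (Suc i)) b))
     <= K * (?t (Suc i) - ?t i) powr \<theta>" by (simp add: p_def q_def)
  qed (use abc in auto)
  finally show ?thesis .
 qed
 have "(%n. K * (2 * pi / 2 ^ n) powr (\<theta> - 1) * (c - a)) \<longlonglongrightarrow> 0"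
  using \<theta> by (intro tendsto_mult_left_zero tendsto_mult_right_zero mesh_tendsto_0) auto
 then have "(%n. sew_sum \<Xi> n a c - sew_sum \<Xi> n a b - sew_sum \<Xi> n b c) \<longlonglongrightarrow> 0"
  by (rule Lim_null_comparison[rotated]) (use bound in auto)
 moreover have "(%n. sew_sum \<Xi> n a c - sew_sum \<Xi> n a b - sew_sum \<Xi> n b c) \<longlonglongrightarrow> sew \<Xi> a c - sew \<Xi> a b - sew \<Xi> b c"
  by (intro tendsto_diff sew_convergent[OF \<Xi> \<theta> K]) (use abc in auto)
 ultimately have "sew \<Xi> a c - sew \<Xi> a b - sew \<Xi> b c = 0" using LIMSEQ_unique by blast
 then show ?thesis by (simp add: algebra_simps)
qed

text \<open>Young's bound holds for every dyadic sum with the same constant and therefore passes to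
  the limit.\<close>

lemma sew_bound:
 assumes \<Xi>: "sewable \<theta> K \<Xi>" and \<theta>: "\<theta> > 1" and K: "K >= 0" and ab: "0 <= a" "a <= b" "b <= 2 * pi"
 shows "norm (sew \<Xi> a b - \<Xi> a b) <= K * young_const \<theta> * (b - a) powr \<theta>"
proof (rule LIMSEQ_le_const2)
 show "(%n. norm (sew_sum \<Xi> n a b - \<Xi> a b)) \<longlonglongrightarrow> norm (sew \<Xi> a b - \<Xi> a b)"
  by (intro tendsto_intros sew_convergent[OF \<Xi> \<theta> K ab])
 have "norm (sew_sum \<Xi> n a b - \<Xi> a b) <= K * young_const \<theta> * (b - a) powr \<theta>" for n
 proof -
  let ?t = "%i. clip a b (grid n i)"
  have e: "?t 0 = a" "?t (2 ^ n) = b" using ab by (auto simp: grid_ends clip_def)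
  have "norm (sew_sum \<Xi> n a b - \<Xi> (?t 0) (?t (2 ^ n))) <= K * young_const \<theta> * (?t (2 ^ n) - ?t 0) powr \<theta>"
   unfolding sew_sum_def
   by (rule young_bound[OF \<Xi> \<theta> K]) (auto simp: e ab clip_mono grid_mono simp del: clip_def)
  then show ?thesis by (simp only: e)
 qed
 then show "EX N. ALL n>=N. norm (sew_sum \<Xi> n a b - \<Xi> a b) <= K * young_const \<theta> * (b - a) powr \<theta>" by blast
qed

lemma sew_increment:
 assumes \<Xi>: "sewable \<theta> K \<Xi>" and \<theta>: "\<theta> > 1" and K: "K >= 0" and ab: "0 <= a" "a <= b" "b <= 2 * pi"
 shows "norm (sew \<Xi> 0 b - sew \<Xi> 0 a - \<Xi> a b) <= K * young_const \<theta> * (b - a) powr \<theta>"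
proof -
 have "sew \<Xi> 0 b - sew \<Xi> 0 a = sew \<Xi> a b"
  using sew_add[OF \<Xi> \<theta> K, of 0 a b] ab by (simp add: algebra_simps)
 then show ?thesis using sew_bound[OF assms] by simp
qed

lemma sew_diff:
 assumes \<Xi>: "sewable \<theta> K \<Xi>" "sewable \<theta> K' \<Xi>'" and \<theta>: "\<theta> > 1" and K: "K >= 0" "K' >= 0" and ab: "0 <= a" "a <= b" "b <= 2 * pi"
 shows "sew (%x y. \<Xi> x y - \<Xi>' x y) a b = sew \<Xi> a b - sew \<Xi>' a b"
proof -
 have "(%n. sew_sum \<Xi> n a b - sew_sum \<Xi>' n a b) \<longlonglongrightarrow> sew \<Xi> a b - sew \<Xi>' a b"
  by (intro tendsto_diff sew_convergent[OF \<Xi>(1) \<theta> K(1) ab] sew_convergent[OF \<Xi>(2) \<theta> K(2) ab])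
 then have "(%n. sew_sum (%x y. \<Xi> x y - \<Xi>' x y) n a b) \<longlonglongrightarrow> sew \<Xi> a b - sew \<Xi>' a b"
  by (simp add: sew_sum_def sum_subtractf)
 then show ?thesis unfolding sew_def by (rule limI)
qed

section \<open>Rough integrals of controlled paths\<close>

lemma powr_le_mult:
 assumes "0 <= d" "d <= e" "p >= (1::real)"
 shows "d powr p <= e powr (p - 1) * d"
proof -
 have "d powr p = d powr (p - 1) * d powr 1" by (simp only: powr_add[symmetric]) simp
 also have "... <= e powr (p - 1) * d powr 1"
  by (intro mult_right_mono powr_mono2) (use assms in auto)
 finally show ?thesis using assms by simp
qed

lemma norm_matrix_vector_le:
 fixes A :: "real^'n^'m"
 shows "norm (A *v x) <= norm A * norm x"
proof -
 have "norm (A *v x) = L2_set (%i. abs ((A $ i) \<bullet> x)) UNIV"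
  by (simp add: norm_vec_def matrix_vector_mul_component)
 also have "... <= L2_set (%i. norm (A $ i) * norm x) UNIV"
  by (intro L2_set_mono) (auto intro: Cauchy_Schwarz_ineq2)
 also have "... = norm A * norm x"
  by (simp add: norm_vec_def L2_set_left_distrib[symmetric])
 finally show ?thesis .
qed

lemma rough_summand_eq:
 "rough_summand X XX Y Y' x y = Y x *v (X y - X x) + (\<Sum>k\<in>UNIV. Y' x k *v (XX x y $ k))"
proof (rule vec_eq_iff[THEN iffD2], rule allI)
 fix i
 have "(\<Sum>j\<in>UNIV. \<Sum>k\<in>UNIV. Y' x k $ i $ j * XX x y $ k $ j) = (\<Sum>k\<in>UNIV. \<Sum>j\<in>UNIV. Y' x k $ i $ j * XX x y $ k $ j)"
  by (rule sum.swap)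
 then show "rough_summand X XX Y Y' x y $ i = (Y x *v (X y - X x) + (\<Sum>k\<in>UNIV. Y' x k *v (XX x y $ k))) $ i"
  by (simp add: rough_summand_def increment_def matrix_vector_mult_def)
qed

text \<open>A quantitative form of \<open>rough_path\<close> with one constant for both levels, so
  that it can be required uniformly in time. Chen's relation is stated row by row, the form in which
  it enters \<open>rough_summand_eq\<close>.\<close>

definition rough_bound :: "real => real => (real => real^'n) => (real => real => real^'n^'n) => bool" where
 "rough_bound \<alpha> a X XX \<longleftrightarrow>
   (ALL x:torus. ALL y:torus. norm (X y - X x) <= a * abs (y - x) powr \<alpha> &
    norm (XX x y) <= a * abs (y - x) powr (2 * \<alpha>)) &
   (ALL x:torus. ALL y:torus. ALL z:torus. ALL k.
    XX x z $ k - XX y z $ k - XX x y $ k = (X y - X x) $ k *\<^sub>R (X z - X y))"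

lemma rough_boundD:
 assumes "rough_bound \<alpha> a X XX" "x : torus" "y : torus"
 shows "norm (X y - X x) <= a * abs (y - x) powr \<alpha>" (is ?A1) "norm (XX x y) <= a * abs (y - x) powr (2 * \<alpha>)"
  "norm (XX x y $ k) <= a * abs (y - x) powr (2 * \<alpha>)" (is ?A2)
proof -
 show ?A1 and XX: "norm (XX x y) <= a * abs (y - x) powr (2 * \<alpha>)"
  using assms unfolding rough_bound_def by blast+
 show ?A2
  by (rule order_trans[OF Finite_Cartesian_Product.norm_nth_le XX])
qed

text \<open>Chen's relation produces \<open>Y'\<close> applied to a product of increments of
  \<open>X\<close>, which is precisely the first order part of the increment of \<open>Y\<close>.
  What survives is the controlled remainder times an increment of \<open>X\<close>, and an increment
  of \<open>Y'\<close> times the area.\<close>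

lemma rough_summand_defect:
 fixes X :: "real => real^'n"
 assumes chen: "!!k. XX x z $ k - XX y z $ k - XX x y $ k = (X y - X x) $ k *\<^sub>R (X z - X y)"
 shows "rough_summand X XX Y Y' x z - rough_summand X XX Y Y' x y - rough_summand X XX Y Y' y z =
  - ((Y y - Y x - (\<Sum>k\<in>UNIV. (X y - X x) $ k *\<^sub>R Y' x k)) *v (X z - X y))
  - (\<Sum>k\<in>UNIV. (Y' y k - Y' x k) *v (XX y z $ k))"
proof -
 have c: "XX x z $ k = XX x y $ k + XX y z $ k + (X y - X x) $ k *\<^sub>R (X z - X y)" for k
  using chen[of k] by (simp add: algebra_simps)
 have "(\<Sum>k\<in>UNIV. Y' x k *v (XX x z $ k)) =
   (\<Sum>k\<in>UNIV. Y' x k *v (XX x y $ k)) + (\<Sum>k\<in>UNIV. Y' x k *v (XX y z $ k)) +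
   (\<Sum>k\<in>UNIV. ((X y - X x) $ k *\<^sub>R Y' x k) *v (X z - X y))"
  unfolding c by (simp add: matrix_vector_right_distrib sum.distrib matrix_vector_mult_scaleR scaleR_matrix_vector_assoc)
 moreover have "(\<Sum>k\<in>UNIV. ((X y - X x) $ k *\<^sub>R Y' x k) *v (X z - X y)) = (\<Sum>k\<in>UNIV. (X y - X x) $ k *\<^sub>R Y' x k) *v (X z - X y)"
 proof -
  have "(\<Sum>k\<in>A. M k *v v) = (\<Sum>k\<in>A. M k) *v v" if "finite A" for A :: "'n set" and M :: "'n => real^'n^'n" and v
   using that by (induction A) (simp_all add: matrix_vector_mult_add_rdistrib)
  then show ?thesis by simp
 qed
 moreover have "Y x *v (X z - X x) = Y x *v (X y - X x) + Y x *v (X z - X y)"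
  by (simp flip: matrix_vector_right_distrib)
 ultimately show ?thesis
  by (simp add: rough_summand_eq matrix_vector_mult_diff_rdistrib sum_subtractf)
qed

text \<open>Each of the two surviving terms pairs a factor of order \<open>2 * \<alpha>\<close> with
  one of order \<alpha>; the second occurs once for every component of \<open>X\<close>.\<close>

lemma rough_summand_sewable:
 fixes X :: "real => real^'n"
 assumes X: "rough_bound \<alpha> a X XX" and a: "a >= 0" "r >= 0" "q >= 0" and \<alpha>: "\<alpha> > 0"
  and R: "!!x y. [|x : torus; y : torus; x <= y|] ==>
   norm (Y y - Y x - (\<Sum>k\<in>UNIV. (X y - X x) $ k *\<^sub>R Y' x k)) <= r * (y - x) powr (2 * \<alpha>)"
  and Y': "!!x y k. [|x : torus; y : torus; x <= y|] ==> norm (Y' y k - Y' x k) <= q * (y - x) powr \<alpha>"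
 shows "sewable (3 * \<alpha>) ((r + real CARD('n) * q) * a) (rough_summand X XX Y Y')"
 unfolding sewable_def
proof (intro allI impI)
 fix x y z :: real assume xyz: "0 <= x & x <= y & y <= z & z <= 2 * pi"
 then have t: "x : torus" "y : torus" "z : torus" by auto
 have chen: "XX x z $ k - XX y z $ k - XX x y $ k = (X y - X x) $ k *\<^sub>R (X z - X y)" for k
  using X t unfolding rough_bound_def by blast
 have d: "(y - x) powr p <= (z - x) powr p" "abs (z - y) powr p <= (z - x) powr p" if "p >= 0" for p
  using xyz that by (auto intro!: powr_mono2)
 have pw: "(z - x) powr (2 * \<alpha>) * (z - x) powr \<alpha> = (z - x) powr (3 * \<alpha>)" by (simp flip: powr_add)
 have "norm ((Y y - Y x - (\<Sum>k\<in>UNIV. (X y - X x) $ k *\<^sub>R Y' x k)) *v (X z - X y)) <=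
   norm (Y y - Y x - (\<Sum>k\<in>UNIV. (X y - X x) $ k *\<^sub>R Y' x k)) * norm (X z - X y)"
  by (rule norm_matrix_vector_le)
 also have "... <= (r * (z - x) powr (2 * \<alpha>)) * (a * (z - x) powr \<alpha>)"
 proof (rule mult_mono)
  show "norm (Y y - Y x - (\<Sum>k\<in>UNIV. (X y - X x) $ k *\<^sub>R Y' x k)) <= r * (z - x) powr (2 * \<alpha>)"
   by (rule order_trans[OF R]) (use t xyz d[of "2 * \<alpha>"] \<alpha> a in "auto intro!: mult_left_mono")
  show "norm (X z - X y) <= a * (z - x) powr \<alpha>"
   by (rule order_trans[OF rough_boundD(1)[OF X t(2,3)]]) (use d[of \<alpha>] \<alpha> a in "auto intro!: mult_left_mono")
 qed (use a in auto)
 finally have 1: "norm ((Y y - Y x - (\<Sum>k\<in>UNIV. (X y - X x) $ k *\<^sub>R Y' x k)) *v (X z - X y)) <= r * a * (z - x) powr (3 * \<alpha>)"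
  unfolding pw[symmetric] by (simp only: mult_ac)
 have "norm (\<Sum>k\<in>UNIV. (Y' y k - Y' x k) *v (XX y z $ k)) <= (\<Sum>k\<in>(UNIV::'n set). q * a * (z - x) powr (3 * \<alpha>))"
 proof (rule sum_norm_le)
  fix k :: 'n
  have "norm ((Y' y k - Y' x k) *v (XX y z $ k)) <= norm (Y' y k - Y' x k) * norm (XX y z $ k)"
   by (rule norm_matrix_vector_le)
  also have "... <= (q * (z - x) powr \<alpha>) * (a * (z - x) powr (2 * \<alpha>))"
  proof (rule mult_mono)
   show "norm (Y' y k - Y' x k) <= q * (z - x) powr \<alpha>"
    by (rule order_trans[OF Y']) (use t xyz d[of \<alpha>] \<alpha> a in "auto intro!: mult_left_mono")
   show "norm (XX y z $ k) <= a * (z - x) powr (2 * \<alpha>)"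
    by (rule order_trans[OF rough_boundD(3)[OF X t(2,3)]]) (use d[of "2 * \<alpha>"] \<alpha> a in "auto intro!: mult_left_mono")
  qed (use a in auto)
  finally show "norm ((Y' y k - Y' x k) *v (XX y z $ k)) <= q * a * (z - x) powr (3 * \<alpha>)"
   unfolding pw[symmetric] by (simp only: mult_ac)
 qed
 then have 2: "norm (\<Sum>k\<in>UNIV. (Y' y k - Y' x k) *v (XX y z $ k)) <= real CARD('n) * q * a * (z - x) powr (3 * \<alpha>)"
  by simp
 have "norm (rough_summand X XX Y Y' x z - rough_summand X XX Y Y' x y - rough_summand X XX Y Y' y z) <=
   norm ((Y y - Y x - (\<Sum>k\<in>UNIV. (X y - X x) $ k *\<^sub>R Y' x k)) *v (X z - X y)) +
   norm (\<Sum>k\<in>UNIV. (Y' y k - Y' x k) *v (XX y z $ k))"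
  unfolding rough_summand_defect[OF chen] by (rule order_trans[OF norm_triangle_ineq4]) simp
 with 1 2 show "norm (rough_summand X XX Y Y' x z - rough_summand X XX Y Y' x y - rough_summand X XX Y Y' y z)
   <= (r + real CARD('n) * q) * a * (z - x) powr (3 * \<alpha>)" by (simp add: algebra_simps)
qed

lemma rough_summand_bound:
 fixes X :: "real => real^'n"
 assumes X: "rough_bound \<alpha> a X XX" and a: "a >= 0" "c >= 0" and \<alpha>: "\<alpha> > 0"
  and Y: "norm (Y x) <= c" "!!k. norm (Y' x k) <= c" and xy: "x : torus" "y : torus" "x <= y"
 shows "norm (rough_summand X XX Y Y' x y) <= (1 + real CARD('n) * (2 * pi) powr \<alpha>) * c * a * (y - x) powr \<alpha>"
proof -
 have "norm (Y x *v (X y - X x)) <= c * (a * (y - x) powr \<alpha>)"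
  by (rule order_trans[OF norm_matrix_vector_le], intro mult_mono Y)
   (use rough_boundD(1)[OF X xy(1,2)] xy a in auto)
 moreover have "norm (\<Sum>k\<in>UNIV. Y' x k *v (XX x y $ k)) <= (\<Sum>k\<in>(UNIV::'n set). c * (a * ((2 * pi) powr \<alpha> * (y - x) powr \<alpha>)))"
 proof (rule sum_norm_le)
  fix k :: 'n
  have "(y - x) powr (2 * \<alpha>) = (y - x) powr \<alpha> * (y - x) powr \<alpha>" by (simp flip: powr_add)
  also have "... <= (2 * pi) powr \<alpha> * (y - x) powr \<alpha>"
   by (intro mult_right_mono powr_mono2) (use xy \<alpha> in auto)
  finally have "a * (y - x) powr (2 * \<alpha>) <= a * ((2 * pi) powr \<alpha> * (y - x) powr \<alpha>)" by (intro mult_left_mono a)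
  then show "norm (Y' x k *v (XX x y $ k)) <= c * (a * ((2 * pi) powr \<alpha> * (y - x) powr \<alpha>))"
   by (intro order_trans[OF norm_matrix_vector_le] mult_mono Y)
    (use rough_boundD(3)[OF X xy(1,2), of k] xy a in auto)
 qed
 ultimately show ?thesis
  unfolding rough_summand_eq by (intro order_trans[OF norm_triangle_ineq]) (simp add: algebra_simps)
qed

text \<open>The bound on \<open>\<Xi>\<close> gives the Hoelder part, the sewing error \<open>|y - x| powr (3\<alpha>)\<close> is absorbed in
 the Lipschitz part; this is where \<open>\<alpha> > 1/3\<close> enters.\<close>

definition rough_const :: "real => real" where
 "rough_const \<alpha> = young_const (3 * \<alpha>) * (2 * pi) powr (3 * \<alpha> - 1)"

lemma rough_const_nonneg: "\<alpha> > 1 / 3 ==> rough_const \<alpha> >= 0"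
 unfolding rough_const_def by (intro mult_nonneg_nonneg young_const_nonneg) auto

lemma sew_hmod:
 assumes \<Xi>: "sewable (3 * \<alpha>) K \<Xi>" and K: "K >= 0" and \<alpha>: "\<alpha> > 1 / 3"
  and b: "!!x y. [|x : torus; y : torus; x <= y|] ==> norm (\<Xi> x y) <= c * (y - x) powr \<alpha>"
 shows "hmod \<alpha> c (rough_const \<alpha> * K) (sew \<Xi> 0)"
proof (rule hmodI)
 fix x y :: real assume xy: "x : torus" "y : torus" "x <= y"
 have y: "young_const (3 * \<alpha>) >= 0" using \<alpha> by (intro young_const_nonneg) auto
 have "norm (sew \<Xi> 0 y - sew \<Xi> 0 x - \<Xi> x y) <= K * young_const (3 * \<alpha>) * (y - x) powr (3 * \<alpha>)"
  by (rule sew_increment[OF \<Xi> _ K]) (use xy \<alpha> in auto)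
 also have "(y - x) powr (3 * \<alpha>) <= (2 * pi) powr (3 * \<alpha> - 1) * (y - x)"
  by (rule powr_le_mult) (use xy \<alpha> in auto)
 then have "K * young_const (3 * \<alpha>) * (y - x) powr (3 * \<alpha>) <= K * young_const (3 * \<alpha>) * ((2 * pi) powr (3 * \<alpha> - 1) * (y - x))"
  using K y by (intro mult_left_mono) auto
 finally have "norm (sew \<Xi> 0 y - sew \<Xi> 0 x - \<Xi> x y) <= rough_const \<alpha> * K * (y - x)"
  by (simp add: rough_const_def mult_ac)
 then show "norm (sew \<Xi> 0 y - sew \<Xi> 0 x) <= c * (y - x) powr \<alpha> + rough_const \<alpha> * K * (y - x)"
  using b[OF xy] norm_triangle_ineq[of "sew \<Xi> 0 y - sew \<Xi> 0 x - \<Xi> x y" "\<Xi> x y"] by simp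
qed

text \<open>Multiplying the integrand by the heat kernel turns the rough integral into the Stieltjes
 convolution of the kernel with the indefinite rough integral.\<close>

lemma rough_summand_scaleR:
 "rough_summand X XX (%y. p y *\<^sub>R Y y) (%y k. p y *\<^sub>R Y' y k) x y = p x *\<^sub>R rough_summand X XX Y Y' x y"
 by (simp add: rough_summand_eq scaleR_matrix_vector_assoc[symmetric] scaleR_add_right scaleR_sum_right)

lemma rough_integral_heat_kernel:
 assumes \<Xi>: "sewable (3 * \<alpha>) K (rough_summand X XX Y Y')" and K: "K >= 0" and \<alpha>: "\<alpha> > 1 / 3" "\<alpha> <= 1"
  and F: "hmod \<alpha> A B (sew (rough_summand X XX Y Y') 0)" "A >= 0" "B >= 0" and t: "t > 0"
  and \<alpha>': "\<alpha>' : {1/3<..<1/2}" "rough_path \<alpha>' X XX"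
   "controlled \<alpha>' X (%y. heat_kernel t (x - y) *\<^sub>R Y y) (%y k. heat_kernel t (x - y) *\<^sub>R Y' y k)"
 shows "has_rough_integral X XX (%y. heat_kernel t (x - y) *\<^sub>R Y y) (%y k. heat_kernel t (x - y) *\<^sub>R Y' y k)
  (heat_div t (sew (rough_summand X XX Y Y') 0) x)"
 unfolding has_rough_integral_def
proof (intro conjI bexI[of _ \<alpha>'] allI impI)
 let ?\<Xi> = "rough_summand X XX Y Y'"
 let ?F = "sew ?\<Xi> 0"
 fix \<epsilon> :: real assume \<epsilon>: "\<epsilon> > 0"
 obtain C where C: "C > 0" "!!x. abs (heat_kernel t x) <= C" using heat_kernel_bounds[OF t] by metis
 have y: "young_const (3 * \<alpha>) >= 0" using \<alpha> by (intro young_const_nonneg) auto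
 let ?c = "C * (K * young_const (3 * \<alpha>))"
 obtain \<delta>1 where \<delta>1: "\<delta>1 > 0" "!!D. D division_of torus ==> (ALL K:D. Sup K - Inf K < \<delta>1) ==>
  norm ((\<Sum>K\<in>D. heat_kernel t (x - Inf K) *\<^sub>R (?F (Sup K) - ?F (Inf K))) - heat_div t ?F x) < \<epsilon> / 2"
  using heat_div_riemann_stieltjes[OF F(1) _ \<alpha>(2) F(2,3) t, of "\<epsilon> / 2" x] \<alpha> \<epsilon> by auto
 have "((%d::real. 2 * pi * (?c * d powr (3 * \<alpha> - 1))) \<longlongrightarrow> 2 * pi * (?c * 0)) (at_right 0)"
  by (intro tendsto_intros tendsto_zero_powrI[OF tendsto_ident_at tendsto_const])
   (use \<alpha> in "auto simp: eventually_at_filter")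
 then have "\<forall>\<^sub>F d in at_right 0. 2 * pi * (?c * d powr (3 * \<alpha> - 1)) < \<epsilon> / 2"
  using \<epsilon> by (intro order_tendstoD(2)[of _ 0]) auto
 then obtain d where d: "d > 0" "!!e. 0 < e ==> e < d ==> 2 * pi * (?c * e powr (3 * \<alpha> - 1)) < \<epsilon> / 2"
  unfolding eventually_at_right_field by blast
 define \<delta> where "\<delta> = min \<delta>1 (d / 2)"
 have \<delta>: "\<delta> > 0" "\<delta> <= \<delta>1" "\<delta> < d" using d \<delta>1 by (auto simp: \<delta>_def)
 show "EX \<delta>>0. ALL D. D division_of torus & (ALL K:D. Sup K - Inf K < \<delta>) -->
   norm ((\<Sum>K\<in>D. rough_summand X XX (%y. heat_kernel t (x - y) *\<^sub>R Y y) (%y k. heat_kernel t (x - y) *\<^sub>R Y' y k) (Inf K) (Sup K)) - heat_div t ?F x) < \<epsilon>"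
 proof (intro exI[of _ \<delta>] conjI \<delta> allI impI)
  fix D assume D: "D division_of torus & (ALL K:D. Sup K - Inf K < \<delta>)"
  let ?k = "%K. heat_kernel t (x - Inf K)"
  \<comment> \<open>On each cell the germ and the increment of \<open>?F\<close> differ by the
    sewing error; summed over the division this is of order
    \<open>\<delta> powr (3 * \<alpha> - 1)\<close>. The sum with increments of \<open>?F\<close> is
    then a Riemann-Stieltjes sum.\<close>
  have "norm (\<Sum>K\<in>D. ?k K *\<^sub>R ?\<Xi> (Inf K) (Sup K) - ?k K *\<^sub>R (?F (Sup K) - ?F (Inf K))) <= 2 * pi * (?c * \<delta> powr (3 * \<alpha> - 1))"
  proof (rule division_torus_sum_bound)
   fix K' assume K': "K' : D"
   obtain a b where ab: "K' = {a..b}" "a <= b" "Inf K' = a" "Sup K' = b" "a : torus" "b : torus"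
    using D K' by (metis division_torusE)
   have "norm (?F b - ?F a - ?\<Xi> a b) <= K * young_const (3 * \<alpha>) * (b - a) powr (3 * \<alpha>)"
    by (rule sew_increment[OF \<Xi> _ K]) (use ab \<alpha> in auto)
   also have "(b - a) powr (3 * \<alpha>) <= \<delta> powr (3 * \<alpha> - 1) * (b - a)"
    by (rule powr_le_mult) (use ab \<alpha> D K' in "auto dest!: bspec[OF _ K']")
   then have "K * young_const (3 * \<alpha>) * (b - a) powr (3 * \<alpha>) <= K * young_const (3 * \<alpha>) * (\<delta> powr (3 * \<alpha> - 1) * (b - a))"
    using K y by (intro mult_left_mono) auto
   finally have "abs (?k K') * norm (?\<Xi> a b - (?F b - ?F a)) <= C * (K * young_const (3 * \<alpha>) * (\<delta> powr (3 * \<alpha> - 1) * (b - a)))"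
    by (intro mult_mono C) (use C in "auto simp: norm_minus_commute")
   then show "norm (?k K' *\<^sub>R ?\<Xi> (Inf K') (Sup K') - ?k K' *\<^sub>R (?F (Sup K') - ?F (Inf K'))) <= ?c * \<delta> powr (3 * \<alpha> - 1) * (Sup K' - Inf K')"
    using ab by (simp add: mult_ac flip: scaleR_diff_right)
  qed (use D in auto)
  also have "... < \<epsilon> / 2" by (rule d(2)) (use \<delta> in auto)
  finally have 1: "norm (\<Sum>K\<in>D. ?k K *\<^sub>R ?\<Xi> (Inf K) (Sup K) - ?k K *\<^sub>R (?F (Sup K) - ?F (Inf K))) < \<epsilon> / 2" .
  have 2: "norm ((\<Sum>K\<in>D. ?k K *\<^sub>R (?F (Sup K) - ?F (Inf K))) - heat_div t ?F x) < \<epsilon> / 2"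
   by (rule \<delta>1(2)) (use D \<delta> in auto)
  show "norm ((\<Sum>K\<in>D. rough_summand X XX (%y. heat_kernel t (x - y) *\<^sub>R Y y) (%y k. heat_kernel t (x - y) *\<^sub>R Y' y k) (Inf K) (Sup K)) - heat_div t ?F x) < \<epsilon>"
   unfolding rough_summand_scaleR[of X XX "%y. heat_kernel t (x - y)"]
   using norm_triangle_lt[of "\<Sum>K\<in>D. ?k K *\<^sub>R ?\<Xi> (Inf K) (Sup K) - ?k K *\<^sub>R (?F (Sup K) - ?F (Inf K))"
     "(\<Sum>K\<in>D. ?k K *\<^sub>R (?F (Sup K) - ?F (Inf K))) - heat_div t ?F x" \<epsilon>] 1 2
   by (simp add: sum_subtractf)
 qed
qed (use \<alpha>' in auto)

text \<open>Uniqueness of the limit needs a division of arbitrarily small mesh to exist. It is taken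
  from a tagged division subordinate to a constant gauge: a cell inside a ball of radius
  \<open>\<delta> / 2\<close> is shorter than \<delta>.\<close>

lemma has_rough_integral_unique:
 assumes "has_rough_integral X XX Y Y' I" "has_rough_integral X XX Y Y' J"
 shows "I = J"
proof (rule ccontr)
 assume "I ~= J"
 then have \<epsilon>: "norm (I - J) / 2 > 0" by simp
 let ?S = "%D. \<Sum>K\<in>D. rough_summand X XX Y Y' (Inf K) (Sup K)"
 obtain \<delta>1 where \<delta>1: "\<delta>1 > 0"
  "!!D. D division_of torus ==> (ALL K:D. Sup K - Inf K < \<delta>1) ==> norm (?S D - I) < norm (I - J) / 2"
  using assms(1) \<epsilon> unfolding has_rough_integral_def by (auto dest!: spec[of _ "norm (I - J) / 2"])
 obtain \<delta>2 where \<delta>2: "\<delta>2 > 0"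
  "!!D. D division_of torus ==> (ALL K:D. Sup K - Inf K < \<delta>2) ==> norm (?S D - J) < norm (I - J) / 2"
  using assms(2) \<epsilon> unfolding has_rough_integral_def by (auto dest!: spec[of _ "norm (I - J) / 2"])
 define \<delta> where "\<delta> = min \<delta>1 \<delta>2"
 have "gauge (%x. ball x (\<delta> / 2))" using \<delta>1 \<delta>2 by (auto simp: gauge_def \<delta>_def)
 then obtain p where p: "p tagged_division_of cbox 0 (2 * pi)" "(%x. ball x (\<delta> / 2)) fine p"
  using fine_division_exists by blast
 let ?D = "snd ` p"
 have D: "?D division_of torus" using division_of_tagged_division[OF p(1)] by simp
 have small: "Sup K - Inf K < \<delta>" if K: "K : ?D" for K
 proof -
  obtain x where x: "(x, K) : p" using K by auto
  obtain a b where ab: "K = {a..b}" "a <= b" "Inf K = a" "Sup K = b" using division_torusE[OF D K] by metis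
  have "K \<subseteq> ball x (\<delta> / 2)" using p(2) x by (auto simp: fine_def)
  then have "dist x a < \<delta> / 2" "dist x b < \<delta> / 2" using ab by (auto simp: subset_iff)
  then have "b - a < \<delta>" unfolding dist_real_def by linarith
  then show ?thesis using ab by simp
 qed
 have "norm (?S ?D - I) < norm (I - J) / 2" "norm (?S ?D - J) < norm (I - J) / 2"
  by (rule \<delta>1(2)[OF D] \<delta>2(2)[OF D], use small in "simp add: \<delta>_def")+
 then show False using norm_triangle_ineq4[of "?S ?D - J" "?S ?D - I"] by simp
qed

section \<open>Difference estimates for smooth nonlinearities\<close>

definition pdiff :: "(real^'n => 'b::real_normed_vector) => 'n => real^'n => 'b" where
 "pdiff h k a = frechet_derivative h (at a) (axis k 1)"

abbreviation "pdir h a d \<equiv> \<Sum>k\<in>UNIV. d $ k *\<^sub>R pdiff h k a"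

lemma partials_pdiff: "partials (axis k 1 # bs) h = pdiff (partials bs h) k"
 by (rule ext) (simp add: pdiff_def)

lemma frechet_derivative_pdiff:
 fixes h :: "real^'n => 'b::real_normed_vector"
 assumes "h differentiable (at a)"
 shows "frechet_derivative h (at a) d = (pdir h a d)"
proof -
 interpret linear "frechet_derivative h (at a)" using assms by (rule linear_frechet_derivative)
 have "frechet_derivative h (at a) d = frechet_derivative h (at a) (\<Sum>k\<in>UNIV. d $ k *\<^sub>R axis k 1)"
  using basis_expansion[of d] by (simp add: scalar_mult_eq_scaleR)
 also have "... = (pdir h a d)"
  by (simp add: sum scale pdiff_def)
 finally show ?thesis .
qed

lemma norm_sum_component_le:
 fixes d :: "real^'n"
 assumes "!!k. norm (P k) <= c"
 shows "norm (\<Sum>k\<in>UNIV. d $ k *\<^sub>R P k) <= real CARD('n) * c * norm d"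
proof -
 have c: "0 <= c" by (rule order_trans[OF norm_ge_zero assms])
 have "norm (\<Sum>k\<in>UNIV. d $ k *\<^sub>R P k) <= (\<Sum>k\<in>(UNIV::'n set). c * norm d)"
 proof (rule sum_norm_le)
  fix k
  have "abs (d $ k) * norm (P k) <= norm d * c" by (intro mult_mono component_le_norm_cart assms) auto
  then show "norm (d $ k *\<^sub>R P k) <= c * norm d" by (simp add: mult.commute)
 qed
 then show ?thesis by (simp add: mult.assoc)
qed

lemma pdiff_lipschitz:
 fixes h :: "real^'n => 'b::real_normed_vector"
 assumes h: "!!a. h differentiable (at a)" and K: "convex K" "a : K" "b : K"
  and bnd: "!!x k. x : K ==> norm (pdiff h k x) <= c"
 shows "norm (h a - h b) <= real CARD('n) * c * norm (a - b)"
proof (rule differentiable_bound[OF K(1) _ _ K(2,3)])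
 fix x assume x: "x : K"
 show "(h has_derivative frechet_derivative h (at x)) (at x within K)"
  by (rule has_derivative_at_withinI) (use h in "simp add: frechet_derivative_works")
 have c: "0 <= c" by (rule order_trans[OF norm_ge_zero bnd[OF x]])
 show "onorm (frechet_derivative h (at x)) <= real CARD('n) * c"
  by (rule onorm_bound) (use c norm_sum_component_le[OF bnd[OF x]] in "auto simp: frechet_derivative_pdiff[OF h]")
qed

lemma pdiff_shift_diff:
 fixes h :: "real^'n => 'b::real_normed_vector"
 assumes h: "!!a. h differentiable (at a)"
 shows "(%x. h (x + e) - h x) differentiable (at a)" (is ?A1)
  "pdiff (%x. h (x + e) - h x) k a = pdiff h k (a + e) - pdiff h k a" (is ?A2)
proof -
 have d: "(h has_derivative frechet_derivative h (at y)) (at y)" for y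
  using h by (simp add: frechet_derivative_works)
 have "((%x. x + e) has_derivative (%v. v)) (at a)" by (auto intro!: derivative_eq_intros)
 from has_derivative_compose[OF this d]
 have "((%x. h (x + e) - h x) has_derivative (%v. frechet_derivative h (at (a + e)) v - frechet_derivative h (at a) v)) (at a)"
  by (intro has_derivative_diff d)
 then show ?A1
  ?A2
  by (auto simp: pdiff_def differentiable_def frechet_derivative_at[symmetric])
qed

text \<open>The mean value inequality is applied to \<open>x \<mapsto> h (x + e) - h x\<close>,
  whose partial derivatives are again increments. Its domain, the points that stay in
  \<open>K\<close> after the shift, is convex as well.\<close>

lemma second_difference:
 fixes h :: "real^'n => 'b::real_normed_vector"
 assumes h: "!!a. h differentiable (at a)" "!!k a. pdiff h k differentiable (at a)" and K: "convex K"
  and bnd: "!!x k l. x : K ==> norm (pdiff (pdiff h k) l x) <= c"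
  and pts: "a : K" "a' : K" "a + e : K" "a' + e : K"
 shows "norm (h (a + e) - h a - (h (a' + e) - h a')) <= (real CARD('n))\<^sup>2 * c * norm (a - a') * norm e"
proof -
 let ?K = "{x. x : K & x + e : K}"
 have cK: "convex ?K"
  unfolding convex_def
 proof (clarify, intro conjI)
  fix x y and u v :: real assume *: "x : K" "x + e : K" "y : K" "y + e : K" "0 <= u" "0 <= v" "u + v = 1"
  then show "u *\<^sub>R x + v *\<^sub>R y : K" using convexD[OF K] by blast
  have "u *\<^sub>R (x + e) + v *\<^sub>R (y + e) : K" using * convexD[OF K] by blast
  moreover have "u *\<^sub>R (x + e) + v *\<^sub>R (y + e) = u *\<^sub>R x + v *\<^sub>R y + (u + v) *\<^sub>R e" by (simp add: algebra_simps)
  ultimately show "u *\<^sub>R x + v *\<^sub>R y + e : K" using * by simp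
 qed
 have "norm ((%x. h (x + e) - h x) a - (%x. h (x + e) - h x) a') <=
   real CARD('n) * (real CARD('n) * c * norm e) * norm (a - a')"
 proof (rule pdiff_lipschitz[OF pdiff_shift_diff(1)[OF h(1)] cK])
  fix x k assume x: "x : ?K"
  have "norm (pdiff h k (x + e) - pdiff h k x) <= real CARD('n) * c * norm (x + e - x)"
   by (rule pdiff_lipschitz[OF h(2) K]) (use x bnd in auto)
  then show "norm (pdiff (%x. h (x + e) - h x) k x) <= real CARD('n) * c * norm e"
   by (simp add: pdiff_shift_diff[OF h(1)])
 qed (use pts in auto)
 then show ?thesis by (simp add: power2_eq_square mult_ac)
qed

text \<open>Along the segment in direction \<open>d\<close> the derivative of the difference of the
  two Taylor remainders is a combination of second differences of the partial derivatives. These are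
  linear in \<open>a - a'\<close> and in \<open>d\<close>, and the direction contributes the second
  factor \<open>norm d\<close>.\<close>

lemma taylor_difference:
 fixes h :: "real^'n => 'b::real_normed_vector"
 assumes h: "!!a. h differentiable (at a)" "!!k a. pdiff h k differentiable (at a)"
   "!!k l a. pdiff (pdiff h k) l differentiable (at a)" and K: "convex K"
  and bnd: "!!x k l m. x : K ==> norm (pdiff (pdiff (pdiff h k) l) m x) <= c"
  and pts: "a : K" "a' : K" "a + d : K" "a' + d : K"
 shows "norm ((h (a + d) - h a - (pdir h a d)) - (h (a' + d) - h a' - (pdir h a' d)))
   <= real CARD('n) ^ 3 * c * norm (a - a') * (norm d)\<^sup>2"
proof -
 let ?f = "%\<theta>::real. h (a + \<theta> *\<^sub>R d) - h (a' + \<theta> *\<^sub>R d) - \<theta> *\<^sub>R (\<Sum>k\<in>UNIV. d $ k *\<^sub>R (pdiff h k a - pdiff h k a'))"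
 let ?f' = "%\<theta>::real. (\<Sum>k\<in>UNIV. d $ k *\<^sub>R ((pdiff h k (a + \<theta> *\<^sub>R d) - pdiff h k a) - (pdiff h k (a' + \<theta> *\<^sub>R d) - pdiff h k a')))"
 have hd: "(h has_derivative frechet_derivative h (at y)) (at y)" for y
  using h by (simp add: frechet_derivative_works)
 have line: "((%\<theta>. h (p + \<theta> *\<^sub>R d)) has_vector_derivative (pdir h (p + \<theta> *\<^sub>R d) d)) (at \<theta>)" for p \<theta>
 proof -
  have "((%\<theta>. p + \<theta> *\<^sub>R d) has_derivative (%v. v *\<^sub>R d)) (at \<theta>)" by (auto intro!: derivative_eq_intros)
  from has_derivative_compose[OF this hd]
  have "((%\<theta>. h (p + \<theta> *\<^sub>R d)) has_derivative (%v. frechet_derivative h (at (p + \<theta> *\<^sub>R d)) (v *\<^sub>R d))) (at \<theta>)" .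
  moreover have "frechet_derivative h (at (p + \<theta> *\<^sub>R d)) (v *\<^sub>R d) = v *\<^sub>R (pdir h (p + \<theta> *\<^sub>R d) d)" for v
   by (simp add: frechet_derivative_pdiff[OF h(1)] scaleR_sum_right)
  ultimately show ?thesis by (simp add: has_vector_derivative_def)
 qed
 have "norm (?f 1 - ?f 0) <= (real CARD('n) * ((real CARD('n))\<^sup>2 * c * norm (a - a') * norm d) * norm d) * abs (1 - 0)"
 proof (rule vector_derivative_bound)
  fix \<theta> :: real assume "\<theta> : closed_segment 0 1"
  then have \<theta>: "0 <= \<theta>" "\<theta> <= 1" by (auto simp: closed_segment_eq_real_ivl)
  have "((%\<theta>. \<theta> *\<^sub>R (\<Sum>k\<in>UNIV. d $ k *\<^sub>R (pdiff h k a - pdiff h k a'))) has_vector_derivative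
    (\<Sum>k\<in>UNIV. d $ k *\<^sub>R (pdiff h k a - pdiff h k a'))) (at \<theta>)"
   by (auto intro!: derivative_eq_intros)
  note has_vector_derivative_diff[OF has_vector_derivative_diff[OF line[of a \<theta>] line[of a' \<theta>]] this]
  moreover have "(pdir h (a + \<theta> *\<^sub>R d) d) - (pdir h (a' + \<theta> *\<^sub>R d) d)
    - (\<Sum>k\<in>UNIV. d $ k *\<^sub>R (pdiff h k a - pdiff h k a')) = ?f' \<theta>"
   by (simp add: sum_subtractf scaleR_diff_right)
  ultimately show "(?f has_vector_derivative ?f' \<theta>) (at \<theta>)" by simp
  have pts': "a + \<theta> *\<^sub>R d : K" "a' + \<theta> *\<^sub>R d : K"
   using convexD_alt[OF K pts(1,3), of \<theta>] convexD_alt[OF K pts(2,4), of \<theta>] \<theta> by (simp_all add: algebra_simps)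
  show "norm (?f' \<theta>) <= real CARD('n) * ((real CARD('n))\<^sup>2 * c * norm (a - a') * norm d) * norm d"
  proof (rule norm_sum_component_le)
   fix k
   have c: "0 <= c" by (rule order_trans[OF norm_ge_zero bnd[OF pts(1)]])
   have "norm ((pdiff h k (a + \<theta> *\<^sub>R d) - pdiff h k a) - (pdiff h k (a' + \<theta> *\<^sub>R d) - pdiff h k a'))
     <= (real CARD('n))\<^sup>2 * c * norm (a - a') * norm (\<theta> *\<^sub>R d)"
    by (rule second_difference[OF h(2,3) K bnd pts(1,2) pts'])
   also have "... <= (real CARD('n))\<^sup>2 * c * norm (a - a') * norm d"
    by (intro mult_left_mono) (use \<theta> c in "auto intro!: mult_left_le_one_le")
   finally show "norm ((pdiff h k (a + \<theta> *\<^sub>R d) - pdiff h k a) - (pdiff h k (a' + \<theta> *\<^sub>R d) - pdiff h k a'))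
     <= (real CARD('n))\<^sup>2 * c * norm (a - a') * norm d" .
  qed
 qed
 moreover have "?f 1 - ?f 0 = (h (a + d) - h a - (pdir h a d)) - (h (a' + d) - h a' - (pdir h a' d))"
  by (simp add: sum_subtractf scaleR_diff_right)
 ultimately have "norm ((h (a + d) - h a - (pdir h a d)) - (h (a' + d) - h a' - (pdir h a' d))) <= (real CARD('n) * ((real CARD('n))\<^sup>2 * c * norm (a - a') * norm d) * norm d) * abs (1 - 0)"
  by (simp only:)
 also have "... = real CARD('n) ^ 3 * c * norm (a - a') * (norm d)\<^sup>2"
  by (simp add: power2_eq_square power3_eq_cube)
 finally show ?thesis .
qed

lemma taylor_bound:
 fixes h :: "real^'n => 'b::real_normed_vector"
 assumes h: "!!a. h differentiable (at a)" "!!k a. pdiff h k differentiable (at a)" and K: "convex K"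
  and bnd: "!!x k l. x : K ==> norm (pdiff (pdiff h k) l x) <= c"
  and pts: "a : K" "a + d : K"
 shows "norm (h (a + d) - h a - (pdir h a d)) <= (real CARD('n))\<^sup>2 * c * (norm d)\<^sup>2"
proof -
 let ?g = "%x. h x - (pdir h a (x - a))"
 have c: "0 <= c" by (rule order_trans[OF norm_ge_zero bnd[OF pts(1)]])
 have "norm (?g (a + d) - ?g a) <= (real CARD('n) * (real CARD('n) * c * norm d)) * norm (a + d - a)"
 proof (rule differentiable_bound[of "closed_segment a (a + d)"])
  fix x assume x: "x : closed_segment a (a + d)"
  then have xK: "x : K" using closed_segment_subset[OF pts K] by auto
  have xd: "norm (x - a) <= norm d" using segment_bound1[OF x] by simp
  have "((%x. \<Sum>k\<in>UNIV. (x - a) $ k *\<^sub>R pdiff h k a) has_derivative (%v. pdir h a v)) (at x)"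
   by (auto intro!: derivative_eq_intros bounded_linear.has_derivative[OF bounded_linear_vec_nth])
  moreover have "(h has_derivative (%v. pdir h x v)) (at x)"
  proof -
   have "frechet_derivative h (at x) = (%v. pdir h x v)"
    by (rule ext, rule frechet_derivative_pdiff[OF h(1)])
   then show ?thesis using h(1)[of x] by (simp add: frechet_derivative_works)
  qed
  ultimately have "(?g has_derivative (%v. (pdir h x v) - (pdir h a v))) (at x)"
   by (intro has_derivative_diff)
  then have "(?g has_derivative (%v. \<Sum>k\<in>UNIV. v $ k *\<^sub>R (pdiff h k x - pdiff h k a))) (at x)"
   by (simp add: sum_subtractf scaleR_diff_right)
  then show "(?g has_derivative (%v. \<Sum>k\<in>UNIV. v $ k *\<^sub>R (pdiff h k x - pdiff h k a))) (at x within closed_segment a (a + d))"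
   by (rule has_derivative_at_withinI)
  show "onorm (%v. \<Sum>k\<in>UNIV. v $ k *\<^sub>R (pdiff h k x - pdiff h k a)) <= real CARD('n) * (real CARD('n) * c * norm d)"
  proof (rule onorm_bound)
   fix v
   have "norm (pdiff h k x - pdiff h k a) <= real CARD('n) * c * norm d" for k
    by (rule order_trans[OF pdiff_lipschitz[OF h(2) K xK pts(1) bnd]]) (use xd c in "auto intro!: mult_left_mono")
   then show "norm (\<Sum>k\<in>UNIV. v $ k *\<^sub>R (pdiff h k x - pdiff h k a)) <= real CARD('n) * (real CARD('n) * c * norm d) * norm v"
    by (rule norm_sum_component_le)
  qed (use c in auto)
 qed auto
 then show ?thesis by (simp add: power2_eq_square mult_ac algebra_simps)
qed

text \<open>The argument \<open>a + d + b\<close> stands for the base value of \<open>u\<close>, an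
  increment of \<open>X\<close> and an increment of \<open>v\<close>. The variable \<open>d\<close>
  appears quadratically in the remainder of \<open>g\<close>, \<open>b\<close> only linearly. Two
  solutions share the same \<open>d\<close>, so their comparison costs just \<open>b - b'\<close>
  and \<open>a - a'\<close>, and the coefficient of the latter contains \<open>b\<close> but not
  \<open>b'\<close>.\<close>

definition nl_bounds :: "real => real => (real^'n => real^'n) => (real^'n => real^'n^'n) => bool" where
 "nl_bounds C \<rho> f g \<longleftrightarrow> C > 0 & continuous_on UNIV f & continuous_on UNIV g &
  (ALL k. continuous_on UNIV (pdiff g k)) & norm (f 0) <= C &
  (ALL a:cball 0 \<rho>. norm (g a) <= C & (ALL k. norm (pdiff g k a) <= C)) &
  (ALL a:cball 0 \<rho>. ALL a':cball 0 \<rho>. norm (f a - f a') <= C * norm (a - a') & norm (g a - g a') <= C * norm (a - a') &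
    (ALL k. norm (pdiff g k a - pdiff g k a') <= C * norm (a - a'))) &
  (ALL a:cball 0 \<rho>. ALL d:cball 0 \<rho>. ALL b:cball 0 \<rho>.
    norm (g (a + d + b) - g a - (pdir g a d)) <= C * (norm b + (norm d)\<^sup>2) &
    (ALL k. norm (pdiff g k (a + d + b) - pdiff g k a) <= C * (norm b + norm d)) &
    (ALL a':cball 0 \<rho>. ALL b':cball 0 \<rho>.
     norm ((g (a + d + b) - g a - (pdir g a d)) - (g (a' + d + b') - g a' - (pdir g a' d)))
      <= C * (norm (b - b') + norm (a - a') * (norm b + (norm d)\<^sup>2)) &
     (ALL k. norm ((pdiff g k (a + d + b) - pdiff g k a) - (pdiff g k (a' + d + b') - pdiff g k a'))
      <= C * (norm (b - b') + norm (a - a') * (norm b + norm d)))))"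

lemma smooth_partials_differentiable:
 fixes h :: "real^'n => 'b::real_normed_vector"
 assumes "smooth h"
 shows "h differentiable (at a)" "pdiff h k differentiable (at a)" "pdiff (pdiff h k) l differentiable (at a)" (is ?A1)
  "pdiff (pdiff (pdiff h k) l) m differentiable (at a)" (is ?A2)
proof -
 have d: "partials bs h differentiable (at a)" if "set bs \<subseteq> Basis" for bs
  using assms that by (auto simp: smooth_def)
 have b: "axis k (1::real) : Basis" for k :: 'n by (simp add: axis_in_Basis_iff)
 show "h differentiable (at a)" "pdiff h k differentiable (at a)" ?A1
  ?A2
  using d[of "[]"] d[of "[axis k 1]"] d[of "[axis l 1, axis k 1]"] d[of "[axis m 1, axis l 1, axis k 1]"] b
  by (simp_all only: partials_pdiff partials.simps(1) list.set insert_subset empty_subsetI simp_thms)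
qed

text \<open>The radius is tripled because three vectors of the ball are added. The third power of
  the dimension comes from the third derivatives in \<open>taylor_difference\<close>; lower powers
  are absorbed since the dimension is at least 1.\<close>

lemma nl_bounds_of_pdiff_bounds:
 fixes f :: "real^'n => real^'n" and g :: "real^'n => real^'n^'n"
 assumes f: "smooth f" and g: "smooth g" and K: "convex K" "cball 0 (3 * \<rho>) \<subseteq> K" and M: "M >= 1" and \<rho>: "\<rho> >= 0"
  and bnd: "!!x. x : K ==> norm (g x) <= M" "!!x k. x : K ==> norm (pdiff f k x) <= M"
   "!!x k. x : K ==> norm (pdiff g k x) <= M" "!!x k l. x : K ==> norm (pdiff (pdiff g k) l x) <= M"
   "!!x k l m. x : K ==> norm (pdiff (pdiff (pdiff g k) l) m x) <= M"
 shows "nl_bounds (3 * real CARD('n) ^ 3 * M + norm (f 0)) \<rho> f g"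
proof -
 let ?n = "real CARD('n)"
 define C where "C = 3 * ?n ^ 3 * M + norm (f 0)"
 note df = smooth_partials_differentiable[OF f] and dg = smooth_partials_differentiable[OF g]
 have n: "?n >= 1" by (simp add: Suc_leI)
 have n3: "1 <= ?n ^ 3" "?n <= ?n ^ 3" "?n\<^sup>2 <= ?n ^ 3"
  using n one_le_power[OF n, of 3] power_increasing[of 1 3 ?n] power_increasing[of 2 3 ?n] by auto
 have CM: "M <= C" "?n * M <= C" "?n * M + ?n\<^sup>2 * M <= C" "?n * M + ?n ^ 3 * M <= C" "?n\<^sup>2 * M <= C" "?n ^ 3 * M <= C" "norm (f 0) <= C"
 proof -
  have "M <= ?n ^ 3 * M" "?n * M <= ?n ^ 3 * M" "?n\<^sup>2 * M <= ?n ^ 3 * M" "0 <= ?n ^ 3 * M"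
   using mult_right_mono[OF n3(1), of M] mult_right_mono[OF n3(2), of M] mult_right_mono[OF n3(3), of M] M by auto
  moreover have "C = ?n ^ 3 * M + ?n ^ 3 * M + ?n ^ 3 * M + norm (f 0)" by (simp add: C_def)
  moreover have "0 <= norm (f 0)" by simp
  ultimately show "M <= C" "?n * M <= C" "?n * M + ?n\<^sup>2 * M <= C" "?n * M + ?n ^ 3 * M <= C" "?n\<^sup>2 * M <= C" "?n ^ 3 * M <= C" "norm (f 0) <= C"
   by linarith+
 qed
 have C0: "C > 0" using CM(1) M by linarith
 have in3: "x : K" if "norm x <= 3 * \<rho>" for x using that K(2) by auto
 have pt: "a : K" "a + d : K" "a + d + b : K" if "norm a <= \<rho>" "norm d <= \<rho>" "norm b <= \<rho>" for a d b
 proof -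
  have "norm (a + d) <= norm a + norm d" "norm (a + d + b) <= norm (a + d) + norm b" by (rule norm_triangle_ineq)+
  then show "a : K" "a + d : K" "a + d + b : K" using that \<rho> by (auto intro!: in3)
 qed
 have lip: "norm (f a - f a') <= C * norm (a - a')" "norm (g a - g a') <= C * norm (a - a')"
  "norm (pdiff g k a - pdiff g k a') <= C * norm (a - a')" if "a : K" "a' : K" for a a' k
  using pdiff_lipschitz[OF df(1) K(1) that bnd(2)] pdiff_lipschitz[OF dg(1) K(1) that bnd(3)]
   pdiff_lipschitz[OF dg(2) K(1) that bnd(4)] mult_right_mono[OF CM(2), of "norm (a - a')"]
  by (auto intro: order_trans)
 have lip': "norm (g a - g a') <= ?n * M * norm (a - a')"
  "norm (pdiff g k a - pdiff g k a') <= ?n * M * norm (a - a')" if "a : K" "a' : K" for a a' k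
  using pdiff_lipschitz[OF dg(1) K(1) that bnd(3)] pdiff_lipschitz[OF dg(2) K(1) that bnd(4)] by auto
 have fin: "c1 * x + c2 * y <= C * (x + y)" if "c1 <= C" "c2 <= C" "0 <= x" "0 <= y" for c1 c2 x y
  using mult_right_mono[OF that(1,3)] mult_right_mono[OF that(2,4)] by (simp add: algebra_simps)
 have tri: "norm (x + (y + z)) <= norm x + (norm y + norm z)" for x y z :: "real^'n^'n"
  using norm_triangle_ineq[of x "y + z"] norm_triangle_ineq[of y z] by linarith
 have small: "norm (g (a + d + b) - g a - (pdir g a d)) <= C * (norm b + (norm d)\<^sup>2)"
  "norm (pdiff g k (a + d + b) - pdiff g k a) <= C * (norm b + norm d)"
  if n: "norm a <= \<rho>" "norm d <= \<rho>" "norm b <= \<rho>" for a d b k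
 proof -
  have pts: "a : K" "a + d : K" "a + d + b : K"
   using pt[OF n] by auto
  have "norm (g (a + d + b) - g a - (pdir g a d)) <=
   norm (g (a + d + b) - g (a + d)) + norm (g (a + d) - g a - (pdir g a d))"
   using norm_triangle_ineq[of "g (a + d + b) - g (a + d)" "g (a + d) - g a - (pdir g a d)"]
   by (simp add: algebra_simps)
  also have "... <= ?n * M * norm b + ?n\<^sup>2 * M * (norm d)\<^sup>2"
   using lip'(1)[OF pts(3,2)] taylor_bound[OF dg(1,2) K(1) bnd(4) pts(1,2)] by simp
  also have "... <= C * (norm b + (norm d)\<^sup>2)" by (rule fin) (use CM in auto)
  finally show "norm (g (a + d + b) - g a - (pdir g a d)) <= C * (norm b + (norm d)\<^sup>2)" .
  have "norm (pdiff g k (a + d + b) - pdiff g k a) <= C * norm (a + d + b - a)" by (rule lip(3)[OF pts(3,1)])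
  also have "... <= C * (norm b + norm d)" using C0 norm_triangle_ineq[of b d] by (intro mult_left_mono) (auto simp: add.commute)
  finally show "norm (pdiff g k (a + d + b) - pdiff g k a) <= C * (norm b + norm d)" .
 qed
 have diff: "norm ((g (a + d + b) - g a - (pdir g a d)) - (g (a' + d + b') - g a' - (pdir g a' d)))
    <= C * (norm (b - b') + norm (a - a') * (norm b + (norm d)\<^sup>2))" (is ?P)
  "norm ((pdiff g k (a + d + b) - pdiff g k a) - (pdiff g k (a' + d + b') - pdiff g k a'))
    <= C * (norm (b - b') + norm (a - a') * (norm b + norm d))" (is ?Q)
  if n: "norm a <= \<rho>" "norm d <= \<rho>" "norm b <= \<rho>" "norm a' <= \<rho>" "norm b' <= \<rho>" for a d b a' b' k
 proof -
  have pts: "a : K" "a + d : K" "a + d + b : K" "a' : K" "a' + d : K" "a' + d + b' : K" "a' + d + b : K"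
   using pt[OF n(1,2,3)] pt[OF n(4,2,5)] pt[OF n(4,2,3)] by auto
  have pts2: "a + (d + b) : K" "a' + (d + b) : K" using pts by (simp_all add: add.assoc)
  let ?t1 = "g (a' + d + b) - g (a' + d + b')"
   and ?t2 = "g (a + d + b) - g (a + d) - (g (a' + d + b) - g (a' + d))"
   and ?t3 = "(g (a + d) - g a - (pdir g a d)) - (g (a' + d) - g a' - (pdir g a' d))"
  \<comment> \<open>A telescoping in three moves: replace \<open>b'\<close> by \<open>b\<close> at
    the second point, compare the effect of \<open>b\<close> at the two points, then compare the
    Taylor remainders in the common direction \<open>d\<close>.\<close>
  have "(g (a + d + b) - g a - (pdir g a d)) - (g (a' + d + b') - g a' - (pdir g a' d)) = ?t1 + (?t2 + ?t3)"
   by (simp add: algebra_simps)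
  then have "norm ((g (a + d + b) - g a - (pdir g a d)) - (g (a' + d + b') - g a' - (pdir g a' d)))
    <= norm ?t1 + (norm ?t2 + norm ?t3)"
   by (simp only: tri)
  also have "... <= C * norm (b - b') + (C * (norm (a - a') * norm b) + C * (norm (a - a') * (norm d)\<^sup>2))"
  proof (intro add_mono)
   show "norm ?t1 <= C * norm (b - b')" using lip(2)[OF pts(7,6)] by simp
   have "norm ?t2 <= ?n\<^sup>2 * M * norm (a + d - (a' + d)) * norm b"
    by (rule second_difference[OF dg(1,2) K(1) bnd(4) pts(2,5,3,7)])
   also have "... = ?n\<^sup>2 * M * (norm (a - a') * norm b)" by simp
   also have "... <= C * (norm (a - a') * norm b)" by (rule mult_right_mono) (use CM in auto)
   finally show "norm ?t2 <= C * (norm (a - a') * norm b)" .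
   have "norm ?t3 <= ?n ^ 3 * M * norm (a - a') * (norm d)\<^sup>2"
    by (rule taylor_difference[OF dg(1,2,3) K(1) bnd(5) pts(1,4,2,5)])
   also have "... = ?n ^ 3 * M * (norm (a - a') * (norm d)\<^sup>2)" by simp
   also have "... <= C * (norm (a - a') * (norm d)\<^sup>2)" by (rule mult_right_mono) (use CM in auto)
   finally show "norm ?t3 <= C * (norm (a - a') * (norm d)\<^sup>2)" .
  qed
  finally show ?P by (simp add: algebra_simps)
  let ?h = "pdiff g k"
  let ?s1 = "?h (a' + d + b) - ?h (a' + d + b')" and ?s2 = "?h (a + (d + b)) - ?h a - (?h (a' + (d + b)) - ?h a')"
  have "(?h (a + d + b) - ?h a) - (?h (a' + d + b') - ?h a') = ?s1 + ?s2" by (simp add: algebra_simps)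
  then have "norm ((?h (a + d + b) - ?h a) - (?h (a' + d + b') - ?h a')) <= norm ?s1 + norm ?s2"
   by (simp only: norm_triangle_ineq)
  also have "... <= C * norm (b - b') + C * (norm (a - a') * (norm b + norm d))"
  proof (intro add_mono)
   show "norm ?s1 <= C * norm (b - b')" using lip(3)[OF pts(7,6)] by simp
   have "norm ?s2 <= ?n\<^sup>2 * M * norm (a - a') * norm (d + b)"
    by (rule second_difference[OF dg(2,3) K(1) bnd(5) pts(1,4) pts2])
   also have "... = ?n\<^sup>2 * M * (norm (a - a') * norm (d + b))" by simp
   also have "... <= C * (norm (a - a') * (norm b + norm d))"
    by (intro mult_mono) (use CM C0 norm_triangle_ineq[of d b] in "auto simp: add.commute")
   finally show "norm ?s2 <= C * (norm (a - a') * (norm b + norm d))" .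
  qed
  finally show ?Q by (simp add: algebra_simps)
 qed
 have cont: "continuous_on UNIV f" "continuous_on UNIV g" "continuous_on UNIV (pdiff g k)" for k
  using df dg by (auto intro!: continuous_at_imp_continuous_on differentiable_imp_continuous_within)
 show ?thesis
  unfolding nl_bounds_def C_def[symmetric]
 proof (intro conjI ballI allI C0 cont CM(7))
  fix a :: "real^'n" and k assume "a : cball 0 \<rho>"
  then have "a : K" using \<rho> by (auto intro!: in3)
  then show "norm (g a) <= C" "norm (pdiff g k a) <= C" using bnd(1,3) CM(1) by (auto intro: order_trans)
  fix a' :: "real^'n" assume "a' : cball 0 \<rho>"
  then have "a' : K" using \<rho> by (auto intro!: in3)
  with \<open>a : K\<close> show "norm (f a - f a') <= C * norm (a - a')" "norm (g a - g a') <= C * norm (a - a')"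
   "norm (pdiff g k a - pdiff g k a') <= C * norm (a - a')" using lip by auto
 qed (use small diff in auto)
qed

lemma smooth_nl_bounds:
 fixes f :: "real^'n => real^'n" and g :: "real^'n => real^'n^'n"
 assumes f: "smooth f" and g: "smooth g" and \<rho>: "\<rho> >= 0"
 shows "EX C. nl_bounds C \<rho> f g"
proof -
 let ?K = "cball (0::real^'n) (3 * \<rho>)"
 have bd: "EX M. ALL x:?K. norm (h x) <= M" if "!!a. h differentiable (at a)" for h :: "real^'n => 'c::real_normed_vector"
 proof -
  have "continuous_on ?K h" by (intro continuous_at_imp_continuous_on ballI differentiable_imp_continuous_within that)
  then have "bounded (h ` ?K)" by (intro compact_imp_bounded compact_continuous_image) auto
  then show ?thesis by (auto simp: bounded_iff)
 qed
 note df = smooth_partials_differentiable[OF f] and dg = smooth_partials_differentiable[OF g]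
 obtain M0 where M0: "!!x. x : ?K ==> norm (g x) <= M0" using bd[OF dg(1)] by blast
 obtain M1 where M1: "!!x k. x : ?K ==> norm (pdiff f k x) <= M1 k" using bd[OF df(2)] by metis
 obtain M2 where M2: "!!x k. x : ?K ==> norm (pdiff g k x) <= M2 k" using bd[OF dg(2)] by metis
 obtain M3 where M3: "!!x k l. x : ?K ==> norm (pdiff (pdiff g k) l x) <= M3 k l" using bd[OF dg(3)] by metis
 obtain M4 where M4: "!!x k l m. x : ?K ==> norm (pdiff (pdiff (pdiff g k) l) m x) <= M4 k l m" using bd[OF dg(4)] by metis
 define S where "S = insert 1 (insert M0 (range M1 \<union> range M2 \<union> range (case_prod M3) \<union> range (%(k, l, m). M4 k l m)))"
 define M where "M = Max S"
 have "finite S" by (simp add: S_def)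
 then have le: "x <= M" if "x : S" for x using that by (simp add: M_def)
 have "1 <= M" "M0 <= M" "M1 k <= M" "M2 k <= M" "M3 k l <= M" "M4 k l m <= M" for k l m
  using rangeI[of M1 k] rangeI[of M2 k] rangeI[of "case_prod M3" "(k, l)"] rangeI[of "%(k, l, m). M4 k l m" "(k, l, m)"]
  by (intro le; simp add: S_def)+
 then have "nl_bounds (3 * real CARD('n) ^ 3 * M + norm (f 0)) \<rho> f g"
  using M0 M1 M2 M3 M4 \<rho> by (intro nl_bounds_of_pdiff_bounds[OF f g, of ?K]) (auto simp del: mem_cball intro: order_trans[OF M0] order_trans[OF M1] order_trans[OF M2] order_trans[OF M3] order_trans[OF M4])
 then show ?thesis by blast
qed

text \<open>The order of quantifiers is the point: \<open>C\<close> precedes \<rho>. For general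
  smooth data the constant depends on the radius, and the radius on the size of the solution, which
  is what limits the time of existence.\<close>

lemma bounded_nl_bounds:
 fixes f :: "real^'n => real^'n" and g :: "real^'n => real^'n^'n"
 assumes f: "smooth f" and g: "smooth g" and b: "bounded (range g)" "bounded_derivatives f" "bounded_derivatives g"
 shows "EX C. ALL \<rho>>=0. nl_bounds C \<rho> f g"
proof -
 have ax: "axis k (1::real) : Basis" for k :: 'n by (simp add: axis_in_Basis_iff)
 have bd: "EX M. ALL x. norm (partials bs h x) <= M" if "bounded_derivatives h" "set bs \<subseteq> Basis" "bs ~= []"
  for h :: "real^'n => 'c::real_normed_vector" and bs
  using that by (auto simp: bounded_derivatives_def bounded_iff)
 obtain M0 where M0: "!!x. norm (g x) <= M0" using b(1) by (auto simp: bounded_iff)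
 have "EX M. ALL x. norm (pdiff f k x) <= M" for k using bd[OF b(2), of "[axis k 1]"] ax unfolding partials_pdiff partials.simps(1) by simp
 then obtain M1 where M1: "!!x k. norm (pdiff f k x) <= M1 k" by metis
 have "EX M. ALL x. norm (pdiff g k x) <= M" for k using bd[OF b(3), of "[axis k 1]"] ax unfolding partials_pdiff partials.simps(1) by simp
 then obtain M2 where M2: "!!x k. norm (pdiff g k x) <= M2 k" by metis
 have "EX M. ALL x. norm (pdiff (pdiff g k) l x) <= M" for k l
  using bd[OF b(3), of "[axis l 1, axis k 1]"] ax unfolding partials_pdiff partials.simps(1) by simp
 then obtain M3 where M3: "!!x k l. norm (pdiff (pdiff g k) l x) <= M3 k l" by metis
 have "EX M. ALL x. norm (pdiff (pdiff (pdiff g k) l) m x) <= M" for k l m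
  using bd[OF b(3), of "[axis m 1, axis l 1, axis k 1]"] ax unfolding partials_pdiff partials.simps(1) by simp
 then obtain M4 where M4: "!!x k l m. norm (pdiff (pdiff (pdiff g k) l) m x) <= M4 k l m" by metis
 define S where "S = insert 1 (insert M0 (range M1 \<union> range M2 \<union> range (case_prod M3) \<union> range (%(k, l, m). M4 k l m)))"
 define M where "M = Max S"
 have "finite S" by (simp add: S_def)
 then have le: "x <= M" if "x : S" for x using that by (simp add: M_def)
 have "1 <= M" "M0 <= M" "M1 k <= M" "M2 k <= M" "M3 k l <= M" "M4 k l m <= M" for k l m
  using rangeI[of M1 k] rangeI[of M2 k] rangeI[of "case_prod M3" "(k, l)"] rangeI[of "%(k, l, m). M4 k l m" "(k, l, m)"]
  by (intro le; simp add: S_def)+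
 then have "nl_bounds (3 * real CARD('n) ^ 3 * M + norm (f 0)) \<rho> f g" if "\<rho> >= 0" for \<rho>
  using M0 M1 M2 M3 M4 that by (intro nl_bounds_of_pdiff_bounds[OF f g, of UNIV]) (auto intro: order_trans[OF M0] order_trans[OF M1] order_trans[OF M2] order_trans[OF M3] order_trans[OF M4])
 then show ?thesis by blast
qed

section \<open>The nonlinear flux\<close>

lemma powr_le_powr_torus:
 assumes "0 <= d" "d <= 2 * pi" "p <= (q::real)" "p > 0"
 shows "d powr q <= (2 * pi) powr (q - p) * d powr p"
proof -
 have "d powr q = d powr (q - p) * d powr p" by (simp flip: powr_add)
 also have "... <= (2 * pi) powr (q - p) * d powr p"
  by (intro mult_right_mono powr_mono2) (use assms in auto)
 finally show ?thesis .
qed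

definition lip_const :: "real => real => real" where
 "lip_const \<alpha> a = (2 * pi) powr (1 - 2 * \<alpha>) + (2 * pi) powr (1 - \<alpha>) + a\<^sup>2 + a"

text \<open>The first summand converts a sup bound of the integrand into a Hoelder constant of its
  rough integral; the second converts the remainder bound into the Lipschitz constant that absorbs
  the sewing error.\<close>

definition rough_flux_const :: "nat => real => real => real" where
 "rough_flux_const n \<alpha> a = (1 + real n * (2 * pi) powr \<alpha>) * a + rough_const \<alpha> * ((1 + real n) * lip_const \<alpha> a * a)"

lemma lip_const_nonneg: "a >= 0 ==> lip_const \<alpha> a >= 0"
 by (simp add: lip_const_def)

lemma rough_flux_const_nonneg: "a >= 0 ==> \<alpha> > 1 / 3 ==> rough_flux_const n \<alpha> a >= 0"
 unfolding rough_flux_const_def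
 by (intro add_nonneg_nonneg mult_nonneg_nonneg rough_const_nonneg lip_const_nonneg) auto

text \<open>Separating the sup bound \<open>c\<close> from the remainder bound \<open>e\<close> lets
  the lemma serve twice: for one integrand with \<open>c = C\<close>,
  \<open>e = C * (1 + l)\<close>, and for a difference of two with \<open>c = C * z\<close>,
  \<open>e = C * (m + z * (1 + l))\<close>.\<close>

lemma rough_primitive_hmod:
 fixes X :: "real => real^'n"
 assumes X: "rough_bound \<alpha> a X XX" and a: "a >= 0" "c >= 0" "e >= 0" and \<alpha>: "\<alpha> > 1 / 3"
  and Y: "!!x. norm (Y x) <= c" "!!x k. norm (Y' x k) <= c"
  and R: "!!x y. [|x : torus; y : torus; x <= y|] ==>
   norm (Y y - Y x - (\<Sum>k\<in>UNIV. (X y - X x) $ k *\<^sub>R Y' x k)) <= lip_const \<alpha> a * e * (y - x) powr (2 * \<alpha>)"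
  and Y': "!!x y k. [|x : torus; y : torus; x <= y|] ==> norm (Y' y k - Y' x k) <= lip_const \<alpha> a * e * (y - x) powr \<alpha>"
 shows "hmod \<alpha> (rough_flux_const CARD('n) \<alpha> a * c) (rough_flux_const CARD('n) \<alpha> a * e) (sew (rough_summand X XX Y Y') 0)"
  "sewable (3 * \<alpha>) ((1 + real CARD('n)) * lip_const \<alpha> a * a * e) (rough_summand X XX Y Y')"
proof -
 let ?l = "lip_const \<alpha> a" and ?n = "real CARD('n)" and ?c = "rough_flux_const CARD('n) \<alpha> a"
 let ?K = "(1 + ?n) * ?l * a * e"
 have l: "?l >= 0" using a by (intro lip_const_nonneg)
 have "sewable (3 * \<alpha>) ((?l * e + ?n * (?l * e)) * a) (rough_summand X XX Y Y')"
  by (rule rough_summand_sewable[OF X]) (use a l \<alpha> R Y' in auto)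
 also have "(?l * e + ?n * (?l * e)) * a = ?K" by (simp add: algebra_simps)
 finally show s: "sewable (3 * \<alpha>) ?K (rough_summand X XX Y Y')" .
 have "hmod \<alpha> ((1 + ?n * (2 * pi) powr \<alpha>) * c * a) (rough_const \<alpha> * ?K) (sew (rough_summand X XX Y Y') 0)"
 proof (rule sew_hmod[OF s _ \<alpha>])
  fix x y :: real assume "x : torus" "y : torus" "x <= y"
  then show "norm (rough_summand X XX Y Y' x y) <= (1 + ?n * (2 * pi) powr \<alpha>) * c * a * (y - x) powr \<alpha>"
   using rough_summand_bound[OF X a(1,2) _ Y(1,2)] \<alpha> by simp
 qed (use l a in auto)
 then show "hmod \<alpha> (?c * c) (?c * e) (sew (rough_summand X XX Y Y') 0)"
 proof (rule hmod_mono)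
  have "0 <= rough_const \<alpha> * ((1 + ?n) * ?l * a) * c" "0 <= (1 + ?n * (2 * pi) powr \<alpha>) * a * e"
   using l a rough_const_nonneg[OF \<alpha>] by auto
  then show "(1 + ?n * (2 * pi) powr \<alpha>) * c * a <= ?c * c" "rough_const \<alpha> * ?K <= ?c * e"
   by (simp_all add: rough_flux_const_def algebra_simps)
 qed
qed

definition rint :: "(real^'n => real^'n^'n) => (real => real^'n) => (real => real => real^'n^'n) => (real => real^'n) => real => real^'n" where
 "rint g X XX v = sew (rough_summand X XX (%y. g (X y + v y)) (%y k. pdiff g k (X y + v y))) 0"

definition drift :: "(real^'n => real^'n) => (real^'n => real^'n^'n) => (real => real^'n) => (real => real^'n) => (real => real^'n) => real => real^'n" where
 "drift f g X v w y = g (X y + v y) *v w y + (f (X y + v y) + (X y + v y))"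

text \<open>A frozen time: \<open>v\<close> with its derivative \<open>w\<close>. The radius \<rho>
  will be the same at all times, whereas \<open>l\<close> blows up as time tends to 0, which is why
  the two bounds are separate.\<close>

definition slice :: "real => real => (real => real^'n) => (real => real^'n) => bool" where
 "slice \<rho> l v w \<longleftrightarrow> continuous_on UNIV w &
  (ALL y. (v has_vector_derivative w y) (at y) & norm (v y) <= \<rho> & norm (w y) <= l)"

lemma slice_lip:
 assumes "slice \<rho> l v w"
 shows "norm (v y - v x) <= l * abs (y - x)"
 using assms by (intro vector_derivative_bound[where f' = w]) (auto simp: slice_def)

lemma slice_diff_lip:
 assumes "slice \<rho> l v w" "slice \<rho>' l' v' w'" "!!y. norm (w y - w' y) <= m"
 shows "norm (v y - v x - (v' y - v' x)) <= m * abs (y - x)"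
proof -
 have "norm ((%x. v x - v' x) y - (%x. v x - v' x) x) <= m * abs (y - x)"
  by (rule vector_derivative_bound[where f' = "%y. w y - w' y"])
   (use assms in "auto simp: slice_def intro!: has_vector_derivative_diff")
 then show ?thesis by (simp add: algebra_simps)
qed

lemma slice_continuous: "slice \<rho> l v w ==> continuous_on UNIV v"
 by (intro continuous_at_imp_continuous_on) (auto simp: slice_def intro: has_vector_derivative_continuous)

section \<open>Estimates for the flux at a frozen time\<close>

context
 fixes f :: "real^'n => real^'n" and g :: "real^'n => real^'n^'n" and X :: "real => real^'n" and XX
  and \<alpha> a C \<rho> :: real
 assumes X: "rough_bound \<alpha> a X XX" and a: "a >= 0" and \<alpha>: "\<alpha> > 1 / 3" "\<alpha> < 1 / 2"
  and nl: "nl_bounds C (2 * \<rho>) f g" and X\<rho>: "!!x. norm (X x) <= \<rho>"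
begin

lemma C_pos: "C > 0" using nl by (simp add: nl_bounds_def)

lemma \<rho>_nonneg: "\<rho> >= 0" by (rule order_trans[OF norm_ge_zero X\<rho>])

lemma in_ball: "slice \<rho> l v w ==> X y + v y : cball 0 (2 * \<rho>)"
 "slice \<rho> l v w ==> v y - v x : cball 0 (2 * \<rho>)" "X y - X x : cball 0 (2 * \<rho>)"
proof -
 show "X y - X x : cball 0 (2 * \<rho>)"
  using X\<rho>[of y] X\<rho>[of x] norm_triangle_ineq4[of "X y" "X x"] by simp
 assume "slice \<rho> l v w"
 then have "norm (v x) <= \<rho>" "norm (v y) <= \<rho>" by (simp_all add: slice_def)
 then show "X y + v y : cball 0 (2 * \<rho>)" "v y - v x : cball 0 (2 * \<rho>)"
  using X\<rho>[of y] norm_triangle_ineq[of "X y" "v y"] norm_triangle_ineq4[of "v y" "v x"] by simp_all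
qed

text \<open>Matches \<open>u\<close> at \<open>y\<close> with the pattern \<open>a + d + b\<close>
  of \<open>nl_bounds\<close>: base value at \<open>x\<close>, rough increment, Lipschitz
  increment.\<close>

lemma u_split: "X y + v y = (X x + v x) + (X y - X x) + (v y - v x)" for v :: "real => real^'n"
 by simp

lemma slice_estimates:
 assumes v: "slice \<rho> l v w" and xy: "x : torus" "y : torus"
 shows "norm (g (X y + v y)) <= C" "norm (pdiff g k (X y + v y)) <= C" (is ?A)
  "norm (g (X y + v y) - g (X x + v x) - (pdir g (X x + v x) (X y - X x)))
   <= lip_const \<alpha> a * (C * (1 + l)) * abs (y - x) powr (2 * \<alpha>)"
  "norm (pdiff g k (X y + v y) - pdiff g k (X x + v x)) <= lip_const \<alpha> a * (C * (1 + l)) * abs (y - x) powr \<alpha>"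
proof -
 show "norm (g (X y + v y)) <= C" ?A
  using nl in_ball(1)[OF v] unfolding nl_bounds_def by blast+
 have l: "0 <= l" using v norm_ge_zero order_trans unfolding slice_def by blast
 let ?d = "abs (y - x)"
 have d: "0 <= ?d" "?d <= 2 * pi" using xy by auto
 have p: "?d <= (2 * pi) powr (1 - 2 * \<alpha>) * ?d powr (2 * \<alpha>)" "?d <= (2 * pi) powr (1 - \<alpha>) * ?d powr \<alpha>"
  using powr_le_powr_torus[OF d, of "2 * \<alpha>" 1] powr_le_powr_torus[OF d, of \<alpha> 1] \<alpha> by auto
 have dv: "norm (v y - v x) <= l * ?d" by (rule slice_lip[OF v])
 have dX: "norm (X y - X x) <= a * ?d powr \<alpha>" by (rule rough_boundD(1)[OF X xy])
 have dX2: "(norm (X y - X x))\<^sup>2 <= a\<^sup>2 * ?d powr (2 * \<alpha>)"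
 proof -
  have "(norm (X y - X x))\<^sup>2 <= (a * ?d powr \<alpha>)\<^sup>2" by (rule power_mono[OF dX]) auto
  also have "... = a\<^sup>2 * ?d powr (2 * \<alpha>)" by (simp add: power_mult_distrib power2_eq_square flip: powr_add)
  finally show ?thesis .
 qed
 have "norm (g (X y + v y) - g (X x + v x) - (pdir g (X x + v x) (X y - X x)))
   <= C * (norm (v y - v x) + (norm (X y - X x))\<^sup>2)"
  unfolding u_split[of y v x] using nl in_ball(1)[OF v, of x] in_ball(2)[OF v, of y x] in_ball(3)[of y x] unfolding nl_bounds_def by blast
 also have "... <= C * (l * ((2 * pi) powr (1 - 2 * \<alpha>) * ?d powr (2 * \<alpha>)) + a\<^sup>2 * ?d powr (2 * \<alpha>))"
  by (intro mult_left_mono add_mono dX2 order_trans[OF dv] p) (use C_pos l in auto)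
 also have "... <= lip_const \<alpha> a * (C * (1 + l)) * ?d powr (2 * \<alpha>)"
  using C_pos l a by (simp add: lip_const_def algebra_simps)
 finally show "norm (g (X y + v y) - g (X x + v x) - (pdir g (X x + v x) (X y - X x)))
   <= lip_const \<alpha> a * (C * (1 + l)) * ?d powr (2 * \<alpha>)" .
 have "norm (pdiff g k (X y + v y) - pdiff g k (X x + v x)) <= C * (norm (v y - v x) + norm (X y - X x))"
  unfolding u_split[of y v x] using nl in_ball(1)[OF v, of x] in_ball(2)[OF v, of y x] in_ball(3)[of y x] unfolding nl_bounds_def by blast
 also have "... <= C * (l * ((2 * pi) powr (1 - \<alpha>) * ?d powr \<alpha>) + a * ?d powr \<alpha>)"
  by (intro mult_left_mono add_mono dX order_trans[OF dv] p) (use C_pos l in auto)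
 also have "... <= lip_const \<alpha> a * (C * (1 + l)) * ?d powr \<alpha>"
  using C_pos l a by (simp add: lip_const_def algebra_simps)
 finally show "norm (pdiff g k (X y + v y) - pdiff g k (X x + v x)) <= lip_const \<alpha> a * (C * (1 + l)) * ?d powr \<alpha>" .
qed

lemma slice_diff_estimates:
 assumes v: "slice \<rho> l v w" and v': "slice \<rho> l' v' w'" and z: "!!y. norm (v y - v' y) <= z" and m: "!!y. norm (w y - w' y) <= m"
  and xy: "x : torus" "y : torus"
 shows "norm (g (X y + v y) - g (X y + v' y)) <= C * z" (is ?A1) "norm (pdiff g k (X y + v y) - pdiff g k (X y + v' y)) <= C * z" (is ?A2)
  "norm ((g (X y + v y) - g (X y + v' y)) - (g (X x + v x) - g (X x + v' x))
    - (\<Sum>k\<in>UNIV. (X y - X x) $ k *\<^sub>R (pdiff g k (X x + v x) - pdiff g k (X x + v' x))))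
   <= lip_const \<alpha> a * (C * (m + z * (1 + l))) * abs (y - x) powr (2 * \<alpha>)"
  "norm ((pdiff g k (X y + v y) - pdiff g k (X y + v' y)) - (pdiff g k (X x + v x) - pdiff g k (X x + v' x)))
   <= lip_const \<alpha> a * (C * (m + z * (1 + l))) * abs (y - x) powr \<alpha>"
proof -
 have "norm (g (X y + v y) - g (X y + v' y)) <= C * norm (X y + v y - (X y + v' y))"
  "norm (pdiff g k (X y + v y) - pdiff g k (X y + v' y)) <= C * norm (X y + v y - (X y + v' y))"
  using nl in_ball(1)[OF v, of y] in_ball(1)[OF v', of y] unfolding nl_bounds_def by blast+
 moreover have "C * norm (X y + v y - (X y + v' y)) <= C * z" using z[of y] C_pos by simp
 ultimately show ?A1
  ?A2 by linarith+
 have l: "0 <= l" using v norm_ge_zero order_trans unfolding slice_def by blast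
 have zm: "0 <= z" "0 <= m" by (rule order_trans[OF norm_ge_zero z] order_trans[OF norm_ge_zero m])+
 let ?d = "abs (y - x)"
 have d: "0 <= ?d" "?d <= 2 * pi" using xy by auto
 have p: "?d <= (2 * pi) powr (1 - 2 * \<alpha>) * ?d powr (2 * \<alpha>)" "?d <= (2 * pi) powr (1 - \<alpha>) * ?d powr \<alpha>"
  using powr_le_powr_torus[OF d, of "2 * \<alpha>" 1] powr_le_powr_torus[OF d, of \<alpha> 1] \<alpha> by auto
 have dv: "norm (v y - v x) <= l * ?d" by (rule slice_lip[OF v])
 have ddv: "norm (v y - v x - (v' y - v' x)) <= m * ?d" by (rule slice_diff_lip[OF v v' m])
 have dX: "norm (X y - X x) <= a * ?d powr \<alpha>" by (rule rough_boundD(1)[OF X xy])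
 have zz: "norm (X x + v x - (X x + v' x)) <= z" using z[of x] by simp
 have dX2: "(norm (X y - X x))\<^sup>2 <= a\<^sup>2 * ?d powr (2 * \<alpha>)"
 proof -
  have "(norm (X y - X x))\<^sup>2 <= (a * ?d powr \<alpha>)\<^sup>2" by (rule power_mono[OF dX]) auto
  also have "... = a\<^sup>2 * ?d powr (2 * \<alpha>)" by (simp add: power_mult_distrib power2_eq_square flip: powr_add)
  finally show ?thesis .
 qed
 have fin: "C * (m * (P * D) + z * (l * (P * D) + Q * D)) <= lip_const \<alpha> a * (C * (m + z * (1 + l))) * D"
  if "0 <= P" "P <= lip_const \<alpha> a" "0 <= Q" "Q <= lip_const \<alpha> a" "0 <= D" for P Q D
 proof -
  have "C * (m * P + z * (l * P + Q)) <= C * (m * lip_const \<alpha> a + z * (l * lip_const \<alpha> a + lip_const \<alpha> a))"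
   by (intro mult_left_mono add_mono that) (use C_pos zm l in auto)
  then have "C * (m * P + z * (l * P + Q)) * D <= C * (m * lip_const \<alpha> a + z * (l * lip_const \<alpha> a + lip_const \<alpha> a)) * D"
   by (rule mult_right_mono) (use that in auto)
  then show ?thesis by (simp add: algebra_simps)
 qed
 have lc: "(2 * pi) powr (1 - 2 * \<alpha>) <= lip_const \<alpha> a" "(2 * pi) powr (1 - \<alpha>) <= lip_const \<alpha> a" "a\<^sup>2 <= lip_const \<alpha> a" "a <= lip_const \<alpha> a"
  using a by (auto simp: lip_const_def)
 have "norm ((g (X y + v y) - g (X y + v' y)) - (g (X x + v x) - g (X x + v' x))
    - (\<Sum>k\<in>UNIV. (X y - X x) $ k *\<^sub>R (pdiff g k (X x + v x) - pdiff g k (X x + v' x)))) =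
   norm ((g (X y + v y) - g (X x + v x) - (pdir g (X x + v x) (X y - X x))) -
    (g (X y + v' y) - g (X x + v' x) - (pdir g (X x + v' x) (X y - X x))))"
  by (rule arg_cong[of _ _ norm]) (simp add: scaleR_diff_right sum_subtractf)
 also have "... <= C * (norm (v y - v x - (v' y - v' x)) + norm (X x + v x - (X x + v' x)) * (norm (v y - v x) + (norm (X y - X x))\<^sup>2))"
  unfolding u_split[of y v x] u_split[of y v' x]
  using nl in_ball(1)[OF v, of x] in_ball(2)[OF v, of y x] in_ball(3)[of y x] in_ball(1)[OF v', of x] in_ball(2)[OF v', of y x] unfolding nl_bounds_def by blast
 also have "... <= C * (m * ((2 * pi) powr (1 - 2 * \<alpha>) * ?d powr (2 * \<alpha>)) + z * (l * ((2 * pi) powr (1 - 2 * \<alpha>) * ?d powr (2 * \<alpha>)) + a\<^sup>2 * ?d powr (2 * \<alpha>)))"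
  by (intro mult_left_mono mult_mono[OF zz] add_mono dX2 order_trans[OF dv] order_trans[OF ddv] p) (use C_pos l zm in auto)
 also have "... <= lip_const \<alpha> a * (C * (m + z * (1 + l))) * ?d powr (2 * \<alpha>)"
  by (rule fin) (use lc a in auto)
 finally show "norm ((g (X y + v y) - g (X y + v' y)) - (g (X x + v x) - g (X x + v' x))
    - (\<Sum>k\<in>UNIV. (X y - X x) $ k *\<^sub>R (pdiff g k (X x + v x) - pdiff g k (X x + v' x))))
   <= lip_const \<alpha> a * (C * (m + z * (1 + l))) * ?d powr (2 * \<alpha>)" .
 have "norm ((pdiff g k (X y + v y) - pdiff g k (X y + v' y)) - (pdiff g k (X x + v x) - pdiff g k (X x + v' x))) =
   norm ((pdiff g k (X y + v y) - pdiff g k (X x + v x)) - (pdiff g k (X y + v' y) - pdiff g k (X x + v' x)))"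
  by (rule arg_cong[of _ _ norm]) simp
 also have "... <= C * (norm (v y - v x - (v' y - v' x)) + norm (X x + v x - (X x + v' x)) * (norm (v y - v x) + norm (X y - X x)))"
  unfolding u_split[of y v x] u_split[of y v' x]
  using nl in_ball(1)[OF v, of x] in_ball(2)[OF v, of y x] in_ball(3)[of y x] in_ball(1)[OF v', of x] in_ball(2)[OF v', of y x] unfolding nl_bounds_def by blast
 also have "... <= C * (m * ((2 * pi) powr (1 - \<alpha>) * ?d powr \<alpha>) + z * (l * ((2 * pi) powr (1 - \<alpha>) * ?d powr \<alpha>) + a * ?d powr \<alpha>))"
  by (intro mult_left_mono mult_mono[OF zz] add_mono dX order_trans[OF dv] order_trans[OF ddv] p) (use C_pos l zm in auto)
 also have "... <= lip_const \<alpha> a * (C * (m + z * (1 + l))) * ?d powr \<alpha>"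
  by (rule fin) (use lc a in auto)
 finally show "norm ((pdiff g k (X y + v y) - pdiff g k (X y + v' y)) - (pdiff g k (X x + v x) - pdiff g k (X x + v' x)))
   <= lip_const \<alpha> a * (C * (m + z * (1 + l))) * ?d powr \<alpha>" .
qed

lemma slice_l_nonneg: "slice \<rho> l v w ==> 0 <= l" for v w :: "real => real^'n"
 using norm_ge_zero order_trans unfolding slice_def by blast

lemma slice_bounds_all:
 assumes v: "slice \<rho> l v w"
 shows "norm (g (X y + v y)) <= C" "norm (pdiff g k (X y + v y)) <= C"
 using nl in_ball(1)[OF v] unfolding nl_bounds_def by blast+

lemma rint_hmod:
 assumes v: "slice \<rho> l v w"
 shows "hmod \<alpha> (rough_flux_const CARD('n) \<alpha> a * C) (rough_flux_const CARD('n) \<alpha> a * (C * (1 + l))) (rint g X XX v)" (is ?A1)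
  "sewable (3 * \<alpha>) ((1 + real CARD('n)) * lip_const \<alpha> a * a * (C * (1 + l)))
   (rough_summand X XX (%y. g (X y + v y)) (%y k. pdiff g k (X y + v y)))" (is ?A2)
proof -
 have "0 <= C * (1 + l)" using C_pos slice_l_nonneg[OF v] by simp
 then have c: "0 <= C" "0 <= C * (1 + l)" using C_pos by auto
 have R: "norm (g (X y + v y) - g (X x + v x) - (pdir g (X x + v x) (X y - X x)))
   <= lip_const \<alpha> a * (C * (1 + l)) * (y - x) powr (2 * \<alpha>)"
  and Q: "norm (pdiff g k (X y + v y) - pdiff g k (X x + v x)) <= lip_const \<alpha> a * (C * (1 + l)) * (y - x) powr \<alpha>"
  if "x : torus" "y : torus" "x <= y" for x y k
  using slice_estimates(3,4)[OF v that(1,2)] that(3) by simp_all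
 note * = rough_primitive_hmod[OF X a c \<alpha>(1), of "%y. g (X y + v y)" "%y k. pdiff g k (X y + v y)", OF slice_bounds_all[OF v] R Q]
 show ?A1
  unfolding rint_def by (rule *(1))
 show ?A2
  by (rule *(2))
qed

text \<open>Sewing is linear, so the difference of two rough integrals is the rough integral of the
  difference of the integrands, which is itself controlled by \<open>X\<close>. Estimating the two
  integrals separately would give no smallness in \<open>z\<close> and \<open>m\<close>.\<close>

lemma rint_diff_hmod:
 assumes v: "slice \<rho> l v w" and v': "slice \<rho> l' v' w'" and z: "!!y. norm (v y - v' y) <= z" and m: "!!y. norm (w y - w' y) <= m"
 shows "hmod \<alpha> (rough_flux_const CARD('n) \<alpha> a * (C * z)) (rough_flux_const CARD('n) \<alpha> a * (C * (m + z * (1 + l))))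
  (%y. rint g X XX v y - rint g X XX v' y)"
proof -
 have zm: "0 <= z" "0 <= m" by (rule order_trans[OF norm_ge_zero z] order_trans[OF norm_ge_zero m])+
 let ?Y = "%y. g (X y + v y) - g (X y + v' y)" and ?Y' = "%y k. pdiff g k (X y + v y) - pdiff g k (X y + v' y)"
 let ?R = "%v. rough_summand X XX (%y. g (X y + v y)) (%y k. pdiff g k (X y + v y))"
 have "hmod \<alpha> (rough_flux_const CARD('n) \<alpha> a * (C * z)) (rough_flux_const CARD('n) \<alpha> a * (C * (m + z * (1 + l))))
  (sew (rough_summand X XX ?Y ?Y') 0)"
 proof (rule rough_primitive_hmod(1)[OF X a _ _ \<alpha>(1)])
  show "0 <= C * z" "0 <= C * (m + z * (1 + l))" using C_pos zm slice_l_nonneg[OF v] by auto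
  show "norm (g (X x + v x) - g (X x + v' x)) <= C * z" "norm (pdiff g k (X x + v x) - pdiff g k (X x + v' x)) <= C * z" for x k
  proof -
   have "norm (g (X x + v x) - g (X x + v' x)) <= C * norm (X x + v x - (X x + v' x))"
    "norm (pdiff g k (X x + v x) - pdiff g k (X x + v' x)) <= C * norm (X x + v x - (X x + v' x))"
    using nl in_ball(1)[OF v, of x] in_ball(1)[OF v', of x] unfolding nl_bounds_def by blast+
   moreover have "C * norm (X x + v x - (X x + v' x)) <= C * z" using z[of x] C_pos by simp
   ultimately show "norm (g (X x + v x) - g (X x + v' x)) <= C * z" "norm (pdiff g k (X x + v x) - pdiff g k (X x + v' x)) <= C * z"
    by linarith+
  qed
  fix x y :: real and k assume xy: "x : torus" "y : torus" "x <= y"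
  show "norm (?Y y - ?Y x - (\<Sum>k\<in>UNIV. (X y - X x) $ k *\<^sub>R ?Y' x k)) <= lip_const \<alpha> a * (C * (m + z * (1 + l))) * (y - x) powr (2 * \<alpha>)"
   "norm (?Y' y k - ?Y' x k) <= lip_const \<alpha> a * (C * (m + z * (1 + l))) * (y - x) powr \<alpha>"
   using slice_diff_estimates(3,4)[OF v v' z m xy(1,2)] xy(3) by simp_all
 qed
 moreover have "sew (rough_summand X XX ?Y ?Y') 0 y = rint g X XX v y - rint g X XX v' y" if "y : torus" for y
 proof -
  have "rough_summand X XX ?Y ?Y' = (%x y. ?R v x y - ?R v' x y)"
   by (intro ext) (simp add: rough_summand_eq matrix_vector_mult_diff_rdistrib sum_subtractf)
  then show ?thesis
   unfolding rint_def
   using sew_diff[OF rint_hmod(2)[OF v] rint_hmod(2)[OF v'], of 0 y] that \<alpha> a C_pos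
    slice_l_nonneg[OF v] slice_l_nonneg[OF v'] lip_const_nonneg[OF a] by simp
 qed
 ultimately show ?thesis by (simp add: hmod_def)
qed

lemma drift_continuous:
 assumes v: "slice \<rho> l v w" and Xc: "continuous_on UNIV X"
 shows "continuous_on UNIV (drift f g X v w)"
proof -
 have c: "continuous_on UNIV (%y. X y + v y)" by (intro continuous_intros Xc slice_continuous[OF v])
 have fg: "continuous_on UNIV f" "continuous_on UNIV g" and w: "continuous_on UNIV w"
  using nl v by (auto simp: nl_bounds_def slice_def)
 have "continuous_on UNIV (%y. g (X y + v y) *v w y)"
  unfolding matrix_vector_mult_def
  by (intro continuous_on_vec_lambda continuous_on_sum continuous_on_mult continuous_on_component
    continuous_on_compose2[OF fg(2) c] w) auto
 then show ?thesis
  unfolding drift_def[abs_def] by (intro continuous_on_add continuous_on_compose2[OF fg(1) c] c) auto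
qed

lemma drift_bound:
 assumes v: "slice \<rho> l v w" and z: "!!y. norm (v y) <= z" and b: "!!y. norm (X y) <= b"
 shows "norm (drift f g X v w y) <= (C + 1) * (1 + b) * (1 + z + l)"
proof -
 have zb: "0 <= z" "0 <= b" by (rule order_trans[OF norm_ge_zero z] order_trans[OF norm_ge_zero b])+
 have l: "0 <= l" by (rule slice_l_nonneg[OF v])
 have f0: "norm (f 0) <= C" and "norm (f (X y + v y) - f 0) <= C * norm (X y + v y - 0)" (is ?A)
 proof -
  have "0 : cball (0::real^'n) (2 * \<rho>)" using \<rho>_nonneg by simp
  then show ?A "norm (f 0) <= C"
   using nl in_ball(1)[OF v, of y] unfolding nl_bounds_def by blast+
 qed
 then have f: "norm (f (X y + v y)) <= C + C * norm (X y + v y)"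
  using norm_triangle_sub[of "f (X y + v y)" "f 0"] by auto
 have u: "norm (X y + v y) <= b + z" using norm_triangle_ineq[of "X y" "v y"] z[of y] b[of y] by linarith
 have "norm (g (X y + v y) *v w y) <= C * l"
  by (rule order_trans[OF norm_matrix_vector_le], rule mult_mono) (use slice_bounds_all(1)[OF v] v C_pos in "auto simp: slice_def")
 then have "norm (drift f g X v w y) <= C * l + ((C + C * (b + z)) + (b + z))"
  unfolding drift_def
  by (intro order_trans[OF norm_triangle_ineq] add_mono u order_trans[OF f] mult_left_mono) (use C_pos in auto)
 also have "... <= (C + 1) * (1 + b) * (1 + z + l)"
 proof -
  have "0 <= C * (b * z)" "0 <= C * (b * l)" "0 <= b * z" "0 <= b * l" using zb l C_pos by auto
  then show ?thesis using zb l C_pos by (simp add: algebra_simps)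
 qed
 finally show ?thesis .
qed

lemma drift_diff_bound:
 assumes v: "slice \<rho> l v w" and v': "slice \<rho> l' v' w'" and z: "!!y. norm (v y - v' y) <= z" and m: "!!y. norm (w y - w' y) <= m"
 shows "norm (drift f g X v w y - drift f g X v' w' y) <= (C + 1) * (m + z * (1 + l))"
proof -
 have zm: "0 <= z" "0 <= m" by (rule order_trans[OF norm_ge_zero z] order_trans[OF norm_ge_zero m])+
 have l: "0 <= l" by (rule slice_l_nonneg[OF v])
 let ?u = "X y + v y" and ?u' = "X y + v' y"
 have fg: "norm (f ?u - f ?u') <= C * norm (?u - ?u')" "norm (g ?u - g ?u') <= C * norm (?u - ?u')"
  using nl in_ball(1)[OF v, of y] in_ball(1)[OF v', of y] unfolding nl_bounds_def by blast+
 have uz: "norm (?u - ?u') <= z" using z[of y] by simp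
 have e: "drift f g X v w y - drift f g X v' w' y = g ?u' *v (w y - w' y) + ((g ?u - g ?u') *v w y + ((f ?u - f ?u') + (?u - ?u')))"
  by (simp add: drift_def matrix_vector_mult_diff_distrib matrix_vector_mult_diff_rdistrib)
 have "norm (g ?u' *v (w y - w' y)) <= C * m"
  by (rule order_trans[OF norm_matrix_vector_le], rule mult_mono) (use slice_bounds_all(1)[OF v'] m C_pos in auto)
 moreover have "norm ((g ?u - g ?u') *v w y) <= (C * z) * l"
  by (rule order_trans[OF norm_matrix_vector_le], rule mult_mono, rule order_trans[OF fg(2)])
   (use v C_pos zm uz in "auto simp: slice_def")
 moreover have "norm (f ?u - f ?u') <= C * z" by (rule order_trans[OF fg(1)]) (use C_pos uz in auto)
 ultimately have "norm (drift f g X v w y - drift f g X v' w' y) <= C * m + (C * z * l + (C * z + z))"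
  unfolding e by (intro order_trans[OF norm_triangle_ineq] add_mono uz)
 also have "... <= (C + 1) * (m + z * (1 + l))" using zm l C_pos by (simp add: algebra_simps)
 finally show ?thesis .
qed

end

lemma integral_hmod:
 fixes D :: "real => 'a::euclidean_space"
 assumes D: "continuous_on UNIV D" and b: "!!y. norm (D y) <= B" and B: "B >= 0"
 shows "hmod \<alpha> 0 B (%y. integral {0..y} D)"
proof (rule hmodI)
 fix x y :: real assume xy: "x : torus" "y : torus" "x <= y"
 have i: "D integrable_on {a..b}" for a b by (rule integrable_continuous_real[OF continuous_on_subset[OF D]]) auto
 have "integral {0..y} D - integral {0..x} D = integral {x..y} D"
  using Henstock_Kurzweil_Integration.integral_combine[of 0 x y D] xy i by (simp add: algebra_simps)
 then show "norm (integral {0..y} D - integral {0..x} D) <= 0 * (y - x) powr \<alpha> + B * (y - x)"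
  using has_integral_bound[OF B integrable_integral, of D x y] i[of x y] b xy by (simp add: box_real)
qed

section \<open>Volterra convolutions with singular kernels\<close>

text \<open>The substitution \<open>r = s / t\<close> turns the integral into Euler's Beta integral.
  The factor \<open>rsqrt s\<close> represents the blow-up of the gradient at the initial
  time.\<close>

lemma singular_kernel_integral:
 fixes p t :: real
 assumes p: "p < 1" and t: "t > 0"
 shows "set_integrable lborel {0<..<t} (%s. (t - s) powr (- p) * rsqrt s)" (is ?A1)
  "(LINT s:{0<..<t}|lborel. (t - s) powr (- p) * rsqrt s) = Beta (1 / 2) (1 - p) * t powr (1 / 2 - p)" (is ?A2)
proof -
 let ?f = "%r::real. indicator {0..1} r *\<^sub>R (rsqrt r * (1 - r) powr (- p))"
 have i: "set_integrable lborel {0..1} (%r. rsqrt r * (1 - r) powr (- p))"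
  using integrable_Beta[of "1 / 2" "1 - p"] p by simp
 then have fi: "integrable lborel ?f" by (simp add: set_integrable_def)
 have "(LINT r:{0..1}|lborel. rsqrt r * (1 - r) powr (- p)) = integral {0..1} (%r. rsqrt r * (1 - r) powr (- p))"
  by (rule set_borel_integral_eq_integral(2)[OF i])
 also have "... = Beta (1 / 2) (1 - p)"
  using has_integral_Beta_real[of "1 / 2" "1 - p"] p by (intro integral_unique) simp
 finally have fB: "integral\<^sup>L lborel ?f = Beta (1 / 2) (1 - p)" by (simp add: set_lebesgue_integral_def)
 have eq: "?f (0 + (1 / t) * s) = t powr (1 / 2 + p) * (indicator {0..t} s * ((t - s) powr (- p) * rsqrt s))" for s
 proof (cases "s : {0..t}")
  case True
  have aux: "(a / t) powr (- q) = a powr (- q) * t powr q" if "a >= 0" for a q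
  proof -
   have "(a / t) powr (- q) = a powr (- q) / t powr (- q)" by (rule powr_divide)
   then show ?thesis by (simp only: powr_minus divide_inverse inverse_inverse_eq)
  qed
  have "1 - s / t = (t - s) / t" using t by (simp add: field_simps)
  then have "rsqrt (s / t) * (1 - s / t) powr (- p) =
    (rsqrt s * t powr (1 / 2)) * ((t - s) powr (- p) * t powr p)"
   using True aux[of s "1 / 2"] aux[of "t - s" p] by simp
  then have "rsqrt (s / t) * (1 - s / t) powr (- p) = t powr (1 / 2 + p) * ((t - s) powr (- p) * rsqrt s)"
   by (simp only: powr_add mult_ac)
  moreover have "indicator {0..1} (0 + (1 / t) * s) = (1::real)" "indicator {0..t} s = (1::real)" using True t by (auto simp: indicator_def)
  ultimately show ?thesis by simp
 qed (use t in "auto simp: indicator_def field_simps")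
 have pos: "t powr (1 / 2 + p) > 0" using t by simp
 have "integrable lborel (%s. ?f (0 + (1 / t) * s))"
  by (rule lborel_integrable_real_affine[OF fi]) (use t in auto)
 then have i2: "integrable lborel (%s. indicator {0..t} s * ((t - s) powr (- p) * rsqrt s))"
  unfolding eq using pos by simp
 have "integral\<^sup>L lborel ?f = abs (1 / t) *\<^sub>R (LINT s|lborel. ?f (0 + (1 / t) * s))"
  by (rule lborel_integral_real_affine) (use t in auto)
 then have "Beta (1 / 2) (1 - p) = (1 / t) * (t powr (1 / 2 + p) * (LINT s|lborel. indicator {0..t} s * ((t - s) powr (- p) * rsqrt s)))"
  unfolding eq fB using t by simp
 then have "Beta (1 / 2) (1 - p) * t powr (1 / 2 - p) = (t powr (1 / 2 - p) * t powr (1 / 2 + p) / t) * (LINT s|lborel. indicator {0..t} s * ((t - s) powr (- p) * rsqrt s))"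
  by simp
 also have "t powr (1 / 2 - p) * t powr (1 / 2 + p) / t = 1" using t by (simp flip: powr_add)
 finally have B: "(LINT s|lborel. indicator {0..t} s * ((t - s) powr (- p) * rsqrt s)) = Beta (1 / 2) (1 - p) * t powr (1 / 2 - p)"
  by simp
 have d: "indicator {0<..<t} s *\<^sub>R ((t - s) powr (- p) * rsqrt s) = indicator {0..t} s * ((t - s) powr (- p) * rsqrt s)" for s
  by (auto simp: indicator_def)
 show ?A1
  ?A2
  unfolding set_integrable_def set_lebesgue_integral_def d using i2 B by auto
qed

lemma exp_neg_le_powr:
 assumes "x > 0" "0 <= \<epsilon>" "\<epsilon> <= (1::real)"
 shows "exp (- x) <= x powr (- \<epsilon>)"
proof -
 have "x powr \<epsilon> <= exp x"
 proof (cases "x <= 1")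
  case True
  then have "x powr \<epsilon> <= 1" using assms by (simp add: powr_le1)
  also have "1 <= exp x" using assms by simp
  finally show ?thesis .
 next
  case False
  then have "x powr \<epsilon> <= x powr 1" using assms by (intro powr_mono) auto
  also have "... <= exp x" using exp_ge_add_one_self[of x] assms by (simp add: order_trans[of x "1 + x"])
  finally show ?thesis .
 qed
 then show ?thesis using assms by (simp add: exp_minus powr_minus le_imp_inverse_le)
qed

definition kern :: "real => real => real => real => real" where
 "kern p L t s = (t - s) powr (- p) * (rsqrt s * exp (L * s))"

lemma kern_nonneg: "kern p L t s >= 0"
 by (simp add: kern_def)

text \<open>Writing \<open>exp (L * s) = exp (L * t) * exp (- (L * (t - s)))\<close> and using
  \<open>exp (- x) <= x powr (- \<epsilon>)\<close> extracts the small factor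
  \<open>L powr (- \<epsilon>)\<close>. The price is a slightly worse singularity, affordable as
  long as \<open>p + \<epsilon> < 1\<close>.\<close>

lemma kern_bound:
 assumes L: "L > 0" and t: "t > 0" and \<epsilon>: "0 <= \<epsilon>" "\<epsilon> <= 1" "p + \<epsilon> < 1"
 shows "set_integrable lborel {0<..<t} (kern p L t)" (is ?A)
  "(LINT s:{0<..<t}|lborel. kern p L t s) <= Beta (1 / 2) (1 - p - \<epsilon>) * (exp (L * t) * L powr (- \<epsilon>) * t powr (1 / 2 - p - \<epsilon>))"
proof -
 let ?c = "exp (L * t) * L powr (- \<epsilon>)"
 have i: "set_integrable lborel {0<..<t} (%s. ?c * ((t - s) powr (- (p + \<epsilon>)) * rsqrt s))"
  by (intro set_integrable_mult_right singular_kernel_integral(1) \<epsilon> t)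
 have le: "kern p L t s <= ?c * ((t - s) powr (- (p + \<epsilon>)) * rsqrt s)" if "s : {0<..<t}" for s
 proof -
  have "exp (L * s) = exp (L * t) * exp (- (L * (t - s)))" by (simp flip: exp_add add: algebra_simps)
  also have "... <= exp (L * t) * (L * (t - s)) powr (- \<epsilon>)"
   by (intro mult_left_mono exp_neg_le_powr \<epsilon>) (use L that in auto)
  also have "... = ?c * (t - s) powr (- \<epsilon>)" using L that by (simp add: powr_mult)
  finally have "(t - s) powr (- p) * (rsqrt s * exp (L * s)) <= (t - s) powr (- p) * (rsqrt s * (?c * (t - s) powr (- \<epsilon>)))"
   by (intro mult_left_mono) auto
  also have "... = ?c * (((t - s) powr (- p) * (t - s) powr (- \<epsilon>)) * rsqrt s)" by (simp only: mult_ac)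
  also have "(t - s) powr (- p) * (t - s) powr (- \<epsilon>) = (t - s) powr (- (p + \<epsilon>))" by (simp flip: powr_add)
  finally show ?thesis by (simp add: kern_def)
 qed
 show i': ?A
 proof (rule set_integrable_bound[OF i])
  show "set_borel_measurable lborel {0<..<t} (kern p L t)"
   unfolding set_borel_measurable_def kern_def[abs_def] by measurable
  show "AE s in lborel. s : {0<..<t} --> norm (kern p L t s) <= norm (?c * ((t - s) powr (- (p + \<epsilon>)) * rsqrt s))"
   using le kern_nonneg by (intro AE_I2) (auto simp: abs_mult)
 qed
 have "(LINT s:{0<..<t}|lborel. kern p L t s) <= (LINT s:{0<..<t}|lborel. ?c * ((t - s) powr (- (p + \<epsilon>)) * rsqrt s))"
  by (rule set_integral_mono[OF i' i le])
 also have "... = ?c * (Beta (1 / 2) (1 - (p + \<epsilon>)) * t powr (1 / 2 - (p + \<epsilon>)))"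
  by (simp only: set_integral_mult_right singular_kernel_integral(2)[OF \<epsilon>(3) t])
 finally show "(LINT s:{0<..<t}|lborel. kern p L t s) <= Beta (1 / 2) (1 - p - \<epsilon>) * (?c * t powr (1 / 2 - p - \<epsilon>))"
  by (simp add: algebra_simps)
qed

text \<open>Dominated convergence with varying majorants, required because a singular kernel moves
  with its singularity and has no useful common majorant.\<close>

lemma integral_pratt_convergence:
 fixes f :: "nat => 'b => 'a::{banach, second_countable_topology}" and g :: "nat => 'b => real"
 assumes f: "!!n. integrable M (f n)" "integrable M f0" and g: "!!n. integrable M (g n)" "integrable M g0"
  and lim: "AE x in M. (%n. f n x) \<longlonglongrightarrow> f0 x" "AE x in M. (%n. g n x) \<longlonglongrightarrow> g0 x"
  and le: "!!n x. norm (f n x) <= g n x" and int: "(%n. \<integral>x. g n x \<partial>M) \<longlonglongrightarrow> (LINT x|M. g0 x)"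
 shows "(%n. \<integral>x. f n x \<partial>M) \<longlonglongrightarrow> (LINT x|M. f0 x)"
proof -
 let ?B = "%x. abs (g0 x) + norm (f0 x)"
 \<comment> \<open>The truncated error plus the part by which the majorant falls short. It is
   dominated by a fixed integrable function, and together with \<open>g n x - g0 x\<close> it bounds
   the true error.\<close>
 let ?h = "%n x. min (norm (f n x - f0 x)) (?B x) + max 0 (g0 x - g n x)"
 note [measurable] = f[THEN borel_measurable_integrable] g[THEN borel_measurable_integrable]
 have B: "integrable M (%x. ?B x + abs (g0 x))" using f g by auto
 have g0: "0 <= g n x" for n x by (rule order_trans[OF norm_ge_zero le])
 have hB: "norm (?h n x) <= ?B x + abs (g0 x)" for n x using g0[of n x] by (auto simp: min_def max_def)
 have hi: "integrable M (?h n)" for n by (rule Bochner_Integration.integrable_bound[OF B]) (measurable, use hB in fastforce)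
 have "(%n. \<integral>x. ?h n x \<partial>M) \<longlonglongrightarrow> (LINT x|M. 0)"
 proof (rule integral_dominated_convergence[OF _ _ B])
  show "AE x in M. (%n. ?h n x) \<longlonglongrightarrow> 0"
   using lim
  proof eventually_elim
   case (elim x)
   have "(%n. ?h n x) \<longlonglongrightarrow> min (norm (f0 x - f0 x)) (?B x) + max 0 (g0 x - g0 x)" by (intro tendsto_intros elim)
   then show ?case by simp
  qed
 qed (measurable, use hB in simp)
 moreover have "(%n. (LINT x|M. g n x) - (LINT x|M. g0 x)) \<longlonglongrightarrow> 0" using int by (rule LIM_zero)
 ultimately have l: "(%n. (LINT x|M. ?h n x) + ((LINT x|M. g n x) - (LINT x|M. g0 x))) \<longlonglongrightarrow> 0"
  using tendsto_add by fastforce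
 have "norm ((LINT x|M. f n x) - (LINT x|M. f0 x)) <= (LINT x|M. ?h n x) + ((LINT x|M. g n x) - (LINT x|M. g0 x))" for n
 proof -
  have "norm (LINT x|M. f n x - f0 x) <= (LINT x|M. ?h n x + (g n x - g0 x))"
  proof (rule order_trans[OF integral_norm_bound integral_mono])
   show "integrable M (%x. norm (f n x - f0 x))" using f by auto
   show "integrable M (%x. ?h n x + (g n x - g0 x))" using hi[of n] g by auto
   show "norm (f n x - f0 x) <= ?h n x + (g n x - g0 x)" for x
    using le[of n x] norm_triangle_ineq4[of "f n x" "f0 x"] by (auto simp: min_def max_def)
  qed
  then show ?thesis using f g hi[of n] by simp
 qed
 then show ?thesis by (intro LIM_zero_cancel[OF Lim_null_comparison[OF _ l]]) auto
qed

definition vconv :: "(real => real => real => 'a::euclidean_space) => real => real => 'a" where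
 "vconv k t x = (LINT s:{0<..<t}|lborel. k s (t - s) x)"

text \<open>\<open>k s \<tau> x\<close> is the effect at \<open>x\<close>, after elapsed time
  \<tau>, of a source at time \<open>s\<close>. Continuity is asked only in \<tau> and
  \<open>x\<close>, where the heat kernel smooths; in \<open>s\<close> mere measurability is
  asked.\<close>

locale volterra =
 fixes k :: "real => real => real => 'a::euclidean_space" and T p Q L :: real
 assumes cont: "!!s. s : {0<..<T} ==> continuous_on ({0<..} \<times> UNIV) (%(\<tau>, x). k s \<tau> x)"
  and meas: "!!t x. set_borel_measurable lborel {0<..<T} (%s. k s (t - s) x)"
  and bnd: "!!s \<tau> x. s : {0<..<T} ==> \<tau> : {0<..T} ==>
   norm (k s \<tau> x) <= Q * (\<tau> powr (- p) * (rsqrt s * exp (L * s)))"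
  and p: "0 <= p" "p < 1" and Q: "Q >= 0" and L: "L > 0"
begin

lemma kern_le: "s : {0<..<t} ==> t <= T ==> norm (k s (t - s) x) <= Q * kern p L t s"
 unfolding kern_def by (rule bnd) auto

lemma meas_sub: "t <= T ==> set_borel_measurable lborel {0<..<t} (%s. k s (t' - s) x)"
 by (rule set_borel_measurable_subset[OF meas]) auto

lemma integrable_k:
 assumes t: "t : {0<..T}"
 shows "set_integrable lborel {0<..<t} (%s. k s (t - s) x)"
proof (rule set_integrable_bound)
 show "set_integrable lborel {0<..<t} (%s. Q * kern p L t s)"
  by (intro set_integrable_mult_right kern_bound(1)[where \<epsilon> = 0]) (use L t p in auto)
 show "set_borel_measurable lborel {0<..<t} (%s. k s (t - s) x)" by (rule meas_sub) (use t in auto)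
 show "AE s in lborel. s : {0<..<t} --> norm (k s (t - s) x) <= norm (Q * kern p L t s)"
  using kern_le[of _ t x] t Q kern_nonneg[of p L t] by (intro AE_I2) (auto simp: abs_mult)
qed

lemma vconv_bound:
 assumes t: "t : {0<..T}" and \<epsilon>: "0 <= \<epsilon>" "p + \<epsilon> < 1"
 shows "norm (vconv k t x) <= Q * (Beta (1 / 2) (1 - p - \<epsilon>) * (exp (L * t) * L powr (- \<epsilon>) * t powr (1 / 2 - p - \<epsilon>)))"
proof -
 have \<epsilon>': "\<epsilon> <= 1" using \<epsilon> p by simp
 have "norm (vconv k t x) <= (LINT s:{0<..<t}|lborel. norm (k s (t - s) x))"
  unfolding vconv_def by (rule set_integral_norm_bound[OF integrable_k[OF t]])
 also have "... <= (LINT s:{0<..<t}|lborel. Q * kern p L t s)"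
  by (rule set_integral_mono) (use t kern_le \<epsilon> \<epsilon>' L in "auto intro!: set_integrable_norm integrable_k set_integrable_mult_right kern_bound(1)")
 also have "... = Q * (LINT s:{0<..<t}|lborel. kern p L t s)" by simp
 also have "... <= Q * (Beta (1 / 2) (1 - p - \<epsilon>) * (exp (L * t) * L powr (- \<epsilon>) * t powr (1 / 2 - p - \<epsilon>)))"
  by (intro mult_left_mono kern_bound(2) Q L \<epsilon> \<epsilon>') (use t in auto)
 finally show ?thesis .
qed

text \<open>Both the domain of integration and the singularity at \<open>s = t\<close> move with
  \<open>t\<close>. The integrals of the majorants have a closed form that is continuous in
  \<open>t\<close>, which is what \<open>integral_pratt_convergence\<close> asks for.\<close>

lemma vconv_continuous: "continuous_on ({0<..T} \<times> UNIV) (%(t, x). vconv k t x)"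
 unfolding continuous_on_sequentially
proof (intro allI ballI impI)
 fix q :: "nat => real \<times> real" and q0
 assume q0: "q0 : {0<..T} \<times> (UNIV :: real set)" and q: "(ALL n. q n : {0<..T} \<times> UNIV) & q \<longlonglongrightarrow> q0"
 let ?K = "Q * exp (L * T)"
 let ?f = "%q s. indicator {0<..<fst q} s *\<^sub>R k s (fst q - s) (snd q)"
  and ?g = "%q s. ?K * (indicator {0<..<fst q} s *\<^sub>R ((fst q - s) powr (- p) * rsqrt s))"
 have t: "fst q0 : {0<..T}" "fst (q n) : {0<..T}" for n using q0 q by (auto simp: mem_Times_iff)
 have lim: "(%n. fst (q n)) \<longlonglongrightarrow> fst q0" "(%n. snd (q n)) \<longlonglongrightarrow> snd q0" using q by (auto intro: tendsto_fst tendsto_snd)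
 have fi: "integrable lborel (?f q)" if "fst q : {0<..T}" for q
  using integrable_k[OF that] by (simp add: set_integrable_def)
 have gi: "integrable lborel (?g q)" "(LINT s|lborel. ?g q s) = ?K * (Beta (1 / 2) (1 - p) * fst q powr (1 / 2 - p))" if "fst q : {0<..T}" for q
  using singular_kernel_integral[OF p(2), of "fst q"] that by (auto simp: set_integrable_def set_lebesgue_integral_def)
 \<comment> \<open>Away from the single time \<open>s = fst q0\<close>, a null set, the indicator of
   the moving interval is eventually constant.\<close>
 have cut: "(%n. indicator {0<..<fst (q n)} s *\<^sub>R F n) \<longlonglongrightarrow> indicator {0<..<fst q0} s *\<^sub>R (F0 :: 'b::real_normed_vector)"
  if s: "s ~= fst q0" and F: "s : {0<..<fst q0} ==> F \<longlonglongrightarrow> F0" for s F F0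
 proof (cases "s < fst q0")
  case True
  have "\<forall>\<^sub>F n in sequentially. indicator {0<..<fst q0} s *\<^sub>R F n = indicator {0<..<fst (q n)} s *\<^sub>R F n"
   using order_tendstoD(1)[OF lim(1) True] by eventually_elim (use True in "auto simp: indicator_def")
  moreover have "(%n. indicator {0<..<fst q0} s *\<^sub>R F n) \<longlonglongrightarrow> indicator {0<..<fst q0} s *\<^sub>R F0"
   using F by (cases "s : {0<..<fst q0}") auto
  ultimately show ?thesis by (rule Lim_transform_eventually[rotated])
 next
  case False
  have "\<forall>\<^sub>F n in sequentially. indicator {0<..<fst (q n)} s *\<^sub>R F n = indicator {0<..<fst q0} s *\<^sub>R F0"
   using order_tendstoD(2)[OF lim(1), of s] s False by (auto simp: indicator_def elim: eventually_mono)
  then show ?thesis by (rule tendsto_eventually)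
 qed
 have ae: "AE s in lborel. s ~= fst q0" by (rule AE_lborel_singleton)
 have "(%n. \<integral>s. ?f (q n) s \<partial>lborel) \<longlonglongrightarrow> (LINT s|lborel. ?f q0 s)"
 proof (rule integral_pratt_convergence[OF fi[OF t(2)] fi[OF t(1)] gi(1)[OF t(2)] gi(1)[OF t(1)]])
  show "AE s in lborel. (%n. ?f (q n) s) \<longlonglongrightarrow> ?f q0 s"
   using ae
  proof eventually_elim
   case (elim s)
   show ?case
   proof (rule cut[OF elim])
    assume s: "s : {0<..<fst q0}"
    then have "(fst q0 - s, snd q0) : interior ({0<..} \<times> UNIV)" "s : {0<..<T}" using t(1) by (auto simp: interior_Times interior_open)
    then have "continuous (at (fst q0 - s, snd q0)) (%(\<tau>, x). k s \<tau> x)" using cont continuous_on_interior by blast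
    moreover have "(%n. (fst (q n) - s, snd (q n))) \<longlonglongrightarrow> (fst q0 - s, snd q0)" by (intro tendsto_intros lim)
    ultimately show "(%n. k s (fst (q n) - s) (snd (q n))) \<longlonglongrightarrow> k s (fst q0 - s) (snd q0)"
     using isCont_tendsto_compose by fastforce
   qed
  qed
  show "AE s in lborel. (%n. ?g (q n) s) \<longlonglongrightarrow> ?g q0 s"
   using ae by eventually_elim (intro tendsto_mult_left cut, auto intro!: tendsto_intros lim)
  show "norm (?f (q n) s) <= ?g (q n) s" for n s
  proof (cases "s : {0<..<fst (q n)}")
   case True
   have "exp (L * s) <= exp (L * T)" using True t(2)[of n] L by simp
   then have "kern p L (fst (q n)) s <= (fst (q n) - s) powr (- p) * (rsqrt s * exp (L * T))"
    unfolding kern_def by (intro mult_left_mono) auto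
   then have "Q * kern p L (fst (q n)) s <= Q * ((fst (q n) - s) powr (- p) * (rsqrt s * exp (L * T)))"
    by (rule mult_left_mono[OF _ Q])
   then show ?thesis using kern_le[OF True, of "snd (q n)"] t(2)[of n] True by (simp add: mult_ac)
  qed (use Q in simp)
  show "(%n. \<integral>s. ?g (q n) s \<partial>lborel) \<longlonglongrightarrow> (LINT s|lborel. ?g q0 s)"
   unfolding gi(2)[OF t(1)] gi(2)[OF t(2)] by (intro tendsto_intros lim) (use t in auto)
 qed
 then show "((%(t, x). vconv k t x) \<circ> q) \<longlonglongrightarrow> (%(t, x). vconv k t x) q0"
  by (simp add: vconv_def set_lebesgue_integral_def case_prod_beta' o_def)
qed

end

lemma vconv_has_vector_derivative:
 assumes k: "volterra k T p Q L" and k': "volterra k' T p' Q' L"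
  and der: "!!s \<tau> x. s : {0<..<T} ==> \<tau> > 0 ==> (k s \<tau> has_vector_derivative k' s \<tau> x) (at x)"
  and t: "t : {0<..T}"
 shows "(vconv k t has_vector_derivative vconv k' t x) (at x)"
proof -
 interpret k: volterra k T p Q L by fact
 interpret k': volterra k' T p' Q' L by fact
 have "((%x. \<integral>s. indicator {0<..<t} s *\<^sub>R k s (t - s) x \<partial>lborel) has_vector_derivative (LINT s|lborel. indicator {0<..<t} s *\<^sub>R k' s (t - s) x)) (at x)"
 proof (rule has_vector_derivative_integral_param(1)[where e = 1 and \<Psi> = "%s. indicator {0<..<t} s *\<^sub>R (Q' * kern p' L t s)"])
  show "integrable lborel (%s. indicator {0<..<t} s *\<^sub>R k s (t - s) x)" for x
   using k.integrable_k[OF t, of x] by (simp add: set_integrable_def)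
  show "((%x. indicator {0<..<t} s *\<^sub>R k s (t - s) x) has_vector_derivative indicator {0<..<t} s *\<^sub>R k' s (t - s) x) (at x)" for x s
  proof (cases "s : {0<..<t}")
   case True
   then have "(k s (t - s) has_vector_derivative k' s (t - s) x) (at x)" using t by (intro der) auto
   with True show ?thesis by simp
  qed simp
  show "norm (indicator {0<..<t} s *\<^sub>R k' s (t - s) x) <= indicator {0<..<t} s *\<^sub>R (Q' * kern p' L t s)" for x s
   using k'.kern_le[of s t x] t by (auto simp: indicator_def)
  have "set_integrable lborel {0<..<t} (%s. Q' * kern p' L t s)"
   by (intro set_integrable_mult_right kern_bound(1)[where \<epsilon> = 0]) (use k'.L t k'.p in auto)
  then show "integrable lborel (%s. indicator {0<..<t} s *\<^sub>R (Q' * kern p' L t s))"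
   by (simp add: set_integrable_def)
 qed simp
 then show ?thesis by (simp add: vconv_def[abs_def] set_lebesgue_integral_def)
qed

section \<open>The Duhamel map\<close>

definition heat_volterra_const :: "real => real => real" where
 "heat_volterra_const \<alpha> T = heat_div_const \<alpha> T * (1 + T powr ((1 - \<alpha>) / 2))"

lemma heat_volterra_const_pos: "heat_volterra_const \<alpha> T > 0"
 unfolding heat_volterra_const_def by (intro mult_pos_pos heat_div_const_pos add_pos_nonneg) auto

lemma set_borel_measurable_restrict:
 fixes f :: "real => 'a::euclidean_space"
 shows "set_borel_measurable lborel {a<..<b} f \<longleftrightarrow> f : borel_measurable (restrict_space lborel {a<..<b})"
 unfolding set_borel_measurable_def by (subst borel_measurable_restrict_space_iff) auto

text \<open>Both coefficients of the flux are dominated by the same weight, so the milder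
  singularity of the Lipschitz part is raised to that of the Hoelder part. The exponents
  \<open>(1 - \<alpha>) / 2\<close> for the values and \<open>1 - \<alpha> / 2\<close> for the
  gradients are below 1.\<close>

lemma heat_volterra:
 fixes F :: "real => real => 'a::euclidean_space"
 assumes F: "!!s. s : {0<..<T} ==> hmod \<alpha> (Q * (rsqrt s * exp (L * s))) (Q * (rsqrt s * exp (L * s))) (F s)"
  and meas: "!!y. y : torus ==> set_borel_measurable lborel {0<..<T} (%s. F s y)"
  and \<alpha>: "0 < \<alpha>" "\<alpha> < 1" and T: "T <= T1" and Q: "Q >= 0" and L: "L > 0"
 shows "volterra (%s \<tau>. heat_div \<tau> (F s)) T ((1 - \<alpha>) / 2) (heat_volterra_const \<alpha> T1 * Q) L" (is ?A1)
  "volterra (%s \<tau>. heat_div' \<tau> (F s)) T (1 - \<alpha> / 2) (heat_volterra_const \<alpha> T1 * Q) L" (is ?A2)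
proof -
 let ?\<beta> = "%s. Q * (rsqrt s * exp (L * s))"
 let ?h = "heat_div_const \<alpha> T1" and ?T = "T1 powr ((1 - \<alpha>) / 2)"
 have \<beta>: "?\<beta> s >= 0" for s using Q by simp
 have \<alpha>': "\<alpha> <= 1" using \<alpha> by simp
 have h: "?h > 0" by (rule heat_div_const_pos)
 have m: "set_borel_measurable lborel {0<..<T} (%s. heat_div (t - s) (F s) x)"
  "set_borel_measurable lborel {0<..<T} (%s. heat_div' (t - s) (F s) x)" for t x
  unfolding set_borel_measurable_restrict
  by (rule heat_div_measurable[where A = ?\<beta> and B = ?\<beta> and \<alpha> = \<alpha>];
   use F meas \<alpha> \<alpha>' \<beta> in "simp add: space_restrict_space set_borel_measurable_restrict measurable_restrict_space1")+
 have c: "continuous_on ({0<..} \<times> UNIV) (%(\<tau>, x). heat_div \<tau> (F s) x)"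
  "continuous_on ({0<..} \<times> UNIV) (%(\<tau>, x). heat_div' \<tau> (F s) x)" if "s : {0<..<T}" for s
  unfolding case_prod_beta'
  by (rule heat_div_continuous[OF F[OF that] \<alpha>(1) \<alpha>' \<beta> \<beta>]; auto intro!: continuous_intros)+
 have \<tau>: "\<tau> powr (q + (1 - \<alpha>) / 2) <= ?T * \<tau> powr q" if "\<tau> : {0<..T}" for \<tau> q
 proof -
  have "\<tau> powr q * \<tau> powr ((1 - \<alpha>) / 2) <= \<tau> powr q * ?T"
   by (intro mult_left_mono powr_mono2) (use that \<alpha> T in auto)
  then show ?thesis by (simp add: powr_add mult.commute)
 qed
 have b: "norm (heat_div \<tau> (F s) x) <= heat_volterra_const \<alpha> T1 * Q * (\<tau> powr (- ((1 - \<alpha>) / 2)) * (rsqrt s * exp (L * s)))"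
  "norm (heat_div' \<tau> (F s) x) <= heat_volterra_const \<alpha> T1 * Q * (\<tau> powr (- (1 - \<alpha> / 2)) * (rsqrt s * exp (L * s)))"
  if s: "s : {0<..<T}" and t: "\<tau> : {0<..T}" for s \<tau> x
 proof -
  have t1: "0 < \<tau>" "\<tau> <= T1" using t T by auto
  have e: "(\<alpha> - 1) / 2 = - ((1 - \<alpha>) / 2)" "(\<alpha> - 2) / 2 = - (1 - \<alpha> / 2)" "- (1 - \<alpha> / 2) + (1 - \<alpha>) / 2 = - 1 / 2"
   by (simp_all add: field_simps)
  have "norm (heat_div \<tau> (F s) x) <= ?h * (?\<beta> s * \<tau> powr ((\<alpha> - 1) / 2) + ?\<beta> s)"
   by (rule heat_div_bounds(1)[OF F[OF s] \<alpha>(1) \<alpha>' \<beta> \<beta> t1])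
  also have "... <= ?h * (?\<beta> s * \<tau> powr (- ((1 - \<alpha>) / 2)) + ?\<beta> s * (?T * \<tau> powr (- ((1 - \<alpha>) / 2))))"
  proof -
   have "1 <= ?T * \<tau> powr (- ((1 - \<alpha>) / 2))" using \<tau>[OF t, of "- ((1 - \<alpha>) / 2)"] t by simp
   from mult_left_mono[OF this \<beta>[of s]] show ?thesis unfolding e using h \<beta>[of s] by (intro mult_left_mono add_mono) auto
  qed
  also have "... = heat_volterra_const \<alpha> T1 * Q * (\<tau> powr (- ((1 - \<alpha>) / 2)) * (rsqrt s * exp (L * s)))"
   by (simp add: heat_volterra_const_def algebra_simps)
  finally show "norm (heat_div \<tau> (F s) x) <= heat_volterra_const \<alpha> T1 * Q * (\<tau> powr (- ((1 - \<alpha>) / 2)) * (rsqrt s * exp (L * s)))" .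
  have "norm (heat_div' \<tau> (F s) x) <= ?h * (?\<beta> s * \<tau> powr ((\<alpha> - 2) / 2) + ?\<beta> s * \<tau> powr (- 1 / 2))"
   by (rule heat_div_bounds(2)[OF F[OF s] \<alpha>(1) \<alpha>' \<beta> \<beta> t1])
  also have "... <= ?h * (?\<beta> s * \<tau> powr (- (1 - \<alpha> / 2)) + ?\<beta> s * (?T * \<tau> powr (- (1 - \<alpha> / 2))))"
  proof -
   have "\<tau> powr (- 1 / 2) <= ?T * \<tau> powr (- (1 - \<alpha> / 2))" using \<tau>[OF t, of "- (1 - \<alpha> / 2)"] unfolding e .
   then show ?thesis unfolding e using h \<beta>[of s] by (intro add_mono mult_left_mono) auto
  qed
  also have "... = heat_volterra_const \<alpha> T1 * Q * (\<tau> powr (- (1 - \<alpha> / 2)) * (rsqrt s * exp (L * s)))"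
   by (simp add: heat_volterra_const_def algebra_simps)
  finally show "norm (heat_div' \<tau> (F s) x) <= heat_volterra_const \<alpha> T1 * Q * (\<tau> powr (- (1 - \<alpha> / 2)) * (rsqrt s * exp (L * s)))" .
 qed
 have "heat_volterra_const \<alpha> T1 * Q >= 0" using heat_volterra_const_pos[of \<alpha> T1] Q by simp
 then show ?A1
  ?A2
  using c m b \<alpha> L by (unfold_locales; simp)+
qed

definition duhamel_const :: "real => real => real => real" where
 "duhamel_const \<alpha> \<epsilon> T = heat_volterra_const \<alpha> T * (abs (Beta (1 / 2) (1 - (1 - \<alpha>) / 2 - \<epsilon>)) + abs (Beta (1 / 2) (1 - (1 - \<alpha> / 2) - \<epsilon>)))"

lemma duhamel_const_nonneg: "duhamel_const \<alpha> \<epsilon> T >= 0"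
 unfolding duhamel_const_def by (intro mult_nonneg_nonneg add_nonneg_nonneg less_imp_le[OF heat_volterra_const_pos]) auto

text \<open>Between the two bounds lies exactly the factor \<open>rsqrt t\<close>, the weight in
  which gradients are measured. The Duhamel map therefore preserves the weighted class, with
  smallness available from \<open>L\<close> or from \<open>t\<close>.\<close>

lemma duhamel_bound:
 fixes F :: "real => real => 'a::euclidean_space"
 assumes V: "volterra (%s \<tau>. heat_div \<tau> (F s)) T ((1 - \<alpha>) / 2) (heat_volterra_const \<alpha> T1 * Q) L"
  "volterra (%s \<tau>. heat_div' \<tau> (F s)) T (1 - \<alpha> / 2) (heat_volterra_const \<alpha> T1 * Q) L"
  and \<epsilon>: "0 <= \<epsilon>" "\<epsilon> < \<alpha> / 2" and \<alpha>: "0 < \<alpha>" "\<alpha> < 1" and t: "t : {0<..T}" and Q: "Q >= 0"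
 shows "norm (vconv (%s \<tau>. heat_div \<tau> (F s)) t x) <= duhamel_const \<alpha> \<epsilon> T1 * Q * (exp (L * t) * L powr (- \<epsilon>) * t powr (\<alpha> / 2 - \<epsilon>))" (is ?A1)
  "norm (vconv (%s \<tau>. heat_div' \<tau> (F s)) t x) <= duhamel_const \<alpha> \<epsilon> T1 * Q * (exp (L * t) * L powr (- \<epsilon>) * t powr (\<alpha> / 2 - \<epsilon>)) * rsqrt t" (is ?A2)
proof -
 interpret v1: volterra "%s \<tau>. heat_div \<tau> (F s)" T "(1 - \<alpha>) / 2" "heat_volterra_const \<alpha> T1 * Q" L by (rule V)
 interpret v2: volterra "%s \<tau>. heat_div' \<tau> (F s)" T "1 - \<alpha> / 2" "heat_volterra_const \<alpha> T1 * Q" L by (rule V)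
 let ?c = "heat_volterra_const \<alpha> T1" and ?B1 = "Beta (1 / 2) (1 - (1 - \<alpha>) / 2 - \<epsilon>)" and ?B2 = "Beta (1 / 2) (1 - (1 - \<alpha> / 2) - \<epsilon>)"
 have c: "?c > 0" by (rule heat_volterra_const_pos)
 have gen: "?c * Q * (B * E) <= duhamel_const \<alpha> \<epsilon> T1 * Q * E" if "B = ?B1 \<or> B = ?B2" "E >= 0" for B E
 proof -
  have "B * (?c * Q * E) <= (abs (?B1) + abs (?B2)) * (?c * Q * E)"
   by (rule mult_right_mono) (use that c Q in auto)
  then show ?thesis by (simp add: duhamel_const_def mult_ac)
 qed
 have "norm (vconv (%s \<tau>. heat_div \<tau> (F s)) t x) <= ?c * Q * (?B1 * (exp (L * t) * L powr (- \<epsilon>) * t powr (1 / 2 - (1 - \<alpha>) / 2 - \<epsilon>)))"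
  by (rule v1.vconv_bound[OF t \<epsilon>(1)]) (use \<epsilon> \<alpha> in "simp add: field_simps")
 also have "... <= duhamel_const \<alpha> \<epsilon> T1 * Q * (exp (L * t) * L powr (- \<epsilon>) * t powr (1 / 2 - (1 - \<alpha>) / 2 - \<epsilon>))"
  by (rule gen) auto
 also have "1 / 2 - (1 - \<alpha>) / 2 - \<epsilon> = \<alpha> / 2 - \<epsilon>" by (simp add: field_simps)
 finally show ?A1 .
 have "norm (vconv (%s \<tau>. heat_div' \<tau> (F s)) t x) <= ?c * Q * (?B2 * (exp (L * t) * L powr (- \<epsilon>) * t powr (1 / 2 - (1 - \<alpha> / 2) - \<epsilon>)))"
  by (rule v2.vconv_bound[OF t \<epsilon>(1)]) (use \<epsilon> \<alpha> in "simp add: field_simps")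
 also have "... <= duhamel_const \<alpha> \<epsilon> T1 * Q * (exp (L * t) * L powr (- \<epsilon>) * t powr (1 / 2 - (1 - \<alpha> / 2) - \<epsilon>))"
  by (rule gen) auto
 also have "1 / 2 - (1 - \<alpha> / 2) - \<epsilon> = (\<alpha> / 2 - \<epsilon>) + (- 1 / 2)" by (simp add: field_simps)
 finally show ?A2
  by (simp only: powr_add mult.assoc)
qed

section \<open>Measurability and moduli of the flux along a time interval\<close>

lemma measurable_matrix_vector:
 fixes A :: "'s => real^'n^'m"
 assumes "A : borel_measurable M" "x : borel_measurable M"
 shows "(%s. A s *v x s) : borel_measurable M"
proof (rule borel_measurable_continuous_Pair[OF assms])
 show "continuous_on UNIV (%p. fst p *v snd p :: real^'m)"
  unfolding matrix_vector_mult_def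
  by (intro continuous_on_vec_lambda continuous_on_sum continuous_on_mult continuous_on_component continuous_intros)
qed

lemma measurable_integral_interval:
 fixes D :: "'s => real => 'a::euclidean_space"
 assumes D: "!!y. (%s. D s y) : borel_measurable M" "!!s. s : space M ==> continuous_on UNIV (D s)"
 shows "(%s. integral {a..b} (D s)) : borel_measurable M"
proof -
 have "(%(s, y). D s y) : borel_measurable (M \<Otimes>\<^sub>M borel)" by (rule caratheodory_measurable[OF D])
 then have [measurable]: "(%p. D (fst p) (snd p)) : borel_measurable (M \<Otimes>\<^sub>M lborel)" by (simp add: case_prod_beta')
 have "(%(s, y). indicator {a..b} y *\<^sub>R D s y) : borel_measurable (M \<Otimes>\<^sub>M lborel)"
  unfolding case_prod_beta' by measurable
 then have "(%s. \<integral>y. indicator {a..b} y *\<^sub>R D s y \<partial>lborel) : borel_measurable M"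
  by (rule lborel.borel_measurable_lebesgue_integral[of _ M])
 moreover have "(LINT y|lborel. indicator {a..b} y *\<^sub>R D s y) = integral {a..b} (D s)" if "s : space M" for s
  using set_borel_integral_eq_integral(2)[OF borel_integrable_atLeastAtMost'[OF continuous_on_subset[OF D(2)[OF that] subset_UNIV]]]
  by (simp add: set_lebesgue_integral_def)
 ultimately show ?thesis by (rule measurable_cong[THEN iffD1, rotated])
qed

text \<open>\<open>T1\<close> is a reference horizon on which all constants depend, kept apart from
  \<open>T\<close> so that \<open>T\<close> can be decreased without changing them. The
  nonlinearities are controlled on radius \<open>2 * \<rho>\<close> because \<open>X\<close> and
  \<open>v\<close> each contribute up to \<rho>.\<close>

locale rough_data =
 fixes X :: "real => real => real^'n" and XX :: "real => real => real => real^'n^'n"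
  and f :: "real^'n => real^'n" and g :: "real^'n => real^'n^'n" and \<alpha> a b C \<rho> T T1 :: real
 assumes T: "0 < T" "T <= T1" and \<alpha>: "1 / 3 < \<alpha>" "\<alpha> < 1 / 2" and a: "a >= 0"
  and rb: "!!t. t : {0..T} ==> rough_bound \<alpha> a (X t) (XX t)"
  and Xper: "!!t. t : {0..T} ==> periodic (X t)" and Xcont: "!!t. t : {0..T} ==> continuous_on UNIV (X t)"
  and Xtime: "!!x. continuous_on {0..T} (%t. X t x)"
  and XXtime: "!!x y. x : torus ==> y : torus ==> continuous_on {0..T} (%t. XX t x y)"
  and Xb: "!!t x. t : {0..T} ==> norm (X t x) <= b"
  and nl: "nl_bounds C (2 * \<rho>) f g" and b\<rho>: "b <= \<rho>"
begin

lemma b_nonneg: "b >= 0" using Xb[of 0 0] T norm_ge_zero order_trans by (metis atLeastAtMost_iff less_imp_le order_refl)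

lemma X\<rho>: "t : {0..T} ==> norm (X t x) <= \<rho>" using Xb[of t x] b\<rho> by linarith

lemma C_pos: "C > 0" using nl by (simp add: nl_bounds_def)

abbreviation "drift_prim v w s y \<equiv> integral {0..y} (drift f g (X s) (v s) (w s))"

definition flux :: "(real => real => real^'n) => (real => real => real^'n) => real => real => real^'n" where
 "flux v w s y = drift_prim v w s y + rint g (X s) (XX s) (v s) y"

definition Kf :: real where
 "Kf = rough_flux_const CARD('n) \<alpha> a * C + (C + 1) * (1 + b)"

lemma rfc_nonneg: "rough_flux_const CARD('n) \<alpha> a >= 0" by (rule rough_flux_const_nonneg[OF a \<alpha>(1)])

lemma Kf_pos: "Kf > 0"
proof -
 have "(C + 1) * (1 + b) > 0" using C_pos b_nonneg by (intro mult_pos_pos) auto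
 moreover have "rough_flux_const CARD('n) \<alpha> a * C >= 0" using rfc_nonneg C_pos by simp
 ultimately show ?thesis unfolding Kf_def by linarith
qed

text \<open>The drift and the rough integral get bounds of their own besides those of the flux,
  because the mild formulation contains two time integrals that have to converge separately.\<close>

lemma flux_parts_hmod:
 assumes s: "s : {0..T}" and v: "slice \<rho> l (v s) (w s)" and z: "!!y. norm (v s y) <= z"
 shows "hmod \<alpha> (Kf * (1 + z + l)) (Kf * (1 + z + l)) (rint g (X s) (XX s) (v s))" (is ?A1)
  "hmod \<alpha> 0 (Kf * (1 + z + l)) (drift_prim v w s)" (is ?A2)
  "hmod \<alpha> (Kf * (1 + z + l)) (Kf * (1 + z + l)) (flux v w s)" (is ?A3)
proof -
 note sl = rb[OF s] a \<alpha> nl X\<rho>[OF s]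
 have z0: "0 <= z" by (rule order_trans[OF norm_ge_zero z])
 have l: "0 <= l" by (rule slice_l_nonneg[OF sl v])
 have r: "hmod \<alpha> (rough_flux_const CARD('n) \<alpha> a * C) (rough_flux_const CARD('n) \<alpha> a * (C * (1 + l))) (rint g (X s) (XX s) (v s))"
  by (rule rint_hmod(1)[OF sl v])
 have d: "hmod \<alpha> 0 ((C + 1) * (1 + b) * (1 + z + l)) (drift_prim v w s)"
  by (rule integral_hmod[OF drift_continuous[OF sl v Xcont[OF s]] drift_bound[OF sl v z Xb[OF s]]])
   (use C_pos b_nonneg z0 l in auto)
 have le: "rough_flux_const CARD('n) \<alpha> a * C <= rough_flux_const CARD('n) \<alpha> a * C * (1 + z + l)"
  "rough_flux_const CARD('n) \<alpha> a * (C * (1 + l)) <= rough_flux_const CARD('n) \<alpha> a * C * (1 + z + l)"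
  "0 <= rough_flux_const CARD('n) \<alpha> a * C * (1 + z + l)" "0 <= (C + 1) * (1 + b) * (1 + z + l)"
  using mult_left_mono[of 1 "1 + z + l" "rough_flux_const CARD('n) \<alpha> a * C"] mult_left_mono[of "1 + l" "1 + z + l" "rough_flux_const CARD('n) \<alpha> a * C"]
   rfc_nonneg C_pos z0 l b_nonneg by (auto simp: mult.assoc)
 have K: "Kf * (1 + z + l) = rough_flux_const CARD('n) \<alpha> a * C * (1 + z + l) + (C + 1) * (1 + b) * (1 + z + l)"
  by (simp add: Kf_def distrib_right)
 show ?A1
  ?A2
  by (rule hmod_mono[OF r] hmod_mono[OF d], use le K in linarith, use le K in linarith)+
 have "hmod \<alpha> (0 + rough_flux_const CARD('n) \<alpha> a * C) ((C + 1) * (1 + b) * (1 + z + l) + rough_flux_const CARD('n) \<alpha> a * (C * (1 + l)))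
  (%y. drift_prim v w s y - (- rint g (X s) (XX s) (v s) y))"
  by (rule hmod_diff[OF d]) (use r in "simp add: hmod_def norm_minus_commute")
 then have "hmod \<alpha> (0 + rough_flux_const CARD('n) \<alpha> a * C) ((C + 1) * (1 + b) * (1 + z + l) + rough_flux_const CARD('n) \<alpha> a * (C * (1 + l))) (flux v w s)"
  by (simp add: flux_def[abs_def])
 then show ?A3
  by (rule hmod_mono) (use le K in linarith)+
qed

text \<open>The bound contains the gradient bound \<open>l\<close> of the first solution but not the
  \<open>l'\<close> of the second. In the uniqueness proof the second solution is an arbitrary one,
  for which no pointwise gradient bound is available.\<close>

lemma flux_diff_hmod:
 assumes s: "s : {0..T}" and v: "slice \<rho> l (v s) (w s)" and v': "slice \<rho> l' (v' s) (w' s)"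
  and z: "!!y. norm (v s y - v' s y) <= z" and m: "!!y. norm (w s y - w' s y) <= m"
 shows "hmod \<alpha> (Kf * z) (Kf * (m + z * (1 + l))) (%y. flux v w s y - flux v' w' s y)"
proof -
 note sl = rb[OF s] a \<alpha> nl X\<rho>[OF s]
 have zm: "0 <= z" "0 <= m" by (rule order_trans[OF norm_ge_zero z] order_trans[OF norm_ge_zero m])+
 have l: "0 <= l" by (rule slice_l_nonneg[OF sl v])
 let ?D = "drift f g (X s) (v s) (w s)" and ?D' = "drift f g (X s) (v' s) (w' s)"
 let ?e = "m + z * (1 + l)"
 have e: "?e >= 0" using zm l by simp
 have Dc: "continuous_on UNIV ?D" "continuous_on UNIV ?D'"
  by (rule drift_continuous[OF sl v Xcont[OF s]] drift_continuous[OF sl v' Xcont[OF s]])+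
 have r: "hmod \<alpha> (rough_flux_const CARD('n) \<alpha> a * (C * z)) (rough_flux_const CARD('n) \<alpha> a * (C * ?e))
   (%y. rint g (X s) (XX s) (v s) y - rint g (X s) (XX s) (v' s) y)"
  by (rule rint_diff_hmod[OF sl v v' z m])
 have "hmod \<alpha> 0 ((C + 1) * ?e) (%y. integral {0..y} (%y. ?D y - ?D' y))"
  by (rule integral_hmod[OF _ drift_diff_bound[OF sl v v' z m]]) (use Dc C_pos e in "auto intro!: continuous_intros")
 moreover have "integral {0..y} (%y. ?D y - ?D' y) = integral {0..y} ?D - integral {0..y} ?D'" for y
  by (rule Henstock_Kurzweil_Integration.integral_diff)
   (auto intro!: integrable_continuous_real continuous_on_subset[OF Dc(1)] continuous_on_subset[OF Dc(2)])
 ultimately have d: "hmod \<alpha> 0 ((C + 1) * ?e) (%y. integral {0..y} ?D - integral {0..y} ?D')" by simp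
 have "hmod \<alpha> (0 + rough_flux_const CARD('n) \<alpha> a * (C * z)) ((C + 1) * ?e + rough_flux_const CARD('n) \<alpha> a * (C * ?e))
  (%y. (integral {0..y} ?D - integral {0..y} ?D') - (rint g (X s) (XX s) (v' s) y - rint g (X s) (XX s) (v s) y))"
 proof (rule hmod_diff[OF d])
  show "hmod \<alpha> (rough_flux_const CARD('n) \<alpha> a * (C * z)) (rough_flux_const CARD('n) \<alpha> a * (C * ?e))
   (%y. rint g (X s) (XX s) (v' s) y - rint g (X s) (XX s) (v s) y)"
   unfolding hmod_def
  proof (intro ballI)
   fix x y :: real assume "x : torus" "y : torus"
   with r have "norm (rint g (X s) (XX s) (v s) x - rint g (X s) (XX s) (v' s) x - (rint g (X s) (XX s) (v s) y - rint g (X s) (XX s) (v' s) y))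
    <= rough_flux_const CARD('n) \<alpha> a * (C * z) * abs (x - y) powr \<alpha> + rough_flux_const CARD('n) \<alpha> a * (C * ?e) * abs (x - y)"
    by (simp add: hmod_def)
   then show "norm (rint g (X s) (XX s) (v' s) x - rint g (X s) (XX s) (v s) x - (rint g (X s) (XX s) (v' s) y - rint g (X s) (XX s) (v s) y))
    <= rough_flux_const CARD('n) \<alpha> a * (C * z) * abs (x - y) powr \<alpha> + rough_flux_const CARD('n) \<alpha> a * (C * ?e) * abs (x - y)"
    by (subst norm_minus_commute) (simp add: algebra_simps)
  qed
 qed
 moreover have "(%y. (integral {0..y} ?D - integral {0..y} ?D') - (rint g (X s) (XX s) (v' s) y - rint g (X s) (XX s) (v s) y)) =
   (%y. flux v w s y - flux v' w' s y)" by (rule ext) (simp add: flux_def)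
 ultimately have H: "hmod \<alpha> (0 + rough_flux_const CARD('n) \<alpha> a * (C * z)) ((C + 1) * ?e + rough_flux_const CARD('n) \<alpha> a * (C * ?e))
  (%y. flux v w s y - flux v' w' s y)" by (simp only:)
 show ?thesis
 proof (rule hmod_mono[OF H])
  have p: "0 <= b * ?e" "0 <= (C + 1) * (b * ?e)" "0 <= (C + 1) * (1 + b) * z" using b_nonneg e C_pos zm by auto
  show "0 + rough_flux_const CARD('n) \<alpha> a * (C * z) <= Kf * z" using p by (simp add: Kf_def algebra_simps)
  show "(C + 1) * ?e + rough_flux_const CARD('n) \<alpha> a * (C * ?e) <= Kf * ?e"
  proof -
   have "Kf * ?e = rough_flux_const CARD('n) \<alpha> a * (C * ?e) + ((C + 1) * ?e + (C + 1) * (b * ?e))"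
    unfolding Kf_def by (simp only: distrib_right distrib_left mult.assoc mult_1 mult_1_right)
   then show ?thesis using p by linarith
  qed
 qed
qed

text \<open>The rough integral is a limit of dyadic sums along a fixed sequence, each a finite
  combination of quantities measurable in time; the drift part is a parametric integral of a
  Caratheodory function.\<close>

lemma flux_measurable:
 assumes v: "!!s. s : {0<..<T} ==> slice \<rho> (l s) (v s) (w s)"
  and vm: "!!y. set_borel_measurable lborel {0<..<T} (%s. v s y)" "!!y. set_borel_measurable lborel {0<..<T} (%s. w s y)"
  and y: "y : torus"
 shows "set_borel_measurable lborel {0<..<T} (%s. rint g (X s) (XX s) (v s) y)" (is ?A1)
  "set_borel_measurable lborel {0<..<T} (%s. drift_prim v w s y)" (is ?A2)
  "set_borel_measurable lborel {0<..<T} (%s. flux v w s y)" (is ?A3)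
proof -
 let ?M = "restrict_space lborel {0<..<T}"
 have s01: "{0<..<T} \<subseteq> {0..T}" by auto
 have sl: "rough_bound \<alpha> a (X s) (XX s)" "a >= 0" "1 / 3 < \<alpha>" "\<alpha> < 1 / 2" "nl_bounds C (2 * \<rho>) f g" "!!x. norm (X s x) <= \<rho>"
  if "s : {0<..<T}" for s using that s01 rb a \<alpha> nl X\<rho> by auto
 have cm: "h : borel_measurable ?M" if "continuous_on {0..T} h" for h :: "real => 'b::topological_space"
 proof -
  have "h : borel_measurable (restrict_space borel {0<..<T})"
   by (rule borel_measurable_continuous_on_restrict[OF continuous_on_subset[OF that s01]])
  then show ?thesis by (simp add: measurable_def space_restrict_space sets_restrict_space)
 qed
 have Xm [measurable]: "(%s. X s x) : borel_measurable ?M" for x by (rule cm[OF Xtime])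
 have XXm: "(%s. XX s x y) : borel_measurable ?M" if "x : torus" "y : torus" for x y by (rule cm[OF XXtime[OF that]])
 have vm' [measurable]: "(%s. v s y) : borel_measurable ?M" "(%s. w s y) : borel_measurable ?M" for y
  using vm by (auto simp: set_borel_measurable_restrict)
 have fgm [measurable]: "f : borel_measurable borel" "g : borel_measurable borel" "pdiff g k : borel_measurable borel" for k
  using nl by (auto simp: nl_bounds_def intro!: borel_measurable_continuous_onI)
 have dm: "(%s. drift f g (X s) (v s) (w s) y) : borel_measurable ?M" for y
  unfolding drift_def by (intro borel_measurable_add measurable_matrix_vector) measurable
 have "(%s. drift_prim v w s y) : borel_measurable ?M"
 proof (rule measurable_integral_interval[OF dm])
  fix s assume "s : space ?M"
  then have s: "s : {0<..<T}" by (simp add: space_restrict_space)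
  show "continuous_on UNIV (drift f g (X s) (v s) (w s))"
   by (rule drift_continuous[OF sl[OF s] v[OF s] Xcont]) (use s in auto)
 qed
 then show d: ?A2
  by (simp add: set_borel_measurable_restrict)
 let ?\<Xi> = "%s. rough_summand (X s) (XX s) (%y. g (X s y + v s y)) (%y k. pdiff g k (X s y + v s y))"
 have summ: "(%s. ?\<Xi> s p q) : borel_measurable ?M" if pq: "p : torus" "q : torus" for p q
 proof -
  have [measurable]: "(%s. XX s p q $ k) : borel_measurable ?M" for k
  proof (rule measurable_compose[OF XXm[OF pq]])
   show "(%A. A $ k) : borel_measurable borel" by (intro borel_measurable_continuous_onI continuous_intros)
  qed
  show ?thesis
   unfolding rough_summand_eq
   by (intro borel_measurable_add borel_measurable_sum measurable_matrix_vector borel_measurable_diff) measurable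
 qed
 have "(%s. rint g (X s) (XX s) (v s) y) : borel_measurable ?M"
 proof (rule borel_measurable_LIMSEQ_metric)
  show "(%s. sew_sum (?\<Xi> s) n 0 y) : borel_measurable ?M" for n
   unfolding sew_sum_def
  proof (intro borel_measurable_sum summ)
   fix i show "clip 0 y (grid n i) : torus" "clip 0 y (grid n (Suc i)) : torus"
    using y clip_bounds[of 0 y] by (auto intro: order_trans)
  qed
  fix s assume "s : space ?M"
  then have s: "s : {0<..<T}" by (simp add: space_restrict_space)
  have "0 <= (1 + real CARD('n)) * lip_const \<alpha> a * a * (C * (1 + l s))"
   using C_pos slice_l_nonneg[OF sl[OF s] v[OF s]] lip_const_nonneg[OF a] a by (intro mult_nonneg_nonneg) auto
  then show "(%n. sew_sum (?\<Xi> s) n 0 y) \<longlonglongrightarrow> rint g (X s) (XX s) (v s) y"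
   unfolding rint_def
   by (intro sew_convergent[OF rint_hmod(2)[OF sl[OF s] v[OF s]]]) (use \<alpha> y in auto)
 qed
 then show r: ?A1
  by (simp add: set_borel_measurable_restrict)
 show ?A3
  using d r unfolding set_borel_measurable_restrict flux_def by (rule borel_measurable_add)
qed

end

section \<open>Existence by Picard iteration\<close>

text \<open>\<open>M * exp (L * t)\<close> is the a priori bound of the solution. The assumption
  \<open>inv\<close> says that the linear evolution and the Duhamel term together do not exceed it,
  and the last one that it stays within the radius on which \<open>f\<close> and \<open>g\<close>
  are controlled.\<close>

locale rough_ivp = rough_data X XX f g \<alpha> a b C \<rho> T T1
 for X :: "real => real => real^'n" and XX f g \<alpha> a b C \<rho> T T1 +
 fixes v0 :: "real => real^'n" and V L M :: real
 assumes v0: "periodic v0" "continuous_on UNIV v0" "!!x. norm (v0 x) <= V"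
  and L: "L > 0" and M: "M >= 0"
  and inv: "(gauss_mom G0 + gauss_mom G1) * V +
   duhamel_const \<alpha> (\<alpha> / 4) T1 * (Kf * ((1 + T1 powr (1 / 2)) * (1 + M))) * (T / L) powr (\<alpha> / 4) <= M"
  and M\<rho>: "M * exp (L * T) <= \<rho>"
begin

section \<open>The invariant class and the Duhamel map\<close>

definition lin :: "real => real => real^'n" where
 "lin t x = exp (- t) *\<^sub>R gauss_op G0 (sqrt t) v0 x"

definition lin' :: "real => real => real^'n" where
 "lin' t x = exp (- t) *\<^sub>R (gauss_op G1 (sqrt t) v0 x /\<^sub>R sqrt t)"

text \<open>The weight \<open>rsqrt t\<close> is forced by initial data that are merely bounded,
  whose heat flow has gradient of that order. Only positive times are included; the behaviour at 0
  is recovered later from the Duhamel formula.\<close>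

definition adm :: "(real => real => real^'n) => (real => real => real^'n) => bool" where
 "adm v w \<longleftrightarrow> continuous_on ({0<..T} \<times> UNIV) (%(t, x). v t x) & continuous_on ({0<..T} \<times> UNIV) (%(t, x). w t x) &
  (ALL t:{0<..T}. periodic (v t) & (ALL x. (v t has_vector_derivative w t x) (at x) &
    norm (v t x) <= M * exp (L * t) & norm (w t x) <= M * exp (L * t) * rsqrt t))"

definition mapv where "mapv v w t x = lin t x + vconv (%s \<tau>. heat_div \<tau> (flux v w s)) t x"
definition mapw where "mapw v w t x = lin' t x + vconv (%s \<tau>. heat_div' \<tau> (flux v w s)) t x"

lemma V_nonneg: "V >= 0" by (rule order_trans[OF norm_ge_zero v0(3)[of 0]])

lemma v0_meas: "v0 : borel_measurable borel" by (rule borel_measurable_continuous_UNIV[OF v0(2)])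

lemma lin_facts:
 "continuous_on ({0<..T} \<times> UNIV) (%(t, x). lin t x)" "continuous_on ({0<..T} \<times> UNIV) (%(t, x). lin' t x)"
 "t : {0<..T} ==> periodic (lin t)" "t : {0<..T} ==> (lin t has_vector_derivative lin' t x) (at x)"
 "t : {0<..T} ==> norm (lin t x) <= (gauss_mom G0 + gauss_mom G1) * V"
 "t : {0<..T} ==> norm (lin' t x) <= (gauss_mom G0 + gauss_mom G1) * V * rsqrt t"
proof -
 have c: "continuous_on ({0<..T} \<times> UNIV) (%p. gauss_op \<phi> (sqrt (fst p)) v0 (snd p))" if "gauss_bounded \<phi>" for \<phi>
  by (rule gauss_op_continuous[OF that v0(2,3)]) (auto intro!: continuous_intros)
 show "continuous_on ({0<..T} \<times> UNIV) (%(t, x). lin t x)" "continuous_on ({0<..T} \<times> UNIV) (%(t, x). lin' t x)"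
  unfolding lin_def lin'_def case_prod_beta' by (intro continuous_intros c G_gauss_bounded; force)+
 assume t: "t : {0<..T}"
 then have st: "sqrt t > 0" by simp
 have "v0 (x + 2 * pi - r * y) = v0 (x - r * y)" for x r y
  using v0(1) unfolding periodic_def by (metis add.commute add_diff_eq)
 then show "periodic (lin t)" by (simp add: periodic_def lin_def gauss_op_def)
 have "((%x. exp (- t) *\<^sub>R gauss_op G0 (sqrt t) v0 x) has_vector_derivative exp (- t) *\<^sub>R (gauss_op G1 (sqrt t) v0 x /\<^sub>R sqrt t)) (at x)"
  using has_vector_derivative_scaleR[OF DERIV_const gauss_op_has_vector_derivative[OF G_gauss_bounded(1,2) G0_deriv v0_meas v0(3) st]]
  by simp
 then show "(lin t has_vector_derivative lin' t x) (at x)" by (simp add: lin_def[abs_def] lin'_def)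
 have m: "gauss_mom G0 >= 0" "gauss_mom G1 >= 0" by (rule gauss_mom_nonneg)+
 have e: "exp (- t) <= 1" using t by simp
 have "exp (- t) * norm (gauss_op G0 (sqrt t) v0 x) <= 1 * (gauss_mom G0 * V)"
  by (intro mult_mono e gauss_op_norm_le[OF G_gauss_bounded(1) v0_meas v0(3)]) auto
 also have "... <= (gauss_mom G0 + gauss_mom G1) * V" using m V_nonneg by (simp add: mult_right_mono)
 finally show "norm (lin t x) <= (gauss_mom G0 + gauss_mom G1) * V" by (simp add: lin_def)
 have "exp (- t) * (norm (gauss_op G1 (sqrt t) v0 x) * rsqrt t) <= 1 * ((gauss_mom G1 * V) * rsqrt t)"
  by (intro mult_mono mult_right_mono e gauss_op_norm_le[OF G_gauss_bounded(2) v0_meas v0(3)]) auto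
 also have "... <= (gauss_mom G0 + gauss_mom G1) * V * rsqrt t" using m V_nonneg by (simp add: mult_right_mono)
 finally show "norm (lin' t x) <= (gauss_mom G0 + gauss_mom G1) * V * rsqrt t"
  using t by (simp add: lin'_def powr_minus powr_half_sqrt mult.commute)
qed

lemma adm_slice:
 assumes "adm v w" "t : {0<..T}"
 shows "slice \<rho> (M * exp (L * t) * rsqrt t) (v t) (w t)"
proof -
 have "continuous_on UNIV (%x. (%(t, x). w t x) (t, x))"
  by (rule continuous_on_compose2[of "{0<..T} \<times> UNIV"]) (use assms in "auto simp: adm_def intro!: continuous_intros")
 moreover have "M * exp (L * t) <= M * exp (L * T)" using assms(2) M L by (intro mult_left_mono) auto
 then have "norm (v t y) <= \<rho>" for y using assms M\<rho> unfolding adm_def by (meson order_trans)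
 ultimately show ?thesis using assms unfolding slice_def adm_def by auto
qed

lemma adm_measurable:
 assumes "adm v w"
 shows "set_borel_measurable lborel {0<..<T} (%s. v s y)" (is ?A1) "set_borel_measurable lborel {0<..<T} (%s. w s y)" (is ?A2)
proof -
 have "set_borel_measurable lborel {0<..<T} (%s. u s y)" if "continuous_on ({0<..T} \<times> UNIV) (%(t, x). u t x)" for u :: "real => real => real^'n"
 proof -
  have "continuous_on {0<..<T} (%s. (%(t, x). u t x) (s, y))"
   by (rule continuous_on_compose2[OF that]) (auto intro!: continuous_intros)
  then have "(%s. u s y) : borel_measurable (restrict_space borel {0<..<T})"
   by (intro borel_measurable_continuous_on_restrict) simp
  then show ?thesis unfolding set_borel_measurable_restrict by (simp add: measurable_def space_restrict_space sets_restrict_space)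
 qed
 then show ?A1 ?A2
  using assms by (auto simp: adm_def)
qed

definition Qf :: real where "Qf = Kf * ((1 + T1 powr (1 / 2)) * (1 + M))"

lemma Qf_nonneg: "Qf >= 0" using Kf_pos M by (simp add: Qf_def)

lemma one_le_weight:
 assumes "s : {0<..T}" "L' >= 0"
 shows "1 <= T1 powr (1 / 2) * (rsqrt s * exp (L' * s))" (is ?A) "1 <= T1 powr (1 / 2) * rsqrt s"
proof -
 have "s powr (1 / 2) * rsqrt s = 1" using assms by (simp flip: powr_add)
 moreover have "s powr (1 / 2) * rsqrt s <= T1 powr (1 / 2) * rsqrt s"
  by (intro mult_right_mono powr_mono2) (use assms T in auto)
 ultimately show 1: "1 <= T1 powr (1 / 2) * rsqrt s" by simp
 have "1 <= exp (L' * s)" using assms by simp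
 from mult_mono[OF 1 this] show ?A by (simp add: mult.assoc)
qed

text \<open>The three contributions 1, sup norm and gradient are brought under the common weight
  \<open>rsqrt s * exp (L * s)\<close>; the first two pay the factor \<open>T1 powr (1 / 2)\<close>
  for it.\<close>

lemma adm_parts_hmod:
 assumes "adm v w" and s: "s : {0<..T}"
 shows "hmod \<alpha> (Qf * (rsqrt s * exp (L * s))) (Qf * (rsqrt s * exp (L * s))) (rint g (X s) (XX s) (v s))"
  "hmod \<alpha> (Qf * (rsqrt s * exp (L * s))) (Qf * (rsqrt s * exp (L * s))) (drift_prim v w s)"
  "hmod \<alpha> (Qf * (rsqrt s * exp (L * s))) (Qf * (rsqrt s * exp (L * s))) (flux v w s)"
proof -
 let ?E = "rsqrt s * exp (L * s)" and ?z = "M * exp (L * s)" and ?l = "M * exp (L * s) * rsqrt s"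
 have s': "s : {0..T}" using s by auto
 have z: "norm (v s y) <= ?z" for y using assms by (auto simp: adm_def)
 have E: "?E >= 0" by simp
 have "1 + ?z + ?l <= T1 powr (1 / 2) * ?E + M * (T1 powr (1 / 2) * ?E) + M * ?E"
 proof -
  have "exp (L * s) * 1 <= exp (L * s) * (T1 powr (1 / 2) * rsqrt s)"
   by (intro mult_left_mono one_le_weight(2)[OF s, of 0]) auto
  then have "?z <= M * (T1 powr (1 / 2) * ?E)" using M by (intro mult_left_mono) (auto simp: mult_ac)
  then show ?thesis using one_le_weight(1)[OF s, of L] L by (simp add: mult_ac)
 qed
 also have "... <= (1 + T1 powr (1 / 2)) * (1 + M) * ?E"
  using E by (simp add: distrib_right distrib_left)
 finally have le: "Kf * (1 + ?z + ?l) <= Qf * ?E" using Kf_pos by (simp add: Qf_def mult_left_mono mult.assoc)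
 have nn: "0 <= Qf * ?E" using Qf_nonneg E by simp
 note h = flux_parts_hmod[where v = v and w = w, OF s' adm_slice[OF assms] z]
 show "hmod \<alpha> (Qf * ?E) (Qf * ?E) (rint g (X s) (XX s) (v s))" by (rule hmod_mono[OF h(1) le le])
 show "hmod \<alpha> (Qf * ?E) (Qf * ?E) (drift_prim v w s)" by (rule hmod_mono[OF h(2) nn le])
 show "hmod \<alpha> (Qf * ?E) (Qf * ?E) (flux v w s)" by (rule hmod_mono[OF h(3) le le])
qed

lemma \<alpha>': "0 < \<alpha>" "\<alpha> < 1" "\<alpha> <= 1" using \<alpha> by auto

lemma adm_slice_open: "adm v w ==> s : {0<..<T} ==> slice \<rho> (M * exp (L * s) * rsqrt s) (v s) (w s)"
 by (rule adm_slice) auto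

lemma adm_volterra:
 assumes vw: "adm v w"
 shows "volterra (%s \<tau>. heat_div \<tau> (flux v w s)) T ((1 - \<alpha>) / 2) (heat_volterra_const \<alpha> T1 * Qf) L" (is ?A1)
  "volterra (%s \<tau>. heat_div' \<tau> (flux v w s)) T (1 - \<alpha> / 2) (heat_volterra_const \<alpha> T1 * Qf) L" (is ?A2)
  "volterra (%s \<tau>. heat_div \<tau> (rint g (X s) (XX s) (v s))) T ((1 - \<alpha>) / 2) (heat_volterra_const \<alpha> T1 * Qf) L" (is ?A3)
  "volterra (%s \<tau>. heat_div \<tau> (drift_prim v w s)) T ((1 - \<alpha>) / 2) (heat_volterra_const \<alpha> T1 * Qf) L" (is ?A4)
proof -
 note m = flux_measurable[of "%s. M * exp (L * s) * rsqrt s", OF adm_slice_open[OF vw] adm_measurable[OF vw]]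
 show ?A1
  by (rule heat_volterra(1)[OF adm_parts_hmod(3)[OF vw] m(3) \<alpha>'(1,2) T(2) Qf_nonneg L]) auto
 show ?A2
  by (rule heat_volterra(2)[OF adm_parts_hmod(3)[OF vw] m(3) \<alpha>'(1,2) T(2) Qf_nonneg L]) auto
 show ?A3
  by (rule heat_volterra(1)[OF adm_parts_hmod(1)[OF vw] m(1) \<alpha>'(1,2) T(2) Qf_nonneg L]) auto
 show ?A4
  by (rule heat_volterra(1)[OF adm_parts_hmod(2)[OF vw] m(2) \<alpha>'(1,2) T(2) Qf_nonneg L]) auto
qed

lemma weight_le:
 assumes "t : {0<..T}" "L' > 0"
 shows "L' powr (- (\<alpha> / 4)) * t powr (\<alpha> / 2 - \<alpha> / 4) <= (T / L') powr (\<alpha> / 4)"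
proof -
 have "L' powr (- (\<alpha> / 4)) * t powr (\<alpha> / 2 - \<alpha> / 4) = t powr (\<alpha> / 4) * L' powr (- (\<alpha> / 4))"
  by (simp add: field_simps)
 also have "... <= T powr (\<alpha> / 4) * L' powr (- (\<alpha> / 4))"
  by (intro mult_right_mono powr_mono2) (use assms \<alpha> in auto)
 also have "... = (T / L') powr (\<alpha> / 4)"
  by (simp only: powr_divide powr_minus_divide) simp
 finally show ?thesis .
qed

lemma adm_lin: "adm lin lin'"
proof -
 let ?c = "(gauss_mom G0 + gauss_mom G1) * V"
 have "duhamel_const \<alpha> (\<alpha> / 4) T1 * Qf * (T / L) powr (\<alpha> / 4) >= 0"
  using duhamel_const_nonneg Qf_nonneg by (intro mult_nonneg_nonneg) auto
 then have cM: "?c <= M" using inv[folded Qf_def] by linarith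
 have "?c <= M * exp (L * t)" if "t : {0<..T}" for t
  using cM mult_left_mono[of 1 "exp (L * t)" M] M L that by simp
 then have "norm (lin t x) <= M * exp (L * t)" "norm (lin' t x) <= M * exp (L * t) * rsqrt t" if "t : {0<..T}" for t x
  using lin_facts(5,6)[OF that, of x] that by (auto intro: order_trans mult_right_mono)
 then show ?thesis using lin_facts(1-4) by (auto simp: adm_def)
qed

lemma vconv_periodic: "periodic (vconv (%s \<tau>. heat_div \<tau> (F s)) t)" for F :: "real => real => real^'n"
proof -
 have "heat_div \<tau> H (x + 2 * pi) = heat_div \<tau> H x" for \<tau> x and H :: "real => real^'n"
  using heat_div_periodic(1)[of \<tau> H] by (simp add: periodic_def)
 then show ?thesis unfolding periodic_def vconv_def by simp
qed

lemma adm_map: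
 assumes vw: "adm v w"
 shows "adm (mapv v w) (mapw v w)"
proof -
 note V = adm_volterra(1,2)[OF vw]
 have c: "continuous_on ({0<..T} \<times> UNIV) (%(t, x). mapv v w t x)" "continuous_on ({0<..T} \<times> UNIV) (%(t, x). mapw v w t x)"
  using continuous_on_add[OF lin_facts(1) volterra.vconv_continuous[OF V(1)]]
   continuous_on_add[OF lin_facts(2) volterra.vconv_continuous[OF V(2)]]
  by (simp_all add: mapv_def mapw_def case_prod_beta')
 show ?thesis
  unfolding adm_def
 proof (intro conjI c ballI allI)
  fix t x assume t: "t : {0<..T}"
  show "periodic (mapv v w t)"
   using lin_facts(3)[OF t] vconv_periodic[of "flux v w" t] by (simp add: periodic_def mapv_def)
  have "(vconv (%s \<tau>. heat_div \<tau> (flux v w s)) t has_vector_derivative vconv (%s \<tau>. heat_div' \<tau> (flux v w s)) t x) (at x)"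
  proof (rule vconv_has_vector_derivative[OF V _ t])
   fix s \<tau> x :: real assume s: "s : {0<..<T}" "\<tau> > 0"
   have "0 <= Qf * (rsqrt s * exp (L * s))" using Qf_nonneg by (intro mult_nonneg_nonneg) auto
   then show "(heat_div \<tau> (flux v w s) has_vector_derivative heat_div' \<tau> (flux v w s) x) (at x)"
    by (intro heat_div_vector_derivative[OF adm_parts_hmod(3)[OF vw]]) (use s \<alpha>' in auto)
  qed
  then show "(mapv v w t has_vector_derivative mapw v w t x) (at x)"
   unfolding mapv_def[abs_def] mapw_def by (intro has_vector_derivative_add lin_facts(4)[OF t])
  let ?c = "(gauss_mom G0 + gauss_mom G1) * V" and ?D = "duhamel_const \<alpha> (\<alpha> / 4) T1 * Qf"
  note db = duhamel_bound[OF V _ _ \<alpha>'(1,2) t Qf_nonneg, of "\<alpha> / 4" x]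
  have D: "?D >= 0" using duhamel_const_nonneg Qf_nonneg by (intro mult_nonneg_nonneg)
  have cp: "?c >= 0" using gauss_mom_nonneg V_nonneg by (intro mult_nonneg_nonneg add_nonneg_nonneg)
  have "?D * (exp (L * t) * L powr (- (\<alpha> / 4)) * t powr (\<alpha> / 2 - \<alpha> / 4)) = ?D * (L powr (- (\<alpha> / 4)) * t powr (\<alpha> / 2 - \<alpha> / 4)) * exp (L * t)"
   by (simp only: mult_ac)
  also have "... <= ?D * (T / L) powr (\<alpha> / 4) * exp (L * t)"
   by (intro mult_right_mono mult_left_mono weight_le t L D) auto
  finally have 1: "?D * (exp (L * t) * L powr (- (\<alpha> / 4)) * t powr (\<alpha> / 2 - \<alpha> / 4)) <= ?D * (T / L) powr (\<alpha> / 4) * exp (L * t)" .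
  have 2: "?c <= ?c * exp (L * t)" using mult_left_mono[of 1 "exp (L * t)" ?c] cp t L by simp
  have 3: "?c * exp (L * t) + ?D * (T / L) powr (\<alpha> / 4) * exp (L * t) <= M * exp (L * t)"
   using mult_right_mono[OF inv[folded Qf_def], of "exp (L * t)"] by (simp add: distrib_right)
  have d1: "norm (vconv (%s \<tau>. heat_div \<tau> (flux v w s)) t x) <= ?D * (exp (L * t) * L powr (- (\<alpha> / 4)) * t powr (\<alpha> / 2 - \<alpha> / 4))"
   "norm (vconv (%s \<tau>. heat_div' \<tau> (flux v w s)) t x) <= ?D * (exp (L * t) * L powr (- (\<alpha> / 4)) * t powr (\<alpha> / 2 - \<alpha> / 4)) * rsqrt t"
   using db \<alpha>' by auto
  show "norm (mapv v w t x) <= M * exp (L * t)"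
   unfolding mapv_def using lin_facts(5)[OF t, of x] d1(1) 1 2 3 by (intro order_trans[OF norm_triangle_ineq]) linarith
  have "norm (mapw v w t x) <= ?c * rsqrt t + ?D * (exp (L * t) * L powr (- (\<alpha> / 4)) * t powr (\<alpha> / 2 - \<alpha> / 4)) * rsqrt t"
   unfolding mapw_def by (intro order_trans[OF norm_triangle_ineq] add_mono lin_facts(6)[OF t] d1(2))
  also have "... = (?c + ?D * (exp (L * t) * L powr (- (\<alpha> / 4)) * t powr (\<alpha> / 2 - \<alpha> / 4))) * rsqrt t"
   by (simp only: distrib_right)
  also have "... <= M * exp (L * t) * rsqrt t"
   by (rule mult_right_mono) (use 1 2 3 in linarith, simp)
  finally show "norm (mapw v w t x) <= M * exp (L * t) * rsqrt t" .
 qed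
qed

definition near :: "real => real => (real => real => real^'n) => (real => real => real^'n) =>
  (real => real => real^'n) => (real => real => real^'n) => bool" where
 "near L' d v w v' w' \<longleftrightarrow> (ALL t:{0<..T}. ALL x. norm (v t x - v' t x) <= d * exp (L' * t) &
   norm (w t x - w' t x) <= d * exp (L' * t) * rsqrt t)"

text \<open>The rate \<open>L'\<close> of the distance is independent of the rate \<open>L\<close>
  in \<open>adm\<close>. The contraction constant contains \<rho>, which is at least
  \<open>M * exp (L * T)\<close>, so demanding smallness through \<open>L\<close> itself would be
  circular.\<close>

lemma map_contraction:
 assumes vw: "adm v w" and vw': "adm v' w'" and nr: "near L' d v w v' w'" and L': "L' > 0" and d: "d >= 0"
 shows "near L' (duhamel_const \<alpha> (\<alpha> / 4) T1 * (Kf * (1 + T1 powr (1 / 2) + \<rho>)) * (T / L') powr (\<alpha> / 4) * d)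
  (mapv v w) (mapw v w) (mapv v' w') (mapw v' w')"
proof -
 let ?F = "%s y. flux v w s y - flux v' w' s y"
 let ?Q = "Kf * (1 + T1 powr (1 / 2) + \<rho>) * d"
 have \<rho>: "\<rho> >= 0" using b_nonneg b\<rho> by linarith
 have Q: "?Q >= 0" using Kf_pos d \<rho> by (intro mult_nonneg_nonneg add_nonneg_nonneg) auto
 have hm: "hmod \<alpha> (?Q * (rsqrt s * exp (L' * s))) (?Q * (rsqrt s * exp (L' * s))) (?F s)"
  if "s : {0<..<T}" for s
 proof -
  have s: "s : {0<..T}" "s : {0..T}" using that by auto
  let ?E = "rsqrt s" and ?z = "d * exp (L' * s)" and ?l = "M * exp (L * s) * rsqrt s"
  have z: "norm (v s y - v' s y) <= ?z" "norm (w s y - w' s y) <= ?z * ?E" for y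
   using nr s by (auto simp: near_def)
  have h: "hmod \<alpha> (Kf * ?z) (Kf * (?z * ?E + ?z * (1 + ?l))) (?F s)"
   by (rule flux_diff_hmod[where v = v and v' = v' and w = w and w' = w', OF s(2) adm_slice[OF vw s(1)] adm_slice[OF vw' s(1)] z])
  have z0: "?z >= 0" using d by simp
  have w1: "1 <= T1 powr (1 / 2) * ?E" by (rule one_le_weight(2)[OF s(1), of 0]) simp
  have "?l <= M * exp (L * T) * ?E" using s M L by (intro mult_right_mono mult_left_mono) auto
  also have "... <= \<rho> * ?E" by (intro mult_right_mono M\<rho>) auto
  finally have l: "?l <= \<rho> * ?E" .
  have "Kf * ?z * 1 <= Kf * ?z * ((1 + T1 powr (1 / 2) + \<rho>) * ?E)"
  proof (intro mult_left_mono)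
   have "0 <= \<rho> * ?E" using \<rho> by simp
   moreover have "0 <= ?E" by simp
   ultimately show "1 <= (1 + T1 powr (1 / 2) + \<rho>) * ?E" using w1 unfolding distrib_right mult_1 by linarith
  qed (use Kf_pos z0 in auto)
  then have A: "Kf * ?z <= ?Q * (?E * exp (L' * s))" by (simp add: mult_ac)
  have "?z * ?E + ?z * (1 + ?l) = ?z * (?E + (1 + ?l))" by (simp only: distrib_left)
  also have "... <= ?z * ((1 + T1 powr (1 / 2) + \<rho>) * ?E)"
  proof (rule mult_left_mono[OF _ z0])
   show "?E + (1 + ?l) <= (1 + T1 powr (1 / 2) + \<rho>) * ?E" using w1 l unfolding distrib_right mult_1 by linarith
  qed
  finally have "Kf * (?z * ?E + ?z * (1 + ?l)) <= Kf * (?z * ((1 + T1 powr (1 / 2) + \<rho>) * ?E))"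
   using Kf_pos by (intro mult_left_mono) auto
  then have B: "Kf * (?z * ?E + ?z * (1 + ?l)) <= ?Q * (?E * exp (L' * s))" by (simp only: mult_ac)
  show ?thesis by (rule hmod_mono[OF h A B])
 qed
 note m = flux_measurable(3)[of "%s. M * exp (L * s) * rsqrt s"]
 have meas: "set_borel_measurable lborel {0<..<T} (%s. ?F s y)" if "y : torus" for y
  using m[OF adm_slice_open[OF vw] adm_measurable[OF vw] that] m[OF adm_slice_open[OF vw'] adm_measurable[OF vw'] that]
  unfolding set_borel_measurable_restrict by (rule borel_measurable_diff)
 note V = heat_volterra[OF hm meas \<alpha>'(1,2) T(2) Q L']
 have eq: "vconv (%s \<tau>. heat_div \<tau> (?F s)) t x = vconv (%s \<tau>. heat_div \<tau> (flux v w s)) t x - vconv (%s \<tau>. heat_div \<tau> (flux v' w' s)) t x"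
  "vconv (%s \<tau>. heat_div' \<tau> (?F s)) t x = vconv (%s \<tau>. heat_div' \<tau> (flux v w s)) t x - vconv (%s \<tau>. heat_div' \<tau> (flux v' w' s)) t x"
  if t: "t : {0<..T}" for t x
 proof -
  have nn: "0 <= Qf * (rsqrt s * exp (L * s))" for s using Qf_nonneg by (intro mult_nonneg_nonneg) auto
  have e: "heat_div \<tau> (?F s) x = heat_div \<tau> (flux v w s) x - heat_div \<tau> (flux v' w' s) x"
   "heat_div' \<tau> (?F s) x = heat_div' \<tau> (flux v w s) x - heat_div' \<tau> (flux v' w' s) x" if "s : {0<..<t}" for s \<tau>
   by (rule heat_div_diff[OF adm_parts_hmod(3)[OF vw] adm_parts_hmod(3)[OF vw'] \<alpha>'(1,3) nn nn nn nn]; use that t in auto)+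
  have "vconv (%s \<tau>. heat_div \<tau> (?F s)) t x = (LINT s:{0<..<t}|lborel. heat_div (t - s) (flux v w s) x - heat_div (t - s) (flux v' w' s) x)"
   unfolding vconv_def by (rule set_lebesgue_integral_cong) (use e in auto)
  also have "... = vconv (%s \<tau>. heat_div \<tau> (flux v w s)) t x - vconv (%s \<tau>. heat_div \<tau> (flux v' w' s)) t x"
   unfolding vconv_def
   by (rule set_integral_diff(2)[OF volterra.integrable_k[OF adm_volterra(1)[OF vw] t] volterra.integrable_k[OF adm_volterra(1)[OF vw'] t]])
  finally show "vconv (%s \<tau>. heat_div \<tau> (?F s)) t x = vconv (%s \<tau>. heat_div \<tau> (flux v w s)) t x - vconv (%s \<tau>. heat_div \<tau> (flux v' w' s)) t x" .
  have "vconv (%s \<tau>. heat_div' \<tau> (?F s)) t x = (LINT s:{0<..<t}|lborel. heat_div' (t - s) (flux v w s) x - heat_div' (t - s) (flux v' w' s) x)"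
   unfolding vconv_def by (rule set_lebesgue_integral_cong) (use e in auto)
  also have "... = vconv (%s \<tau>. heat_div' \<tau> (flux v w s)) t x - vconv (%s \<tau>. heat_div' \<tau> (flux v' w' s)) t x"
   unfolding vconv_def
   by (rule set_integral_diff(2)[OF volterra.integrable_k[OF adm_volterra(2)[OF vw] t] volterra.integrable_k[OF adm_volterra(2)[OF vw'] t]])
  finally show "vconv (%s \<tau>. heat_div' \<tau> (?F s)) t x = vconv (%s \<tau>. heat_div' \<tau> (flux v w s)) t x - vconv (%s \<tau>. heat_div' \<tau> (flux v' w' s)) t x" .
 qed
 let ?K = "duhamel_const \<alpha> (\<alpha> / 4) T1"
 have K: "?K * ?Q >= 0" by (rule mult_nonneg_nonneg[OF duhamel_const_nonneg Q])
 have wt: "?K * ?Q * (exp (L' * t) * L' powr (- (\<alpha> / 4)) * t powr (\<alpha> / 2 - \<alpha> / 4)) <=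
   ?K * (Kf * (1 + T1 powr (1 / 2) + \<rho>)) * (T / L') powr (\<alpha> / 4) * d * exp (L' * t)" if t: "t : {0<..T}" for t
 proof -
  have "?K * ?Q * (exp (L' * t) * L' powr (- (\<alpha> / 4)) * t powr (\<alpha> / 2 - \<alpha> / 4)) = ?K * ?Q * (L' powr (- (\<alpha> / 4)) * t powr (\<alpha> / 2 - \<alpha> / 4)) * exp (L' * t)"
   by (simp only: mult_ac)
  also have "... <= ?K * ?Q * (T / L') powr (\<alpha> / 4) * exp (L' * t)"
   by (intro mult_right_mono mult_left_mono weight_le t L' K) auto
  finally show ?thesis by (simp only: mult_ac)
 qed
 show ?thesis
  unfolding near_def
 proof (intro ballI allI conjI)
  fix t x assume t: "t : {0<..T}"
  note db = duhamel_bound[OF V _ _ \<alpha>'(1,2) t Q, of "\<alpha> / 4" x, unfolded eq[OF t]]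
  have "norm (mapv v w t x - mapv v' w' t x) <= ?K * ?Q * (exp (L' * t) * L' powr (- (\<alpha> / 4)) * t powr (\<alpha> / 2 - \<alpha> / 4))"
   using db(1) \<alpha>' by (simp add: mapv_def)
  also note wt[OF t]
  finally show "norm (mapv v w t x - mapv v' w' t x) <= ?K * (Kf * (1 + T1 powr (1 / 2) + \<rho>)) * (T / L') powr (\<alpha> / 4) * d * exp (L' * t)" .
  have "norm (mapw v w t x - mapw v' w' t x) <= ?K * ?Q * (exp (L' * t) * L' powr (- (\<alpha> / 4)) * t powr (\<alpha> / 2 - \<alpha> / 4)) * rsqrt t"
   using db(2) \<alpha>' by (simp add: mapw_def)
  also have "... <= ?K * (Kf * (1 + T1 powr (1 / 2) + \<rho>)) * (T / L') powr (\<alpha> / 4) * d * exp (L' * t) * rsqrt t"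
   by (rule mult_right_mono[OF wt[OF t]]) auto
  finally show "norm (mapw v w t x - mapw v' w' t x) <= ?K * (Kf * (1 + T1 powr (1 / 2) + \<rho>)) * (T / L') powr (\<alpha> / 4) * d * exp (L' * t) * rsqrt t" .
 qed
qed

lemma near_triangle:
 assumes "near L' d v w v' w'" "near L' d' v w v'' w''"
 shows "near L' (d + d') v' w' v'' w''"
 unfolding near_def distrib_right
proof (intro ballI allI conjI)
 have tri: "norm (p' - p'') <= c + c'" if "norm (p - p') <= c" "norm (p - p'') <= c'" for p p' p'' :: "real^'n" and c c'
  using norm_triangle_ineq4[of "p - p''" "p - p'"] that by simp
 fix t x assume "t : {0<..T}"
 with assms show "norm (v' t x - v'' t x) <= d * exp (L' * t) + d' * exp (L' * t)"
  "norm (w' t x - w'' t x) <= d * exp (L' * t) * rsqrt t + d' * exp (L' * t) * rsqrt t"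
  unfolding near_def by (intro tri; blast)+
qed

lemma near_eq:
 assumes "!!d. d > 0 ==> near L' d v w v' w'" and t: "t : {0<..T}"
 shows "v t x = v' t x" "w t x = w' t x"
proof -
 have 0: "p = 0" if "!!d. d > 0 ==> norm p <= d * c" "c > 0" for p :: "real^'n" and c
 proof -
  have "norm p <= 0 + e" if "e > 0" for e using \<open>!!d. d > 0 ==> norm p <= d * c\<close>[of "e / c"] that \<open>c > 0\<close> by simp
  then have "norm p <= 0" by (rule field_le_epsilon)
  then show ?thesis by simp
 qed
 show "v t x = v' t x" using 0[of "v t x - v' t x" "exp (L' * t)"] assms by (simp add: near_def)
 show "w t x = w' t x"
  using 0[of "w t x - w' t x" "exp (L' * t) * rsqrt t"] assms by (simp add: near_def mult.assoc)
qed

lemma uniform_geometric_limit: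
 fixes F :: "nat => 'b => 'c::banach"
 assumes "!!n q. q : S ==> norm (F (Suc n) q - F n q) <= c * (1 / 2) ^ n"
 obtains G where "uniform_limit S F G sequentially"
proof -
 have "summable (%n. c * (1 / 2 :: real) ^ n)" by (intro summable_mult summable_geometric) simp
 with assms have "uniform_limit S (%n q. \<Sum>i<n. F (Suc i) q - F i q) (%q. \<Sum>i. F (Suc i) q - F i q) sequentially"
  by (rule Weierstrass_m_test)
 then have "uniform_limit S (%n q. (\<Sum>i<n. F (Suc i) q - F i q) + F 0 q) (%q. (\<Sum>i. F (Suc i) q - F i q) + F 0 q) sequentially"
  by (intro uniform_limit_add uniform_limit_const)
 moreover have "(\<Sum>i<n. F (Suc i) q - F i q) + F 0 q = F n q" for n q using sum_lessThan_telescope[of "%i. F i q" n] by simp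
 ultimately show thesis by (intro that) simp
qed

theorem fixed_point_exists:
 obtains v w where "adm v w" "!!t x. t : {0<..T} ==> mapv v w t x = v t x" "!!t x. t : {0<..T} ==> mapw v w t x = w t x"
proof -
 let ?K = "duhamel_const \<alpha> (\<alpha> / 4) T1 * (Kf * (1 + T1 powr (1 / 2) + \<rho>))"
 have "((%L'. ?K * (T / L') powr (\<alpha> / 4)) \<longlongrightarrow> ?K * 0) at_top"
 proof (intro tendsto_intros tendsto_zero_powrI)
  show "((%L'. T / L') \<longlongrightarrow> 0) at_top" by real_asymp
  show "\<forall>\<^sub>F L' in at_top. 0 <= T / L'" using eventually_gt_at_top[of 0] by eventually_elim (use T in auto)
 qed (use \<alpha> in auto)
 then have "\<forall>\<^sub>F L' in at_top. ?K * (T / L') powr (\<alpha> / 4) < 1 / 2" by (intro order_tendstoD(2)[of _ 0]) auto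
 with eventually_ge_at_top[of L] have "\<forall>\<^sub>F L' in at_top. L <= L' & ?K * (T / L') powr (\<alpha> / 4) < 1 / 2"
  by (rule eventually_conj)
 then obtain L' where L': "L <= L'" "?K * (T / L') powr (\<alpha> / 4) <= 1 / 2"
  using eventually_happens'[OF trivial_limit_at_top_linorder] by (metis (no_types, lifting) less_imp_le)
 have L'0: "L' > 0" using L' L by linarith
 have contr: "near L' (1 / 2 * d) (mapv v w) (mapw v w) (mapv v' w') (mapw v' w')"
  if "adm v w" "adm v' w'" "near L' d v w v' w'" "d >= 0" for v w v' w' d
 proof -
  have "?K * (T / L') powr (\<alpha> / 4) * d * e <= 1 / 2 * d * e" if "e >= 0" for e
   by (intro mult_right_mono L' \<open>d >= 0\<close> that)
  from this[of "exp (L' * t)" for t] this[of "exp (L' * t) * rsqrt t" for t]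
  have "?K * (T / L') powr (\<alpha> / 4) * d * exp (L' * t) <= 1 / 2 * d * exp (L' * t)"
   "?K * (T / L') powr (\<alpha> / 4) * d * exp (L' * t) * rsqrt t <= 1 / 2 * d * exp (L' * t) * rsqrt t" for t
   by (simp_all add: mult.assoc)
  then show ?thesis using map_contraction[OF that(1-3) L'0 that(4)] unfolding near_def by (meson order_trans)
 qed
 define P where "P n = ((%(v, w). (mapv v w, mapw v w)) ^^ n) (lin, lin')" for n
 define vs where "vs n = fst (P n)" for n
 define ws where "ws n = snd (P n)" for n
 have vs0: "vs 0 = lin" "ws 0 = lin'" by (simp_all add: vs_def ws_def P_def)
 have vsS: "vs (Suc n) = mapv (vs n) (ws n)" "ws (Suc n) = mapw (vs n) (ws n)" for n
  by (simp_all add: vs_def ws_def P_def case_prod_beta')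
 have ad: "adm (vs n) (ws n)" for n
  by (induction n) (simp_all add: vs0 vsS adm_lin adm_map)
 have step: "near L' (2 * M * (1 / 2) ^ n) (vs (Suc n)) (ws (Suc n)) (vs n) (ws n)" for n
 proof (induction n)
  case 0
  show ?case
   unfolding near_def
  proof (intro ballI allI conjI)
   fix t x assume t: "t : {0<..T}"
   have e: "M * exp (L * t) <= M * exp (L' * t)" using L' t M by (intro mult_left_mono) auto
   have b: "norm (vs n t x) <= M * exp (L * t)" "norm (ws n t x) <= M * exp (L * t) * rsqrt t" for n
    using ad t by (auto simp: adm_def)
   show "norm (vs (Suc 0) t x - vs 0 t x) <= 2 * M * (1 / 2) ^ 0 * exp (L' * t)"
    using norm_triangle_ineq4[of "vs (Suc 0) t x" "vs 0 t x"] b(1)[of "Suc 0"] b(1)[of 0] e by simp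
   have "M * exp (L * t) * rsqrt t <= M * exp (L' * t) * rsqrt t" by (rule mult_right_mono[OF e]) simp
   then show "norm (ws (Suc 0) t x - ws 0 t x) <= 2 * M * (1 / 2) ^ 0 * exp (L' * t) * rsqrt t"
    using norm_triangle_ineq4[of "ws (Suc 0) t x" "ws 0 t x"] b(2)[of "Suc 0"] b(2)[of 0] by simp
  qed
 next
  case (Suc n)
  have "near L' (1 / 2 * (2 * M * (1 / 2) ^ n)) (vs (Suc (Suc n))) (ws (Suc (Suc n))) (vs (Suc n)) (ws (Suc n))"
   unfolding vsS(1)[of "Suc n"] vsS(2)[of "Suc n"] vsS(1)[of n] vsS(2)[of n]
   by (rule contr[OF _ ad]) (use ad[of "Suc n"] Suc M in "simp_all add: vsS")
  then show ?case by simp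
 qed
 let ?S = "{0<..T} \<times> (UNIV :: real set)"
 have expT: "exp (L' * t) <= exp (L' * T)" "1 <= exp (L' * t)" if "t : {0<..T}" for t using that L'0 by simp_all
 have tt: "t powr (1 / 2) * rsqrt t = 1" if "t : {0<..T}" for t using that by (simp flip: powr_add)
 \<comment> \<open>Multiplying the gradients by \<open>sqrt t\<close> turns the weighted distances
   into a uniform Cauchy estimate on all positive times up to \<open>T\<close>.\<close>
 let ?V = "%n (t, x). vs n t x" and ?W = "%n (t, x). t powr (1 / 2) *\<^sub>R ws n t x"
 have vwS: "norm (?V (Suc n) q - ?V n q) <= 2 * M * exp (L' * T) * (1 / 2) ^ n" "norm (?W (Suc n) q - ?W n q) <= 2 * M * exp (L' * T) * (1 / 2) ^ n"
  if q: "q : ?S" for n q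
 proof -
  obtain t x where t: "q = (t, x)" "t : {0<..T}" using q by force
  have e: "2 * M * (1 / 2) ^ n * exp (L' * t) <= 2 * M * exp (L' * T) * (1 / 2) ^ n" using expT(1)[OF t(2)] M by (simp add: mult_left_mono)
  note st = step[of n, unfolded near_def, rule_format, OF t(2), of x]
  show "norm (?V (Suc n) q - ?V n q) <= 2 * M * exp (L' * T) * (1 / 2) ^ n" using st(1)[THEN conjunct1] e t by simp
  have "norm (?W (Suc n) q - ?W n q) = t powr (1 / 2) * norm (ws (Suc n) t x - ws n t x)"
   using t by (simp flip: scaleR_diff_right)
  also have "... <= t powr (1 / 2) * (2 * M * (1 / 2) ^ n * exp (L' * t) * rsqrt t)"
   by (intro mult_left_mono st[THEN conjunct2]) simp
  also have "... = 2 * M * (1 / 2) ^ n * exp (L' * t) * (t powr (1 / 2) * rsqrt t)" by (simp only: mult_ac)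
  finally show "norm (?W (Suc n) q - ?W n q) <= 2 * M * exp (L' * T) * (1 / 2) ^ n" using e unfolding tt[OF t(2)] by simp
 qed
 obtain V' where VW1: "uniform_limit ?S ?V V' sequentially" by (rule uniform_geometric_limit[where F = ?V, OF vwS(1)])
 obtain W' where VW2: "uniform_limit ?S ?W W' sequentially" by (rule uniform_geometric_limit[where F = ?W, OF vwS(2)])
 define v where "v t x = V' (t, x)" for t x
 define w where "w t x = rsqrt t *\<^sub>R W' (t, x)" for t x
 have nearl: "\<forall>\<^sub>F n in sequentially. near L' d (vs n) (ws n) v w" if d: "d > 0" for d
  using uniform_limitD[OF VW1 d] uniform_limitD[OF VW2 d]
 proof eventually_elim
  case (elim n)
  show ?case
   unfolding near_def
  proof (intro ballI allI conjI)
   fix t x assume t: "t : {0<..T}"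
   have de: "d <= d * exp (L' * t)" using mult_left_mono[OF expT(2)[OF t], of d] d by simp
   have "dist (vs n t x) (V' (t, x)) < d" "dist (t powr (1 / 2) *\<^sub>R ws n t x) (W' (t, x)) < d" using elim t by auto
   then have b: "norm (vs n t x - v t x) <= d * exp (L' * t)" (is ?A) "norm (t powr (1 / 2) *\<^sub>R ws n t x - W' (t, x)) <= d * exp (L' * t)"
    using de by (auto simp: dist_norm v_def)
   then show ?A by simp
   have "ws n t x - w t x = rsqrt t *\<^sub>R (t powr (1 / 2) *\<^sub>R ws n t x - W' (t, x))"
    using tt[OF t] by (simp add: w_def scaleR_diff_right mult.commute)
   then show "norm (ws n t x - w t x) <= d * exp (L' * t) * rsqrt t"
    using mult_right_mono[OF b(2), of "rsqrt t"] by (simp add: mult.commute)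
  qed
 qed
 have conv: "\<forall>\<^sub>F n in sequentially. ALL x. norm (vs n t x - v t x) < e & norm (ws n t x - w t x) < e" if t: "t : {0<..T}" and e: "e > 0" for t e
 proof -
  define c where "c = exp (L' * t) * (1 + rsqrt t)"
  have c: "c > 0" "exp (L' * t) <= c" "exp (L' * t) * rsqrt t <= c" by (simp_all add: c_def add_pos_nonneg)
  define \<delta> where "\<delta> = e / 2 / c"
  have \<delta>: "\<delta> > 0" "\<delta> * c < e" using c(1) e by (simp_all add: \<delta>_def)
  show ?thesis
   using nearl[OF \<delta>(1)]
  proof eventually_elim
   case (elim n)
   have "\<delta> * exp (L' * t) < e" "\<delta> * (exp (L' * t) * rsqrt t) < e"
    using mult_left_mono[OF c(2), of \<delta>] mult_left_mono[OF c(3), of \<delta>] \<delta> by linarith+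
   then show ?case using elim t unfolding near_def mult.assoc by (meson le_less_trans)
  qed
 qed
 have lim: "(%n. vs n t x) \<longlonglongrightarrow> v t x" "(%n. ws n t x) \<longlonglongrightarrow> w t x" if t: "t : {0<..T}" for t x
  unfolding tendsto_iff dist_norm by (auto intro!: eventually_mono[OF conv[OF t]])
 have adv: "adm v w"
  unfolding adm_def
 proof (intro conjI ballI allI)
  have c: "continuous_on ?S (?V n)" "continuous_on ?S (?W n)" for n
   using ad[of n] by (auto simp: adm_def case_prod_beta' intro!: continuous_intros)
  have "continuous_on ?S V'" "continuous_on ?S W'"
   by (rule uniform_limit_theorem[OF _ VW1] uniform_limit_theorem[OF _ VW2]; use c in simp)+
  then show "continuous_on ?S (%(t, x). v t x)" "continuous_on ?S (%(t, x). w t x)"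
   by (auto simp: v_def w_def case_prod_beta' intro!: continuous_intros)
  fix t x assume t: "t : {0<..T}"
  have "vs n t (x + 2 * pi) = vs n t x" for n x using ad[of n] t by (auto simp: adm_def periodic_def)
  then have "(%n. vs n t x) \<longlonglongrightarrow> v t (x + 2 * pi)" for x using lim(1)[OF t, of "x + 2 * pi"] by simp
  then show "periodic (v t)" unfolding periodic_def using LIMSEQ_unique[OF _ lim(1)[OF t]] by blast
  show "norm (v t x) <= M * exp (L * t)"
   by (rule LIMSEQ_le_const2[OF tendsto_norm[OF lim(1)[OF t]]]) (use ad t in "auto simp: adm_def")
  show "norm (w t x) <= M * exp (L * t) * rsqrt t"
   by (rule LIMSEQ_le_const2[OF tendsto_norm[OF lim(2)[OF t]]]) (use ad t in "auto simp: adm_def")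
  \<comment> \<open>At a fixed positive time the gradients converge uniformly in space, so the limit
    of the gradients is the gradient of the limit.\<close>
  have "EX h. ALL x:UNIV. (%n. vs n t x) \<longlonglongrightarrow> h x & (h has_derivative (%y. y *\<^sub>R w t x)) (at x within UNIV)"
  proof (rule has_derivative_sequence[of UNIV "%n. vs n t" "%n x y. y *\<^sub>R ws n t x" "%x y. y *\<^sub>R w t x" 0 "v t 0"])
   show "(vs n t has_derivative (%y. y *\<^sub>R ws n t x)) (at x within UNIV)" for n x
    using ad[of n] t by (auto simp: adm_def has_vector_derivative_def)
   show "(%n. vs n t 0) \<longlonglongrightarrow> v t 0" by (rule lim(1)[OF t])
   show "\<forall>\<^sub>F n in sequentially. ALL x:UNIV. ALL h. norm (h *\<^sub>R ws n t x - h *\<^sub>R w t x) <= e * norm h" if "e > 0" for e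
    using conv[OF t that]
   proof eventually_elim
    case (elim n)
    then have "norm (ws n t x - w t x) <= e" for x by (auto intro: less_imp_le)
    then show ?case by (auto simp: scaleR_diff_right[symmetric] mult.commute[of e] intro: mult_left_mono)
   qed
  qed auto
  then obtain h where h: "!!x. (%n. vs n t x) \<longlonglongrightarrow> h x" "!!x. (h has_derivative (%y. y *\<^sub>R w t x)) (at x)" by auto
  have "h = v t" using LIMSEQ_unique[OF h(1) lim(1)[OF t]] by auto
  then show "(v t has_vector_derivative w t x) (at x)" using h(2)[of x] by (simp add: has_vector_derivative_def)
 qed
 \<comment> \<open>The limit is compared with its image through one further iterate: half of
   \<open>d / 2\<close> by contraction plus \<open>d / 2\<close> by approximation, in total
   \<open>3 / 4 * d\<close>.\<close>
 have "near L' d (mapv v w) (mapw v w) v w" if d: "d > 0" for d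
 proof -
  have "\<forall>\<^sub>F n in sequentially. near L' (d / 2) (vs n) (ws n) v w" by (rule nearl) (use d in simp)
  then obtain n where n: "near L' (d / 2) (vs n) (ws n) v w" "near L' (d / 2) (vs (Suc n)) (ws (Suc n)) v w"
   unfolding eventually_sequentially by (meson le_SucI order_refl)
  have "near L' (1 / 2 * (d / 2)) (vs (Suc n)) (ws (Suc n)) (mapv v w) (mapw v w)"
   unfolding vsS by (rule contr[OF ad adv n(1)]) (use d in simp)
  from near_triangle[OF this n(2)] have "near L' (3 / 4 * d) (mapv v w) (mapw v w) v w" by simp
  moreover have "3 / 4 * d * e <= d * e" "3 / 4 * d * e * e' <= d * e * e'" if "e >= 0" "e' >= 0" for e e'
   using that d by (simp_all add: mult_right_mono)
  ultimately show ?thesis unfolding near_def by (meson exp_ge_zero order_trans powr_ge_zero)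
 qed
 from near_eq[OF this] show thesis by (rule that[OF adv])
qed

end

section \<open>Mild solutions in terms of the flux\<close>

text \<open>Measurability of \<open>h'\<close> is inherited from \<open>h\<close> because Lebesgue
  measure is complete; this permits integrands that are identified only almost everywhere.\<close>

lemma set_integral_cong_lebesgue:
 fixes h h' :: "real => 'a::euclidean_space"
 assumes i: "set_integrable lebesgue A h" and ae: "AE s in lebesgue. s : A --> h s = h' s"
 shows "set_integrable lebesgue A h'" "(LINT s:A|lebesgue. h' s) = (LINT s:A|lebesgue. h s)" (is ?A)
proof -
 have ae': "AE s in lebesgue. indicat_real A s *\<^sub>R h s = indicat_real A s *\<^sub>R h' s"
  using ae by eventually_elim (auto simp: indicator_def)
 have m: "(%s. indicat_real A s *\<^sub>R h s) : borel_measurable lebesgue" using i by (auto simp: set_integrable_def)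
 have m': "(%s. indicat_real A s *\<^sub>R h' s) : borel_measurable lebesgue" by (rule borel_measurable_AE[OF m ae'])
 show "set_integrable lebesgue A h'"
  unfolding set_integrable_def by (rule iffD1[OF integrable_cong_AE[OF m m' ae'] i[unfolded set_integrable_def]])
 show ?A
  unfolding set_lebesgue_integral_def by (rule integral_cong_AE[OF m m' ae', symmetric])
qed

lemma two_param_quotients_le:
 assumes "!!x y. [|x : torus; y : torus; x ~= y|] ==> norm (R x y) <= c * abs (x - y) powr \<gamma>" and "q : two_param_quotients \<gamma> R"
 shows "q <= c"
 using assms by (auto simp: two_param_quotients_def divide_le_eq)

lemma two_param_bound:
 assumes "!!x y. [|x : torus; y : torus; x ~= y|] ==> norm (R x y) <= c * abs (x - y) powr \<gamma>"
 shows "two_param_finite \<gamma> R" "two_param_norm \<gamma> R <= c"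
proof -
 show "two_param_finite \<gamma> R"
  unfolding two_param_finite_def by (rule bdd_aboveI) (rule two_param_quotients_le[OF assms])
 have "norm (R 0 (2 * pi)) / abs (0 - 2 * pi) powr \<gamma> : two_param_quotients \<gamma> R"
  unfolding two_param_quotients_def by (rule CollectI, rule exI[of _ 0], rule exI[of _ "2 * pi"]) auto
 then show "two_param_norm \<gamma> R <= c"
  unfolding two_param_norm_def using two_param_quotients_le[OF assms] by (intro cSup_least) auto
qed

lemma two_param_norm_ge:
 assumes "two_param_finite \<gamma> R" "x : torus" "y : torus" "x ~= y"
 shows "norm (R x y) <= two_param_norm \<gamma> R * abs (x - y) powr \<gamma>"
proof -
 have "norm (R x y) / abs (x - y) powr \<gamma> <= two_param_norm \<gamma> R"
  unfolding two_param_norm_def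
  by (rule cSup_upper) (use assms in "auto simp: two_param_quotients_def two_param_finite_def")
 then show ?thesis using assms by (simp add: divide_le_eq)
qed

lemma two_param_norm_nonneg: "two_param_finite \<gamma> R ==> 0 <= two_param_norm \<gamma> R"
 using order_trans[OF norm_ge_zero two_param_norm_ge[of \<gamma> R 0 "2 * pi"]] by (simp add: zero_le_mult_iff)

text \<open>A Lipschitz factor changes the remainder by its own increment times \<open>Y\<close>, of
  order \<open>abs (y - x)\<close>. On a bounded interval this is of order
  \<open>2 * \<alpha>\<close>, since \<open>2 * \<alpha> < 1\<close>.\<close>

lemma controlled_scaleR:
 fixes X :: "real => real^'n"
 assumes \<kappa>: "!!y. abs (\<kappa> y) <= c" "!!x y. abs (\<kappa> y - \<kappa> x) <= c * abs (y - x)"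
  and Y: "!!y. norm (Y y) <= C" "!!y k. norm (Y' y k) <= C"
  and R: "!!x y. x : torus ==> y : torus ==> norm (Y y - Y x - (\<Sum>k\<in>UNIV. (X y - X x) $ k *\<^sub>R Y' x k)) <= K * abs (y - x) powr (2 * \<alpha>)"
  and Q: "!!x y k. x : torus ==> y : torus ==> norm (Y' y k - Y' x k) <= K * abs (y - x) powr \<alpha>"
  and X: "!!x y. x : torus ==> y : torus ==> norm (X y - X x) <= a * abs (y - x) powr \<alpha>"
  and \<alpha>: "0 < \<alpha>" "\<alpha> < 1 / 2" and K: "K >= 0"
 shows "controlled \<alpha> X (%y. \<kappa> y *\<^sub>R Y y) (%y k. \<kappa> y *\<^sub>R Y' y k)"
proof -
 have c: "c >= 0" by (rule order_trans[OF abs_ge_zero \<kappa>(1)])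
 have C: "C >= 0" by (rule order_trans[OF norm_ge_zero Y(1)])
 let ?\<pi> = "(2 * pi) powr (1 - 2 * \<alpha>) + (2 * pi) powr (1 - \<alpha>)"
 let ?D = "c * K + c * ?\<pi> * C"
 have rem: "norm (\<kappa> y *\<^sub>R Y y - \<kappa> x *\<^sub>R Y x - (\<Sum>k\<in>UNIV. (X y - X x) $ k *\<^sub>R (\<kappa> x *\<^sub>R Y' x k))) <= ?D * abs (y - x) powr (2 * \<alpha>)"
  and der: "norm (\<kappa> y *\<^sub>R Y' y k - \<kappa> x *\<^sub>R Y' x k) <= ?D * abs (y - x) powr \<alpha>"
  and hol: "norm (\<kappa> y *\<^sub>R Y y - \<kappa> x *\<^sub>R Y x) <= (?D * (2 * pi) powr \<alpha> + real CARD('n) * (a * (c * C))) * abs (y - x) powr \<alpha>"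
  if xy: "x : torus" "y : torus" for x y k
 proof -
  let ?d = "abs (y - x)"
  have d: "0 <= ?d" "?d <= 2 * pi" using xy by auto
  have p: "?d <= ?\<pi> * ?d powr (2 * \<alpha>)" "?d <= ?\<pi> * ?d powr \<alpha>" "?d powr (2 * \<alpha>) <= (2 * pi) powr \<alpha> * ?d powr \<alpha>"
   using powr_le_powr_torus[OF d, of "2 * \<alpha>" 1] powr_le_powr_torus[OF d, of \<alpha> 1] powr_le_powr_torus[OF d, of \<alpha> "2 * \<alpha>"] \<alpha> d
   by (auto simp: distrib_right add_increasing add_increasing2)
  have tb1: "norm (\<kappa> x *\<^sub>R U) <= c * (K * q)" if "norm U <= K * q" for U :: "real^'n^'n" and q
   unfolding norm_scaleR real_norm_def by (intro mult_mono \<kappa> that) (use c in auto)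
  have tb2: "norm ((\<kappa> y - \<kappa> x) *\<^sub>R U') <= c * ?\<pi> * C * q"
   if "norm U' <= C" "?d <= ?\<pi> * q" for U' :: "real^'n^'n" and q
  proof -
   have *: "abs (\<kappa> y - \<kappa> x) <= c * (?\<pi> * q)" by (rule order_trans[OF \<kappa>(2) mult_left_mono[OF that(2) c]])
   have "norm ((\<kappa> y - \<kappa> x) *\<^sub>R U') <= (c * (?\<pi> * q)) * C"
    unfolding norm_scaleR real_norm_def by (intro mult_mono that *) (use order_trans[OF abs_ge_zero *] in auto)
   then show "norm ((\<kappa> y - \<kappa> x) *\<^sub>R U') <= c * ?\<pi> * C * q" by (simp only: mult_ac)
  qed
  \<comment> \<open>Product rule with the factor frozen at the base point \<open>x\<close>, so that
    the remainder of \<open>Y\<close> appears unchanged.\<close>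
  have "\<kappa> y *\<^sub>R Y y - \<kappa> x *\<^sub>R Y x - (\<Sum>k\<in>UNIV. (X y - X x) $ k *\<^sub>R (\<kappa> x *\<^sub>R Y' x k)) =
   \<kappa> x *\<^sub>R (Y y - Y x - (\<Sum>k\<in>UNIV. (X y - X x) $ k *\<^sub>R Y' x k)) + (\<kappa> y - \<kappa> x) *\<^sub>R Y y"
   by (simp add: algebra_simps scaleR_sum_right)
  moreover have "norm ... <= c * (K * ?d powr (2 * \<alpha>)) + c * ?\<pi> * C * ?d powr (2 * \<alpha>)"
   by (intro order_trans[OF norm_triangle_ineq] add_mono tb1 tb2 R[OF xy] Y p)
  ultimately show 1: "norm (\<kappa> y *\<^sub>R Y y - \<kappa> x *\<^sub>R Y x - (\<Sum>k\<in>UNIV. (X y - X x) $ k *\<^sub>R (\<kappa> x *\<^sub>R Y' x k))) <= ?D * ?d powr (2 * \<alpha>)"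
   by (simp only: distrib_right mult.assoc)
  have "\<kappa> y *\<^sub>R Y' y k - \<kappa> x *\<^sub>R Y' x k = \<kappa> x *\<^sub>R (Y' y k - Y' x k) + (\<kappa> y - \<kappa> x) *\<^sub>R Y' y k"
   by (simp add: algebra_simps)
  moreover have "norm ... <= c * (K * ?d powr \<alpha>) + c * ?\<pi> * C * ?d powr \<alpha>"
   by (intro order_trans[OF norm_triangle_ineq] add_mono tb1 tb2 Q[OF xy] Y p)
  ultimately show "norm (\<kappa> y *\<^sub>R Y' y k - \<kappa> x *\<^sub>R Y' x k) <= ?D * ?d powr \<alpha>"
   by (simp only: distrib_right mult.assoc)
  have "norm ((X y - X x) $ k *\<^sub>R (\<kappa> x *\<^sub>R Y' x k)) <= a * ?d powr \<alpha> * (c * C)" for k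
   unfolding norm_scaleR real_norm_def
   by (intro mult_mono \<kappa> Y order_trans[OF component_le_norm_cart X[OF xy]]) (use c C order_trans[OF norm_ge_zero X[OF xy]] in auto)
  then have "norm (\<Sum>k\<in>UNIV. (X y - X x) $ k *\<^sub>R (\<kappa> x *\<^sub>R Y' x k)) <= real CARD('n) * (a * ?d powr \<alpha> * (c * C))"
   by (intro sum_norm_bound)
  moreover have "?D * ?d powr (2 * \<alpha>) <= ?D * ((2 * pi) powr \<alpha> * ?d powr \<alpha>)"
   by (intro mult_left_mono p) (use c C K in auto)
  ultimately have "norm (\<kappa> y *\<^sub>R Y y - \<kappa> x *\<^sub>R Y x) <= ?D * ((2 * pi) powr \<alpha> * ?d powr \<alpha>) + real CARD('n) * (a * ?d powr \<alpha> * (c * C))"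
   using 1 norm_triangle_sub[of "\<kappa> y *\<^sub>R Y y - \<kappa> x *\<^sub>R Y x" "\<Sum>k\<in>UNIV. (X y - X x) $ k *\<^sub>R (\<kappa> x *\<^sub>R Y' x k)"] by linarith
  then show "norm (\<kappa> y *\<^sub>R Y y - \<kappa> x *\<^sub>R Y x) <= (?D * (2 * pi) powr \<alpha> + real CARD('n) * (a * (c * C))) * ?d powr \<alpha>"
  proof -
   have "D * (p * d) + m * (a * d * e) = (D * p + m * (a * e)) * d" for D p d m e :: real by algebra
   then show "norm (\<kappa> y *\<^sub>R Y y - \<kappa> x *\<^sub>R Y x) <= ?D * ((2 * pi) powr \<alpha> * ?d powr \<alpha>) + real CARD('n) * (a * ?d powr \<alpha> * (c * C)) ==> ?thesis"
    by metis
  qed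
 qed
 show ?thesis
  unfolding controlled_def holder_space_def mem_Collect_eq increment_def
 proof (intro conjI allI)
  show "two_param_finite \<alpha> (%x y. \<kappa> y *\<^sub>R Y y - \<kappa> x *\<^sub>R Y x)"
   by (rule two_param_bound(1)) (use hol in "simp only: abs_minus_commute")
  show "two_param_finite \<alpha> (%x y. \<kappa> y *\<^sub>R Y' y k - \<kappa> x *\<^sub>R Y' x k)" for k
   by (rule two_param_bound(1)) (use der in "simp only: abs_minus_commute")
  show "two_param_finite (2 * \<alpha>) (%x y. \<kappa> y *\<^sub>R Y y - \<kappa> x *\<^sub>R Y x - (\<Sum>k\<in>UNIV. (X y - X x) $ k *\<^sub>R (\<kappa> x *\<^sub>R Y' x k)))"
   by (rule two_param_bound(1)) (use rem in "simp only: abs_minus_commute")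
 qed
qed

lemma heat_kernel_shift_lipschitz:
 assumes "t > 0"
 obtains c where "!!y. abs (heat_kernel t (x - y)) <= c" "!!y z. abs (heat_kernel t (x - z) - heat_kernel t (x - y)) <= c * abs (z - y)"
proof -
 obtain c where c: "!!x. abs (heat_kernel t x) <= c" "!!x. abs (heat_kernel' t x) <= c" using heat_kernel_bounds[OF assms] by metis
 have "norm (heat_kernel t (x - z) - heat_kernel t (x - y)) <= c * abs (z - y)" for y z
  by (rule vector_derivative_bound[where f' = "%y. - heat_kernel' t (x - y)"])
   (use c heat_kernel_shift_deriv[OF assms, of x _ UNIV] in "auto simp: has_real_derivative_iff_has_vector_derivative")
 with c show thesis by (intro that[of c]) auto
qed

context rough_data
begin

lemma slice_rough_integral:
 assumes s: "s : {0..T}" and rp: "rough_path \<alpha> (X s) (XX s)" and v: "slice \<rho> l v w" and t: "t > 0"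
 shows "has_rough_integral (X s) (XX s) (%y. heat_kernel t (x - y) *\<^sub>R g (X s y + v y))
  (%y k. heat_kernel t (x - y) *\<^sub>R pdiff g k (X s y + v y)) (heat_div t (rint g (X s) (XX s) v) x)"
proof -
 note sl = rb[OF s] a \<alpha> nl X\<rho>[OF s]
 have l: "0 <= C * (1 + l)" using slice_l_nonneg[OF sl v] C_pos by simp
 obtain c where c: "!!y. abs (heat_kernel t (x - y)) <= c" "!!y z. abs (heat_kernel t (x - z) - heat_kernel t (x - y)) <= c * abs (z - y)"
  using heat_kernel_shift_lipschitz[OF t] by metis
 have ctr: "controlled \<alpha> (X s) (%y. heat_kernel t (x - y) *\<^sub>R g (X s y + v y)) (%y k. heat_kernel t (x - y) *\<^sub>R pdiff g k (X s y + v y))"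
  by (rule controlled_scaleR[OF c slice_bounds_all[OF sl v] slice_estimates(3,4)[OF sl v] rough_boundD(1)[OF rb[OF s]]])
   (use \<alpha> l lip_const_nonneg[OF a] in auto)
 show ?thesis
  unfolding rint_def
  by (rule rough_integral_heat_kernel[OF rint_hmod(2)[OF sl v] _ _ _ rint_hmod(1)[OF sl v, unfolded rint_def] _ _ t _ rp ctr])
   (use \<alpha> a l C_pos lip_const_nonneg[OF a] rfc_nonneg in auto)
qed

lemma slice_heat_semigroup:
 assumes s: "s : {0..T}" and v: "slice \<rho> l (v s) (w s)" and t: "t > 0"
 shows "heat_semigroup t (drift f g (X s) (v s) (w s)) x = heat_div t (drift_prim v w s) x" (is ?A1)
  "heat_div t (flux v w s) x = heat_div t (drift_prim v w s) x + heat_div t (rint g (X s) (XX s) (v s)) x" (is ?A2)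
proof -
 note sl = rb[OF s] a \<alpha> nl X\<rho>[OF s]
 have z: "norm (v s y) <= \<rho>" for y using v by (simp add: slice_def)
 have l: "0 <= Kf * (1 + \<rho> + l)" using slice_l_nonneg[OF sl v] \<rho>_nonneg[OF sl] Kf_pos by simp
 note h = flux_parts_hmod[where v = v and w = w, OF s v z]
 show ?A1
  by (rule heat_semigroup_eq_heat_div[OF t drift_continuous[OF sl v Xcont[OF s]] h(2)]) (use \<alpha> l in auto)
 have "(%y. flux v w s y - drift_prim v w s y) = rint g (X s) (XX s) (v s)" by (simp add: flux_def fun_eq_iff)
 with heat_div_diff(1)[OF h(3,2) _ _ l l _ l, of t x] \<alpha>
 show ?A2 by simp
qed

text \<open>Brings an arbitrary mild solution into the form used for the fixed point. Its inner
  integrals \<open>J\<close> are identified with the sewn ones by uniqueness of the rough integral,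
  and its slices are differentiable only for almost every time.\<close>

lemma mild_solution_flux:
 assumes rp: "!!s. s : {0..T} ==> rough_path \<alpha> (X s) (XX s)"
  and u: "mild_solution f g u0 X XX T u" and b: "!!t x. t : {0..T} ==> norm (u t x - X t x) <= \<rho>"
 defines "v \<equiv> %t x. u t x - X t x"
 defines "w \<equiv> %t x. vector_derivative (v t) (at x)"
 shows "AE s in lebesgue. s : {0..T} --> slice \<rho> (C1_norm (v s)) (v s) (w s)" (is ?A)
  and "!!t x. [|t : {0<..T}; x : torus|] ==> set_integrable lebesgue {0..t} (%s. heat_div (t - s) (flux v w s) x) &
   v t x = heat_semigroup t (%y. u0 y - X 0 y) x + (LINT s:{0..t}|lebesgue. heat_div (t - s) (flux v w s) x)"
proof -
 \<comment> \<open>\<open>C1_norm\<close> sees only one period. Periodicity of \<open>v s\<close>,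
   and hence of its derivative, extends the bounds to the whole line.\<close>
 have sl: "slice \<rho> (C1_norm (v s)) (v s) (w s)" if s: "s : {0..T}" and C1: "v s C1_differentiable_on UNIV" for s
 proof -
  obtain D where D: "!!x. (v s has_vector_derivative D x) (at x)" "continuous_on UNIV D"
   using C1 unfolding C1_differentiable_on_def by auto
  have wD: "w s = D" unfolding w_def using D(1) by (auto intro: vector_derivative_at)
  have pv: "periodic (v s)" using u s Xper[OF s] by (simp add: mild_solution_def Let_def periodic_def v_def)
  then have pD: "periodic D"
   unfolding periodic_def
  proof (intro allI)
   fix x assume p: "ALL x. v s (x + 2 * pi) = v s x"
   have "((%x. v s (x + 2 * pi)) has_vector_derivative D (x + 2 * pi)) (at x)"
    using vector_diff_chain_at[of "%x. x + 2 * pi" 1 x "v s" "D (x + 2 * pi)"] D(1)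
    by (simp add: o_def has_vector_derivative_add_const)
   then have "(v s has_vector_derivative D (x + 2 * pi)) (at x)" using p by simp
   then show "D (x + 2 * pi) = D x" using D(1) by (rule vector_derivative_unique_at)
  qed
  have le: "norm (h y) <= sup_norm h" if h: "periodic h" "continuous_on UNIV h" for h :: "real => real^'n" and y
  proof (rule periodic_bound[OF h(1)])
   obtain K where "!!x. norm (h x) <= K" using periodic_continuous_bounded[OF h(1) continuous_on_subset[OF h(2)]] by blast
   then have bd: "bdd_above ((%x. norm (h x)) ` torus)" by (auto intro!: bdd_aboveI)
   show "norm (h y) <= sup_norm h" if "y : torus" for y unfolding sup_norm_def by (rule cSUP_upper[OF that bd])
  qed
  have sup: "norm (h y) <= sup_norm h" "0 <= sup_norm h" if h: "periodic h" "continuous_on UNIV h" for h :: "real => real^'n" and y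
   using le[OF h] order_trans[OF norm_ge_zero le[OF h, of 0]] by auto
  have vc: "continuous_on UNIV (v s)"
   by (intro continuous_at_imp_continuous_on ballI has_vector_derivative_continuous[OF D(1)])
  have "norm (D y) <= C1_norm (v s)" for y
   unfolding C1_norm_def using sup(1)[OF pD D(2), of y] sup(2)[OF pv vc] wD unfolding w_def by simp
  moreover have "norm (v s y) <= \<rho>" for y using b[OF s] by (simp add: v_def)
  ultimately show ?thesis unfolding slice_def wD using D by simp
 qed
 have "AE s in lebesgue. s : {0..T} --> v s C1_differentiable_on UNIV"
  using u by (simp add: mild_solution_def Let_def integrable_into_C1_def v_def)
 then show ae: ?A
  by eventually_elim (use sl in blast)
 fix t x assume t: "t : {0<..T}" and x: "x : torus"
 have uX: "X s y + v s y = u s y" for s y by (simp add: v_def)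
 have dr: "g (u s y) *v vector_derivative (v s) (at y) + (f (u s y) + u s y) = drift f g (X s) (v s) (w s) y" for s y
  by (simp add: drift_def w_def uX)
 obtain J where J: "AE s in lebesgue. s : {0..<t} -->
       has_rough_integral (X s) (XX s)
        (%y. heat_kernel (t - s) (x - y) *\<^sub>R g (u s y))
        (%y k. heat_kernel (t - s) (x - y) *\<^sub>R frechet_derivative g (at (u s y)) (axis k 1)) (J s)"
   "set_integrable lebesgue {0..t} J"
   "set_integrable lebesgue {0..t} (%s. heat_semigroup (t - s) (drift f g (X s) (v s) (w s)) x)"
   "v t x = heat_semigroup t (%y. u0 y - X 0 y) x
      + (LINT s:{0..t}|lebesgue. heat_semigroup (t - s) (drift f g (X s) (v s) (w s)) x) + (LINT s:{0..t}|lebesgue. J s)"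
  using u t x unfolding mild_solution_def Let_def v_def[symmetric] dr by blast
 \<comment> \<open>\<open>J s\<close> is specified only for \<open>s < t\<close>, and
   \<open>heat_div\<close> is used only at positive elapsed time; the endpoint is
   negligible.\<close>
 have ne: "AE s in lebesgue. s ~= t" by (rule AE_completion) (rule AE_lborel_singleton)
 have eq: "AE s in lebesgue. s : {0..t} -->
   heat_semigroup (t - s) (drift f g (X s) (v s) (w s)) x + J s = heat_div (t - s) (flux v w s) x"
  using ae J(1) ne
 proof eventually_elim
  case (elim s)
  show ?case
  proof
   assume "s : {0..t}"
   then have s: "s : {0..T}" "s : {0..<t}" "t - s > 0" using t elim(3) by auto
   have v: "slice \<rho> (C1_norm (v s)) (v s) (w s)" using elim(1) s by blast
   have "J s = heat_div (t - s) (rint g (X s) (XX s) (v s)) x"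
    by (rule has_rough_integral_unique[OF _ slice_rough_integral[OF s(1) rp[OF s(1)] v s(3)]])
     (use elim(2) s(2) in "simp add: uX pdiff_def")
   then show "heat_semigroup (t - s) (drift f g (X s) (v s) (w s)) x + J s = heat_div (t - s) (flux v w s) x"
    using slice_heat_semigroup[where v = v and w = w, OF s(1) v s(3), of x] by simp
  qed
 qed
 note i = set_integral_add[OF J(3,2)]
 show "set_integrable lebesgue {0..t} (%s. heat_div (t - s) (flux v w s) x) &
   v t x = heat_semigroup t (%y. u0 y - X 0 y) x + (LINT s:{0..t}|lebesgue. heat_div (t - s) (flux v w s) x)"
  using set_integral_cong_lebesgue[OF i(1) eq] i(2) J(4) by simp
qed

end

section \<open>Uniqueness\<close>

text \<open>With the weight \<open>exp (- L * s)\<close> and \<open>L\<close> large the convolution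
  kernel has total mass at most 1/2. Tonelli then bounds the weighted integral of \<phi> by half of
  itself, and it is finite, hence zero. Extended nonnegative values avoid any pointwise finiteness
  question.\<close>

lemma ennreal_volterra_unique:
 fixes \<phi> :: "real => ennreal" and c p T :: real
 assumes [measurable]: "\<phi> : borel_measurable borel" and \<phi>0: "!!t. t \<notin> {0..T} ==> \<phi> t = 0"
  and fin: "(\<integral>\<^sup>+t. \<phi> t \<partial>lborel) < \<infinity>" and p: "0 <= p" "p < 1" and c: "c >= 0" and T: "T > 0"
  and le: "!!t. t : {0<..T} ==> \<phi> t <= (\<integral>\<^sup>+s. ennreal (c * (t - s) powr (- p)) * indicator {0<..T} (t - s) * \<phi> s \<partial>lborel)"
 shows "AE t in lborel. \<phi> t = 0"
proof -
 \<comment> \<open>Half of the distance from \<open>p\<close> to 1: a positive power of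
   \<open>1 / L\<close> is gained while the kernel remains integrable.\<close>
 define \<epsilon> where "\<epsilon> = (1 - p) / 2"
 have \<epsilon>: "\<epsilon> > 0" "\<epsilon> <= 1" "- p - \<epsilon> > - 1" using p by (auto simp: \<epsilon>_def field_simps)
 define D where "D = T powr (- p - \<epsilon> + 1) / (- p - \<epsilon> + 1)"
 have D: "(\<integral>\<^sup>+\<tau>. ennreal (\<tau> powr (- p - \<epsilon>)) * indicator {0..T} \<tau> \<partial>lborel) = ennreal D"
  unfolding D_def by (rule nn_integral_has_integral_lebesgue'[OF _ has_integral_powr_from_0[OF \<epsilon>(3)]]) (use T in auto)
 have D0: "D >= 0" using \<epsilon> by (simp add: D_def)
 have "((%L. c * L powr (- \<epsilon>) * D) \<longlongrightarrow> c * 0 * D) at_top"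
  using tendsto_neg_powr[OF _ filterlim_ident, of "- \<epsilon>"] \<epsilon>(1) by (intro tendsto_mult_right tendsto_mult_left) auto
 then have "\<forall>\<^sub>F L in at_top. c * L powr (- \<epsilon>) * D < 1 / 2" by (intro order_tendstoD(2)[of _ 0]) auto
 with eventually_gt_at_top[of 0] have "\<forall>\<^sub>F L in at_top. 0 < L & c * L powr (- \<epsilon>) * D < 1 / 2" by (rule eventually_conj)
 then obtain L where L: "L > 0" "c * L powr (- \<epsilon>) * D <= 1 / 2"
  using eventually_happens'[OF trivial_limit_at_top_linorder] by (metis (no_types, lifting) less_imp_le)
 let ?k = "%\<tau>. ennreal (exp (- L * \<tau>) * (c * \<tau> powr (- p))) * indicator {0<..T} \<tau>"
 let ?\<psi> = "%s. ennreal (exp (- L * s)) * \<phi> s"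
 let ?W = "\<integral>\<^sup>+s. ?\<psi> s \<partial>lborel"
 have k: "(\<integral>\<^sup>+\<tau>. ?k \<tau> \<partial>lborel) <= ennreal (1 / 2)"
 proof -
  have "exp (- L * \<tau>) * (c * \<tau> powr (- p)) <= c * L powr (- \<epsilon>) * \<tau> powr (- p - \<epsilon>)" if "\<tau> > 0" for \<tau>
  proof -
   have "exp (- (L * \<tau>)) <= (L * \<tau>) powr (- \<epsilon>)" by (rule exp_neg_le_powr) (use L \<epsilon> that in auto)
   then have "exp (- (L * \<tau>)) * (c * \<tau> powr (- p)) <= (L * \<tau>) powr (- \<epsilon>) * (c * \<tau> powr (- p))"
    by (rule mult_right_mono) (use c in auto)
   also have "... = c * L powr (- \<epsilon>) * (\<tau> powr (- p) * \<tau> powr (- \<epsilon>))" using L that by (simp add: powr_mult)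
   also have "\<tau> powr (- p) * \<tau> powr (- \<epsilon>) = \<tau> powr (- p - \<epsilon>)" by (simp flip: powr_add)
   finally show ?thesis by simp
  qed
  then have "(\<integral>\<^sup>+\<tau>. ?k \<tau> \<partial>lborel) <= (\<integral>\<^sup>+\<tau>. ennreal (c * L powr (- \<epsilon>)) * (ennreal (\<tau> powr (- p - \<epsilon>)) * indicator {0..T} \<tau>) \<partial>lborel)"
   by (intro nn_integral_mono) (use c in "auto simp: indicator_def ennreal_mult'[symmetric] intro!: ennreal_leI")
  also have "... = ennreal (c * L powr (- \<epsilon>)) * ennreal D" by (subst nn_integral_cmult) (auto simp: D)
  also have "... = ennreal (c * L powr (- \<epsilon>) * D)" by (rule ennreal_mult[symmetric]) (use c D0 in auto)
  also have "... <= ennreal (1 / 2)" by (rule ennreal_leI[OF L(2)])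
  finally show ?thesis .
 qed
 have "?\<psi> t <= (\<integral>\<^sup>+s. ?k (t - s) * ?\<psi> s \<partial>lborel)" if "t ~= 0" for t
 proof (cases "t : {0<..T}")
  case True
  have "?\<psi> t <= ennreal (exp (- L * t)) * (\<integral>\<^sup>+s. ennreal (c * (t - s) powr (- p)) * indicator {0<..T} (t - s) * \<phi> s \<partial>lborel)"
   by (rule mult_left_mono[OF le[OF True]]) simp
  also have "... = (\<integral>\<^sup>+s. ennreal (exp (- L * t)) * (ennreal (c * (t - s) powr (- p)) * indicator {0<..T} (t - s) * \<phi> s) \<partial>lborel)"
   by (rule nn_integral_cmult[symmetric]) measurable
  also have "... = (\<integral>\<^sup>+s. ?k (t - s) * ?\<psi> s \<partial>lborel)"
  proof (rule nn_integral_cong)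
   fix s
   have "exp (- L * t) = exp (- L * (t - s)) * exp (- L * s)" unfolding exp_add[symmetric] by (simp add: algebra_simps)
   then have "ennreal (exp (- L * t)) = ennreal (exp (- L * (t - s))) * ennreal (exp (- L * s))" by (simp add: ennreal_mult'[symmetric])
   then show "ennreal (exp (- L * t)) * (ennreal (c * (t - s) powr (- p)) * indicator {0<..T} (t - s) * \<phi> s) = ?k (t - s) * ?\<psi> s"
    unfolding ennreal_mult'[OF exp_ge_zero] by (simp only: mult_ac)
  qed
  finally show ?thesis .
 next
  case False
  then show ?thesis using \<phi>0[of t] that by auto
 qed
 then have "?W <= (\<integral>\<^sup>+t. \<integral>\<^sup>+s. ?k (t - s) * ?\<psi> s \<partial>lborel \<partial>lborel)"
  by (intro nn_integral_mono_AE) (use AE_lborel_singleton[of "0::real"] in "auto elim: eventually_mono")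
 also have "... = (\<integral>\<^sup>+s. \<integral>\<^sup>+t. ?k (t - s) * ?\<psi> s \<partial>lborel \<partial>lborel)"
  by (rule lborel_pair.Fubini') measurable
 also have "... = (\<integral>\<^sup>+s. (\<integral>\<^sup>+\<tau>. ?k \<tau> \<partial>lborel) * ?\<psi> s \<partial>lborel)"
 proof (rule nn_integral_cong)
  fix s
  have "(\<integral>\<^sup>+t. ?k (t - s) * ?\<psi> s \<partial>lborel) = (\<integral>\<^sup>+t. ?k (t - s) \<partial>lborel) * ?\<psi> s" by (rule nn_integral_multc) measurable
  also have "(\<integral>\<^sup>+t. ?k (t - s) \<partial>lborel) = (\<integral>\<^sup>+\<tau>. ?k \<tau> \<partial>lborel)"
   by (subst nn_integral_real_affine[where c = 1 and t = s]) auto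
  finally show "(\<integral>\<^sup>+t. ?k (t - s) * ?\<psi> s \<partial>lborel) = (\<integral>\<^sup>+\<tau>. ?k \<tau> \<partial>lborel) * ?\<psi> s" .
 qed
 also have "... = (\<integral>\<^sup>+\<tau>. ?k \<tau> \<partial>lborel) * ?W" by (rule nn_integral_cmult) measurable
 also have "... <= ennreal (1 / 2) * ?W" by (rule mult_right_mono[OF k]) simp
 finally have W: "?W <= ennreal (1 / 2) * ?W" .
 have "?W <= (\<integral>\<^sup>+t. \<phi> t \<partial>lborel)"
 proof (rule nn_integral_mono)
  fix s
  show "?\<psi> s <= \<phi> s"
  proof (cases "s : {0..T}")
   case True
   then have "ennreal (exp (- L * s)) <= 1" using L by (simp add: ennreal_le_1)
   from mult_right_mono[OF this, of "\<phi> s"] show ?thesis by simp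
  qed (simp add: \<phi>0)
 qed
 then have "?W < \<infinity>" using fin by (rule le_less_trans)
 then obtain r where r: "?W = ennreal r" "r >= 0" by (cases ?W) auto
 have "ennreal r <= ennreal (1 / 2 * r)" using W unfolding r(1) by (subst ennreal_mult) (use r in auto)
 then have "r <= 1 / 2 * r" by (subst (asm) ennreal_le_iff) (use r in auto)
 then have "?W = 0" using r by simp
 then have "AE s in lborel. ?\<psi> s = 0" by (subst (asm) nn_integral_0_iff_AE) measurable
 then show ?thesis by eventually_elim (simp add: ennreal_eq_0_iff not_le)
qed

text \<open>Suprema over a countable set are measurable in time, and by continuity a dense one
  controls the whole torus. Coinciding points do no harm to the quotients, as division by zero
  yields 0.\<close>

lemma dense_sup_bound:
 fixes d :: "real => 'a::real_normed_vector"
 assumes A: "A \<subseteq> torus" "torus \<subseteq> closure A" and d: "continuous_on torus d"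
 shows "[|(SUP q\<in>A. ennreal (norm (d q))) <= ennreal z; z >= 0; y : torus|] ==> norm (d y) <= z"
  and "[|(SUP q\<in>A \<times> A. ennreal (norm (d (fst q) - d (snd q)) / abs (fst q - snd q))) <= ennreal m; m >= 0; x : torus; y : torus|]
   ==> norm (d x - d y) <= m * abs (x - y)"
proof -
 have cl: "closure A = torus" using A closure_mono[OF A(1)] by simp
 { assume *: "(SUP q\<in>A. ennreal (norm (d q))) <= ennreal z" "z >= 0" "y : torus"
  show "norm (d y) <= z"
  proof (rule continuous_le_on_closure[of A "%y. norm (d y)" y z])
   show "continuous_on (closure A) (%y. norm (d y))" unfolding cl by (intro continuous_intros d)
   show "y : closure A" using * cl by simp
   fix q assume "q : A"
   then have "ennreal (norm (d q)) <= ennreal z" using *(1) by (meson SUP_upper order_trans)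
   then show "norm (d q) <= z" using * by simp
  qed }
 { assume *: "(SUP q\<in>A \<times> A. ennreal (norm (d (fst q) - d (snd q)) / abs (fst q - snd q))) <= ennreal m" "m >= 0" "x : torus" "y : torus"
  have "(%q. norm (d (fst q) - d (snd q)) - m * abs (fst q - snd q)) (x, y) <= 0"
  proof (rule continuous_le_on_closure[of "A \<times> A"])
   show "continuous_on (closure (A \<times> A)) (%q. norm (d (fst q) - d (snd q)) - m * abs (fst q - snd q))"
    unfolding closure_Times cl by (intro continuous_intros continuous_on_compose2[OF d]) auto
   show "(x, y) : closure (A \<times> A)" using * by (simp add: closure_Times cl)
   fix q assume "q : A \<times> A"
   then have "ennreal (norm (d (fst q) - d (snd q)) / abs (fst q - snd q)) <= ennreal m" using *(1) by (meson SUP_upper order_trans)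
   then have "norm (d (fst q) - d (snd q)) / abs (fst q - snd q) <= m" using * by simp
   then show "norm (d (fst q) - d (snd q)) - m * abs (fst q - snd q) <= 0"
    by (cases "fst q = snd q") (auto simp: divide_le_eq)
  qed
  then show "norm (d x - d y) <= m * abs (x - y)" by simp }
qed

lemma lipschitz_vector_derivative_bound:
 fixes d :: "real => 'a::real_normed_vector"
 assumes d: "(d has_vector_derivative w) (at y)" and y: "y : torus" and lip: "!!x. x : torus ==> norm (d x - d y) <= m * abs (x - y)"
 shows "norm w <= m"
proof -
 let ?e = "%x. (1 / norm (x - y)) *\<^sub>R (d x - (d y + (x - y) *\<^sub>R w))"
 have "(?e \<longlongrightarrow> 0) (at y within torus)"
  using has_vector_derivative_at_within[OF d, of torus] by (simp add: has_vector_derivative_def has_derivative_within)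
 then have "((%x. norm (?e x) + m) \<longlongrightarrow> 0 + m) (at y within torus)" by (intro tendsto_intros tendsto_norm_zero)
 moreover have "\<forall>\<^sub>F x in at y within torus. norm w <= norm (?e x) + m"
 proof -
  have "norm w <= norm (?e x) + m" if x: "x : torus" "x ~= y" for x
  proof -
   have n: "abs (x - y) > 0" using x by simp
   have "abs (x - y) * norm w = norm ((d x - d y) - (d x - (d y + (x - y) *\<^sub>R w)))" by simp
   also have "... <= m * abs (x - y) + norm (d x - (d y + (x - y) *\<^sub>R w))"
    by (intro order_trans[OF norm_triangle_ineq4] add_mono lip x order_refl)
   finally have "norm w <= (m * abs (x - y) + norm (d x - (d y + (x - y) *\<^sub>R w))) / abs (x - y)"
    using n by (simp add: le_divide_eq mult.commute)
   then show ?thesis using n by (simp add: add_divide_distrib)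
  qed
  then show ?thesis by (auto simp: eventually_at_filter)
 qed
 moreover have "\<not> trivial_limit (at y within torus)" using y by (simp add: trivial_limit_within)
 ultimately have "norm w <= 0 + m" by (intro tendsto_lowerbound[of _ "0 + m" "at y within torus"])
 then show ?thesis by simp
qed

context rough_data
begin

text \<open>With \<open>q\<close> above both coefficients the two parts of the modulus share one
  constant. The gradient estimate is phrased as a Lipschitz bound in space, the form in which the
  uniqueness proof measures gradients.\<close>

lemma flux_diff_heat_div:
 assumes s: "s : {0..T}" and v: "slice \<rho> l (v s) (w s)" and v': "slice \<rho> l' (v' s) (w' s)"
  and z: "!!y. norm (v s y - v' s y) <= z" and m: "!!y. norm (w s y - w' s y) <= m"
  and q: "z <= q" "m + z * (1 + l) <= q" and \<tau>: "\<tau> : {0<..T}"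
 shows "norm (heat_div \<tau> (flux v w s) x - heat_div \<tau> (flux v' w' s) x) <= heat_volterra_const \<alpha> T * Kf * \<tau> powr (- ((1 - \<alpha>) / 2)) * q" (is ?A1)
  "norm ((heat_div \<tau> (flux v w s) x - heat_div \<tau> (flux v' w' s) x) - (heat_div \<tau> (flux v w s) y - heat_div \<tau> (flux v' w' s) y)) <=
   heat_volterra_const \<alpha> T * Kf * \<tau> powr (- (1 - \<alpha> / 2)) * q * abs (x - y)" (is ?A2)
proof -
 note sl = rb[OF s] a \<alpha> nl X\<rho>[OF s]
 have z0: "0 <= z" by (rule order_trans[OF norm_ge_zero z])
 have \<tau>': "\<tau> > 0" "\<tau> <= T" using \<tau> by auto
 let ?F = "%y. flux v w s y - flux v' w' s y"
 have Kq: "0 <= Kf * q" using Kf_pos z0 q by simp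
 have "Kf * z <= Kf * q" "Kf * (m + z * (1 + l)) <= Kf * q" using q Kf_pos by (auto intro: mult_left_mono)
 from hmod_mono[OF flux_diff_hmod[where v = v and w = w and v' = v' and w' = w', OF s v v' z m] this]
 have F: "hmod \<alpha> (Kf * q) (Kf * q) ?F" .
 have nb: "norm (v s y) <= \<rho>" "norm (v' s y) <= \<rho>" for y using v v' by (auto simp: slice_def)
 have l: "0 <= Kf * (1 + \<rho> + l)" "0 <= Kf * (1 + \<rho> + l')"
  using slice_l_nonneg[OF sl v] slice_l_nonneg[OF sl v'] \<rho>_nonneg[OF sl] Kf_pos by auto
 have \<alpha>1: "0 < \<alpha>" "\<alpha> <= 1" using \<alpha> by auto
 have eq: "heat_div \<tau> ?F x = heat_div \<tau> (flux v w s) x - heat_div \<tau> (flux v' w' s) x" for x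
  by (rule heat_div_diff(1)[OF flux_parts_hmod(3)[where v = v and w = w, OF s v nb(1)] flux_parts_hmod(3)[where v = v' and w = w', OF s v' nb(2)] \<alpha>1 l(1,1,2,2)])
 let ?h = "heat_div_const \<alpha> T"
 have h: "?h > 0" by (rule heat_div_const_pos)
 have one: "1 <= T powr ((1 - \<alpha>) / 2) * \<tau> powr (- ((1 - \<alpha>) / 2))"
 proof -
  have "\<tau> powr ((1 - \<alpha>) / 2) * \<tau> powr (- ((1 - \<alpha>) / 2)) = 1" using \<tau>' by (simp flip: powr_add)
  moreover have "\<tau> powr ((1 - \<alpha>) / 2) * \<tau> powr (- ((1 - \<alpha>) / 2)) <= T powr ((1 - \<alpha>) / 2) * \<tau> powr (- ((1 - \<alpha>) / 2))"
   by (intro mult_right_mono powr_mono2) (use \<tau>' \<alpha> in auto)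
  ultimately show ?thesis by simp
 qed
 have e: "(\<alpha> - 1) / 2 = - ((1 - \<alpha>) / 2)" "(\<alpha> - 2) / 2 = - (1 - \<alpha> / 2)" "- 1 / 2 + - ((1 - \<alpha>) / 2) = - (1 - \<alpha> / 2)"
  by (auto simp: field_simps)
 have p: "\<tau> powr (- 1 / 2) * \<tau> powr (- ((1 - \<alpha>) / 2)) = \<tau> powr (- (1 - \<alpha> / 2))"
  unfolding e(3)[symmetric] by (rule powr_add[symmetric])
 have A: "\<tau> powr (- ((1 - \<alpha>) / 2)) + 1 <= (1 + T powr ((1 - \<alpha>) / 2)) * \<tau> powr (- ((1 - \<alpha>) / 2))"
  using one unfolding distrib_right mult_1 by linarith
 have "\<tau> powr (- (1 - \<alpha> / 2)) + \<tau> powr (- 1 / 2) = \<tau> powr (- 1 / 2) * (\<tau> powr (- ((1 - \<alpha>) / 2)) + 1)"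
  unfolding distrib_left p by simp
 also have "... <= \<tau> powr (- 1 / 2) * ((1 + T powr ((1 - \<alpha>) / 2)) * \<tau> powr (- ((1 - \<alpha>) / 2)))"
  by (rule mult_left_mono[OF A]) simp
 also have "... = (1 + T powr ((1 - \<alpha>) / 2)) * \<tau> powr (- (1 - \<alpha> / 2))" unfolding p[symmetric] by (simp only: mult_ac)
 finally have B: "\<tau> powr (- (1 - \<alpha> / 2)) + \<tau> powr (- 1 / 2) <= (1 + T powr ((1 - \<alpha>) / 2)) * \<tau> powr (- (1 - \<alpha> / 2))" .
 have fin: "?h * (Kf * q * r + Kf * q * r') <= heat_volterra_const \<alpha> T * Kf * t * q"
  if "r + r' <= (1 + T powr ((1 - \<alpha>) / 2)) * t" for r r' t
 proof -
  have "?h * (Kf * q) * (r + r') <= ?h * (Kf * q) * ((1 + T powr ((1 - \<alpha>) / 2)) * t)"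
   by (rule mult_left_mono[OF that]) (use h Kq in auto)
  then show ?thesis unfolding heat_volterra_const_def by (simp add: algebra_simps)
 qed
 have b: "norm (heat_div \<tau> ?F x) <= ?h * (Kf * q * \<tau> powr (- ((1 - \<alpha>) / 2)) + Kf * q * 1)"
  "norm (heat_div' \<tau> ?F x) <= ?h * (Kf * q * \<tau> powr (- (1 - \<alpha> / 2)) + Kf * q * \<tau> powr (- 1 / 2))" for x
  using heat_div_bounds[OF F \<alpha>1 Kq Kq \<tau>', of x] unfolding e(1,2) by simp_all
 show ?A1
  unfolding eq[symmetric] by (rule order_trans[OF b(1) fin[OF A]])
 show ?A2
  unfolding eq[symmetric]
  by (rule vector_derivative_bound[OF heat_div_vector_derivative[OF F \<alpha>1 Kq Kq \<tau>'(1)] order_trans[OF b(2) fin[OF B]]])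
qed

end

lemma continuous_AE_zero:
 fixes h :: "real => 'a::euclidean_space"
 assumes h: "continuous_on {0..T} h" and ae: "AE t in lborel. t : {0..T} --> h t = 0" and T: "T > 0" and t: "t : {0..T}"
 shows "h t = 0"
proof -
 let ?S = "{t. \<not> (t : {0..T} --> h t = 0)}"
 have "AE t in lebesgue. t : {0..T} --> h t = 0" by (rule AE_completion[OF ae])
 then have "negligible ?S" unfolding negligible_iff_null_sets completion.AE_iff_null_sets by simp
 then have "((%t. norm (h t)) has_integral 0) {0..T}" by (rule has_integral_negligible) auto
 then have "integral {0..T} (%t. norm (h t)) = 0" by (rule integral_unique)
 then have "ALL t:{0..T}. norm (h t) = 0"
  by (subst (asm) integral_eq_0_iff) (use T h in "auto intro!: continuous_intros")
 then show ?thesis using t by simp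
qed

lemma powr_minus_half_integrable:
 fixes T :: real
 assumes "T >= 0"
 shows "set_integrable lebesgue {0..T} (%s. rsqrt s)"
 by (rule nonnegative_absolutely_integrable_1)
  (use has_integral_powr_from_0[of "- 1 / 2" T] assms in auto)

lemma norm_set_integral_le_nn_integral:
 fixes H :: "real => 'a::euclidean_space"
 assumes i: "set_integrable lebesgue {0..t} H" and le: "AE s in lebesgue. s : {0<..<t} --> ennreal (norm (H s)) <= \<Phi> s"
 shows "ennreal (norm (LINT s:{0..t}|lebesgue. H s)) <= (\<integral>\<^sup>+s. \<Phi> s \<partial>lborel)"
proof -
 have ne: "AE s in lebesgue. s ~= 0 & s ~= t"
  by (rule AE_completion) (use AE_lborel_singleton[of 0] AE_lborel_singleton[of t] in "auto elim: eventually_elim2")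
 have "ennreal (norm (LINT s:{0..t}|lebesgue. H s)) <= (\<integral>\<^sup>+s. ennreal (norm (indicat_real {0..t} s *\<^sub>R H s)) \<partial>lebesgue)"
  unfolding set_lebesgue_integral_def by (rule integral_norm_bound_ennreal) (use i in "simp add: set_integrable_def")
 also have "... <= (\<integral>\<^sup>+s. \<Phi> s \<partial>lebesgue)"
  by (rule nn_integral_mono_AE, use le ne in eventually_elim) (auto simp: indicator_def)
 finally show ?thesis by (simp add: nn_integral_completion)
qed

context rough_data
begin

text \<open>Only the first solution is required to have gradients of order \<open>rsqrt s\<close>.
  About the second, arbitrary one the definition gives no more than an integrable C1 norm, hence a
  Gronwall argument in the mean over time instead of a supremum.\<close>

theorem mild_solution_unique:
 assumes rp: "!!s. s : {0..T} ==> rough_path \<alpha> (X s) (XX s)"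
  and u: "mild_solution f g u0 X XX T u" "!!t x. t : {0..T} ==> norm (u t x - X t x) <= \<rho>"
  and u': "mild_solution f g u0 X XX T u'" "!!t x. t : {0..T} ==> norm (u' t x - X t x) <= \<rho>"
  and N: "!!s y. s : {0<..T} ==> norm (vector_derivative (%x. u s x - X s x) (at y)) <= N * rsqrt s" "N >= 0"
  and t: "t : {0..T}"
 shows "u t = u' t"
proof -
 define v where "v = (%t x. u t x - X t x)"
 define v' where "v' = (%t x. u' t x - X t x)"
 define w where "w = (%t x. vector_derivative (v t) (at x))"
 define w' where "w' = (%t x. vector_derivative (v' t) (at x))"
 define D where "D s y = (if s : {0..T} then u s y - u' s y else 0)" for s y
 have Dv: "D s y = v s y - v' s y" if "s : {0..T}" for s y using that by (simp add: D_def v_def v'_def)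
 have fx: "AE s in lebesgue. s : {0..T} --> slice \<rho> (C1_norm (v s)) (v s) (w s)"
  "!!t x. [|t : {0<..T}; x : torus|] ==> set_integrable lebesgue {0..t} (%s. heat_div (t - s) (flux v w s) x) &
   v t x = heat_semigroup t (%y. u0 y - X 0 y) x + (LINT s:{0..t}|lebesgue. heat_div (t - s) (flux v w s) x)"
  using mild_solution_flux[OF rp u] unfolding v_def w_def by blast+
 have fx': "AE s in lebesgue. s : {0..T} --> slice \<rho> (C1_norm (v' s)) (v' s) (w' s)"
  "!!t x. [|t : {0<..T}; x : torus|] ==> set_integrable lebesgue {0..t} (%s. heat_div (t - s) (flux v' w' s) x) &
   v' t x = heat_semigroup t (%y. u0 y - X 0 y) x + (LINT s:{0..t}|lebesgue. heat_div (t - s) (flux v' w' s) x)"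
  using mild_solution_flux[OF rp u'] unfolding v'_def w'_def by blast+
 obtain A where A: "countable A" "A \<subseteq> torus" "torus \<subseteq> closure A" by (rule separable)
 have cC: "continuous_into_C T u" "continuous_into_C T u'" using u(1) u'(1) by (auto simp: mild_solution_def Let_def)
 have time: "continuous_on {0..T} (%s. h s y)" if "continuous_into_C T h" "y : torus" for h :: "real => real => real^'n" and y
  unfolding continuous_on_def using that by (auto simp: continuous_into_C_def dest!: tendsto_uniform_limitI)
 have dt: "continuous_on {0..T} (%s. u s y - u' s y)" if "y : torus" for y
  by (intro continuous_intros time cC that)
 have dc: "continuous_on torus (D s)" for s
  using cC by (cases "s : {0..T}") (auto simp: D_def[abs_def] continuous_into_C_def intro!: continuous_intros)
 have Dm: "(%s. D s y) : borel_measurable borel" if "y : torus" for y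
 proof -
  have "(%s. indicator {0..T} s *\<^sub>R (u s y - u' s y)) : borel_measurable borel"
   by (rule borel_measurable_continuous_on_indicator[OF _ dt[OF that]]) simp
  moreover have "(%s. indicator {0..T} s *\<^sub>R (u s y - u' s y)) = (%s. D s y)" by (auto simp: D_def fun_eq_iff)
  ultimately show ?thesis by simp
 qed
 \<comment> \<open>\<open>Z\<close> and \<open>Q\<close> are sup norm and Lipschitz seminorm of the
   difference. In \<open>\<phi>\<close> the weight on \<open>Z\<close> matches the factor
   \<open>1 + l\<close> with \<open>l = N * rsqrt s\<close>, which multiplies the sup distance in
   \<open>flux_diff_hmod\<close>.\<close>
 define Z where "Z s = (SUP q\<in>A. ennreal (norm (D s q)))" for s
 define Q where "Q s = (SUP q\<in>A \<times> A. ennreal (norm (D s (fst q) - D s (snd q)) / abs (fst q - snd q)))" for s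
 define \<phi> where "\<phi> s = Z s * ennreal (1 + rsqrt s) + Q s" for s
 have [measurable]: "Z : borel_measurable borel" "Q : borel_measurable borel"
 proof -
  show "Z : borel_measurable borel" unfolding Z_def[abs_def]
   by (rule borel_measurable_SUP[OF A(1)]) (use A(2) in "auto intro!: measurable_compose[OF Dm] borel_measurable_norm")
  have "countable (A \<times> A)" using A(1) by auto
  then show "Q : borel_measurable borel" unfolding Q_def[abs_def]
  proof (rule borel_measurable_SUP)
   fix q assume "q : A \<times> A"
   then have [measurable]: "(%s. D s (fst q)) : borel_measurable borel" "(%s. D s (snd q)) : borel_measurable borel"
    using A(2) by (auto intro!: Dm)
   show "(%s. ennreal (norm (D s (fst q) - D s (snd q)) / abs (fst q - snd q))) : borel_measurable borel" by measurable
  qed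
 qed
 have [measurable]: "\<phi> : borel_measurable borel" unfolding \<phi>_def[abs_def] by measurable
 have \<phi>0: "\<phi> s = 0" if "s \<notin> {0..T}" for s
 proof -
  have "Z s = 0" "Q s = 0" unfolding Z_def Q_def using that by (auto simp: D_def intro!: antisym SUP_least)
  then show ?thesis by (simp add: \<phi>_def)
 qed
 let ?n = "%s. C1_norm (v' s)"
 \<comment> \<open>A majorant of \<open>\<phi>\<close> that is integrable although it contains the
   C1 norm of the second solution; it supplies the finiteness needed by
   \<open>ennreal_volterra_unique\<close>.\<close>
 define B where "B s = 2 * \<rho> * (1 + rsqrt s) + (N * rsqrt s + ?n s)" for s
 have \<rho>: "\<rho> >= 0" using b_nonneg b\<rho> by linarith
 have good: "AE s in lebesgue. s : {0<..T} --> slice \<rho> (N * rsqrt s) (v s) (w s) & slice \<rho> (?n s) (v' s) (w' s)"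
  using fx(1) fx'(1)
 proof eventually_elim
  case (elim s)
  show ?case
  proof
   assume s: "s : {0<..T}"
   have "norm (w s y) <= N * rsqrt s" for y using N(1)[OF s, of y] by (simp add: w_def v_def)
   then show "slice \<rho> (N * rsqrt s) (v s) (w s) & slice \<rho> (?n s) (v' s) (w' s)"
    using elim s by (auto simp: slice_def)
  qed
 qed
 have real\<phi>: "EX z m. 0 <= z & 0 <= m & Z s = ennreal z & Q s = ennreal m & \<phi> s = ennreal (z * (1 + rsqrt s) + m) &
   z * (1 + rsqrt s) + m <= B s & (ALL y. norm (v s y - v' s y) <= z) & (ALL y. norm (w s y - w' s y) <= m)"
  if s: "s : {0<..T}" and sl: "slice \<rho> (N * rsqrt s) (v s) (w s)" "slice \<rho> (?n s) (v' s) (w' s)" for s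
 proof -
  have s': "s : {0..T}" using s by auto
  let ?l = "N * rsqrt s + ?n s"
  have l: "0 <= ?l" using slice_l_nonneg[OF rb[OF s'] a \<alpha> nl X\<rho>[OF s'] sl(2)] N(2) by (auto intro!: add_nonneg_nonneg)
  have wl: "norm (w s y - w' s y) <= ?l" for y
   using sl unfolding slice_def by (intro order_trans[OF norm_triangle_ineq4] add_mono) auto
  have "ennreal (norm (D s q)) <= ennreal (2 * \<rho>)" for q
  proof (rule ennreal_leI)
   have "norm (v s q) <= \<rho>" "norm (v' s q) <= \<rho>" using sl by (auto simp: slice_def)
   then show "norm (D s q) <= 2 * \<rho>" unfolding Dv[OF s'] using norm_triangle_ineq4[of "v s q" "v' s q"] by linarith
  qed
  then have Zle: "Z s <= ennreal (2 * \<rho>)" unfolding Z_def by (intro SUP_least)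
  have dd: "((%x. D s x) has_vector_derivative w s y - w' s y) (at y)" for y
   unfolding Dv[OF s'] using sl by (auto simp: slice_def intro!: has_vector_derivative_diff)
  have "ennreal (norm (D s p - D s q) / abs (p - q)) <= ennreal ?l" for p q
  proof (rule ennreal_leI)
   have "norm (D s p - D s q) <= ?l * abs (p - q)" by (rule vector_derivative_bound[OF dd wl])
   then show "norm (D s p - D s q) / abs (p - q) <= ?l" using l by (cases "p = q") (auto simp: divide_le_eq)
  qed
  then have Qle: "Q s <= ennreal ?l" unfolding Q_def by (intro SUP_least) auto
  obtain z where z: "Z s = ennreal z" "0 <= z" "z <= 2 * \<rho>" using Zle \<rho> by (cases "Z s") (auto simp: top_unique)
  obtain m where m: "Q s = ennreal m" "0 <= m" "m <= ?l" using Qle l by (cases "Q s") (auto simp: top_unique)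
  have lipm: "norm (D s x - D s y) <= m * abs (x - y)" if "x : torus" "y : torus" for x y
   by (rule dense_sup_bound(2)[OF A(2,3) dc _ m(2) that]) (use m(1) in "simp add: Q_def")
  have zt: "norm (D s y) <= z" if "y : torus" for y
   by (rule dense_sup_bound(1)[OF A(2,3) dc _ z(2) that]) (use z(1) in "simp add: Z_def")
  have pD: "periodic (D s)" using u(1) u'(1) s' by (simp add: mild_solution_def Let_def periodic_def D_def)
  have zb: "norm (D s y) <= z" for y by (rule periodic_bound[where P = "%r. norm r <= z", OF pD zt])
  have wt: "norm (w s y - w' s y) <= m" if "y : torus" for y
   by (rule lipschitz_vector_derivative_bound[OF dd that lipm]) (use that in auto)
  have pw: "periodic (%y. w s y - w' s y)"
   unfolding periodic_def
  proof
   fix x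
   have "((%x. D s (x + 2 * pi)) has_vector_derivative w s (x + 2 * pi) - w' s (x + 2 * pi)) (at x)"
    using vector_diff_chain_at[of "%x. x + 2 * pi" 1 x "D s" "w s (x + 2 * pi) - w' s (x + 2 * pi)"] dd
    by (simp add: o_def has_vector_derivative_add_const)
   then have "(D s has_vector_derivative w s (x + 2 * pi) - w' s (x + 2 * pi)) (at x)" using pD by (simp add: periodic_def)
   then show "w s (x + 2 * pi) - w' s (x + 2 * pi) = w s x - w' s x" using dd by (rule vector_derivative_unique_at)
  qed
  have mb: "norm (w s y - w' s y) <= m" for y by (rule periodic_bound[where P = "%r. norm r <= m", OF pw wt])
  have p: "0 <= 1 + rsqrt s" by (simp add: add_nonneg_nonneg)
  have "\<phi> s = ennreal (z * (1 + rsqrt s) + m)"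
   unfolding \<phi>_def z m by (simp only: ennreal_mult[OF z(2) p, symmetric]) (rule ennreal_plus[symmetric]; use z m p in auto)
  moreover have "z * (1 + rsqrt s) + m <= B s"
   unfolding B_def by (intro add_mono mult_right_mono z m p)
  ultimately show ?thesis using z m zb mb unfolding Dv[OF s'] by blast
 qed
 have fin: "(\<integral>\<^sup>+s. \<phi> s \<partial>lborel) < \<infinity>"
 proof -
  have "set_integrable lebesgue {0..T} ?n" using u'(1) by (simp add: mild_solution_def Let_def integrable_into_C1_def v'_def)
  moreover have "set_integrable lebesgue {0..T} (%s. rsqrt s)" using powr_minus_half_integrable[of T] T by simp
  moreover have "set_integrable lebesgue {0..T} (%s. 1 :: real)"
   by (rule absolutely_integrable_on_const) simp
  ultimately have "set_integrable lebesgue {0..T} B" unfolding B_def[abs_def]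
   by (intro set_integral_add set_integrable_mult_right) auto
  then have "(\<integral>\<^sup>+s. ennreal (norm (indicat_real {0..T} s *\<^sub>R B s)) \<partial>lebesgue) < \<infinity>"
   unfolding set_integrable_def integrable_iff_bounded by simp
  moreover have "AE s in lebesgue. s ~= 0" by (rule AE_completion[OF AE_lborel_singleton])
  then have "AE s in lebesgue. \<phi> s <= ennreal (norm (indicat_real {0..T} s *\<^sub>R B s))"
   using good
  proof eventually_elim
   case (elim s)
   show ?case
   proof (cases "s : {0<..T}")
    case True
    then obtain z m where "\<phi> s = ennreal (z * (1 + rsqrt s) + m)" "z * (1 + rsqrt s) + m <= B s"
     using real\<phi>[OF True] elim by blast
    then show ?thesis using True by (auto intro!: ennreal_leI)
   next
    case False
    then have "s \<notin> {0..T}" using elim(1) by auto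
    then show ?thesis by (simp add: \<phi>0)
   qed
  qed
  then have "(\<integral>\<^sup>+s. \<phi> s \<partial>lebesgue) <= (\<integral>\<^sup>+s. ennreal (norm (indicat_real {0..T} s *\<^sub>R B s)) \<partial>lebesgue)"
   by (rule nn_integral_mono_AE)
  ultimately have "(\<integral>\<^sup>+s. \<phi> s \<partial>lebesgue) < \<infinity>" by (metis le_less_trans)
  then show ?thesis by (simp add: nn_integral_completion)
 qed
 define p where "p = 1 - \<alpha> / 2"
 define c where "c = heat_volterra_const \<alpha> T * Kf * (1 + N)"
 have c: "c >= 0" using Kf_pos heat_volterra_const_pos[of \<alpha> T] N(2) by (auto simp: c_def intro!: mult_nonneg_nonneg less_imp_le)
 define I where "I t = (\<integral>\<^sup>+s. ennreal ((t - s) powr (- p)) * indicator {0<..T} (t - s) * \<phi> s \<partial>lborel)" for t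
 have key: "\<phi> t <= (\<integral>\<^sup>+s. ennreal (c * (2 + T powr (1 / 2)) * (t - s) powr (- p)) * indicator {0<..T} (t - s) * \<phi> s \<partial>lborel)"
  if t: "t : {0<..T}" for t
 proof -
  have t': "t : {0..T}" using t by auto
  let ?G = "%s x. heat_div (t - s) (flux v w s) x - heat_div (t - s) (flux v' w' s) x"
  have Gi: "set_integrable lebesgue {0..t} (%s. ?G s x)" and DG: "D t x = (LINT s:{0..t}|lebesgue. ?G s x)" if x: "x : torus" for x
  proof -
   note i = set_integral_diff[OF conjunct1[OF fx(2)[OF t x]] conjunct1[OF fx'(2)[OF t x]]]
   show "set_integrable lebesgue {0..t} (%s. ?G s x)" by (rule i(1))
   show "D t x = (LINT s:{0..t}|lebesgue. ?G s x)"
    unfolding Dv[OF t'] using conjunct2[OF fx(2)[OF t x]] conjunct2[OF fx'(2)[OF t x]] i(2) by simp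
  qed
  have Gb: "AE s in lebesgue. s : {0<..<t} --> (EX q>=0. \<phi> s = ennreal q & (ALL x y. norm (?G s x) <= c * (t - s) powr (- ((1 - \<alpha>) / 2)) * q &
    norm (?G s x - ?G s y) <= c * (t - s) powr (- p) * q * abs (x - y)))"
   using good
  proof eventually_elim
   case (elim s)
   show ?case
   proof
    assume s0: "s : {0<..<t}"
    then have s: "s : {0<..T}" "s : {0..T}" "t - s : {0<..T}" using t by auto
    have sl: "slice \<rho> (N * rsqrt s) (v s) (w s)" "slice \<rho> (?n s) (v' s) (w' s)" using elim s by auto
    obtain z m where zm: "0 <= z" "0 <= m" "\<phi> s = ennreal (z * (1 + rsqrt s) + m)"
     "!!y. norm (v s y - v' s y) <= z" "!!y. norm (w s y - w' s y) <= m" using real\<phi>[OF s(1) sl] by blast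
    let ?q = "z * (1 + rsqrt s) + m"
    have q0: "?q >= 0" using zm by (intro add_nonneg_nonneg mult_nonneg_nonneg) auto
    have q: "z <= (1 + N) * ?q" "m + z * (1 + N * rsqrt s) <= (1 + N) * ?q"
    proof -
     have "0 <= z * rsqrt s" "0 <= N * z" "0 <= N * (z * rsqrt s)" "0 <= N * m" using zm N(2) by auto
     then show "z <= (1 + N) * ?q" "m + z * (1 + N * rsqrt s) <= (1 + N) * ?q" using zm by (auto simp: algebra_simps)
    qed
    note fd = flux_diff_heat_div[where v = v and w = w and v' = v' and w' = w', OF s(2) sl zm(4,5) q s(3)]
    have "norm (?G s x) <= c * (t - s) powr (- ((1 - \<alpha>) / 2)) * ?q & norm (?G s x - ?G s y) <= c * (t - s) powr (- p) * ?q * abs (x - y)" for x y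
     using fd(1)[of x] fd(2)[of x y] unfolding c_def p_def by (simp only: mult_ac)
    then show "EX q>=0. \<phi> s = ennreal q & (ALL x y. norm (?G s x) <= c * (t - s) powr (- ((1 - \<alpha>) / 2)) * q &
     norm (?G s x - ?G s y) <= c * (t - s) powr (- p) * q * abs (x - y))" using q0 zm(3) by blast
   qed
  qed
  have le: "ennreal (norm (LINT s:{0..t}|lebesgue. H s)) <= ennreal K * I t"
   if H: "set_integrable lebesgue {0..t} H" and K: "K >= 0"
    and b: "AE s in lebesgue. s : {0<..<t} --> (EX q>=0. \<phi> s = ennreal q & norm (H s) <= K * ((t - s) powr (- p) * q))" for H :: "real => real^'n" and K
  proof -
   have "ennreal (norm (LINT s:{0..t}|lebesgue. H s)) <= (\<integral>\<^sup>+s. ennreal K * (ennreal ((t - s) powr (- p)) * indicator {0<..T} (t - s) * \<phi> s) \<partial>lborel)"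
   proof (rule norm_set_integral_le_nn_integral[OF H], use b in eventually_elim, rule impI)
    fix s assume *: "s : {0<..<t} --> (EX q>=0. \<phi> s = ennreal q & norm (H s) <= K * ((t - s) powr (- p) * q))" and s: "s : {0<..<t}"
    then obtain q where q: "q >= 0" "\<phi> s = ennreal q" "norm (H s) <= K * ((t - s) powr (- p) * q)" by blast
    have "indicator {0<..T} (t - s) = (1 :: ennreal)" using s t by auto
    then have "ennreal K * (ennreal ((t - s) powr (- p)) * indicator {0<..T} (t - s) * \<phi> s) = ennreal (K * ((t - s) powr (- p) * q))"
     using q K by (simp add: ennreal_mult)
    then show "ennreal (norm (H s)) <= ennreal K * (ennreal ((t - s) powr (- p)) * indicator {0<..T} (t - s) * \<phi> s)"
     using q by (simp add: ennreal_leI)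
   qed
   also have "... = ennreal K * I t" unfolding I_def by (rule nn_integral_cmult) measurable
   finally show ?thesis .
  qed
  let ?e = "1 + rsqrt t"
  have e0: "?e >= 0" by (simp add: add_nonneg_nonneg)
  have Zt: "Z t * ennreal ?e <= ennreal (c * (1 + T powr (1 / 2))) * I t"
   unfolding Z_def
  proof (subst SUP_mult_right_ennreal, rule SUP_least)
   fix x assume "x : A"
   then have x: "x : torus" using A(2) by auto
   have "ennreal (norm (D t x)) * ennreal ?e = ennreal (norm (LINT s:{0..t}|lebesgue. ?e *\<^sub>R ?G s x))"
    using e0 by (simp add: DG[OF x] ennreal_mult mult.commute)
   also have "... <= ennreal (c * (1 + T powr (1 / 2))) * I t"
   proof (rule le)
    show "set_integrable lebesgue {0..t} (%s. ?e *\<^sub>R ?G s x)" by (rule set_integrable_scaleR_right) (rule Gi[OF x])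
    show "0 <= c * (1 + T powr (1 / 2))" using c by (simp add: add_nonneg_nonneg)
    show "AE s in lebesgue. s : {0<..<t} --> (EX q>=0. \<phi> s = ennreal q & norm (?e *\<^sub>R ?G s x) <= c * (1 + T powr (1 / 2)) * ((t - s) powr (- p) * q))"
     using Gb
    proof eventually_elim
     case (elim s)
     show ?case
     proof
      assume s: "s : {0<..<t}"
      with elim obtain q where q: "q >= 0" "\<phi> s = ennreal q" "norm (?G s x) <= c * (t - s) powr (- ((1 - \<alpha>) / 2)) * q" by blast
      have ts: "t - s > 0" "t - s <= t" "t - s <= T" using s t by auto
      \<comment> \<open>Because \<open>t - s <= t\<close>, the weight at time \<open>t\<close> is at
        most a multiple of \<open>rsqrt (t - s)\<close>. This raises the exponent
        \<open>(1 - \<alpha>) / 2\<close> of the sup estimate to \<open>1 - \<alpha> / 2\<close>,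
        the exponent of the gradient estimate.\<close>
      have "1 = (t - s) powr (1 / 2) * rsqrt (t - s)" using ts by (simp flip: powr_add)
      also have "... <= T powr (1 / 2) * rsqrt (t - s)" by (intro mult_right_mono powr_mono2) (use ts in auto)
      finally have "1 <= T powr (1 / 2) * rsqrt (t - s)" .
      moreover have "rsqrt t <= rsqrt (t - s)" by (rule powr_mono2') (use ts in auto)
      ultimately have "?e <= (1 + T powr (1 / 2)) * rsqrt (t - s)" unfolding distrib_right mult_1 by linarith
      then have "norm (?e *\<^sub>R ?G s x) <= ((1 + T powr (1 / 2)) * rsqrt (t - s)) * (c * (t - s) powr (- ((1 - \<alpha>) / 2)) * q)"
       unfolding norm_scaleR using e0 by (intro mult_mono q) auto
      also have "... = c * (1 + T powr (1 / 2)) * ((rsqrt (t - s) * (t - s) powr (- ((1 - \<alpha>) / 2))) * q)" by (simp only: mult_ac)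
      also have "rsqrt (t - s) * (t - s) powr (- ((1 - \<alpha>) / 2)) = (t - s) powr (- p)"
       unfolding powr_add[symmetric] p_def by (rule arg_cong[where f = "%r. (t - s) powr r"]) (simp add: field_simps)
      finally show "EX q>=0. \<phi> s = ennreal q & norm (?e *\<^sub>R ?G s x) <= c * (1 + T powr (1 / 2)) * ((t - s) powr (- p) * q)"
       using q by blast
     qed
    qed
   qed
   finally show "ennreal (norm (D t x)) * ennreal ?e <= ennreal (c * (1 + T powr (1 / 2))) * I t" .
  qed
  have Qt: "Q t <= ennreal c * I t"
   unfolding Q_def
  proof (rule SUP_least)
   fix r assume "r : A \<times> A"
   then obtain x y where r: "r = (x, y)" and "x : A" "y : A" by auto
   with A(2) have x: "x : torus" and y: "y : torus" by blast+
   have "ennreal (norm (D t x - D t y) / abs (x - y)) = ennreal (norm (LINT s:{0..t}|lebesgue. (1 / abs (x - y)) *\<^sub>R (?G s x - ?G s y)))"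
    unfolding DG[OF x] DG[OF y] set_integral_diff(2)[OF Gi[OF x] Gi[OF y], symmetric] by simp
   also have "... <= ennreal c * I t"
   proof (rule le[OF _ c])
    show "set_integrable lebesgue {0..t} (%s. (1 / abs (x - y)) *\<^sub>R (?G s x - ?G s y))"
     by (rule set_integrable_scaleR_right) (rule set_integral_diff(1)[OF Gi[OF x] Gi[OF y]])
    show "AE s in lebesgue. s : {0<..<t} --> (EX q>=0. \<phi> s = ennreal q & norm ((1 / abs (x - y)) *\<^sub>R (?G s x - ?G s y)) <= c * ((t - s) powr (- p) * q))"
     using Gb
    proof eventually_elim
     case (elim s)
     show ?case
     proof
      assume s: "s : {0<..<t}"
      with elim obtain q where q: "q >= 0" "\<phi> s = ennreal q" "norm (?G s x - ?G s y) <= c * (t - s) powr (- p) * q * abs (x - y)" by blast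
      have "norm ((1 / abs (x - y)) *\<^sub>R (?G s x - ?G s y)) = norm (?G s x - ?G s y) / abs (x - y)" by simp
      also have "... <= c * ((t - s) powr (- p) * q)" using q c by (cases "x = y") (auto simp: divide_le_eq mult.assoc)
      finally show "EX q>=0. \<phi> s = ennreal q & norm ((1 / abs (x - y)) *\<^sub>R (?G s x - ?G s y)) <= c * ((t - s) powr (- p) * q)"
       using q by blast
     qed
    qed
   qed
   finally show "ennreal (norm (D t (fst r) - D t (snd r)) / abs (fst r - snd r)) <= ennreal c * I t" by (simp add: r)
  qed
  have "\<phi> t <= ennreal (c * (1 + T powr (1 / 2))) * I t + ennreal c * I t" unfolding \<phi>_def by (intro add_mono Zt Qt)
  also have "... = ennreal (c * (2 + T powr (1 / 2))) * I t"
   unfolding distrib_right[symmetric] by (subst ennreal_plus[symmetric]) (use c in "auto simp: algebra_simps intro!: add_nonneg_nonneg")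
  also have "... = (\<integral>\<^sup>+s. ennreal (c * (2 + T powr (1 / 2))) * (ennreal ((t - s) powr (- p)) * indicator {0<..T} (t - s) * \<phi> s) \<partial>lborel)"
   unfolding I_def by (rule nn_integral_cmult[symmetric]) measurable
  also have "... = (\<integral>\<^sup>+s. ennreal (c * (2 + T powr (1 / 2)) * (t - s) powr (- p)) * indicator {0<..T} (t - s) * \<phi> s \<partial>lborel)"
   by (intro nn_integral_cong) (simp add: ennreal_mult'' mult.assoc)
  finally show ?thesis .
 qed
 have "AE t in lborel. \<phi> t = 0"
  by (rule ennreal_volterra_unique[OF _ \<phi>0 fin _ _ _ T(1) key]) (use c \<alpha> in "auto simp: p_def intro!: mult_nonneg_nonneg add_nonneg_nonneg")
 \<comment> \<open>\<open>Z\<close> vanishes for almost every time, which gives equality on the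
   whole torus there; continuity in time at each point then reaches all times.\<close>
 then have ae: "AE t in lborel. t : {0..T} --> u t y - u' t y = 0" if y: "y : torus" for y
 proof eventually_elim
  case (elim t)
  show ?case
  proof
   assume t: "t : {0..T}"
   have "1 + rsqrt t > 0" by (simp add: add_pos_nonneg)
   with elim have "Z t = 0" by (simp add: \<phi>_def)
   then have "norm (D t y) <= 0" by (intro dense_sup_bound(1)[OF A(2,3) dc _ _ y]) (simp_all add: Z_def)
   then show "u t y - u' t y = 0" using t by (simp add: D_def)
  qed
 qed
 have "u t y = u' t y" if "y : torus" for y
  using continuous_AE_zero[OF dt[OF that] ae[OF that] T(1) t] by simp
 moreover have "periodic (%y. (u t y, u' t y))" using u(1) u'(1) t by (simp add: mild_solution_def Let_def periodic_def)
 ultimately show ?thesis using periodic_bound[of "%y. (u t y, u' t y)" "%(a, b). a = b"] by auto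
qed

end

section \<open>Hoelder regularity of the solution\<close>

text \<open>Explicit bounds in place of the suprema in \<open>holder_norm\<close>, whose values are
  meaningful only once finiteness is known. They are stable under sums and imply membership in the
  space.\<close>

definition holder_le :: "real => real => (real => 'a::real_normed_vector) => bool" where
 "holder_le \<beta> c h \<longleftrightarrow> (ALL x:torus. norm (h x) <= c) & (ALL x:torus. ALL y:torus. norm (h x - h y) <= c * abs (x - y) powr \<beta>)"

lemma holder_le_nonneg: "holder_le \<beta> c h ==> c >= 0"
 unfolding holder_le_def by (rule order_trans[OF norm_ge_zero, of "h 0"]) auto

lemma holder_le_add:
 assumes "holder_le \<beta> c h" "holder_le \<beta> c' h'"
 shows "holder_le \<beta> (c + c') (%x. h x + h' x)"
 unfolding holder_le_def
proof (intro conjI ballI)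
 fix x assume "x : torus"
 then show "norm (h x + h' x) <= c + c'"
  using assms unfolding holder_le_def by (intro order_trans[OF norm_triangle_ineq] add_mono) auto
next
 fix x y assume xy: "x : torus" "y : torus"
 have "norm ((h x - h y) + (h' x - h' y)) <= c * abs (x - y) powr \<beta> + c' * abs (x - y) powr \<beta>"
  using assms xy unfolding holder_le_def by (intro order_trans[OF norm_triangle_ineq] add_mono) auto
 then show "norm (h x + h' x - (h y + h' y)) <= (c + c') * abs (x - y) powr \<beta>"
  by (simp add: algebra_simps)
qed

lemma holder_le_mono:
 assumes "holder_le \<beta> c h" "c <= c'"
 shows "holder_le \<beta> c' h"
 unfolding holder_le_def
proof (intro conjI ballI)
 fix x y :: real assume xy: "x : torus" "y : torus"
 have "c * abs (x - y) powr \<beta> <= c' * abs (x - y) powr \<beta>" using assms(2) by (rule mult_right_mono) simp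
 moreover have "norm (h x - h y) <= c * abs (x - y) powr \<beta>" using assms(1) xy by (auto simp: holder_le_def)
 ultimately show "norm (h x - h y) <= c' * abs (x - y) powr \<beta>" by linarith
qed (use assms in "force simp: holder_le_def")

lemma holder_le_exponent:
 assumes h: "holder_le \<alpha> c h" and \<beta>: "0 < \<beta>" "\<beta> <= \<alpha>"
 shows "holder_le \<beta> ((1 + (2 * pi) powr (\<alpha> - \<beta>)) * c) h"
 unfolding holder_le_def
proof (intro conjI ballI)
 have c: "c >= 0" by (rule holder_le_nonneg[OF h])
 have c': "0 <= (2 * pi) powr (\<alpha> - \<beta>) * c" using c by simp
 fix x :: real assume x: "x : torus"
 then show "norm (h x) <= (1 + (2 * pi) powr (\<alpha> - \<beta>)) * c"
  using h c' unfolding holder_le_def distrib_right mult_1 by fastforce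
 fix y :: real assume y: "y : torus"
 have "abs (x - y) powr \<alpha> <= (2 * pi) powr (\<alpha> - \<beta>) * abs (x - y) powr \<beta>"
  by (rule powr_le_powr_torus) (use x y \<beta> in auto)
 then have "c * abs (x - y) powr \<alpha> <= c * ((2 * pi) powr (\<alpha> - \<beta>) * abs (x - y) powr \<beta>)" using c by (rule mult_left_mono)
 moreover have "0 <= c * abs (x - y) powr \<beta>" using c by simp
 moreover have "norm (h x - h y) <= c * abs (x - y) powr \<alpha>" using h x y by (auto simp: holder_le_def)
 ultimately have "norm (h x - h y) <= c * abs (x - y) powr \<beta> + c * ((2 * pi) powr (\<alpha> - \<beta>) * abs (x - y) powr \<beta>)" by linarith
 then show "norm (h x - h y) <= (1 + (2 * pi) powr (\<alpha> - \<beta>)) * c * abs (x - y) powr \<beta>"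
  by (simp add: algebra_simps)
qed

lemma sup_norm_bounds:
 assumes "!!x. x : torus ==> norm (h x) <= c"
 shows "sup_norm h <= c" "x : torus ==> norm (h x) <= sup_norm h" "0 <= sup_norm h"
proof -
 have bd: "bdd_above ((%x. norm (h x)) ` torus)" using assms by (rule bdd_aboveI2)
 show "sup_norm h <= c" unfolding sup_norm_def by (rule cSUP_least) (use assms in auto)
 have up: "norm (h x) <= sup_norm h" if "x : torus" for x unfolding sup_norm_def by (rule cSUP_upper[OF that bd])
 then show "x : torus ==> norm (h x) <= sup_norm h" .
 show "0 <= sup_norm h" by (rule order_trans[OF norm_ge_zero up[of 0]]) auto
qed

lemma holder_le_norm:
 assumes h: "holder_le \<beta> c h"
 shows "h : holder_space \<beta>" "holder_norm \<beta> h <= 2 * c" "0 <= holder_norm \<beta> h"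
proof -
 have *: "norm (increment h x y) <= c * abs (x - y) powr \<beta>" if "x : torus" "y : torus" for x y
  using h that by (auto simp: holder_le_def increment_def norm_minus_commute)
 have s: "!!x. x : torus ==> norm (h x) <= c" using h by (auto simp: holder_le_def)
 note tp = two_param_bound[of "increment h" c \<beta>, OF *]
 show "h : holder_space \<beta>" using tp(1) by (simp add: holder_space_def)
 show "holder_norm \<beta> h <= 2 * c" using tp(2) sup_norm_bounds(1)[of h, OF s] by (simp add: holder_norm_def)
 show "0 <= holder_norm \<beta> h" using two_param_norm_nonneg[OF tp(1)] sup_norm_bounds(3)[of h, OF s] by (simp add: holder_norm_def)
qed

lemma holder_space_le:
 assumes h: "h : holder_space \<beta>" and \<beta>: "\<beta> >= 0"
 shows "holder_le \<beta> (holder_norm \<beta> h) h"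
proof -
 have fin: "two_param_finite \<beta> (increment h)" using h by (simp add: holder_space_def)
 let ?n = "two_param_norm \<beta> (increment h)"
 have n0: "?n >= 0" by (rule two_param_norm_nonneg[OF fin])
 have d: "norm (h x - h y) <= ?n * abs (x - y) powr \<beta>" if "x : torus" "y : torus" for x y
  using two_param_norm_ge[OF fin that] by (cases "x = y") (auto simp: increment_def norm_minus_commute)
 have "norm (h x) <= norm (h 0) + ?n * (2 * pi) powr \<beta>" if x: "x : torus" for x
 proof -
  have "?n * abs (x - 0) powr \<beta> <= ?n * (2 * pi) powr \<beta>" by (intro mult_left_mono powr_mono2) (use x \<beta> n0 in auto)
  then show ?thesis using d[OF x, of 0] norm_triangle_sub[of "h x" "h 0"] by auto
 qed
 note s = sup_norm_bounds[of h, OF this]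
 show ?thesis
  unfolding holder_le_def holder_norm_def
 proof (intro conjI ballI)
  fix x :: real assume x: "x : torus"
  then show "norm (h x) <= ?n + sup_norm h" using s(2)[OF _ x] n0 by linarith
  fix y :: real assume y: "y : torus"
  have "?n * abs (x - y) powr \<beta> <= (?n + sup_norm h) * abs (x - y) powr \<beta>" by (rule mult_right_mono) (use s(3) in auto)
  then show "norm (h x - h y) <= (?n + sup_norm h) * abs (x - y) powr \<beta>" using d[OF x y] by linarith
 qed
qed

lemma holder_norm_tendsto_zero:
 assumes "!!\<epsilon>. \<epsilon> > 0 ==> \<forall>\<^sub>F s in F. holder_le \<beta> \<epsilon> (h s)"
 shows "((%s. holder_norm \<beta> (h s)) \<longlongrightarrow> 0) F"
proof (rule tendstoI)
 fix e :: real assume "e > 0"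
 then have "\<forall>\<^sub>F s in F. holder_le \<beta> (e / 3) (h s)" by (intro assms) simp
 then show "\<forall>\<^sub>F s in F. dist (holder_norm \<beta> (h s)) 0 < e"
 proof eventually_elim
  case (elim s)
  then show ?case using holder_le_norm(2,3)[OF elim] \<open>e > 0\<close> by simp
 qed
qed

lemma holder_norm_tendsto_zeroD:
 assumes "((%s. holder_norm \<beta> (h s)) \<longlongrightarrow> 0) F" "\<forall>\<^sub>F s in F. h s : holder_space \<beta>" "\<beta> >= 0" "\<epsilon> > 0"
 shows "\<forall>\<^sub>F s in F. holder_le \<beta> \<epsilon> (h s)"
proof -
 have "\<forall>\<^sub>F s in F. holder_norm \<beta> (h s) < \<epsilon>" using assms(1,4) by (rule order_tendstoD)
 with assms(2) show ?thesis
  by eventually_elim (use holder_space_le[OF _ assms(3)] holder_le_mono in "meson less_imp_le")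
qed

lemma holder_le_lipschitz:
 assumes "!!x. x : torus ==> norm (h x) <= c" "!!x. x : torus ==> (h has_vector_derivative h' x) (at x)" "!!x. x : torus ==> norm (h' x) <= c"
 shows "holder_le 1 c h"
 unfolding holder_le_def
proof (intro conjI ballI)
 fix x y :: real assume "x : torus" "y : torus"
 then have "closed_segment y x \<subseteq> torus" by (simp add: closed_segment_subset)
 then have "norm (h x - h y) <= c * abs (x - y)"
  by (intro vector_derivative_bound[where f' = h'] assms) auto
 then show "norm (h x - h y) <= c * abs (x - y) powr 1" by simp
qed (use assms in auto)

lemma joint_continuous_uniform:
 fixes h :: "real => real => 'a::metric_space"
 assumes c: "continuous_on (A \<times> torus) (%(t, x). h t x)" and t: "t : A"
 shows "uniform_limit torus h (h t) (at t within A)" (is ?A) "continuous_on torus (h t)"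
proof -
 show ?A
 proof (rule uniform_limitI)
  fix e :: real assume "e > 0"
  then obtain S where S: "t : S" "open S" "!!s x. s : S \<inter> A ==> x : torus ==> dist (h s x) (h t x) <= e / 2"
  proof -
   have "compact torus" "e / 2 > 0" using \<open>e > 0\<close> by auto
   from continuous_on_prod_compactE[OF c this(1) t this(2)]
   obtain S where "t : S" "open S" "ALL s:S \<inter> A. ALL x:torus. dist (case (s, x) of (t, x) => h t x) (case (t, x) of (t, x) => h t x) <= e / 2" by metis
   then show thesis by (intro that) auto
  qed
  have "\<forall>\<^sub>F s in at t within A. s : S \<inter> A"
   using S(1,2) by (auto simp: eventually_at_topological)
  then show "\<forall>\<^sub>F s in at t within A. ALL x:torus. dist (h s x) (h t x) < e"
  proof eventually_elim
   case (elim s)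
   show ?case
   proof
    fix x :: real assume "x : torus"
    from S(3)[OF elim this] \<open>e > 0\<close> show "dist (h s x) (h t x) < e" by linarith
   qed
  qed
 qed
 have "continuous_on torus (%x. (%(t, x). h t x) (t, x))"
  by (rule continuous_on_compose2[OF c]) (use t in "auto intro!: continuous_intros")
 then show "continuous_on torus (h t)" by simp
qed

lemma sup_norm_continuous:
 fixes h :: "real => real => 'a::real_normed_vector"
 assumes c: "!!t. t : A ==> continuous_on torus (h t)" and u: "!!t. t : A ==> uniform_limit torus h (h t) (at t within A)"
 shows "continuous_on A (%t. sup_norm (h t))"
 unfolding continuous_on_def
proof (intro ballI tendstoI)
 fix t and e :: real assume t: "t : A" and e: "e > 0"
 have bd: "EX K. ALL x:torus. norm (h s x) <= K" if "s : A" for s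
 proof -
  have "bounded (h s ` torus)"
   by (intro compact_imp_bounded compact_continuous_image c[OF that]) simp
  then show ?thesis by (auto simp: bounded_iff)
 qed
 have le: "sup_norm (h s) <= sup_norm (h r) + e / 2" if sr: "s : A" "r : A" and d: "!!x. x : torus ==> dist (h s x) (h r x) < e / 2" for s r
 proof -
  obtain K where K: "!!x. x : torus ==> norm (h r x) <= K" using bd[OF sr(2)] by blast
  have "norm (h s x) <= sup_norm (h r) + e / 2" if x: "x : torus" for x
   using sup_norm_bounds(2)[of "h r", OF K x] d[OF x] norm_triangle_sub[of "h s x" "h r x"] by (simp add: dist_norm)
  then show ?thesis by (rule sup_norm_bounds(1))
 qed
 have "\<forall>\<^sub>F s in at t within A. ALL x:torus. dist (h s x) (h t x) < e / 2"
  using uniform_limitD[OF u[OF t], of "e / 2"] e by simp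
 moreover have "\<forall>\<^sub>F s in at t within A. s : A" by (simp add: eventually_at_filter)
 ultimately show "\<forall>\<^sub>F s in at t within A. dist (sup_norm (h s)) (sup_norm (h t)) < e"
 proof eventually_elim
  case (elim s)
  have "sup_norm (h s) <= sup_norm (h t) + e / 2" by (rule le[OF elim(2) t]) (use elim(1) in auto)
  moreover have "sup_norm (h t) <= sup_norm (h s) + e / 2" by (rule le[OF t elim(2)]) (use elim(1) in "auto simp: dist_commute")
  ultimately show ?case using e by (simp add: dist_real_def)
 qed
qed

text \<open>Convolution commutes with translation, so any modulus of continuity of \<open>H\<close>
  passes to its Gaussian average, whatever the scale.\<close>

lemma gauss_op_increment:
 fixes H :: "real => 'a::euclidean_space"
 assumes \<phi>: "gauss_bounded \<phi>" and H: "H : borel_measurable borel" "!!x. norm (H x) <= K"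
  and d: "!!z. norm (H z - H (z - (x - y))) <= c"
 shows "norm (gauss_op \<phi> r H x - gauss_op \<phi> r H y) <= gauss_mom \<phi> * c"
proof -
 have m: "(%z. H (z - (x - y))) : borel_measurable borel" using H(1) by measurable
 have "gauss_op \<phi> r H y = gauss_op \<phi> r (%z. H (z - (x - y))) x"
  unfolding gauss_op_def by (intro Bochner_Integration.integral_cong refl) (simp add: algebra_simps)
 then have "gauss_op \<phi> r H x - gauss_op \<phi> r H y = gauss_op \<phi> r (%z. H z - H (z - (x - y))) x"
  using gauss_op_add[OF \<phi> H m H(2), where x = x and r = r] by simp
 then show ?thesis using gauss_op_norm_le[OF \<phi> borel_measurable_diff[OF H(1) m] d] by simp
qed

text \<open>The modulus of continuity of \<open>P\<^sub>t v - v\<close> is controlled on short distances by that of \<open>v\<close>, and on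
 long distances by its supremum.\<close>

lemma gauss_semigroup_holder_limit:
 fixes v0 :: "real => 'a::euclidean_space"
 assumes v0: "continuous_on UNIV v0" "!!x. norm (v0 x) <= K" and \<beta>: "\<beta> > 0"
  and little: "!!\<epsilon>. \<epsilon> > 0 ==> EX \<eta>>0. ALL x y. abs (x - y) < \<eta> --> norm (v0 x - v0 y) <= \<epsilon> * abs (x - y) powr \<beta>"
  and lim: "uniform_limit torus L v0 F" and L: "\<forall>\<^sub>F t in F. EX c r. abs c <= 1 & L t = (%x. c *\<^sub>R gauss_op G0 r v0 x)" and \<epsilon>: "\<epsilon> > 0"
 shows "\<forall>\<^sub>F t in F. holder_le \<beta> \<epsilon> (%x. L t x - v0 x)"
proof -
 let ?m = "gauss_mom G0 + 1"
 have m: "?m > 0" using gauss_mom_nonneg[of G0] by linarith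
 obtain \<eta> where \<eta>: "\<eta> > 0" "!!x y. abs (x - y) < \<eta> ==> norm (v0 x - v0 y) <= \<epsilon> / ?m * abs (x - y) powr \<beta>"
  using little[of "\<epsilon> / ?m"] \<epsilon> m by auto
 define \<delta> where "\<delta> = min \<epsilon> (\<epsilon> * \<eta> powr \<beta> / 2)"
 have \<delta>: "\<delta> > 0" "\<delta> <= \<epsilon>" "2 * \<delta> <= \<epsilon> * \<eta> powr \<beta>" using \<epsilon> \<eta> by (auto simp: \<delta>_def min_def)
 have "\<forall>\<^sub>F t in F. ALL x:torus. dist (L t x) (v0 x) < \<delta>" by (rule uniform_limitD[OF lim \<delta>(1)])
 with L show ?thesis
 proof eventually_elim
  case (elim t)
  then obtain c r where L: "abs c <= 1" "L t = (%x. c *\<^sub>R gauss_op G0 r v0 x)" by blast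
  have s: "norm (L t x - v0 x) <= \<delta>" if "x : torus" for x using elim(2) that by (auto simp: dist_norm intro: less_imp_le)
  show ?case
   unfolding holder_le_def
  proof (intro conjI ballI)
   fix x :: real assume x: "x : torus"
   show "norm (L t x - v0 x) <= \<epsilon>" using s[OF x] \<delta> by linarith
   fix y :: real assume y: "y : torus"
   show "norm (L t x - v0 x - (L t y - v0 y)) <= \<epsilon> * abs (x - y) powr \<beta>"
   proof (cases "abs (x - y) < \<eta>")
    case True
    let ?e = "\<epsilon> / ?m * abs (x - y) powr \<beta>"
    have "norm (gauss_op G0 r v0 x - gauss_op G0 r v0 y) <= gauss_mom G0 * ?e"
    proof (rule gauss_op_increment[OF G_gauss_bounded(1) borel_measurable_continuous_UNIV[OF v0(1)] v0(2)])
     show "norm (v0 z - v0 (z - (x - y))) <= ?e" for z using \<eta>(2)[of z "z - (x - y)"] True by simp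
    qed
    moreover have "norm (L t x - L t y) <= 1 * norm (gauss_op G0 r v0 x - gauss_op G0 r v0 y)"
     unfolding L(2) scaleR_diff_right[symmetric] norm_scaleR by (rule mult_right_mono) (use L in auto)
    ultimately have "norm (L t x - L t y) + norm (v0 x - v0 y) <= gauss_mom G0 * ?e + ?e" using \<eta>(2)[OF True] by linarith
    also have "gauss_mom G0 * ?e + ?e = ?m * ?e" by (simp only: distrib_right mult_1)
    also have "?m * ?e = \<epsilon> * abs (x - y) powr \<beta>" using m by simp
    finally show ?thesis using norm_triangle_ineq4[of "L t x - L t y" "v0 x - v0 y"] by (simp add: algebra_simps)
   next
    case False
    then have "\<eta> powr \<beta> <= abs (x - y) powr \<beta>" using \<eta>(1) \<beta> by (intro powr_mono2) auto
    then have "\<epsilon> * \<eta> powr \<beta> <= \<epsilon> * abs (x - y) powr \<beta>" using \<epsilon> by (intro mult_left_mono) auto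
    then show ?thesis using norm_triangle_ineq4[of "L t x - v0 x" "L t y - v0 y"] s[OF x] s[OF y] \<delta>(3) by linarith
   qed
  qed
 qed
qed

lemma set_integral_lborel_lebesgue:
 fixes h :: "real => 'a::euclidean_space"
 assumes i: "set_integrable lborel {0<..<t} h"
 shows "set_integrable lebesgue {0..t} h" "(LINT s:{0..t}|lebesgue. h s) = (LINT s:{0<..<t}|lborel. h s)" (is ?A)
proof -
 let ?h = "%s. indicat_real {0<..<t} s *\<^sub>R h s"
 have m: "?h : borel_measurable lborel" using i by (auto simp: set_integrable_def)
 have i': "integrable lebesgue ?h" using i integrable_completion[OF m] by (simp add: set_integrable_def)
 have ae: "AE s in lebesgue. ?h s = indicat_real {0..t} s *\<^sub>R h s"
  by (rule AE_completion) (use AE_lborel_singleton[of 0] AE_lborel_singleton[of t] in eventually_elim, auto simp: indicator_def)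
 have ml: "?h : borel_measurable lebesgue" using i' by auto
 have m': "(%s. indicat_real {0..t} s *\<^sub>R h s) : borel_measurable lebesgue" by (rule borel_measurable_AE[OF ml ae])
 show "set_integrable lebesgue {0..t} h"
  unfolding set_integrable_def by (rule iffD1[OF integrable_cong_AE[OF ml m' ae] i'])
 have "(LINT s:{0..t}|lebesgue. h s) = (LINT s|lebesgue. ?h s)"
  unfolding set_lebesgue_integral_def by (rule integral_cong_AE[OF m' ml]) (use ae in "auto elim: eventually_mono")
 also have "... = (LINT s:{0<..<t}|lborel. h s)" unfolding set_lebesgue_integral_def by (rule integral_completion[OF m])
 finally show ?A .
qed

text \<open>The driving path is continuous in time at the exponent \<alpha>, the solution is sought
  at the smaller \<beta>. The gap gives the Duhamel term a positive power of time and makes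
  small-scale \<open>\<beta>\<close>-quotients of \<open>X\<close> vanish.\<close>

locale rough_solution = rough_ivp X XX f g \<alpha> a b C \<rho> T T1 v0 V L M
 for X :: "real => real => real^'n" and XX f g \<alpha> a b C \<rho> T T1 v0 V L M +
 fixes u0 :: "real => real^'n" and \<beta> :: real and v w :: "real => real => real^'n"
 assumes v0_eq: "v0 = (%x. u0 x - X 0 x)" and u0: "u0 : holder_space \<beta>" and \<beta>: "0 < \<beta>" "\<beta> < \<alpha>"
  and rp: "!!t. t : {0..T} ==> rough_path \<alpha> (X t) (XX t)"
  and XH: "!!t. t : {0..T} ==> ((%s. holder_norm \<alpha> (%x. X s x - X t x)) \<longlongrightarrow> 0) (at t within {0..T})"
  and vw: "adm v w" and fixv: "!!t x. t : {0<..T} ==> mapv v w t x = v t x" and fixw: "!!t x. t : {0<..T} ==> mapw v w t x = w t x"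
begin

text \<open>The fixed point is determined at positive times only, so the initial value is prescribed
  separately.\<close>

definition u :: "real => real => real^'n" where
 "u t x = (if t = 0 then u0 x else X t x + v t x)"

definition N :: "real => real => real^'n" where
 "N t x = vconv (%s \<tau>. heat_div \<tau> (flux v w s)) t x"

lemma u0_eq: "u0 x = X 0 x + v0 x" by (simp add: v0_eq)

lemma v_split: "t : {0<..T} ==> v t x = lin t x + N t x"
 using fixv by (simp add: mapv_def N_def)

definition cN :: real where "cN = duhamel_const \<alpha> 0 T1 * Qf * exp (L * T)"

lemma cN_nonneg: "cN >= 0"
 unfolding cN_def using duhamel_const_nonneg Qf_nonneg by (intro mult_nonneg_nonneg) auto

lemma N_bounds:
 assumes t: "t : {0<..T}"
 shows "norm (N t x) <= cN * t powr (\<alpha> / 2)" (is ?A1) "norm (N t x - N t y) <= cN * t powr (\<alpha> / 2 - 1 / 2) * abs (x - y)" (is ?A2)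
proof -
 let ?N' = "vconv (%s \<tau>. heat_div' \<tau> (flux v w s)) t"
 note db = duhamel_bound[OF adm_volterra(1,2)[OF vw] _ _ \<alpha>'(1,2) t Qf_nonneg, of 0]
 have E: "duhamel_const \<alpha> 0 T1 * Qf * (exp (L * t) * L powr (- 0) * t powr (\<alpha> / 2 - 0)) <= cN * t powr (\<alpha> / 2)"
 proof -
  have "exp (L * t) <= exp (L * T)" using t L by simp
  then have "duhamel_const \<alpha> 0 T1 * Qf * (exp (L * t) * t powr (\<alpha> / 2)) <= duhamel_const \<alpha> 0 T1 * Qf * (exp (L * T) * t powr (\<alpha> / 2))"
   using duhamel_const_nonneg Qf_nonneg by (intro mult_left_mono mult_right_mono mult_nonneg_nonneg) auto
  then show ?thesis using L by (simp add: cN_def mult.assoc)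
 qed
 have 0: "(0::real) < \<alpha> / 2" using \<alpha> by simp
 show ?A1 unfolding N_def by (rule order_trans[OF db(1)[OF order_refl 0] E])
 have N': "norm (?N' x) <= cN * t powr (\<alpha> / 2 - 1 / 2)" for x
 proof -
  have "norm (?N' x) <= cN * t powr (\<alpha> / 2) * rsqrt t"
   by (rule order_trans[OF db(2)[OF order_refl 0] mult_right_mono[OF E]]) simp
  also have "... = cN * t powr (\<alpha> / 2 - 1 / 2)" by (simp add: mult.assoc flip: powr_add)
  finally show ?thesis .
 qed
 have e: "v t = (%x. lin t x + N t x)" "w t = (%x. lin' t x + ?N' x)"
  using v_split[OF t] fixw[OF t] by (simp_all add: fun_eq_iff mapw_def)
 have d: "(v t has_vector_derivative w t x) (at x)" for x using vw t by (simp add: adm_def)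
 have "(N t has_vector_derivative ?N' x) (at x)" for x
  using has_vector_derivative_diff[OF d lin_facts(4)[OF t], of x] unfolding e by simp
 from vector_derivative_bound[OF this N'] show ?A2 .
qed

definition hN :: "real => real" where "hN t = 2 * cN * (t powr (\<alpha> / 2) + t powr ((\<alpha> - \<beta>) / 2))"

text \<open>Interpolation at the parabolic scale: for distances above \<open>sqrt t\<close> the sup
  bound is used, below it the Lipschitz bound. Both yield
  \<open>t powr ((\<alpha> - \<beta>) / 2)\<close> times the power \<beta> of the distance.\<close>

lemma N_holder:
 assumes t: "t : {0<..T}"
 shows "holder_le \<beta> (hN t) (N t)"
 unfolding holder_le_def
proof (intro conjI ballI)
 fix x y :: real
 have p: "0 <= cN * t powr (\<alpha> / 2)" "0 <= cN * t powr ((\<alpha> - \<beta>) / 2)" using cN_nonneg by auto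
 have h: "hN t = 2 * (cN * t powr (\<alpha> / 2)) + 2 * (cN * t powr ((\<alpha> - \<beta>) / 2))" by (simp add: hN_def algebra_simps)
 show "norm (N t x) <= hN t" using N_bounds(1)[OF t, of x] p unfolding h by linarith
 have le: "2 * (cN * t powr ((\<alpha> - \<beta>) / 2)) * abs (x - y) powr \<beta> <= hN t * abs (x - y) powr \<beta>"
  unfolding h using p by (intro mult_right_mono) auto
 have tp: "t > 0" using t by simp
 show "norm (N t x - N t y) <= hN t * abs (x - y) powr \<beta>"
 proof (cases "abs (x - y) >= t powr (1 / 2)")
  case True
  have "norm (N t x - N t y) <= 2 * cN * t powr (\<alpha> / 2)"
   using norm_triangle_ineq4[of "N t x" "N t y"] N_bounds(1)[OF t, of x] N_bounds(1)[OF t, of y] by linarith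
  also have "t powr (\<alpha> / 2) = t powr ((\<alpha> - \<beta>) / 2) * (t powr (1 / 2)) powr \<beta>"
   by (simp add: powr_powr flip: powr_add) (simp add: field_simps)
  also have "2 * cN * ... <= 2 * cN * (t powr ((\<alpha> - \<beta>) / 2) * abs (x - y) powr \<beta>)"
   using True cN_nonneg \<beta> by (intro mult_left_mono powr_mono2) auto
  finally show ?thesis using le by (simp add: mult.assoc)
 next
  case False
  then have d: "abs (x - y) <= t powr (1 / 2)" by simp
  have "abs (x - y) = abs (x - y) powr (1 - \<beta>) * abs (x - y) powr \<beta>" by (cases "x = y") (auto simp flip: powr_add)
  also have "... <= (t powr (1 / 2)) powr (1 - \<beta>) * abs (x - y) powr \<beta>"
   by (intro mult_right_mono powr_mono2) (use d \<beta> \<alpha> in auto)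
  finally have "cN * t powr (\<alpha> / 2 - 1 / 2) * abs (x - y) <= cN * t powr (\<alpha> / 2 - 1 / 2) * ((t powr (1 / 2)) powr (1 - \<beta>) * abs (x - y) powr \<beta>)"
   using cN_nonneg by (intro mult_left_mono) auto
  also have "... = cN * (t powr (\<alpha> / 2 - 1 / 2) * (t powr (1 / 2)) powr (1 - \<beta>)) * abs (x - y) powr \<beta>" by (simp only: mult_ac)
  also have "t powr (\<alpha> / 2 - 1 / 2) * (t powr (1 / 2)) powr (1 - \<beta>) = t powr ((\<alpha> - \<beta>) / 2)"
   unfolding powr_powr powr_add[symmetric] by (rule arg_cong[where f = "%r. t powr r"]) (simp add: field_simps)
  finally have "norm (N t x - N t y) <= cN * t powr ((\<alpha> - \<beta>) / 2) * abs (x - y) powr \<beta>"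
   using N_bounds(2)[OF t, of x y] by linarith
  moreover have "0 <= cN * t powr ((\<alpha> - \<beta>) / 2) * abs (x - y) powr \<beta>" using p by simp
  ultimately show ?thesis using le by (simp only: mult.assoc)
 qed
qed

lemma hN_tendsto: "(hN \<longlongrightarrow> 0) (at 0 within {0..T})"
proof -
 have "((%t. 2 * cN * (t powr (\<alpha> / 2) + t powr ((\<alpha> - \<beta>) / 2))) \<longlongrightarrow> 2 * cN * (0 + 0)) (at 0 within {0..T})"
  by (intro tendsto_intros tendsto_zero_powrI[OF tendsto_ident_at tendsto_const])
   (use \<alpha> \<beta> in "auto simp: eventually_at_filter")
 then show ?thesis by (simp add: hN_def[abs_def])
qed

lemma hN_le: "t : {0<..T} ==> hN t <= hN T"
 unfolding hN_def using cN_nonneg \<alpha> \<beta> by (intro mult_left_mono add_mono powr_mono2) auto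

lemma X_holder: "t : {0..T} ==> holder_le \<beta> ((1 + (2 * pi) powr (\<alpha> - \<beta>)) * (a + b)) (X t)"
proof (rule holder_le_exponent)
 assume t: "t : {0..T}"
 show "holder_le \<alpha> (a + b) (X t)"
  unfolding holder_le_def
 proof (intro conjI ballI)
  fix x y :: real assume xy: "x : torus" "y : torus"
  show "norm (X t x) <= a + b" using Xb[OF t, of x] a by simp
  have "norm (X t x - X t y) <= a * abs (x - y) powr \<alpha>" using rough_boundD(1)[OF rb[OF t] xy(2,1)] .
  moreover have "0 <= b * abs (x - y) powr \<alpha>" using b_nonneg by simp
  ultimately show "norm (X t x - X t y) <= (a + b) * abs (x - y) powr \<alpha>" unfolding distrib_right by linarith
 qed
qed (use \<beta> in auto)

lemma X_holder_tendsto: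
 assumes t: "t : {0..T}" and \<epsilon>: "\<epsilon> > 0"
 shows "\<forall>\<^sub>F s in at t within {0..T}. holder_le \<beta> \<epsilon> (%x. X s x - X t x)"
proof -
 let ?p = "1 + (2 * pi) powr (\<alpha> - \<beta>)"
 have p: "?p > 0" by (simp add: add_pos_nonneg)
 have "X s : holder_space \<alpha>" if "s : {0..T}" for s using rp[OF that] by (simp add: rough_path_def)
 then have "(%x. X s x - X t x) : holder_space \<alpha>" if s: "s : {0..T}" for s
 proof -
  have "norm (increment (%x. X s x - X t x) x y) <= (a + a) * abs (x - y) powr \<alpha>" if xy: "x : torus" "y : torus" for x y
  proof -
   have "norm ((X s y - X s x) - (X t y - X t x)) <= a * abs (y - x) powr \<alpha> + a * abs (y - x) powr \<alpha>"
    by (intro order_trans[OF norm_triangle_ineq4] add_mono rough_boundD(1)[OF rb xy] s t)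
   then show ?thesis by (simp add: increment_def algebra_simps abs_minus_commute)
  qed
  then show ?thesis unfolding holder_space_def mem_Collect_eq by (rule two_param_bound(1))
 qed
 then have "\<forall>\<^sub>F s in at t within {0..T}. (%x. X s x - X t x) : holder_space \<alpha>"
  by (auto simp: eventually_at_filter)
 from holder_norm_tendsto_zeroD[OF XH[OF t] this, of "\<epsilon> / ?p"]
 have "\<forall>\<^sub>F s in at t within {0..T}. holder_le \<alpha> (\<epsilon> / ?p) (%x. X s x - X t x)" using \<alpha> \<epsilon> p by simp
 then show ?thesis
 proof eventually_elim
  case (elim s)
  have "holder_le \<beta> (?p * (\<epsilon> / ?p)) (%x. X s x - X t x)" by (rule holder_le_exponent[OF elim]) (use \<beta> in auto)
  then show ?case using p by simp
 qed
qed

lemma u0_holder: "holder_le \<beta> (holder_norm \<beta> u0) u0"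
 by (rule holder_space_le[OF u0]) (use \<beta> in auto)

lemma lin_0: "lin 0 x = v0 x"
 using gauss_bounded_integrable(2)[OF G_gauss_bounded(1)] by (simp add: lin_def gauss_op_def G_integral)

lemma lin_uniform_limit: "uniform_limit torus lin v0 (at 0 within {0..T})"
proof -
 have "continuous_on ({0..T} \<times> torus) (%p. exp (- fst p) *\<^sub>R gauss_op G0 (sqrt (fst p)) v0 (snd p))"
  by (intro continuous_intros gauss_op_continuous[OF G_gauss_bounded(1) v0(2,3)])
 then have "continuous_on ({0..T} \<times> torus) (%(t, x). lin t x)" by (simp add: lin_def case_prod_beta')
 from joint_continuous_uniform(1)[OF this, of 0] show ?thesis using T by (simp add: lin_0[abs_def])
qed

lemma N_uniform_limit: "uniform_limit torus N (%x. 0) (at 0 within {0..T})"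
proof (rule uniform_limitI)
 fix e :: real assume "e > 0"
 then have "\<forall>\<^sub>F t in at 0 within {0..T}. hN t < e" by (rule order_tendstoD(2)[OF hN_tendsto])
 moreover have "\<forall>\<^sub>F t in at 0 within {0..T}. t : {0<..T}" by (auto simp: eventually_at_filter)
 ultimately show "\<forall>\<^sub>F t in at 0 within {0..T}. ALL x:torus. dist (N t x) 0 < e"
 proof eventually_elim
  case (elim t)
  then show ?case using N_holder[OF elim(2)] unfolding holder_le_def by (auto intro: le_less_trans)
 qed
qed

definition v' :: "real => real => real^'n" where "v' t x = u t x - X t x"

lemma v'_eq: "t ~= 0 ==> v' t = v t" "v' 0 = v0"
 by (auto simp: v'_def u_def v0_eq fun_eq_iff)

lemma at_within_pos: "t : {0<..T} ==> at t within {0..T} = at t within {0<..T}"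
 by (rule at_within_nhd[of _ "{0<..}"]) auto

lemma vw_continuous: "continuous_on ({0<..T} \<times> torus) (%(t, x). v t x)" "continuous_on ({0<..T} \<times> torus) (%(t, x). w t x)"
 using vw by (auto simp: adm_def intro: continuous_on_subset)

lemma v'_continuous: "continuous_into_C T v'"
 unfolding continuous_into_C_def
proof (intro ballI conjI)
 fix t assume t: "t : {0..T}"
 show "continuous_on torus (v' t)"
  using joint_continuous_uniform(2)[OF vw_continuous(1), of t] t continuous_on_subset[OF v0(2)] by (cases "t = 0") (auto simp: v'_eq)
 show "uniform_limit torus v' (v' t) (at t within {0..T})"
 proof (cases "t = 0")
  case True
  have ev: "\<forall>\<^sub>F s in at t within {0..T}. s : {0<..T}" using True by (auto simp: eventually_at_filter)
  have "uniform_limit torus (%s x. lin s x + N s x) (%x. v0 x + 0) (at t within {0..T})"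
   unfolding True by (intro uniform_limit_add lin_uniform_limit N_uniform_limit)
  moreover have "\<forall>\<^sub>F s in at t within {0..T}. ALL x:torus. lin s x + N s x = v' s x"
   using ev by eventually_elim (auto simp: v'_eq v_split)
  ultimately show ?thesis by (subst (asm) uniform_limit_cong[of _ _ v' _ _ "v' t"]) (auto simp: True v'_eq)
 next
  case False
  then have t: "t : {0<..T}" using t by auto
  have "uniform_limit torus v (v t) (at t within {0..T})"
   unfolding at_within_pos[OF t] by (rule joint_continuous_uniform(1)[OF vw_continuous(1) t])
  moreover have "\<forall>\<^sub>F s in at t within {0..T}. ALL x:torus. v s x = v' s x"
   unfolding at_within_pos[OF t] by (auto simp: eventually_at_filter v'_eq)
  ultimately show ?thesis using False by (subst (asm) uniform_limit_cong[of _ _ v' _ _ "v' t"]) (auto simp: v'_eq)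
 qed
qed

lemma u_continuous: "continuous_into_C T u"
 unfolding continuous_into_C_def
proof (intro ballI conjI)
 fix t assume t: "t : {0..T}"
 have e: "u = (%s x. X s x + v' s x)" by (simp add: v'_def fun_eq_iff)
 have v': "continuous_on torus (v' t)" "uniform_limit torus v' (v' t) (at t within {0..T})"
  using v'_continuous t by (auto simp: continuous_into_C_def)
 show "continuous_on torus (u t)" unfolding e by (intro continuous_intros continuous_on_subset[OF Xcont[OF t]] v') auto
 have "uniform_limit torus X (X t) (at t within {0..T})"
 proof (rule uniform_limitI)
  fix \<epsilon> :: real assume \<epsilon>: "\<epsilon> > 0"
  then have "\<forall>\<^sub>F s in at t within {0..T}. holder_le \<beta> (\<epsilon> / 2) (%x. X s x - X t x)" by (intro X_holder_tendsto t) simp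
  then show "\<forall>\<^sub>F s in at t within {0..T}. ALL x:torus. dist (X s x) (X t x) < \<epsilon>"
  proof eventually_elim
   case (elim s)
   then show ?case using \<epsilon> unfolding holder_le_def dist_norm by fastforce
  qed
 qed
 then show "uniform_limit torus u (u t) (at t within {0..T})" unfolding e by (intro uniform_limit_add v'(2))
qed

text \<open>At positive times \<open>v\<close> and its gradient are jointly continuous, so
  \<open>v\<close> moves continuously even in C1; the part \<open>X\<close> moves continuously at
  the larger exponent \<alpha>.\<close>

lemma u_holder_continuous:
 assumes t: "t : {0<..T}"
 shows "((%s. holder_norm \<beta> (%x. u s x - u t x)) \<longlongrightarrow> 0) (at t within {0..T})"
proof (rule holder_norm_tendsto_zero)
 fix \<epsilon> :: real assume \<epsilon>: "\<epsilon> > 0"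
 let ?p = "1 + (2 * pi) powr (1 - \<beta>)"
 have p: "?p > 0" by (simp add: add_pos_nonneg)
 have e: "\<epsilon> / 2 / ?p > 0" using \<epsilon> p by simp
 have X: "\<forall>\<^sub>F s in at t within {0..T}. holder_le \<beta> (\<epsilon> / 2) (%x. X s x - X t x)"
  by (rule X_holder_tendsto) (use t \<epsilon> in auto)
 have V: "\<forall>\<^sub>F s in at t within {0..T}. ALL x:torus. dist (v s x) (v t x) < \<epsilon> / 2 / ?p"
  "\<forall>\<^sub>F s in at t within {0..T}. ALL x:torus. dist (w s x) (w t x) < \<epsilon> / 2 / ?p"
  unfolding at_within_pos[OF t] by (rule uniform_limitD[OF joint_continuous_uniform(1)[OF vw_continuous(1) t] e]
   uniform_limitD[OF joint_continuous_uniform(1)[OF vw_continuous(2) t] e])+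
 have pos: "\<forall>\<^sub>F s in at t within {0..T}. s : {0<..T}" unfolding at_within_pos[OF t] by (simp add: eventually_at_filter)
 from X V pos show "\<forall>\<^sub>F s in at t within {0..T}. holder_le \<beta> \<epsilon> (%x. u s x - u t x)"
 proof eventually_elim
  case (elim s)
  have d: "(v r has_vector_derivative w r x) (at x)" if "r : {0<..T}" for r x using vw that by (simp add: adm_def)
  have "holder_le 1 (\<epsilon> / 2 / ?p) (%x. v s x - v t x)"
   by (rule holder_le_lipschitz[where h' = "%x. w s x - w t x"])
    (use elim(2,3) in "auto simp: dist_norm intro: less_imp_le intro!: has_vector_derivative_diff d t elim(4)")
  then have "holder_le \<beta> (?p * (\<epsilon> / 2 / ?p)) (%x. v s x - v t x)" by (rule holder_le_exponent) (use \<beta> \<alpha> in auto)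
  moreover have "?p * (\<epsilon> / 2 / ?p) = \<epsilon> / 2" using p by (metis nonzero_mult_div_cancel_left order_less_irrefl times_divide_eq_right)
  ultimately have "holder_le \<beta> (\<epsilon> / 2) (%x. v s x - v t x)" by (simp only:)
  from holder_le_add[OF elim(1) this] have "holder_le \<beta> \<epsilon> (%x. X s x - X t x + (v s x - v t x))" by simp
  moreover have "X s x - X t x + (v s x - v t x) = u s x - u t x" for x using t elim(4) by (simp add: u_def)
  ultimately show ?case by simp
 qed
qed

lemma v0_modulus:
 shows "norm (v0 x - v0 y) <= 2 * (holder_norm \<beta> u0 + (1 + (2 * pi) powr (\<alpha> - \<beta>)) * (a + b)) * abs (x - y) powr \<beta>"
proof -
 have 0: "0 : {0..T}" using T by simp
 let ?c = "holder_norm \<beta> u0 + (1 + (2 * pi) powr (\<alpha> - \<beta>)) * (a + b)"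
 have "hmod \<beta> ?c (0 + 0) v0"
  unfolding v0_eq by (rule hmod_diff) (use u0_holder X_holder[OF 0] in "auto simp: hmod_def holder_le_def")
 from periodic_modulus[OF this v0(1) _ _] show ?thesis
  using holder_le_nonneg[OF u0_holder] holder_le_nonneg[OF X_holder[OF 0]] \<beta> by simp
qed

lemma v_holder:
 assumes t: "t : {0<..T}"
 shows "holder_le \<beta> ((gauss_mom G0 + gauss_mom G1) * V + gauss_mom G0 * (2 * (holder_norm \<beta> u0 + (1 + (2 * pi) powr (\<alpha> - \<beta>)) * (a + b))) + hN T) (v t)"
proof -
 let ?c = "2 * (holder_norm \<beta> u0 + (1 + (2 * pi) powr (\<alpha> - \<beta>)) * (a + b))"
 have c: "?c >= 0" using holder_le_nonneg[OF u0_holder] a b_nonneg by simp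
 have m: "gauss_mom G0 >= 0" "gauss_mom G1 >= 0" by (rule gauss_mom_nonneg)+
 have p: "0 <= (gauss_mom G0 + gauss_mom G1) * V" "0 <= gauss_mom G0 * ?c" using m c V_nonneg by auto
 have "holder_le \<beta> ((gauss_mom G0 + gauss_mom G1) * V + gauss_mom G0 * ?c) (lin t)"
  unfolding holder_le_def
 proof (intro conjI ballI)
  fix x y :: real
  show "norm (lin t x) <= (gauss_mom G0 + gauss_mom G1) * V + gauss_mom G0 * ?c" using lin_facts(5)[OF t, of x] p by linarith
  have "norm (gauss_op G0 (sqrt t) v0 x - gauss_op G0 (sqrt t) v0 y) <= gauss_mom G0 * (?c * abs (x - y) powr \<beta>)"
   by (rule gauss_op_increment[OF G_gauss_bounded(1) v0_meas v0(3)]) (use v0_modulus[of z "z - (x - y)" for z] in simp)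
  moreover have "norm (lin t x - lin t y) <= 1 * norm (gauss_op G0 (sqrt t) v0 x - gauss_op G0 (sqrt t) v0 y)"
   unfolding lin_def scaleR_diff_right[symmetric] norm_scaleR by (rule mult_right_mono) (use t in auto)
  moreover have "0 <= (gauss_mom G0 + gauss_mom G1) * V * abs (x - y) powr \<beta>" using p by simp
  ultimately show "norm (lin t x - lin t y) <= ((gauss_mom G0 + gauss_mom G1) * V + gauss_mom G0 * ?c) * abs (x - y) powr \<beta>"
   unfolding distrib_right[of _ _ "abs (x - y) powr \<beta>"] by (simp only: mult.assoc mult_1)
 qed
 from holder_le_add[OF this holder_le_mono[OF N_holder[OF t] hN_le[OF t]]]
 have "holder_le \<beta> ((gauss_mom G0 + gauss_mom G1) * V + gauss_mom G0 * ?c + hN T) (%x. lin t x + N t x)" .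
 moreover have "(%x. lin t x + N t x) = v t" using v_split[OF t] by auto
 ultimately show ?thesis by simp
qed

lemma u_holder: "EX c. ALL t:{0..T}. holder_le \<beta> c (u t)"
proof -
 obtain c1 c2 where c: "!!t. t : {0..T} ==> holder_le \<beta> c1 (X t)" "!!t. t : {0<..T} ==> holder_le \<beta> c2 (v t)"
  using X_holder v_holder by blast
 have "holder_le \<beta> (max (holder_norm \<beta> u0) (c1 + c2)) (u t)" if t: "t : {0..T}" for t
 proof (cases "t = 0")
  case True
  then have "u t = u0" by (simp add: u_def fun_eq_iff)
  then show ?thesis using holder_le_mono[OF u0_holder] by simp
 next
  case False
  then have "u t = (%x. X t x + v t x)" by (simp add: u_def fun_eq_iff)
  moreover have "holder_le \<beta> (c1 + c2) (%x. X t x + v t x)" using t False by (intro holder_le_add c) auto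
  ultimately show ?thesis using holder_le_mono by (metis max.cobounded2)
 qed
 then show ?thesis by blast
qed

theorem u_C_holder0: "u : C_holder0 \<beta> T"
proof -
 obtain c where c: "!!t. t : {0..T} ==> holder_le \<beta> c (u t)" using u_holder by blast
 have "continuous_into_holder \<beta> {0<..T} u"
  unfolding continuous_into_holder_def
  using holder_le_norm(1)[OF c] u_holder_continuous at_within_pos by auto
 moreover have "bdd_above ((%t. holder_norm \<beta> (u t)) ` {0..T})"
  using holder_le_norm(2)[OF c] by (rule bdd_aboveI2)
 moreover have "uniform_limit torus u (u 0) (at 0 within {0..T})"
  using u_continuous T by (auto simp: continuous_into_C_def)
 ultimately show ?thesis using holder_le_norm(1)[OF c] by (auto simp: C_holder0_def)
qed

end

lemma C1_holder_le:
 fixes w :: "real => 'a::euclidean_space"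
 assumes "w C1_differentiable_on UNIV"
 obtains B where "holder_le 1 B w"
proof -
 obtain D where D: "!!x. (w has_vector_derivative D x) (at x)" "continuous_on UNIV D"
  using assms unfolding C1_differentiable_on_def by auto
 have wc: "continuous_on torus w"
  by (intro continuous_at_imp_continuous_on ballI has_vector_derivative_continuous[OF D(1)])
 have "bounded (w ` torus)" "bounded (D ` torus)"
  by (intro compact_imp_bounded compact_continuous_image wc continuous_on_subset[OF D(2)]; simp)+
 then obtain B B' where B: "!!x. x : torus ==> norm (w x) <= B" "!!x. x : torus ==> norm (D x) <= B'"
  unfolding bounded_iff by blast
 have "holder_le 1 (max B B') w"
  by (rule holder_le_lipschitz[OF _ D(1)]) (use B in "auto simp: le_max_iff_disj")
 then show thesis by (rule that)
qed

context rough_solution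
begin

section \<open>Continuity up to time 0 for data in the closure of C1\<close>

lemma u0_periodic: "periodic u0"
proof -
 have "periodic (X 0)" using T by (intro Xper) auto
 then show ?thesis using v0(1) by (simp add: periodic_def u0_eq)
qed

text \<open>The initial value is a C1 function \<open>w1\<close> up to an error small in
  \<open>\<beta>\<close>-norm, and \<open>w1 - X 0\<close> has the better modulus with exponents
  \<alpha> and 1. At short distances its \<open>\<beta>\<close>-quotient is as small as
  desired.\<close>

lemma v0_little:
 assumes little: "u0 : little_holder \<beta>" and \<epsilon>: "\<epsilon> > 0"
 shows "EX \<eta>>0. ALL x y. abs (x - y) < \<eta> --> norm (v0 x - v0 y) <= \<epsilon> * abs (x - y) powr \<beta>"
proof -
 have t0: "0 : {0..T}" using T by simp
 obtain w1 where w1: "periodic w1" "w1 C1_differentiable_on UNIV" "holder_norm \<beta> (%x. u0 x - w1 x) < \<epsilon> / 4"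
  using little \<epsilon> unfolding little_holder_def by (auto dest: spec[of _ "\<epsilon> / 4"])
 obtain B where B: "holder_le 1 B w1" using C1_holder_le[OF w1(2)] by blast
 have B0: "B >= 0" by (rule holder_le_nonneg[OF B])
 have "holder_le 1 B (%x. - w1 x)" using B unfolding holder_le_def by (auto simp: norm_minus_commute)
 then have "holder_le \<beta> ((1 + (2 * pi) powr (1 - \<beta>)) * B) (%x. - w1 x)" by (rule holder_le_exponent) (use \<beta> \<alpha> in auto)
 from holder_le_norm(1)[OF holder_le_add[OF u0_holder this]] have "(%x. u0 x - w1 x) : holder_space \<beta>" by simp
 then have "holder_le \<beta> (holder_norm \<beta> (%x. u0 x - w1 x)) (%x. u0 x - w1 x)" by (rule holder_space_le) (use \<beta> in auto)
 then have "holder_le \<beta> (\<epsilon> / 4) (%x. u0 x - w1 x)" by (rule holder_le_mono) (use w1 in auto)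
 then have "hmod \<beta> (\<epsilon> / 4) 0 (%x. u0 x - w1 x)" by (simp add: hmod_def holder_le_def)
 moreover have "periodic (%x. u0 x - w1 x)" using w1(1) u0_periodic by (simp add: periodic_def)
 ultimately have 1: "norm ((u0 x - w1 x) - (u0 y - w1 y)) <= \<epsilon> / 2 * abs (x - y) powr \<beta>" for x y
  using periodic_modulus[of \<beta> "\<epsilon> / 4" 0 "%x. u0 x - w1 x" x y] \<epsilon> \<beta> by simp
 have "hmod \<alpha> (0 + a) (B + 0) (%x. w1 x - X 0 x)"
  by (rule hmod_diff) (use B rough_boundD(1)[OF rb[OF t0]] in "auto simp: hmod_def holder_le_def")
 moreover have "periodic (%x. w1 x - X 0 x)" using w1(1) Xper[OF t0] by (simp add: periodic_def)
 ultimately have 2: "norm ((w1 x - X 0 x) - (w1 y - X 0 y)) <= 2 * a * abs (x - y) powr \<alpha> + 2 * B * abs (x - y)" for x y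
  using periodic_modulus[of \<alpha> a B "%x. w1 x - X 0 x" x y] a B0 \<alpha>' by simp
 have "((%d. 2 * a * d powr (\<alpha> - \<beta>) + 2 * B * d powr (1 - \<beta>)) \<longlongrightarrow> 2 * a * 0 + 2 * B * 0) (at_right 0)"
  by (intro tendsto_intros tendsto_zero_powrI[OF tendsto_ident_at tendsto_const])
   (use \<alpha> \<beta> in "auto simp: eventually_at_filter")
 then have "\<forall>\<^sub>F d in at_right 0. 2 * a * d powr (\<alpha> - \<beta>) + 2 * B * d powr (1 - \<beta>) < \<epsilon> / 2"
  using \<epsilon> by (intro order_tendstoD(2)[of _ 0]) auto
 then obtain \<eta> where \<eta>: "\<eta> > 0" "!!d. 0 < d ==> d < \<eta> ==> 2 * a * d powr (\<alpha> - \<beta>) + 2 * B * d powr (1 - \<beta>) < \<epsilon> / 2"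
  unfolding eventually_at_right_field by blast
 have "norm (v0 x - v0 y) <= \<epsilon> * abs (x - y) powr \<beta>" if xy: "abs (x - y) < \<eta>" for x y
 proof (cases "x = y")
  case False
  let ?d = "abs (x - y)"
  have d: "0 < ?d" using False by simp
  have "2 * a * ?d powr \<alpha> + 2 * B * ?d = (2 * a * ?d powr (\<alpha> - \<beta>) + 2 * B * ?d powr (1 - \<beta>)) * ?d powr \<beta>"
   using d by (simp add: distrib_right mult.assoc flip: powr_add)
  also have "... <= \<epsilon> / 2 * ?d powr \<beta>" by (rule mult_right_mono[OF less_imp_le[OF \<eta>(2)[OF d xy]]]) simp
  finally have "norm ((u0 x - w1 x) - (u0 y - w1 y)) + norm ((w1 x - X 0 x) - (w1 y - X 0 y)) <= \<epsilon> * ?d powr \<beta>"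
   using 1[of x y] 2[of x y] by simp
  then show ?thesis
   using norm_triangle_ineq[of "(u0 x - w1 x) - (u0 y - w1 y)" "(w1 x - X 0 x) - (w1 y - X 0 y)"] by (simp add: v0_eq algebra_simps)
 qed simp
 with \<eta>(1) show ?thesis by blast
qed

theorem u_C_holder:
 assumes little: "u0 : little_holder \<beta>"
 shows "u : C_holder \<beta> T"
proof -
 obtain c where c: "!!t. t : {0..T} ==> holder_le \<beta> c (u t)" using u_holder by blast
 have t0: "0 : {0..T}" using T by simp
 have "((%s. holder_norm \<beta> (%x. u s x - u 0 x)) \<longlongrightarrow> 0) (at 0 within {0..T})"
 proof (rule holder_norm_tendsto_zero)
  fix \<epsilon> :: real assume \<epsilon>: "\<epsilon> > 0"
  have X: "\<forall>\<^sub>F s in at 0 within {0..T}. holder_le \<beta> (\<epsilon> / 3) (%x. X s x - X 0 x)"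
   by (rule X_holder_tendsto[OF t0]) (use \<epsilon> in auto)
  have pos: "\<forall>\<^sub>F s in at 0 within {0..T}. s : {0<..T}" by (auto simp: eventually_at_filter)
  then have ev: "\<forall>\<^sub>F s in at 0 within {0..T}. EX c r. abs c <= 1 & lin s = (%x. c *\<^sub>R gauss_op G0 r v0 x)"
  proof eventually_elim
   case (elim s)
   then show ?case by (intro exI[of _ "exp (- s)"] exI[of _ "sqrt s"]) (auto simp: lin_def)
  qed
  have l: "\<forall>\<^sub>F s in at 0 within {0..T}. holder_le \<beta> (\<epsilon> / 3) (%x. lin s x - v0 x)"
   by (rule gauss_semigroup_holder_limit[OF v0(2,3) \<beta>(1) v0_little[OF little] lin_uniform_limit ev]) (use \<epsilon> in auto)
  have "\<forall>\<^sub>F s in at 0 within {0..T}. hN s < \<epsilon> / 3" by (rule order_tendstoD(2)[OF hN_tendsto]) (use \<epsilon> in auto)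
  with X pos l show "\<forall>\<^sub>F s in at 0 within {0..T}. holder_le \<beta> \<epsilon> (%x. u s x - u 0 x)"
  proof eventually_elim
   case (elim s)
   have "holder_le \<beta> (\<epsilon> / 3) (N s)" by (rule holder_le_mono[OF N_holder[OF elim(2)]]) (use elim(4) in auto)
   from holder_le_add[OF elim(1) holder_le_add[OF elim(3) this]]
   have "holder_le \<beta> \<epsilon> (%x. X s x - X 0 x + (lin s x - v0 x + N s x))" by simp
   moreover have "X s x - X 0 x + (lin s x - v0 x + N s x) = u s x - u 0 x" for x
    using elim(2) v_split[OF elim(2)] by (simp add: u_def u0_eq)
   ultimately show ?case by simp
  qed
 qed
 then have "((%s. holder_norm \<beta> (%x. u s x - u t x)) \<longlongrightarrow> 0) (at t within {0..T})" if "t : {0..T}" for t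
  using u_holder_continuous[of t] that by (cases "t = 0") auto
 then show ?thesis
  using holder_le_norm(1)[OF c] unfolding C_holder_def continuous_into_holder_def by blast
qed

lemma v_deriv: "t : {0<..T} ==> (v t has_vector_derivative w t x) (at x)"
 using vw by (simp add: adm_def)

lemma C1_norm_v: "t : {0<..T} ==> C1_norm (v t) = sup_norm (v t) + sup_norm (w t)"
proof -
 assume t: "t : {0<..T}"
 have "(%x. vector_derivative (v t) (at x)) = w t" by (rule ext) (rule vector_derivative_at[OF v_deriv[OF t]])
 then show ?thesis by (simp add: C1_norm_def)
qed

text \<open>The sup norms of \<open>v t\<close> and \<open>w t\<close> are continuous in
  \<open>t > 0\<close>, which gives measurability, and of order \<open>1 + rsqrt t\<close>, which
  gives integrability.\<close>

lemma v'_integrable_C1: "integrable_into_C1 T v'"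
 unfolding integrable_into_C1_def
proof
 have ne: "AE t in lebesgue. t ~= 0" by (rule AE_completion[OF AE_lborel_singleton])
 have C1: "v t C1_differentiable_on UNIV" if t: "t : {0<..T}" for t
 proof -
  have "continuous_on UNIV (w t)" using adm_slice[OF vw t] by (simp add: slice_def)
  then show ?thesis unfolding C1_differentiable_on_def using v_deriv[OF t] by blast
 qed
 show "AE t in lebesgue. t : {0..T} --> v' t C1_differentiable_on UNIV"
  using ne by eventually_elim (use C1 in "auto simp: v'_eq")
 let ?F = "%t. sup_norm (v t) + sup_norm (w t)" and ?K = "M * exp (L * T)"
 let ?h = "%t. indicat_real {0<..T} t *\<^sub>R ?F t"
 have K: "?K >= 0" using M by simp
 have Fb: "0 <= ?F t" "?F t <= ?K * (1 + rsqrt t)" if t: "t : {0<..T}" for t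
 proof -
  have e: "M * exp (L * t) <= ?K" using t M L by (intro mult_left_mono) auto
  then have "M * exp (L * t) * rsqrt t <= ?K * rsqrt t" by (rule mult_right_mono) simp
  then have b: "norm (v t x) <= ?K" "norm (w t x) <= ?K * rsqrt t" for x
   using vw t e unfolding adm_def by (meson order_trans)+
  show "0 <= ?F t" "?F t <= ?K * (1 + rsqrt t)"
   using sup_norm_bounds(1,3)[of "v t", OF b(1)] sup_norm_bounds(1,3)[of "w t", OF b(2)] by (auto simp: distrib_left)
 qed
 have "continuous_on {0<..T} ?F" by (intro continuous_on_add sup_norm_continuous joint_continuous_uniform[OF vw_continuous(1)] joint_continuous_uniform[OF vw_continuous(2)])
 then have hm: "?h : borel_measurable borel" by (rule borel_measurable_continuous_on_indicator[rotated]) simp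
 have "set_integrable lebesgue {0..T} ?h"
 proof (rule set_integrable_bound)
  show "set_integrable lebesgue {0..T} (%t. ?K * (1 + rsqrt t))"
  proof (intro set_integrable_mult_right set_integral_add(1))
   show "set_integrable lebesgue {0..T} (%t. 1 :: real)" by (rule absolutely_integrable_on_const) simp
   show "set_integrable lebesgue {0..T} (%t. rsqrt t)" using powr_minus_half_integrable[of T] T by simp
  qed
  have "(%t. indicat_real {0..T} t *\<^sub>R ?h t) : borel_measurable lborel" using hm by measurable
  then show "set_borel_measurable lebesgue {0..T} ?h" unfolding set_borel_measurable_def by (rule measurable_completion)
  have "norm (?h t) <= norm (?K * (1 + rsqrt t))" for t
   using Fb[of t] K M by (auto simp: indicator_def abs_mult)
  then show "AE t in lebesgue. t : {0..T} --> norm (?h t) <= norm (?K * (1 + rsqrt t))" by simp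
 qed
 then show "set_integrable lebesgue {0..T} (%t. C1_norm (v' t))"
  by (rule set_integral_cong_lebesgue(1)) (use ne in "eventually_elim, auto simp: v'_eq C1_norm_v")
qed

text \<open>The heat flow of the rough primitive serves as the inner integral \<open>J\<close>. The
  Duhamel integral of the flux splits into the two integrals of the definition because each part is
  integrable by itself; the times 0 and \<open>t\<close> are discarded as null.\<close>

theorem u_mild_solution: "mild_solution f g u0 X XX T u"
proof -
 have v': "(%t x. u t x - X t x) = v'" by (simp add: v'_def fun_eq_iff)
 show ?thesis
  unfolding mild_solution_def Let_def v'
 proof (intro conjI ballI u_continuous v'_continuous v'_integrable_C1)
  show "u 0 = u0" by (simp add: u_def fun_eq_iff)
  fix t assume t: "t : {0..T}"
  have "periodic (v' t)"
   using vw t v0(1) by (cases "t = 0") (auto simp: v'_eq adm_def)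
  then show "periodic (u t)" using Xper[OF t] by (simp add: periodic_def v'_def)
 next
  fix t x assume t: "t : {0<..T}" and x: "x : torus"
  let ?J = "%s. heat_div (t - s) (rint g (X s) (XX s) (v s)) x"
  let ?D = "%s. heat_div (t - s) (drift_prim v w s) x"
  let ?dr = "%s y. g (u s y) *v vector_derivative (v' s) (at y) + (f (u s y) + u s y)"
  have ne: "AE s in lebesgue. s ~= 0 & s ~= t"
   by (rule AE_completion) (use AE_lborel_singleton[of 0] AE_lborel_singleton[of t] in eventually_elim, simp)
  have uX: "u s y = X s y + v s y" if "s : {0<..T}" for s y using that by (simp add: u_def)
  have dr: "?dr s = drift f g (X s) (v s) (w s)" if s: "s : {0<..T}" for s
  proof -
   have "v' s = v s" using s by (intro v'_eq) auto
   moreover have "vector_derivative (v s) (at y) = w s y" for y by (rule vector_derivative_at[OF v_deriv[OF s]])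
   ultimately show ?thesis by (simp only: drift_def[abs_def] uX[OF s])
  qed
  note iJ = volterra.integrable_k[OF adm_volterra(3)[OF vw] t, of x] and iD = volterra.integrable_k[OF adm_volterra(4)[OF vw] t, of x]
  note J = set_integral_lborel_lebesgue[OF iJ] and D = set_integral_lborel_lebesgue[OF iD]
  have sg: "AE s in lebesgue. s : {0..t} --> ?D s = heat_semigroup (t - s) (?dr s) x"
   using ne
  proof eventually_elim
   case (elim s)
   show ?case
   proof
    assume "s : {0..t}"
    then have s: "s : {0<..T}" "s : {0..T}" "t - s > 0" using t elim by auto
    show "?D s = heat_semigroup (t - s) (?dr s) x"
     unfolding dr[OF s(1)] by (rule slice_heat_semigroup(1)[where v = v and w = w, OF s(2) adm_slice[OF vw s(1)] s(3), symmetric])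
   qed
  qed
  note DS = set_integral_cong_lebesgue[OF D(1) sg]
  have split: "heat_div (t - s) (flux v w s) x = ?D s + ?J s" if "s : {0<..<t}" for s
   by (rule slice_heat_semigroup(2)[where v = v and w = w, OF _ adm_slice[OF vw]]) (use that t in auto)
  have "N t x = (LINT s:{0<..<t}|lborel. ?D s + ?J s)"
   unfolding N_def vconv_def by (rule set_lebesgue_integral_cong) (use split in auto)
  also have "... = (LINT s:{0<..<t}|lborel. ?D s) + (LINT s:{0<..<t}|lborel. ?J s)" by (rule set_integral_add(2)[OF iD iJ])
  finally have N: "N t x = (LINT s:{0..t}|lebesgue. heat_semigroup (t - s) (?dr s) x) + (LINT s:{0..t}|lebesgue. ?J s)"
   unfolding DS(2) D(2) J(2) .
  have t0: "t > 0" "t ~= 0" using t by auto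
  have lin: "lin t x = heat_semigroup t (%y. u0 y - X 0 y) x"
   unfolding v0_eq[symmetric] lin_def by (rule heat_semigroup_gauss_op[OF t0(1) v0(1,2), symmetric])
  show "EX J. (AE s in lebesgue. s : {0..<t} -->
       has_rough_integral (X s) (XX s) (%y. heat_kernel (t - s) (x - y) *\<^sub>R g (u s y))
        (%y k. heat_kernel (t - s) (x - y) *\<^sub>R frechet_derivative g (at (u s y)) (axis k 1)) (J s)) &
     set_integrable lebesgue {0..t} J &
     set_integrable lebesgue {0..t} (%s. heat_semigroup (t - s) (?dr s) x) &
     v' t x = heat_semigroup t (%y. u0 y - X 0 y) x
      + (LINT s:{0..t}|lebesgue. heat_semigroup (t - s) (?dr s) x) + (LINT s:{0..t}|lebesgue. J s)"
  proof (intro exI[of _ ?J] conjI J(1) DS(1))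
   show "v' t x = heat_semigroup t (%y. u0 y - X 0 y) x
      + (LINT s:{0..t}|lebesgue. heat_semigroup (t - s) (?dr s) x) + (LINT s:{0..t}|lebesgue. ?J s)"
    unfolding v'_eq(1)[OF t0(2)] v_split[OF t] lin N by (rule add.assoc[symmetric])
   show "AE s in lebesgue. s : {0..<t} -->
       has_rough_integral (X s) (XX s) (%y. heat_kernel (t - s) (x - y) *\<^sub>R g (u s y))
        (%y k. heat_kernel (t - s) (x - y) *\<^sub>R frechet_derivative g (at (u s y)) (axis k 1)) (?J s)"
    using ne
   proof eventually_elim
    case (elim s)
    show ?case
    proof
     assume "s : {0..<t}"
     then have s: "s : {0<..T}" "s : {0..T}" "t - s > 0" using t elim by auto
     show "has_rough_integral (X s) (XX s) (%y. heat_kernel (t - s) (x - y) *\<^sub>R g (u s y))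
        (%y k. heat_kernel (t - s) (x - y) *\<^sub>R frechet_derivative g (at (u s y)) (axis k 1)) (?J s)"
      using slice_rough_integral[OF s(2) rp[OF s(2)] adm_slice[OF vw s(1)] s(3), of x] unfolding pdiff_def uX[OF s(1)] .
    qed
   qed
  qed
 qed
qed

text \<open>The maximum covers time 0, where the bound is that of the initial value instead of the
  one from \<open>adm\<close>.\<close>

lemma v'_bounds:
 "t : {0..T} ==> norm (u t x - X t x) <= max V \<rho>"
 "t : {0<..T} ==> norm (vector_derivative (%x. u t x - X t x) (at x)) <= \<rho> * rsqrt t"
proof -
 have e: "M * exp (L * t) <= \<rho>" if "t : {0<..T}" for t
 proof -
  have "M * exp (L * t) <= M * exp (L * T)" using that M L by (intro mult_left_mono) auto
  then show ?thesis using M\<rho> by linarith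
 qed
 { assume t: "t : {0..T}"
  show "norm (u t x - X t x) <= max V \<rho>"
  proof (cases "t = 0")
   case True
   then show ?thesis using v0(3)[of x] by (simp add: u_def v0_eq le_max_iff_disj)
  next
   case False
   then have t': "t : {0<..T}" using t by auto
   then have "norm (v t x) <= \<rho>" using vw e[OF t'] unfolding adm_def by (meson order_trans)
   then show ?thesis using False by (simp add: u_def le_max_iff_disj)
  qed }
 { assume t: "t : {0<..T}"
  have "(%x. u t x - X t x) = v t" using t by (auto simp: u_def)
  then have "norm (vector_derivative (%x. u t x - X t x) (at x)) = norm (w t x)" using vector_derivative_at[OF v_deriv[OF t]] by simp
  also have "... <= M * exp (L * t) * rsqrt t" using vw t by (simp add: adm_def)
  also have "... <= \<rho> * rsqrt t" by (rule mult_right_mono[OF e[OF t]]) simp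
  finally show "norm (vector_derivative (%x. u t x - X t x) (at x)) <= \<rho> * rsqrt t" . }
qed

end

section \<open>Well-posedness\<close>

lemma rough_path_rough_bound:
 assumes rp: "rough_path \<alpha> X XX" and \<alpha>: "\<alpha> > 0"
 obtains c where "c >= 0" "rough_bound \<alpha> c X XX"
proof -
 have X: "holder_le \<alpha> (holder_norm \<alpha> X) X" by (rule holder_space_le) (use rp \<alpha> in "auto simp: rough_path_def")
 have fin: "two_param_finite (2 * \<alpha>) XX" and diag: "!!x. x : torus ==> XX x x = 0" using rp by (auto simp: rough_path_def)
 let ?c = "max (holder_norm \<alpha> X) (two_param_norm (2 * \<alpha>) XX)"
 show thesis
 proof (rule that[of ?c])
  show "0 <= ?c" using holder_le_nonneg[OF X] by simp
  show "rough_bound \<alpha> ?c X XX"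
   unfolding rough_bound_def
  proof (intro conjI ballI allI)
   fix x y assume xy: "x : torus" "y : torus"
   have "norm (X y - X x) <= holder_norm \<alpha> X * abs (y - x) powr \<alpha>" using X xy by (simp add: holder_le_def)
   also have "... <= ?c * abs (y - x) powr \<alpha>" by (rule mult_right_mono) auto
   finally show "norm (X y - X x) <= ?c * abs (y - x) powr \<alpha>" .
   have "norm (XX x y) <= two_param_norm (2 * \<alpha>) XX * abs (y - x) powr (2 * \<alpha>)"
    using two_param_norm_ge[OF fin xy] diag[OF xy(1)] by (cases "x = y") (auto simp: abs_minus_commute)
   also have "... <= ?c * abs (y - x) powr (2 * \<alpha>)" by (rule mult_right_mono) auto
   finally show "norm (XX x y) <= ?c * abs (y - x) powr (2 * \<alpha>)" .
   fix z k assume "z : torus"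
   with rp xy show "XX x z $ k - XX y z $ k - XX x y $ k = (X y - X x) $ k *\<^sub>R (X z - X y)"
    by (simp add: rough_path_def increment_def vec_eq_iff)
  qed
 qed
qed

lemma rough_dist_bounds:
 assumes rp: "rough_path \<alpha> X XX" "rough_path \<alpha> X' XX'" and \<alpha>: "\<alpha> > 0"
 defines "d \<equiv> rough_dist \<alpha> (X, XX) (X', XX')"
 shows "holder_le \<alpha> d (%x. X x - X' x)" (is ?A1) "0 <= holder_norm \<alpha> (%x. X x - X' x)" (is ?A2) "holder_norm \<alpha> (%x. X x - X' x) <= d" (is ?A3)
  "[|x : torus; y : torus|] ==> norm (XX x y - XX' x y) <= d * abs (x - y) powr (2 * \<alpha>)"
proof -
 obtain c c' where c: "rough_bound \<alpha> c X XX" "rough_bound \<alpha> c' X' XX'"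
  using rough_path_rough_bound[OF rp(1) \<alpha>] rough_path_rough_bound[OF rp(2) \<alpha>] by metis
 have "norm (increment (%x. X x - X' x) x y) <= (c + c') * abs (x - y) powr \<alpha>" if "x : torus" "y : torus" for x y
 proof -
  have "norm ((X y - X x) - (X' y - X' x)) <= c * abs (y - x) powr \<alpha> + c' * abs (y - x) powr \<alpha>"
   by (intro order_trans[OF norm_triangle_ineq4] add_mono rough_boundD(1)[OF c(1) that] rough_boundD(1)[OF c(2) that])
  then show ?thesis by (simp add: increment_def algebra_simps abs_minus_commute)
 qed
 then have "(%x. X x - X' x) : holder_space \<alpha>" unfolding holder_space_def mem_Collect_eq by (rule two_param_bound(1))
 then have h: "holder_le \<alpha> (holder_norm \<alpha> (%x. X x - X' x)) (%x. X x - X' x)" by (rule holder_space_le) (use \<alpha> in auto)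
 have fin: "two_param_finite (2 * \<alpha>) (%x y. XX x y - XX' x y)"
 proof (rule two_param_bound(1))
  fix x y assume xy: "x : torus" "y : torus"
  have "norm (XX x y - XX' x y) <= c * abs (y - x) powr (2 * \<alpha>) + c' * abs (y - x) powr (2 * \<alpha>)"
   by (intro order_trans[OF norm_triangle_ineq4] add_mono rough_boundD(2)[OF c(1) xy] rough_boundD(2)[OF c(2) xy])
  then show "norm (XX x y - XX' x y) <= (c + c') * abs (x - y) powr (2 * \<alpha>)" by (simp add: algebra_simps abs_minus_commute)
 qed
 have d: "d = holder_norm \<alpha> (%x. X x - X' x) + two_param_norm (2 * \<alpha>) (%x y. XX x y - XX' x y)"
  by (simp add: d_def rough_dist_def)
 note n = two_param_norm_nonneg[OF fin] holder_le_nonneg[OF h]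
 show ?A2 by (rule n(2))
 show ?A3 using n by (simp add: d)
 then show ?A1 by (rule holder_le_mono[OF h])
 assume xy: "x : torus" "y : torus"
 have "XX x x = 0" "XX' x x = 0" using rp xy(1) by (auto simp: rough_path_def)
 then have "norm (XX x y - XX' x y) <= two_param_norm (2 * \<alpha>) (%x y. XX x y - XX' x y) * abs (x - y) powr (2 * \<alpha>)"
  using two_param_norm_ge[OF fin xy] by (cases "x = y") auto
 also have "... <= d * abs (x - y) powr (2 * \<alpha>)" by (rule mult_right_mono) (use n d in auto)
 finally show "norm (XX x y - XX' x y) <= d * abs (x - y) powr (2 * \<alpha>)" .
qed

lemma periodic_holder_continuous:
 fixes u :: "real => 'a::real_normed_vector"
 assumes u: "periodic u" "u : holder_space \<beta>" and \<beta>: "\<beta> > 0"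
 shows "continuous_on UNIV u"
proof -
 have h: "holder_le \<beta> (holder_norm \<beta> u) u" by (rule holder_space_le[OF u(2)]) (use \<beta> in auto)
 then have "hmod \<beta> (holder_norm \<beta> u) 0 u" by (simp add: hmod_def holder_le_def)
 from periodic_modulus[OF this u(1) holder_le_nonneg[OF h]] have m: "norm (u y - u x) <= 2 * holder_norm \<beta> u * abs (y - x) powr \<beta>" for x y
  using \<beta> by simp
 have "(u \<longlongrightarrow> u x) (at x)" for x
 proof (rule LIM_zero_cancel, rule Lim_null_comparison)
  show "\<forall>\<^sub>F y in at x. norm (u y - u x) <= 2 * holder_norm \<beta> u * abs (y - x) powr \<beta>" using m by simp
  have "((%y. abs (y - x)) \<longlongrightarrow> abs (x - x)) (at x)" by (intro tendsto_intros)
  then have "((%y. 2 * holder_norm \<beta> u * abs (y - x) powr \<beta>) \<longlongrightarrow> 2 * holder_norm \<beta> u * 0) (at x)"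
   using \<beta> by (intro tendsto_intros tendsto_zero_powrI[OF _ tendsto_const]) auto
  then show "((%y. 2 * holder_norm \<beta> u * abs (y - x) powr \<beta>) \<longlongrightarrow> 0) (at x)" by simp
 qed
 then show ?thesis by (simp add: continuous_on_def)
qed

lemma continuous_into_C_bounded:
 fixes h :: "real => real => 'a::real_normed_vector"
 assumes "continuous_into_C T h" "!!t. t : {0..T} ==> periodic (h t)"
 obtains K where "!!t x. t : {0..T} ==> norm (h t x) <= K"
proof -
 have c: "continuous_on torus (h t)" if "t : {0..T}" for t using assms(1) that by (simp add: continuous_into_C_def)
 have "continuous_on {0..T} (%t. sup_norm (h t))"
  by (rule sup_norm_continuous) (use assms(1) in "auto simp: continuous_into_C_def")
 then have "bounded ((%t. sup_norm (h t)) ` {0..T})" by (intro compact_imp_bounded compact_continuous_image) auto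
 then obtain K where K: "!!t. t : {0..T} ==> abs (sup_norm (h t)) <= K" unfolding bounded_iff by (metis imageI real_norm_def)
 have "norm (h t x) <= K" if t: "t : {0..T}" for t x
 proof (rule periodic_bound[where P = "%r. norm r <= K", OF assms(2)[OF t]])
  obtain B where "!!x. norm (h t x) <= B" using periodic_continuous_bounded[OF assms(2)[OF t] c[OF t]] by blast
  then show "norm (h t x) <= K" if "x : torus" for x using sup_norm_bounds(2)[of "h t" B x] that K[OF t] by fastforce
 qed
 then show thesis by (rule that)
qed

context rough_solution
begin

text \<open>A competitor may leave the ball of radius \<rho>. It is bounded by continuity, so the
  estimates are set up anew on a larger radius with a larger constant; the time \<open>T\<close> is
  unaffected, since the uniqueness argument requires no smallness.\<close>

lemma solution_unique:
 assumes fg: "smooth f" "smooth g" and u': "mild_solution f g u0 X XX T u'" and t: "t : {0..T}"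
 shows "u' t = u t"
proof -
 have p: "periodic (%x. u' t x - X t x)" if "t : {0..T}" for t
  using u' Xper[OF that] that by (simp add: mild_solution_def Let_def periodic_def)
 have "continuous_into_C T (%t x. u' t x - X t x)" using u' by (simp add: mild_solution_def Let_def)
 from continuous_into_C_bounded[OF this p] obtain K where K: "!!t x. t : {0..T} ==> norm (u' t x - X t x) <= K" by blast
 define \<rho>' where "\<rho>' = max (max V \<rho>) K"
 have \<rho>: "\<rho> >= 0" "\<rho> <= \<rho>'" using b_nonneg b\<rho> by (auto simp: \<rho>'_def)
 obtain C' where C': "nl_bounds C' (2 * \<rho>') f g" using smooth_nl_bounds[OF fg, of "2 * \<rho>'"] \<rho> by auto
 interpret r: rough_data X XX f g \<alpha> a b C' \<rho>' T T1
  by unfold_locales (fact T \<alpha> a rb Xper Xcont Xtime XXtime Xb C' order_trans[OF b\<rho> \<rho>(2)])+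
 have "norm (u t x - X t x) <= \<rho>'" "norm (u' t x - X t x) <= \<rho>'" if "t : {0..T}" for t x
  using v'_bounds(1)[OF that, of x] K[OF that, of x] by (auto simp: \<rho>'_def)
 from r.mild_solution_unique[OF rp u_mild_solution this(1) u' this(2) v'_bounds(2) \<rho>(1) t]
 show ?thesis by simp
qed

theorem solution_well_posed:
 assumes fg: "smooth f" "smooth g"
 shows "well_posed \<beta> f g u0 X XX T"
proof -
 \<comment> \<open>Uniqueness holds among all mild solutions, hence in every class that contains
   \<open>u\<close>, and in particular in both classes of \<open>well_posed\<close>.\<close>
 have "unique_mild_solution_in \<U> f g u0 X XX T" if "u : \<U>" for \<U>
  unfolding unique_mild_solution_in_def
  by (intro bexI[OF _ that] conjI ballI impI u_mild_solution solution_unique[OF fg])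
 then show ?thesis unfolding well_posed_def using u_C_holder0 u_C_holder by blast
qed

end

text \<open>The nonlinear coefficient of the assumption \<open>inv\<close> with \<open>Kf\<close>
  unfolded and \<open>M\<close> one more than the bound of the linear evolution. It is written
  outside the locales so that \<open>T\<close> and \<open>L\<close> can be chosen before entering
  them; \<rho> does not occur in it.\<close>

definition growth :: "nat => real => real => real => real => real => real => real" where
 "growth n \<alpha> a b C V T = duhamel_const \<alpha> (\<alpha> / 4) T * ((rough_flux_const n \<alpha> a * C + (C + 1) * (1 + b)) *
   ((1 + T powr (1 / 2)) * (1 + ((gauss_mom G0 + gauss_mom G1) * V + 1))))"

text \<open>The properties of a realisation that hold almost surely, together with the data.
  Everything derived in this locale is deterministic.\<close>

locale rough_problem =
 fixes X :: "real => real => real^'n" and XX :: "real => real => real => real^'n^'n"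
  and f :: "real^'n => real^'n" and g :: "real^'n => real^'n^'n" and u0 :: "real => real^'n" and \<alpha> \<beta> :: real
 assumes \<alpha>: "1 / 3 < \<alpha>" "\<alpha> < 1 / 2" and \<beta>: "0 < \<beta>" "\<beta> < \<alpha>"
  and rp: "!!t. t >= 0 ==> rough_path \<alpha> (X t) (XX t)"
  and dist: "!!t. t >= 0 ==> ((%s. rough_dist \<alpha> (X s, XX s) (X t, XX t)) \<longlongrightarrow> 0) (at t within {0..})"
  and Xc: "continuous_on ({0..} \<times> UNIV) (%(t, x). X t x)" and Xper: "!!t. t >= 0 ==> periodic (X t)"
  and fg: "smooth f" "smooth g" and u0: "u0 : holder_space \<beta>" "periodic u0"
begin

lemma \<alpha>0: "\<alpha> > 0" using \<alpha> by simp

lemma X_continuous: "t >= 0 ==> continuous_on UNIV (X t)" "continuous_on {0..T} (%t. X t x)"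
proof -
 have "continuous_on {0..T} (%t. (%(t, x). X t x) (t, x))"
  by (rule continuous_on_compose2[OF Xc]) (auto intro!: continuous_intros)
 then show "continuous_on {0..T} (%t. X t x)" by simp
 assume "t >= 0"
 then have "continuous_on UNIV (%x. (%(t, x). X t x) (t, x))"
  by (intro continuous_on_compose2[OF Xc]) (auto intro!: continuous_intros)
 then show "continuous_on UNIV (X t)" by simp
qed

text \<open>Continuity in the rough path distance gives a common constant near each time. A Bolzano
  covering argument on the compact interval, taking maxima when intervals are joined, makes it
  uniform.\<close>

lemma rough_bound_time:
 assumes "T >= 0"
 obtains a where "a >= 0" "!!t. t : {0..T} ==> rough_bound \<alpha> a (X t) (XX t)"
proof -
 let ?P = "%p q. EX c>=0. ALL t:{p..q} \<inter> {0..T}. rough_bound \<alpha> c (X t) (XX t)"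
 have mono: "rough_bound \<alpha> c' (X t) (XX t)" if "rough_bound \<alpha> c (X t) (XX t)" "c <= c'" for c c' t
 proof -
  have "c * r powr q <= c' * r powr q" for r q :: real by (rule mult_right_mono[OF that(2)]) simp
  then show ?thesis using that(1) unfolding rough_bound_def by (meson order_trans)
 qed
 have "?P 0 T"
 proof (rule Bolzano[where P = ?P, OF assms])
  fix p q r assume "?P p q" "?P q r"
  then obtain c c' where c: "c >= 0" "ALL t:{p..q} \<inter> {0..T}. rough_bound \<alpha> c (X t) (XX t)" "ALL t:{q..r} \<inter> {0..T}. rough_bound \<alpha> c' (X t) (XX t)"
   by blast
  have "rough_bound \<alpha> (max c c') (X t) (XX t)" if "t : {p..r} \<inter> {0..T}" for t
   using c(2,3) mono[of c t "max c c'"] mono[of c' t "max c c'"] that by (cases "t <= q") auto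
  then show "?P p r" using c(1) by (intro exI[of _ "max c c'"]) auto
 next
  fix t assume t: "0 <= t" "t <= T"
  obtain c where c: "c >= 0" "rough_bound \<alpha> c (X t) (XX t)" using rough_path_rough_bound[OF rp[OF t(1)] \<alpha>0] by blast
  have "\<forall>\<^sub>F s in at t within {0..}. rough_dist \<alpha> (X s, XX s) (X t, XX t) < 1" by (rule order_tendstoD(2)[OF dist[OF t(1)]]) simp
  then obtain d where d: "d > 0" "!!s. s >= 0 ==> s ~= t ==> abs (s - t) < d ==> rough_dist \<alpha> (X s, XX s) (X t, XX t) < 1"
   unfolding eventually_at by (auto simp: dist_real_def)
  have "rough_bound \<alpha> (c + 1) (X s) (XX s)" if s: "s >= 0" "abs (s - t) < d" for s
  proof (cases "s = t")
   case False
   have le: "rough_dist \<alpha> (X s, XX s) (X t, XX t) <= 1" using d(2)[OF s(1) False s(2)] by simp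
   note rd = rough_dist_bounds[OF rp[OF s(1)] rp[OF t(1)] \<alpha>0]
   obtain c' where c': "rough_bound \<alpha> c' (X s) (XX s)" using rough_path_rough_bound[OF rp[OF s(1)] \<alpha>0] by blast
   show ?thesis
    unfolding rough_bound_def
   proof (intro conjI ballI)
    fix x y :: real assume xy: "x : torus" "y : torus"
    have "norm ((X s y - X t y) - (X s x - X t x)) <= 1 * abs (y - x) powr \<alpha>"
     using holder_le_mono[OF rd(1) le] xy by (simp add: holder_le_def)
    then have "norm ((X s y - X t y) - (X s x - X t x)) + norm (X t y - X t x) <= (c + 1) * abs (y - x) powr \<alpha>"
     using rough_boundD(1)[OF c(2) xy] by (simp add: distrib_right)
    then show "norm (X s y - X s x) <= (c + 1) * abs (y - x) powr \<alpha>"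
     using norm_triangle_ineq[of "(X s y - X t y) - (X s x - X t x)" "X t y - X t x"] by simp
    have "norm (XX s x y - XX t x y) <= 1 * abs (y - x) powr (2 * \<alpha>)"
     using order_trans[OF rd(4)[OF xy] mult_right_mono[OF le]] by (simp add: abs_minus_commute)
    then have "norm (XX s x y - XX t x y) + norm (XX t x y) <= (c + 1) * abs (y - x) powr (2 * \<alpha>)"
     using rough_boundD(2)[OF c(2) xy] by (simp add: distrib_right)
    then show "norm (XX s x y) <= (c + 1) * abs (y - x) powr (2 * \<alpha>)"
     using norm_triangle_ineq[of "XX s x y - XX t x y" "XX t x y"] by simp
   qed (use c' in "simp add: rough_bound_def")
  qed (use mono[OF c(2)] in simp)
  then show "EX d>0. ALL p q. p <= t & t <= q & q - p < d --> ?P p q"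
   using d(1) c(1) by (intro exI[of _ d] conjI allI impI exI[of _ "c + 1"] ballI) auto
 qed
 then show thesis using that by (metis Int_absorb)
qed

lemma X_bounded:
 obtains b where "!!t x. t : {0..T} ==> norm (X t x) <= b"
proof -
 have "bounded ((%(t, x). X t x) ` ({0..T} \<times> torus))"
  by (intro compact_imp_bounded compact_continuous_image continuous_on_subset[OF Xc] compact_Times) auto
 then obtain b where b: "!!t x. t : {0..T} ==> x : torus ==> norm (X t x) <= b" by (force simp: bounded_iff)
 show thesis
 proof (rule that)
  fix t x assume t: "t : {0..T}"
  show "norm (X t x) <= b" by (rule periodic_bound[where P = "%r. norm r <= b", OF Xper b[OF t]]) (use t in auto)
 qed
qed

text \<open>\<open>M\<close> exceeds the bound of the linear evolution by 1, so invariance reduces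
  to the Duhamel part being at most 1, which is the last assumption. The common core of the local
  and the global statement: they differ in how that assumption is met.\<close>

lemma well_posed_up_to:
 assumes T: "0 < T" "T <= T1" and a: "a >= 0" "!!t. t : {0..T1} ==> rough_bound \<alpha> a (X t) (XX t)"
  and b: "!!t x. t : {0..T1} ==> norm (X t x) <= b" and V: "!!x. norm (u0 x - X 0 x) <= V"
  and L: "L > 0" and \<rho>: "((gauss_mom G0 + gauss_mom G1) * V + 1) * exp (L * T) <= \<rho>" "b <= \<rho>" and nl: "nl_bounds C (2 * \<rho>) f g"
  and small: "growth CARD('n) \<alpha> a b C V T1 * (T / L) powr (\<alpha> / 4) <= 1"
 shows "well_posed \<beta> f g u0 X XX T"
proof -
 have sub: "t : {0..T1}" "t >= 0" if "t : {0..T}" for t using that T by auto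
 have lim: "((%s. rough_dist \<alpha> (X s, XX s) (X t, XX t)) \<longlongrightarrow> 0) (at t within {0..T})" if "t : {0..T}" for t
  by (rule tendsto_within_subset[OF dist]) (use that in auto)
 have pos: "\<forall>\<^sub>F s in at t within {0..T}. s >= 0" for t by (auto simp: eventually_at_filter)
 have XXtime: "continuous_on {0..T} (%t. XX t x y)" if xy: "x : torus" "y : torus" for x y
  unfolding continuous_on_def
 proof
  fix t assume t: "t : {0..T}"
  show "((%t. XX t x y) \<longlongrightarrow> XX t x y) (at t within {0..T})"
  proof (rule LIM_zero_cancel, rule Lim_null_comparison)
   show "\<forall>\<^sub>F s in at t within {0..T}. norm (XX s x y - XX t x y) <= rough_dist \<alpha> (X s, XX s) (X t, XX t) * abs (x - y) powr (2 * \<alpha>)"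
    using pos by eventually_elim (rule rough_dist_bounds(4)[OF rp rp \<alpha>0 xy]; use t in auto)
   show "((%s. rough_dist \<alpha> (X s, XX s) (X t, XX t) * abs (x - y) powr (2 * \<alpha>)) \<longlongrightarrow> 0) (at t within {0..T})"
    by (rule tendsto_mult_left_zero[OF lim[OF t]])
  qed
 qed
 have v0c: "continuous_on UNIV (%x. u0 x - X 0 x)"
  by (intro continuous_intros periodic_holder_continuous[OF u0(2,1) \<beta>(1)] X_continuous) simp
 have v0p: "periodic (%x. u0 x - X 0 x)" using u0(2) Xper[of 0] by (simp add: periodic_def)
 interpret rough_data X XX f g \<alpha> a b C \<rho> T T1
 proof unfold_locales
  fix t x assume t: "t : {0..T}"
  show "rough_bound \<alpha> a (X t) (XX t)" "norm (X t x) <= b" "periodic (X t)" "continuous_on UNIV (X t)"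
   using sub[OF t] by (simp_all add: a b Xper X_continuous)
 qed (fact T \<alpha> a X_continuous XXtime nl \<rho>)+
 let ?M = "(gauss_mom G0 + gauss_mom G1) * V + 1"
 have V0: "V >= 0" by (rule order_trans[OF norm_ge_zero V[of 0]])
 have gm: "gauss_mom G0 >= 0" "gauss_mom G1 >= 0" by (rule gauss_mom_nonneg)+
 interpret rough_ivp X XX f g \<alpha> a b C \<rho> T T1 "%x. u0 x - X 0 x" V L ?M
 proof unfold_locales
  show "(gauss_mom G0 + gauss_mom G1) * V + duhamel_const \<alpha> (\<alpha> / 4) T1 * (Kf * ((1 + T1 powr (1 / 2)) * (1 + ?M))) * (T / L) powr (\<alpha> / 4) <= ?M"
   using small unfolding Kf_def growth_def by simp
 qed (use v0p v0c V L \<rho> V0 gm in auto)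
 obtain v w where vw: "adm v w" "!!t x. t : {0<..T} ==> mapv v w t x = v t x" "!!t x. t : {0<..T} ==> mapw v w t x = w t x"
  using fixed_point_exists by blast
 interpret rough_solution X XX f g \<alpha> a b C \<rho> T T1 "%x. u0 x - X 0 x" V L ?M u0 \<beta> v w
 proof unfold_locales
  fix t assume t: "t : {0..T}"
  then show "rough_path \<alpha> (X t) (XX t)" by (intro rp) auto
  show "((%s. holder_norm \<alpha> (%x. X s x - X t x)) \<longlongrightarrow> 0) (at t within {0..T})"
  proof (rule tendsto_sandwich[OF _ _ tendsto_const lim[OF t]])
   show "\<forall>\<^sub>F s in at t within {0..T}. 0 <= holder_norm \<alpha> (%x. X s x - X t x)"
    using pos by eventually_elim (rule rough_dist_bounds(2)[OF rp rp \<alpha>0]; use t in auto)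
   show "\<forall>\<^sub>F s in at t within {0..T}. holder_norm \<alpha> (%x. X s x - X t x) <= rough_dist \<alpha> (X s, XX s) (X t, XX t)"
    using pos by eventually_elim (rule rough_dist_bounds(3)[OF rp rp \<alpha>0]; use t in auto)
  qed
 qed (use u0 \<beta> vw in auto)
 show ?thesis by (rule solution_well_posed[OF fg])
qed

lemma initial_bound:
 obtains V where "!!x. norm (u0 x - X 0 x) <= V"
proof -
 have "continuous_on torus (%x. u0 x - X 0 x)"
  by (intro continuous_intros continuous_on_subset[OF periodic_holder_continuous[OF u0(2,1) \<beta>(1)]] continuous_on_subset[OF X_continuous(1)]) auto
 moreover have "periodic (%x. u0 x - X 0 x)" using u0(2) Xper[of 0] by (simp add: periodic_def)
 ultimately show thesis using periodic_continuous_bounded that by blast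
qed

theorem well_posed_local: "EX T>0. well_posed \<beta> f g u0 X XX T"
proof -
 obtain a where a: "a >= 0" "!!t. t : {0..1} ==> rough_bound \<alpha> a (X t) (XX t)" using rough_bound_time[of 1] by auto
 obtain b where b: "!!t x. t : {0..1} ==> norm (X t x) <= b" using X_bounded[of 1] by blast
 obtain V where V: "!!x. norm (u0 x - X 0 x) <= V" using initial_bound by blast
 \<comment> \<open>The factor \<open>exp 1\<close> anticipates the choice \<open>L = 1 / T\<close>,
   for which \<open>exp (L * T)\<close> does not depend on \<open>T\<close>. Thus \<rho>, and with
   it \<open>C\<close>, can be fixed before \<open>T\<close>.\<close>
 define \<rho> where "\<rho> = ((gauss_mom G0 + gauss_mom G1) * V + 1) * exp 1 + b"
 have b0: "b >= 0" using b[of 0 0] by (auto intro: order_trans[OF norm_ge_zero])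
 have "V >= 0" by (rule order_trans[OF norm_ge_zero V[of 0]])
 then have \<rho>: "((gauss_mom G0 + gauss_mom G1) * V + 1) * exp 1 <= \<rho>" "b <= \<rho>"
  using b0 gauss_mom_nonneg[of G0] gauss_mom_nonneg[of G1] by (auto simp: \<rho>_def)
 then obtain C where C: "nl_bounds C (2 * \<rho>) f g" using smooth_nl_bounds[OF fg, of "2 * \<rho>"] b0 by auto
 have "((%T. growth CARD('n) \<alpha> a b C V 1 * T powr (\<alpha> / 2)) \<longlongrightarrow> growth CARD('n) \<alpha> a b C V 1 * 0) (at_right 0)"
  by (intro tendsto_mult_left tendsto_zero_powrI[OF tendsto_ident_at tendsto_const])
   (use \<alpha> in "auto simp: eventually_at_filter")
 then have "\<forall>\<^sub>F T in at_right 0. growth CARD('n) \<alpha> a b C V 1 * T powr (\<alpha> / 2) < 1" by (intro order_tendstoD(2)[of _ 0]) auto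
 then obtain d where d: "d > 0" "!!T. 0 < T ==> T < d ==> growth CARD('n) \<alpha> a b C V 1 * T powr (\<alpha> / 2) < 1"
  unfolding eventually_at_right_field by blast
 define T where "T = min 1 (d / 2)"
 have T: "0 < T" "T <= 1" "T < d" using d(1) by (auto simp: T_def)
 \<comment> \<open>With \<open>L = 1 / T\<close> the ratio \<open>T / L\<close> is the square of
   \<open>T\<close>, so smallness comes from a short time alone.\<close>
 have "well_posed \<beta> f g u0 X XX T"
 proof (rule well_posed_up_to[OF T(1,2) a b V _ _ \<rho>(2) C, where L = "1 / T"])
  have "(T / (1 / T)) powr (\<alpha> / 4) = T powr (\<alpha> / 2)" using T by (simp add: powr_mult flip: powr_add)
  then show "growth CARD('n) \<alpha> a b C V 1 * (T / (1 / T)) powr (\<alpha> / 4) <= 1" using d(2)[OF T(1,3)] by simp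
 qed (use T \<rho> in auto)
 with T(1) show ?thesis by blast
qed

theorem well_posed_global:
 assumes "bounded (range g)" "bounded_derivatives f" "bounded_derivatives g" and T: "T > 0"
 shows "well_posed \<beta> f g u0 X XX T"
proof -
 obtain a where a: "a >= 0" "!!t. t : {0..T} ==> rough_bound \<alpha> a (X t) (XX t)" using rough_bound_time[of T] T by auto
 obtain b where b: "!!t x. t : {0..T} ==> norm (X t x) <= b" using X_bounded[of T] by blast
 obtain V where V: "!!x. norm (u0 x - X 0 x) <= V" using initial_bound by blast
 \<comment> \<open>\<open>C\<close> is valid for every radius. It determines \<open>growth\<close>,
   hence \<open>L\<close>; the radius, which grows like \<open>exp (L * T)\<close>, is chosen last
   without disturbing either.\<close>
 obtain C where C: "!!\<rho>. \<rho> >= 0 ==> nl_bounds C \<rho> f g" using bounded_nl_bounds[OF fg assms(1-3)] by blast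
 have "((%L. growth CARD('n) \<alpha> a b C V T * (T / L) powr (\<alpha> / 4)) \<longlongrightarrow> growth CARD('n) \<alpha> a b C V T * 0) at_top"
 proof (intro tendsto_mult_left tendsto_zero_powrI[OF _ tendsto_const])
  show "((%L. T / L) \<longlongrightarrow> 0) at_top" by real_asymp
  show "\<forall>\<^sub>F L in at_top. 0 <= T / L" using eventually_gt_at_top[of 0] by eventually_elim (use T in auto)
 qed (use \<alpha> in auto)
 then have "\<forall>\<^sub>F L in at_top. growth CARD('n) \<alpha> a b C V T * (T / L) powr (\<alpha> / 4) < 1" by (intro order_tendstoD(2)[of _ 0]) auto
 with eventually_gt_at_top[of 0] have "\<forall>\<^sub>F L in at_top. 0 < L & growth CARD('n) \<alpha> a b C V T * (T / L) powr (\<alpha> / 4) < 1" by (rule eventually_conj)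
 then obtain L where L: "L > 0" "growth CARD('n) \<alpha> a b C V T * (T / L) powr (\<alpha> / 4) <= 1"
  using eventually_happens'[OF trivial_limit_at_top_linorder] by (metis (no_types, lifting) less_imp_le)
 define \<rho> where "\<rho> = max (((gauss_mom G0 + gauss_mom G1) * V + 1) * exp (L * T)) b"
 have "b >= 0" using b[of 0 0] T by (auto intro: order_trans[OF norm_ge_zero])
 then have \<rho>: "2 * \<rho> >= 0" by (auto simp: \<rho>_def le_max_iff_disj)
 show ?thesis
  by (rule well_posed_up_to[OF T order_refl a b V L(1) _ _ C[OF \<rho>] L(2)]) (auto simp: \<rho>_def)
qed

end

theorem theorem3p7:
  fixes M :: "'w measure"
    and W :: "real \<Rightarrow> (real \<Rightarrow> real^'n) \<Rightarrow> 'w \<Rightarrow> real"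
    and \<psi> :: "real \<Rightarrow> real \<Rightarrow> 'w \<Rightarrow> real^'n"
    and \<Psi> :: "real \<Rightarrow> real \<Rightarrow> real \<Rightarrow> 'w \<Rightarrow> real^'n^'n"
    and \<sigma> \<beta> :: real
    and f :: "real^'n \<Rightarrow> real^'n"
    and g :: "real^'n \<Rightarrow> real^'n^'n"
    and u0 :: "real \<Rightarrow> real^'n"
  assumes "prob_space M"
    and "cylindrical_wiener M W"
    and "stationary_solution M \<sigma> W \<psi>"
    and "driving_rough_path M \<psi> \<Psi>"
    and "smooth f" and "smooth g"
    and "\<beta> \<in> {1/3<..<1/2}"
    and "u0 \<in> holder_space \<beta>" and "periodic u0"
  shows "(AE \<omega> in M. \<exists>T>0. well_posed \<beta> f g u0 (\<lambda>t x. \<psi> t x \<omega>) (\<lambda>t x y. \<Psi> t x y \<omega>) T) \<and>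
    (bounded (range g) \<and> bounded_derivatives f \<and> bounded_derivatives g \<longrightarrow>
       (AE \<omega> in M. \<forall>T>0. well_posed \<beta> f g u0 (\<lambda>t x. \<psi> t x \<omega>) (\<lambda>t x y. \<Psi> t x y \<omega>) T))"
proof -
 \<comment> \<open>The midpoint between \<beta> and 1/2: large enough for the gap above \<beta>, and
   still an exponent at which the lift is a continuous rough path process.\<close>
 define \<alpha> where "\<alpha> = (\<beta> + 1 / 2) / 2"
 have \<alpha>: "1 / 3 < \<alpha>" "\<alpha> < 1 / 2" "0 < \<beta>" "\<beta> < \<alpha>" "\<alpha> : {0<..<1/2}" using assms(7) by (auto simp: \<alpha>_def)
 have "AE \<omega> in M. ALL t>=0. rough_path \<alpha> (%x. \<psi> t x \<omega>) (%x y. \<Psi> t x y \<omega>) &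
    ((%s. rough_dist \<alpha> (%x. \<psi> s x \<omega>, %x y. \<Psi> s x y \<omega>) (%x. \<psi> t x \<omega>, %x y. \<Psi> t x y \<omega>)) \<longlongrightarrow> 0) (at t within {0..})"
  using assms(4) \<alpha>(5) unfolding driving_rough_path_def by blast
 moreover have "AE \<omega> in M. continuous_on ({0..} \<times> UNIV) (%(t, x). \<psi> t x \<omega>)" "AE \<omega> in M. ALL t>=0. periodic (%x. \<psi> t x \<omega>)"
  using assms(3) unfolding stationary_solution_def by blast+
 ultimately have ae: "AE \<omega> in M. rough_problem (%t x. \<psi> t x \<omega>) (%t x y. \<Psi> t x y \<omega>) f g u0 \<alpha> \<beta>"
  by eventually_elim (unfold_locales; use \<alpha> assms(5,6,8,9) in auto)
 from ae have "AE \<omega> in M. EX T>0. well_posed \<beta> f g u0 (%t x. \<psi> t x \<omega>) (%t x y. \<Psi> t x y \<omega>) T"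
  by eventually_elim (rule rough_problem.well_posed_local)
 moreover from ae have "bounded (range g) & bounded_derivatives f & bounded_derivatives g -->
   (AE \<omega> in M. ALL T>0. well_posed \<beta> f g u0 (%t x. \<psi> t x \<omega>) (%t x y. \<Psi> t x y \<omega>) T)"
  by (auto elim!: eventually_mono intro: rough_problem.well_posed_global)
 ultimately show ?thesis by blast
qed

end
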